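(* For every $s\ge0$, $\mathcal V^{\mathrm{spec}}_s(M)$ (with its norm $\|\cdot\|_{\mathcal V^{\mathrm{spec}}_s(M)}$) is a Banach space, finite spectral sums are dense in $\mathcal V^{\mathrm{spec}}_s(M)$, and $\|f\|_{L^2(M)}\le\|f\|_{\mathcal V^{\mathrm{spec}}_s(M)}$. If $t\ge s$, then $\mathcal V^{\mathrm{spec}}_t(M)\hookrightarrow\mathcal V^{\mathrm{spec}}_s(M)$ continuously and $$\|f\|_{\mathcal V^{\mathrm{spec}}_s(M)}\le\|f\|_{\mathcal V^{\mathrm{spec}}_t(M)}.$$ Moreover, if $T:M\to M$ is an isometry, then $\|f\circ T\|_{\mathcal V^{\mathrm{spec}}_s(M)}=\|f\|_{\mathcal V^{\mathrm{spec}}_s(M)}$.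
   Context: $(M,g)$ is a compact connected smooth Riemannian manifold without boundary, $\nu$ is Riemannian volume normalized so that $\nu(M)=1$, $L^2(M)=L^2(M,\nu)$ (real-valued). $L=-\Delta_M$ is the nonnegative Laplace–Beltrami operator with distinct eigenvalues $0=\mu_0<\mu_1<\cdots$; $E_j=\ker(L-\mu_jI)$ and $P_j:L^2(M)\to E_j$ is the orthogonal projector. For $s\ge0$, $\|f\|_{\mathcal V^{\mathrm{spec}}_s(M)}=\sum_{j\ge0}(1+\mu_j)^{s/2}\|P_jf\|_{L^2(M)}$ and $\mathcal V^{\mathrm{spec}}_s(M)=\{f\in L^2(M):\|f\|_{\mathcal V^{\mathrm{spec}}_s(M)}<\infty\}$. A finite spectral sum is an element of the algebraic direct sum of the $E_j$ (a function with $P_jf\neq0$ for only finitely many $j$). *)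

theory Defs
  imports "HOL-Analysis.Analysis"
begin

section \<open>Smooth manifolds\<close>

text \<open>These notions are meant for open subsets of a Euclidean space; there \<open>smooth_on\<close> is
  the usual \<open>C\<^sup>\<infinity>\<close>.\<close>

primrec Ck_on :: "nat \<Rightarrow> ('a::euclidean_space \<Rightarrow> 'b::real_normed_vector) \<Rightarrow> 'a set \<Rightarrow> bool" where
  "Ck_on 0 f S \<longleftrightarrow> continuous_on S f"
| "Ck_on (Suc k) f S \<longleftrightarrow>
     (\<forall>x\<in>S. f differentiable (at x)) \<and> (\<forall>v. Ck_on k (\<lambda>x. frechet_derivative f (at x) v) S)"

definition smooth_on :: "('a::euclidean_space \<Rightarrow> 'b::real_normed_vector) \<Rightarrow> 'a set \<Rightarrow> bool" where
  "smooth_on f S \<longleftrightarrow> (\<forall>k. Ck_on k f S)"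

text \<open>A chart is a domain together with a coordinate map. The manifold is the whole type
  \<open>'m\<close>; its dimension is \<open>CARD('n)\<close>.\<close>

type_synonym ('m, 'n) chart = "'m set \<times> ('m \<Rightarrow> real ^ 'n)"

abbreviation chart_dom :: "('m, 'n) chart \<Rightarrow> 'm set" where "chart_dom c \<equiv> fst c"
abbreviation chart_map :: "('m, 'n) chart \<Rightarrow> 'm \<Rightarrow> real ^ 'n" where "chart_map c \<equiv> snd c"

definition chart_inv :: "('m, 'n) chart \<Rightarrow> real ^ 'n \<Rightarrow> 'm" where
  "chart_inv c = inv_into (chart_dom c) (chart_map c)"

definition smooth_atlas ::
  "('m::{t2_space,second_countable_topology}, 'n::finite) chart set \<Rightarrow> bool" where
  "smooth_atlas A \<longleftrightarrow>
     (\<Union>c\<in>A. chart_dom c) = UNIV \<and>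
     (\<forall>c\<in>A. open (chart_dom c) \<and> open (chart_map c ` chart_dom c) \<and>
        homeomorphism (chart_dom c) (chart_map c ` chart_dom c) (chart_map c) (chart_inv c)) \<and>
     (\<forall>c\<in>A. \<forall>d\<in>A.
        smooth_on (chart_map d \<circ> chart_inv c) (chart_map c ` (chart_dom c \<inter> chart_dom d)))"

definition smooth_fun :: "('m, 'n::finite) chart set \<Rightarrow> ('m \<Rightarrow> real) \<Rightarrow> bool" where
  "smooth_fun A u \<longleftrightarrow> (\<forall>c\<in>A. smooth_on (u \<circ> chart_inv c) (chart_map c ` chart_dom c))"

definition smooth_map ::
  "('m::topological_space, 'n::finite) chart set \<Rightarrow> ('m \<Rightarrow> 'm) \<Rightarrow> bool" where
  "smooth_map A T \<longleftrightarrow> continuous_on UNIV T \<and>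
     (\<forall>c\<in>A. \<forall>d\<in>A. smooth_on (chart_map d \<circ> T \<circ> chart_inv c)
        (chart_map c ` (chart_dom c \<inter> T -` chart_dom d)))"

section \<open>Riemannian metrics\<close>

text \<open>A metric tensor is given by its component matrices \<open>G c p = (g\<^sub>i\<^sub>j(p))\<close> in every chart
  \<open>c\<close> around \<open>p\<close>, subject to the transformation law of covariant 2-tensors. Values
  \<open>G c p\<close> with \<open>p\<close> outside the domain of \<open>c\<close> are irrelevant.\<close>

type_synonym ('m, 'n) metric_tensor = "('m, 'n) chart \<Rightarrow> 'm \<Rightarrow> real ^ 'n ^ 'n"

definition riemannian_metric ::
  "('m, 'n::finite) chart set \<Rightarrow> ('m, 'n) metric_tensor \<Rightarrow> bool" where
  "riemannian_metric A G \<longleftrightarrow>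
     (\<forall>c\<in>A. \<forall>p\<in>chart_dom c.
        transpose (G c p) = G c p \<and> (\<forall>v. v \<noteq> 0 \<longrightarrow> 0 < v \<bullet> (G c p *v v))) \<and>
     (\<forall>c\<in>A. \<forall>i j. smooth_on (\<lambda>x. G c (chart_inv c x) $ i $ j) (chart_map c ` chart_dom c)) \<and>
     (\<forall>c\<in>A. \<forall>d\<in>A. \<forall>p \<in> chart_dom c \<inter> chart_dom d.
        (let J = jacobian (chart_map d \<circ> chart_inv c) (at (chart_map c p))
         in G c p = transpose J ** G d p ** J))"

text \<open>Diffeomorphisms \<open>T\<close> of the manifold with \<open>T\<^sup>* g = g\<close>.\<close>

definition riemannian_isometry ::
  "('m::topological_space, 'n::finite) chart set \<Rightarrow> ('m, 'n) metric_tensor \<Rightarrow> ('m \<Rightarrow> 'm) \<Rightarrow> bool"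
  where
  "riemannian_isometry A G T \<longleftrightarrow>
     bij T \<and> smooth_map A T \<and> smooth_map A (inv T) \<and>
     (\<forall>c\<in>A. \<forall>d\<in>A. \<forall>p \<in> chart_dom c \<inter> T -` chart_dom d.
        (let J = jacobian (chart_map d \<circ> T \<circ> chart_inv c) (at (chart_map c p))
         in G c p = transpose J ** G d (T p) ** J))"

text \<open>The Riemannian volume is the unique Borel measure with density \<open>sqrt (det g)\<close> with
  respect to Lebesgue measure in every chart.\<close>

definition riemannian_volume ::
  "('m::topological_space, 'n::finite) chart set \<Rightarrow> ('m, 'n) metric_tensor \<Rightarrow> 'm measure" where
  "riemannian_volume A G = (THE V. sets V = sets borel \<and>
     (\<forall>c\<in>A. \<forall>B\<in>sets borel. B \<subseteq> chart_dom c \<longrightarrow>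
        emeasure V B =
          (\<integral>\<^sup>+ x. ennreal (sqrt (det (G c (chart_inv c x)))) * indicator (chart_map c ` B) x
             \<partial>lborel)))"

definition normalized_volume ::
  "('m::topological_space, 'n::finite) chart set \<Rightarrow> ('m, 'n) metric_tensor \<Rightarrow> 'm measure" where
  "normalized_volume A G =
     scale_measure (1 / emeasure (riemannian_volume A G) UNIV) (riemannian_volume A G)"

text \<open>The gradient pairing \<open>\<langle>\<nabla>u, \<nabla>v\<rangle> = g\<^sup>i\<^sup>j \<partial>\<^sub>i u \<partial>\<^sub>j v\<close> and the Laplace--Beltrami operator
  \<open>\<Delta>u = (det g) powr (-1/2) * \<partial>\<^sub>i ((det g) powr (1/2) * g\<^sup>i\<^sup>j \<partial>\<^sub>j u)\<close> on smooth functions.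
  Both are evaluated at \<open>p\<close> in an arbitrary chart around \<open>p\<close>; the values do not depend on
  this chart.\<close>

definition chart_at :: "('m, 'n::finite) chart set \<Rightarrow> 'm \<Rightarrow> ('m, 'n) chart" where
  "chart_at A p = (SOME c. c \<in> A \<and> p \<in> chart_dom c)"

definition partial_deriv :: "'n::finite \<Rightarrow> (real ^ 'n \<Rightarrow> real) \<Rightarrow> real ^ 'n \<Rightarrow> real" where
  "partial_deriv i f x = frechet_derivative f (at x) (axis i 1)"

definition coord_differential ::
  "('m, 'n::finite) chart \<Rightarrow> ('m \<Rightarrow> real) \<Rightarrow> real ^ 'n \<Rightarrow> real ^ 'n" where
  "coord_differential c u x = (\<chi> i. partial_deriv i (u \<circ> chart_inv c) x)"

definition grad_inner ::
  "('m, 'n::finite) chart set \<Rightarrow> ('m, 'n) metric_tensor \<Rightarrow> ('m \<Rightarrow> real) \<Rightarrow> ('m \<Rightarrow> real) \<Rightarrow> 'm \<Rightarrow> real"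
  where
  "grad_inner A G u v p = (let c = chart_at A p; x = chart_map c p in
     coord_differential c u x \<bullet> (matrix_inv (G c p) *v coord_differential c v x))"

definition laplace_beltrami ::
  "('m, 'n::finite) chart set \<Rightarrow> ('m, 'n) metric_tensor \<Rightarrow> ('m \<Rightarrow> real) \<Rightarrow> 'm \<Rightarrow> real" where
  "laplace_beltrami A G u p = (let c = chart_at A p; x = chart_map c p;
       rho = (\<lambda>y. sqrt (det (G c (chart_inv c y)))) in
     (1 / rho x) *
       (\<Sum>i\<in>UNIV. partial_deriv i
          (\<lambda>y. rho y * (matrix_inv (G c (chart_inv c y)) *v coord_differential c u y) $ i) x))"

section \<open>Square-integrable functions\<close>

text \<open>Elements of \<open>L\<^sup>2\<close> are represented by functions; equality of elements is equality almost
  everywhere.\<close>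

definition L2 :: "'m measure \<Rightarrow> ('m \<Rightarrow> real) set" where
  "L2 N = {f \<in> borel_measurable N. integrable N (\<lambda>x. (f x)\<^sup>2)}"

definition L2_inner :: "'m measure \<Rightarrow> ('m \<Rightarrow> real) \<Rightarrow> ('m \<Rightarrow> real) \<Rightarrow> real" where
  "L2_inner N f h = (\<integral>x. f x * h x \<partial>N)"

definition L2_norm :: "'m measure \<Rightarrow> ('m \<Rightarrow> real) \<Rightarrow> real" where
  "L2_norm N f = sqrt (L2_inner N f f)"

text \<open>The orthogonal projection onto a closed subspace of \<open>L\<^sup>2\<close>; it is determined up to
  equality almost everywhere.\<close>

definition orth_proj :: "'m measure \<Rightarrow> ('m \<Rightarrow> real) set \<Rightarrow> ('m \<Rightarrow> real) \<Rightarrow> 'm \<Rightarrow> real" where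
  "orth_proj N E f = (SOME h. h \<in> E \<and> (\<forall>e\<in>E. L2_inner N (\<lambda>x. f x - h x) e = 0))"

text \<open>\<open>V\<close>, a union of classes of functions modulo equality almost everywhere, becomes a real
  Banach space with norm \<open>nrm\<close> after passing to these classes.\<close>

definition banach_space_ae ::
  "'m measure \<Rightarrow> ('m \<Rightarrow> real) set \<Rightarrow> (('m \<Rightarrow> real) \<Rightarrow> real) \<Rightarrow> bool" where
  "banach_space_ae N V nrm \<longleftrightarrow>
     V \<subseteq> borel_measurable N \<and>
     (\<forall>f\<in>V. \<forall>h\<in>borel_measurable N. (AE x in N. h x = f x) \<longrightarrow> h \<in> V \<and> nrm h = nrm f) \<and>
     (\<lambda>x. 0) \<in> V \<and>
     (\<forall>f\<in>V. \<forall>h\<in>V. (\<lambda>x. f x + h x) \<in> V) \<and>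
     (\<forall>a. \<forall>f\<in>V. (\<lambda>x. a * f x) \<in> V) \<and>
     (\<forall>f\<in>V. 0 \<le> nrm f) \<and>
     (\<forall>f\<in>V. nrm f = 0 \<longleftrightarrow> (AE x in N. f x = 0)) \<and>
     (\<forall>a. \<forall>f\<in>V. nrm (\<lambda>x. a * f x) = \<bar>a\<bar> * nrm f) \<and>
     (\<forall>f\<in>V. \<forall>h\<in>V. nrm (\<lambda>x. f x + h x) \<le> nrm f + nrm h) \<and>
     (\<forall>F::nat \<Rightarrow> 'm \<Rightarrow> real.
        (\<forall>n. F n \<in> V) \<and>
        (\<forall>e>0. \<exists>K. \<forall>m\<ge>K. \<forall>n\<ge>K. nrm (\<lambda>x. F m x - F n x) < e) \<longrightarrow>
        (\<exists>f\<in>V. (\<lambda>n. nrm (\<lambda>x. F n x - f x)) \<longlonglongrightarrow> 0))"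

definition dense_in_norm ::
  "('m \<Rightarrow> real) set \<Rightarrow> ('m \<Rightarrow> real) set \<Rightarrow> (('m \<Rightarrow> real) \<Rightarrow> real) \<Rightarrow> bool" where
  "dense_in_norm D V nrm \<longleftrightarrow>
     D \<subseteq> V \<and> (\<forall>f\<in>V. \<forall>e>0. \<exists>h\<in>D. nrm (\<lambda>x. f x - h x) < e)"

definition continuously_embedded ::
  "('m \<Rightarrow> real) set \<Rightarrow> (('m \<Rightarrow> real) \<Rightarrow> real) \<Rightarrow> ('m \<Rightarrow> real) set \<Rightarrow> (('m \<Rightarrow> real) \<Rightarrow> real) \<Rightarrow> bool"
  where
  "continuously_embedded V nrmV W nrmW \<longleftrightarrow>
     V \<subseteq> W \<and>
     (\<forall>f\<in>V. \<forall>e>0. \<exists>d>0. \<forall>h\<in>V.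
        nrmV (\<lambda>x. h x - f x) < d \<longrightarrow> nrmW (\<lambda>x. h x - f x) < e)"

section \<open>The Laplacian as an operator in \<open>L\<^sup>2\<close> and its eigenspaces\<close>

text \<open>The Sobolev space \<open>H\<^sup>1\<close>: the closure of the smooth functions in \<open>L\<^sup>2\<close> with respect to the
  norm whose square is \<open>\<integral> u\<^sup>2 + \<integral> \<langle>\<nabla>u, \<nabla>u\<rangle>\<close>.\<close>

definition dirichlet_energy ::
  "('m::topological_space, 'n::finite) chart set \<Rightarrow> ('m, 'n) metric_tensor \<Rightarrow> ('m \<Rightarrow> real) \<Rightarrow> real"
  where
  "dirichlet_energy A G u = (\<integral>p. grad_inner A G u u p \<partial>normalized_volume A G)"

definition sobolev_H1 ::
  "('m::topological_space, 'n::finite) chart set \<Rightarrow> ('m, 'n) metric_tensor \<Rightarrow> ('m \<Rightarrow> real) set"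
  where
  "sobolev_H1 A G = {f \<in> L2 (normalized_volume A G).
     \<exists>u::nat \<Rightarrow> 'm \<Rightarrow> real. (\<forall>n. smooth_fun A (u n)) \<and>
       (\<lambda>n. L2_norm (normalized_volume A G) (\<lambda>p. u n p - f p)) \<longlonglongrightarrow> 0 \<and>
       (\<forall>e>0. \<exists>K. \<forall>m\<ge>K. \<forall>n\<ge>K. dirichlet_energy A G (\<lambda>p. u m p - u n p) < e)}"

text \<open>The graph of the self-adjoint operator \<open>L = -\<Delta>\<close> in \<open>L\<^sup>2\<close>: its domain consists of the
  \<open>f\<close> in \<open>H\<^sup>1\<close> whose distributional Laplacian is in \<open>L\<^sup>2\<close>. This is the Friedrichs
  extension of \<open>-\<Delta>\<close> on smooth functions (and its closure, as \<open>-\<Delta>\<close> is essentially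
  self-adjoint on a compact manifold).\<close>

definition laplacian_graph ::
  "('m::topological_space, 'n::finite) chart set \<Rightarrow> ('m, 'n) metric_tensor \<Rightarrow>
     (('m \<Rightarrow> real) \<times> ('m \<Rightarrow> real)) set" where
  "laplacian_graph A G = {(f, w). f \<in> sobolev_H1 A G \<and> w \<in> L2 (normalized_volume A G) \<and>
     (\<forall>\<phi>. smooth_fun A \<phi> \<longrightarrow>
        L2_inner (normalized_volume A G) f (\<lambda>p. - laplace_beltrami A G \<phi> p) =
        L2_inner (normalized_volume A G) w \<phi>)}"

definition eigenspace ::
  "('m::topological_space, 'n::finite) chart set \<Rightarrow> ('m, 'n) metric_tensor \<Rightarrow> real \<Rightarrow> ('m \<Rightarrow> real) set"
  where
  "eigenspace A G l = {f. (f, \<lambda>p. l * f p) \<in> laplacian_graph A G}"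

definition eigenvalues ::
  "('m::topological_space, 'n::finite) chart set \<Rightarrow> ('m, 'n) metric_tensor \<Rightarrow> real set" where
  "eigenvalues A G = {l. \<exists>f\<in>eigenspace A G l. \<not> (AE p in normalized_volume A G. f p = 0)}"

section \<open>The spectral spaces\<close>

definition vspec_norm ::
  "('m::topological_space, 'n::finite) chart set \<Rightarrow> ('m, 'n) metric_tensor \<Rightarrow> (nat \<Rightarrow> real) \<Rightarrow> real \<Rightarrow>
     ('m \<Rightarrow> real) \<Rightarrow> ennreal" where
  "vspec_norm A G \<mu> s f = (\<Sum>j. ennreal ((1 + \<mu> j) powr (s / 2) *
     L2_norm (normalized_volume A G)
       (orth_proj (normalized_volume A G) (eigenspace A G (\<mu> j)) f)))"

definition vspec ::
  "('m::topological_space, 'n::finite) chart set \<Rightarrow> ('m, 'n) metric_tensor \<Rightarrow> (nat \<Rightarrow> real) \<Rightarrow> real \<Rightarrow>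
     ('m \<Rightarrow> real) set" where
  "vspec A G \<mu> s = {f \<in> L2 (normalized_volume A G). vspec_norm A G \<mu> s f < \<infinity>}"

definition finite_spectral_sums ::
  "('m::topological_space, 'n::finite) chart set \<Rightarrow> ('m, 'n) metric_tensor \<Rightarrow> (nat \<Rightarrow> real) \<Rightarrow>
     ('m \<Rightarrow> real) set" where
  "finite_spectral_sums A G \<mu> =
     {f. \<exists>J e. finite J \<and> (\<forall>j\<in>J. e j \<in> eigenspace A G (\<mu> j)) \<and> f = (\<lambda>p. \<Sum>j\<in>J. e j p)}"

end

theory Submission
  imports Defs "HOL-Library.Diagonal_Subsequence"
begin

text \<open>The spectral norm is a weighted sum of the norms of the components \<open>P\<^sub>j f\<close>, so most of
  the theorem concerns weighted spaces of summable sequences: comparing the weights gives the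
  inclusions, cutting off the series gives the density of finite sums, and passing to the limit in
  one coefficient at a time gives completeness. What has to be known about the Laplacian is that
  its eigenspaces exhaust \<open>L\<^sup>2\<close>: the partial sums of the \<open>P\<^sub>j f\<close> converge to \<open>f\<close>
  (\<open>partial_proj_converges\<close>). This gives \<open>\<parallel>f\<parallel> \<le> \<Sum> \<parallel>P\<^sub>j f\<parallel>\<close> (\<open>L2_norm_le_spec_norm\<close>), on which
  completeness of the spaces and definiteness of the norms rest as well.

  Exhaustion is proved for an abstract nonnegative form \<open>D\<close> on a dense space \<open>X\<close> of test functions
  that satisfies Green's formula \<open>D u \<phi> = \<langle>u, S \<phi>\<rangle>\<close> and a compactness condition (the locale
  \<open>energy_form\<close>). Such a form is closable (\<open>closable\<close>), and sequences of bounded energy have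
  subsequences that converge in \<open>L\<^sup>2\<close> (\<open>energy_bounded_subsequence\<close>). On the orthogonal
  complement of the first \<open>n\<close> eigenspaces the infimum of the Rayleigh quotient is therefore
  attained, and at an eigenfunction; so the infimum is at least \<open>\<mu> n\<close> (\<open>rayleigh_bound\<close>). The same
  compactness makes the eigenvalues unbounded (\<open>\<mu>_unbounded\<close>). Hence for a test function
  the remainder after \<open>n\<close> terms, whose energy is bounded, tends to zero, and density of the
  test functions extends this to \<open>L\<^sup>2\<close>.

  The smooth functions on the manifold with the Dirichlet form fit this scheme for three reasons.
  Green's formula (\<open>green_formula\<close>) follows from integration by parts in charts and a partition of
  unity; along the way it shows that the Laplacian does not depend on the chart
  (\<open>lap_le_chart\<close>). Smooth functions are dense in \<open>L\<^sup>2\<close> (\<open>smooth_dense\<close>), because a function that is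
  orthogonal to all of them has integral zero over every open set. The compactness condition
  (\<open>energy_coercive\<close>) comes from Poincare's inequality on small boxes in charts
  (\<open>poincare_convex\<close>): up to a small multiple of the energy, the norm is controlled by finitely many
  mean values. All this needs the volume measure, which is glued from the charts by the
  change of variables formula (\<open>volume_exists\<close>, \<open>volume_unique\<close>).

  Isometries preserve the volume, the smooth functions and the energy (\<open>isometry_symmetry\<close>).
  Composition with an isometry therefore maps each eigenspace onto itself, commutes with the
  projections, and leaves the norms of the components unchanged (\<open>spec_norm_symmetry\<close>).\<close>

section \<open>Semi-inner products on spaces of functions\<close>

definition form_norm :: "(('a \<Rightarrow> real) \<Rightarrow> ('a \<Rightarrow> real) \<Rightarrow> real) \<Rightarrow> ('a \<Rightarrow> real) \<Rightarrow> real" where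
  "form_norm B f = sqrt (B f f)"

text \<open>The form is only required to be semidefinite, and it lives on functions rather than
  on classes modulo equality almost everywhere. This covers the inner product of
  \<open>L\<^sup>2\<close>, the Dirichlet form on smooth functions, the closure of the latter,
  and the differences of forms in \<open>rayleigh_bound\<close>.\<close>

locale semi_inner =
  fixes V :: "('a \<Rightarrow> real) set" and B :: "('a \<Rightarrow> real) \<Rightarrow> ('a \<Rightarrow> real) \<Rightarrow> real"
  assumes zero_in [simp, intro]: "(\<lambda>x. 0) \<in> V"
    and add_in [simp, intro]: "f \<in> V \<Longrightarrow> g \<in> V \<Longrightarrow> (\<lambda>x. f x + g x) \<in> V"
    and scale_in [simp, intro]: "f \<in> V \<Longrightarrow> (\<lambda>x. a * f x) \<in> V"
    and form_add: "f \<in> V \<Longrightarrow> g \<in> V \<Longrightarrow> h \<in> V \<Longrightarrow> B (\<lambda>x. f x + g x) h = B f h + B g h"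
    and form_scale: "f \<in> V \<Longrightarrow> h \<in> V \<Longrightarrow> B (\<lambda>x. a * f x) h = a * B f h"
    and form_sym: "f \<in> V \<Longrightarrow> g \<in> V \<Longrightarrow> B f g = B g f"
    and form_nonneg: "f \<in> V \<Longrightarrow> 0 \<le> B f f"
begin

lemma diff_in [simp, intro]: "f \<in> V \<Longrightarrow> g \<in> V \<Longrightarrow> (\<lambda>x. f x - g x) \<in> V"
  using add_in[of f "\<lambda>x. (-1) * g x"] scale_in[of g "-1"] by simp

lemma sum_in [simp, intro]: "(\<And>i. i \<in> I \<Longrightarrow> f i \<in> V) \<Longrightarrow> (\<lambda>x. \<Sum>i\<in>I. f i x) \<in> V"
  by (induction I rule: infinite_finite_induct) auto

lemma form_zero: "h \<in> V \<Longrightarrow> B (\<lambda>x. 0) h = 0"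
  using form_scale[of "\<lambda>x. 0" h 0] by simp

lemma form_diff: "f \<in> V \<Longrightarrow> g \<in> V \<Longrightarrow> h \<in> V \<Longrightarrow> B (\<lambda>x. f x - g x) h = B f h - B g h"
  using form_add[of f "\<lambda>x. (-1) * g x" h] form_scale[of g h "-1"] scale_in[of g "-1"] by simp

lemma form_add_right: "f \<in> V \<Longrightarrow> g \<in> V \<Longrightarrow> h \<in> V \<Longrightarrow> B h (\<lambda>x. f x + g x) = B h f + B h g"
  using form_add[of f g h] form_sym[of h] by simp

lemma form_scale_right: "f \<in> V \<Longrightarrow> h \<in> V \<Longrightarrow> B h (\<lambda>x. a * f x) = a * B h f"
  using form_scale[of f h a] form_sym[of h] by simp

lemma form_diff_right: "f \<in> V \<Longrightarrow> g \<in> V \<Longrightarrow> h \<in> V \<Longrightarrow> B h (\<lambda>x. f x - g x) = B h f - B h g"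
  using form_diff[of f g h] form_sym[of h] by simp

lemma form_sum: "(\<And>i. i \<in> I \<Longrightarrow> f i \<in> V) \<Longrightarrow> h \<in> V \<Longrightarrow>
    B (\<lambda>x. \<Sum>i\<in>I. f i x) h = (\<Sum>i\<in>I. B (f i) h)"
  by (induction I rule: infinite_finite_induct) (auto simp: form_zero form_add)

lemma form_sum_right: "(\<And>i. i \<in> I \<Longrightarrow> f i \<in> V) \<Longrightarrow> h \<in> V \<Longrightarrow>
    B h (\<lambda>x. \<Sum>i\<in>I. f i x) = (\<Sum>i\<in>I. B h (f i))"
  using form_sum[of I f h] form_sym[of h] by (simp add: sum_in)

lemmas form_simps = form_add form_diff form_scale form_add_right form_diff_right form_scale_right

lemma form_square_diff:
  "f \<in> V \<Longrightarrow> g \<in> V \<Longrightarrow> B (\<lambda>x. f x - g x) (\<lambda>x. f x - g x) = B f f - 2 * B f g + B g g"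
  using form_sym[of f g] by (simp add: form_simps)

lemma form_square_add:
  "f \<in> V \<Longrightarrow> g \<in> V \<Longrightarrow> B (\<lambda>x. f x + g x) (\<lambda>x. f x + g x) = B f f + 2 * B f g + B g g"
  using form_sym[of f g] by (simp add: form_simps)

lemma form_scale_square: "f \<in> V \<Longrightarrow> B (\<lambda>x. a * f x) (\<lambda>x. a * f x) = a\<^sup>2 * B f f"
  by (simp add: form_scale form_scale_right power2_eq_square)

lemma parallelogram:
  "f \<in> V \<Longrightarrow> g \<in> V \<Longrightarrow>
   B (\<lambda>x. f x + g x) (\<lambda>x. f x + g x) + B (\<lambda>x. f x - g x) (\<lambda>x. f x - g x) = 2 * B f f + 2 * B g g"
  by (simp add: form_square_diff form_square_add)

text \<open>A quadratic polynomial in \<open>t\<close> that is minimal at \<open>0\<close> has no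
  linear term.\<close>

lemma form_minimal_imp_orthogonal:
  assumes "f \<in> V" "e \<in> V" and "\<And>t. B f f \<le> B (\<lambda>x. f x - t * e x) (\<lambda>x. f x - t * e x)"
  shows "B f e = 0"
proof -
  have *: "2 * t * B f e \<le> t\<^sup>2 * B e e" for t
    using assms(3)[of t] assms(1,2)
    by (simp add: form_square_diff form_scale form_scale_right power2_eq_square algebra_simps)
  have e0: "0 \<le> B e e" using assms form_nonneg by blast
  \<comment> \<open>The vertex of the parabola is at \<open>B f e / B e e\<close>; the summand
    \<open>1\<close> also covers \<open>B e e = 0\<close>.\<close>
  define t where "t = B f e / (B e e + 1)"
  have t: "t * (B e e + 1) = B f e" using e0 by (simp add: t_def)
  have "2 * t * (t * (B e e + 1)) \<le> t\<^sup>2 * B e e" using *[of t] t by simp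
  hence "t\<^sup>2 * (B e e + 2) \<le> 0" by (simp add: power2_eq_square algebra_simps)
  hence "t\<^sup>2 \<le> 0" using e0 by (smt (verit) mult_pos_pos zero_le_power2)
  hence "t = 0" by simp
  thus ?thesis using t by simp
qed

lemma Cauchy_Schwarz:
  assumes "f \<in> V" "g \<in> V"
  shows "(B f g)\<^sup>2 \<le> B f f * B g g"
proof (cases "B g g = 0")
  case True
  \<comment> \<open>A function of length zero is minimal on every line through it.\<close>
  have "B g f = 0"
  proof (rule form_minimal_imp_orthogonal)
    show "B g g \<le> B (\<lambda>x. g x - t * f x) (\<lambda>x. g x - t * f x)" for t
      using True assms form_nonneg by simp
  qed (use assms in auto)
  thus ?thesis using True assms form_sym[of f g] by simp
next
  case False
  hence pos: "B g g > 0" using form_nonneg[OF assms(2)] by simp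
  define t where "t = B f g / B g g"
  have "0 \<le> B (\<lambda>x. f x - t * g x) (\<lambda>x. f x - t * g x)" using assms form_nonneg by simp
  also have "\<dots> = B f f - 2 * t * B f g + t\<^sup>2 * B g g"
    using assms by (simp add: form_square_diff form_scale form_scale_right power2_eq_square)
  also have "\<dots> = B f f - (B f g)\<^sup>2 / B g g"
    using pos by (simp add: t_def field_simps power2_eq_square)
  finally show ?thesis using pos by (simp add: field_simps)
qed

lemma form_norm_nonneg [simp]: "f \<in> V \<Longrightarrow> 0 \<le> form_norm B f"
  by (simp add: form_norm_def form_nonneg)

lemma form_norm_square: "f \<in> V \<Longrightarrow> (form_norm B f)\<^sup>2 = B f f"
  by (simp add: form_norm_def form_nonneg)

lemma form_norm_zero [simp]: "form_norm B (\<lambda>x. 0) = 0"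
  by (simp add: form_norm_def form_zero)

lemma abs_form_le: "f \<in> V \<Longrightarrow> g \<in> V \<Longrightarrow> \<bar>B f g\<bar> \<le> form_norm B f * form_norm B g"
  using Cauchy_Schwarz[of f g]
  by (metis form_norm_def real_sqrt_abs real_sqrt_le_mono real_sqrt_mult)

lemma form_norm_scale: "f \<in> V \<Longrightarrow> form_norm B (\<lambda>x. a * f x) = \<bar>a\<bar> * form_norm B f"
  by (simp add: form_norm_def form_scale form_scale_right mult.assoc[symmetric] real_sqrt_mult)

lemma form_norm_triangle:
  assumes "f \<in> V" "g \<in> V"
  shows "form_norm B (\<lambda>x. f x + g x) \<le> form_norm B f + form_norm B g"
proof (rule power2_le_imp_le)
  show "(form_norm B (\<lambda>x. f x + g x))\<^sup>2 \<le> (form_norm B f + form_norm B g)\<^sup>2"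
    using abs_form_le[OF assms] assms
    by (simp add: form_norm_square form_square_add power2_sum)
qed (use assms in auto)

lemma form_norm_commute:
  "f \<in> V \<Longrightarrow> g \<in> V \<Longrightarrow> form_norm B (\<lambda>x. f x - g x) = form_norm B (\<lambda>x. g x - f x)"
  using form_norm_scale[of "\<lambda>x. g x - f x" "-1"] by simp

lemma form_norm_triangle3:
  assumes "f \<in> V" "g \<in> V" "h \<in> V"
  shows "form_norm B (\<lambda>x. f x - h x) \<le> form_norm B (\<lambda>x. f x - g x) + form_norm B (\<lambda>x. g x - h x)"
  using form_norm_triangle[of "\<lambda>x. f x - g x" "\<lambda>x. g x - h x"] assms by simp

lemma form_norm_reverse_triangle:
  assumes "f \<in> V" "g \<in> V"
  shows "\<bar>form_norm B f - form_norm B g\<bar> \<le> form_norm B (\<lambda>x. f x - g x)"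
  using form_norm_triangle[of "\<lambda>x. f x - g x" g] form_norm_triangle[of "\<lambda>x. g x - f x" f]
    form_norm_commute[of f g] assms by simp

lemma form_norm_sum:
  assumes "\<And>i. i \<in> I \<Longrightarrow> f i \<in> V"
  shows "form_norm B (\<lambda>x. \<Sum>i\<in>I. f i x) \<le> (\<Sum>i\<in>I. form_norm B (f i))"
  using assms
proof (induction I rule: infinite_finite_induct)
  case (insert i I)
  have "form_norm B (\<lambda>x. f i x + (\<Sum>i\<in>I. f i x)) \<le> form_norm B (f i) + form_norm B (\<lambda>x. \<Sum>i\<in>I. f i x)"
    using insert by (intro form_norm_triangle) auto
  also have "\<dots> \<le> form_norm B (f i) + (\<Sum>i\<in>I. form_norm B (f i))" using insert by auto
  finally show ?case using insert by simp
qed auto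

definition converges_to :: "(nat \<Rightarrow> 'a \<Rightarrow> real) \<Rightarrow> ('a \<Rightarrow> real) \<Rightarrow> bool" where
  "converges_to u f \<longleftrightarrow> (\<lambda>n. form_norm B (\<lambda>x. u n x - f x)) \<longlonglongrightarrow> 0"

definition cauchy_seq :: "(nat \<Rightarrow> 'a \<Rightarrow> real) \<Rightarrow> bool" where
  "cauchy_seq u \<longleftrightarrow> (\<forall>e>0. \<exists>K. \<forall>m\<ge>K. \<forall>n\<ge>K. form_norm B (\<lambda>x. u m x - u n x) < e)"

lemma cauchy_seqI_square:
  assumes "\<And>n. u n \<in> V"
    and "\<And>e. e > 0 \<Longrightarrow> \<exists>K. \<forall>m\<ge>K. \<forall>n\<ge>K. B (\<lambda>x. u m x - u n x) (\<lambda>x. u m x - u n x) < e"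
  shows "cauchy_seq u"
  unfolding cauchy_seq_def
proof (intro allI impI)
  fix e :: real assume "e > 0"
  then obtain K where K: "\<forall>m\<ge>K. \<forall>n\<ge>K. B (\<lambda>x. u m x - u n x) (\<lambda>x. u m x - u n x) < e\<^sup>2"
    using assms(2)[of "e\<^sup>2"] by auto
  have "form_norm B (\<lambda>x. u m x - u n x) < e" if "m \<ge> K" "n \<ge> K" for m n
    using K that \<open>e > 0\<close> unfolding form_norm_def by (simp add: real_less_lsqrt)
  thus "\<exists>K. \<forall>m\<ge>K. \<forall>n\<ge>K. form_norm B (\<lambda>x. u m x - u n x) < e" by blast
qed

lemma cauchy_seqD_square:
  assumes "\<And>n. u n \<in> V" "cauchy_seq u" "e > 0"
  shows "\<exists>K. \<forall>m\<ge>K. \<forall>n\<ge>K. B (\<lambda>x. u m x - u n x) (\<lambda>x. u m x - u n x) < e"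
proof -
  obtain K where K: "\<And>m n. m \<ge> K \<Longrightarrow> n \<ge> K \<Longrightarrow> form_norm B (\<lambda>x. u m x - u n x) < sqrt e"
    using assms unfolding cauchy_seq_def by (metis real_sqrt_gt_0_iff)
  have "B (\<lambda>x. u m x - u n x) (\<lambda>x. u m x - u n x) < e" if "m \<ge> K" "n \<ge> K" for m n
    using K[OF that] unfolding form_norm_def by simp
  thus ?thesis by blast
qed

lemma converges_to_form:
  assumes "\<And>n. u n \<in> V" "f \<in> V" "converges_to u f" "g \<in> V"
  shows "(\<lambda>n. B (u n) g) \<longlonglongrightarrow> B f g"
proof -
  have "(\<lambda>n. form_norm B (\<lambda>x. u n x - f x) * form_norm B g) \<longlonglongrightarrow> 0 * form_norm B g"
    using assms(3) unfolding converges_to_def by (intro tendsto_mult tendsto_const)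
  moreover have "norm (B (u n) g - B f g) \<le> form_norm B (\<lambda>x. u n x - f x) * form_norm B g" for n
    using abs_form_le[of "\<lambda>x. u n x - f x" g] assms by (simp add: form_diff)
  ultimately have "(\<lambda>n. B (u n) g - B f g) \<longlonglongrightarrow> 0"
    by - (rule Lim_null_comparison[where g = "\<lambda>n. form_norm B (\<lambda>x. u n x - f x) * form_norm B g"], auto)
  thus ?thesis by (simp add: LIM_zero_iff)
qed

lemma converges_to_norm:
  assumes "\<And>n. u n \<in> V" "f \<in> V" "converges_to u f"
  shows "(\<lambda>n. form_norm B (u n)) \<longlonglongrightarrow> form_norm B f"
proof -
  have "norm (form_norm B (u n) - form_norm B f) \<le> form_norm B (\<lambda>x. u n x - f x)" for n
    using form_norm_reverse_triangle[of "u n" f] assms by simp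
  hence "(\<lambda>n. form_norm B (u n) - form_norm B f) \<longlonglongrightarrow> 0"
    using assms(3) unfolding converges_to_def
    by - (rule Lim_null_comparison[where g = "\<lambda>n. form_norm B (\<lambda>x. u n x - f x)"], auto)
  thus ?thesis by (simp add: LIM_zero_iff)
qed

lemma converges_to_square:
  assumes "\<And>n. u n \<in> V" "f \<in> V" "converges_to u f"
  shows "(\<lambda>n. B (u n) (u n)) \<longlonglongrightarrow> B f f"
  using tendsto_power[OF converges_to_norm[OF assms], of 2] assms by (simp add: form_norm_square)

lemma converges_to_add:
  assumes "\<And>n. u n \<in> V" "f \<in> V" "converges_to u f" "\<And>n. v n \<in> V" "g \<in> V" "converges_to v g"
  shows "converges_to (\<lambda>n x. u n x + v n x) (\<lambda>x. f x + g x)"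
  unfolding converges_to_def
proof (rule tendsto_sandwich[OF _ _ tendsto_const])
  show "(\<lambda>n. form_norm B (\<lambda>x. u n x - f x) + form_norm B (\<lambda>x. v n x - g x)) \<longlonglongrightarrow> 0"
    using tendsto_add[OF assms(3)[unfolded converges_to_def] assms(6)[unfolded converges_to_def]] by simp
  have "form_norm B (\<lambda>x. u n x + v n x - (f x + g x))
      \<le> form_norm B (\<lambda>x. u n x - f x) + form_norm B (\<lambda>x. v n x - g x)" for n
    using form_norm_triangle[of "\<lambda>x. u n x - f x" "\<lambda>x. v n x - g x"] assms
    by (simp add: algebra_simps)
  thus "\<forall>\<^sub>F n in sequentially. form_norm B (\<lambda>x. u n x + v n x - (f x + g x))
      \<le> form_norm B (\<lambda>x. u n x - f x) + form_norm B (\<lambda>x. v n x - g x)" by simp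
qed (use assms in auto)

lemma converges_to_scale:
  assumes "\<And>n. u n \<in> V" "f \<in> V" "converges_to u f"
  shows "converges_to (\<lambda>n x. a * u n x) (\<lambda>x. a * f x)"
proof -
  have "form_norm B (\<lambda>x. a * u n x - a * f x) = \<bar>a\<bar> * form_norm B (\<lambda>x. u n x - f x)" for n
    using form_norm_scale[of "\<lambda>x. u n x - f x" a] assms by (simp add: algebra_simps)
  thus ?thesis
    using tendsto_mult_left[OF assms(3)[unfolded converges_to_def], of "\<bar>a\<bar>"]
    by (simp add: converges_to_def)
qed

lemma cauchy_seq_bounded:
  assumes "\<And>n. u n \<in> V" "cauchy_seq u"
  obtains C where "C > 0" "\<And>n. form_norm B (u n) \<le> C"
proof -
  have "Cauchy (\<lambda>n. form_norm B (u n))"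
  proof (rule metric_CauchyI)
    fix e :: real assume "e > 0"
    then obtain K where K: "\<And>m n. m \<ge> K \<Longrightarrow> n \<ge> K \<Longrightarrow> form_norm B (\<lambda>x. u m x - u n x) < e"
      using assms(2) unfolding cauchy_seq_def by blast
    have "dist (form_norm B (u m)) (form_norm B (u n)) < e" if "m \<ge> K" "n \<ge> K" for m n
      using form_norm_reverse_triangle[of "u m" "u n"] K[OF that] assms by (simp add: dist_real_def)
    thus "\<exists>K. \<forall>m\<ge>K. \<forall>n\<ge>K. dist (form_norm B (u m)) (form_norm B (u n)) < e" by blast
  qed
  then obtain C where "C > 0" "\<And>n. norm (form_norm B (u n)) \<le> C"
    using Cauchy_Bseq BseqE by blast
  thus ?thesis using that[of C] by (metis abs_ge_self order_trans real_norm_def)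
qed

lemma cauchy_seq_perturb:
  assumes "\<And>n. u n \<in> V" "\<And>n. v n \<in> V" "cauchy_seq v"
    and "(\<lambda>n. form_norm B (\<lambda>x. u n x - v n x)) \<longlonglongrightarrow> 0"
  shows "cauchy_seq u"
  unfolding cauchy_seq_def
proof (intro allI impI)
  fix e :: real assume "e > 0"
  hence "e / 3 > 0" by simp
  obtain K where K: "\<And>m n. m \<ge> K \<Longrightarrow> n \<ge> K \<Longrightarrow> form_norm B (\<lambda>x. v m x - v n x) < e / 3"
    using assms(3) \<open>e / 3 > 0\<close> unfolding cauchy_seq_def by blast
  obtain L where L: "\<And>n. n \<ge> L \<Longrightarrow> form_norm B (\<lambda>x. u n x - v n x) < e / 3"
    using order_tendstoD(2)[OF assms(4) \<open>e / 3 > 0\<close>] by (auto simp: eventually_sequentially)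
  have "form_norm B (\<lambda>x. u m x - u n x) < e" if "m \<ge> max K L" "n \<ge> max K L" for m n
  proof -
    have "form_norm B (\<lambda>x. u m x - u n x) \<le> form_norm B (\<lambda>x. u m x - v m x) + form_norm B (\<lambda>x. v m x - u n x)"
      by (rule form_norm_triangle3) (use assms in auto)
    moreover have "form_norm B (\<lambda>x. v m x - u n x) \<le> form_norm B (\<lambda>x. v m x - v n x) + form_norm B (\<lambda>x. v n x - u n x)"
      by (rule form_norm_triangle3) (use assms in auto)
    moreover have "form_norm B (\<lambda>x. v n x - u n x) = form_norm B (\<lambda>x. u n x - v n x)"
      by (rule form_norm_commute) (use assms in auto)
    ultimately show ?thesis using K[of m n] L[of m] L[of n] that by simp
  qed
  thus "\<exists>K. \<forall>m\<ge>K. \<forall>n\<ge>K. form_norm B (\<lambda>x. u m x - u n x) < e" by blast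
qed

lemma converges_to_perturb:
  assumes "\<And>n. u n \<in> V" "\<And>n. v n \<in> V" "f \<in> V" "converges_to v f"
    and "(\<lambda>n. form_norm B (\<lambda>x. u n x - v n x)) \<longlonglongrightarrow> 0"
  shows "converges_to u f"
  unfolding converges_to_def
proof (rule tendsto_sandwich[OF _ _ tendsto_const])
  show "(\<lambda>n. form_norm B (\<lambda>x. u n x - v n x) + form_norm B (\<lambda>x. v n x - f x)) \<longlonglongrightarrow> 0"
    using tendsto_add[OF assms(5) assms(4)[unfolded converges_to_def]] by simp
  show "\<forall>\<^sub>F n in sequentially. form_norm B (\<lambda>x. u n x - f x)
      \<le> form_norm B (\<lambda>x. u n x - v n x) + form_norm B (\<lambda>x. v n x - f x)"
    using assms by (intro always_eventually allI form_norm_triangle3)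
qed (use assms in auto)

lemma cauchy_seq_add:
  assumes "\<And>n. u n \<in> V" "cauchy_seq u" "\<And>n. v n \<in> V" "cauchy_seq v"
  shows "cauchy_seq (\<lambda>n x. u n x + v n x)"
  unfolding cauchy_seq_def
proof (intro allI impI)
  fix e :: real assume "e > 0"
  hence "e / 2 > 0" by simp
  obtain K where K: "\<And>m n. m \<ge> K \<Longrightarrow> n \<ge> K \<Longrightarrow> form_norm B (\<lambda>x. u m x - u n x) < e / 2"
    using assms(2) \<open>e / 2 > 0\<close> unfolding cauchy_seq_def by blast
  obtain L where L: "\<And>m n. m \<ge> L \<Longrightarrow> n \<ge> L \<Longrightarrow> form_norm B (\<lambda>x. v m x - v n x) < e / 2"
    using assms(4) \<open>e / 2 > 0\<close> unfolding cauchy_seq_def by blast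
  have "form_norm B (\<lambda>x. u m x + v m x - (u n x + v n x)) < e" if "m \<ge> max K L" "n \<ge> max K L" for m n
  proof -
    have "form_norm B (\<lambda>x. (u m x - u n x) + (v m x - v n x))
        \<le> form_norm B (\<lambda>x. u m x - u n x) + form_norm B (\<lambda>x. v m x - v n x)"
      by (rule form_norm_triangle) (use assms in auto)
    moreover have "(\<lambda>x. (u m x - u n x) + (v m x - v n x)) = (\<lambda>x. u m x + v m x - (u n x + v n x))"
      by auto
    ultimately show ?thesis using K[of m n] L[of m n] that by simp
  qed
  thus "\<exists>K. \<forall>m\<ge>K. \<forall>n\<ge>K. form_norm B (\<lambda>x. u m x + v m x - (u n x + v n x)) < e" by blast
qed

lemma cauchy_seq_scale:
  assumes "\<And>n. u n \<in> V" "cauchy_seq u"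
  shows "cauchy_seq (\<lambda>n x. a * u n x)"
  unfolding cauchy_seq_def
proof (intro allI impI)
  fix e :: real assume "e > 0"
  hence "e / (\<bar>a\<bar> + 1) > 0" by simp
  then obtain K where K: "\<And>m n. m \<ge> K \<Longrightarrow> n \<ge> K \<Longrightarrow> form_norm B (\<lambda>x. u m x - u n x) < e / (\<bar>a\<bar> + 1)"
    using assms(2) unfolding cauchy_seq_def by blast
  have "form_norm B (\<lambda>x. a * u m x - a * u n x) < e" if "m \<ge> K" "n \<ge> K" for m n
  proof -
    have "form_norm B (\<lambda>x. a * u m x - a * u n x) = \<bar>a\<bar> * form_norm B (\<lambda>x. u m x - u n x)"
      using form_norm_scale[of "\<lambda>x. u m x - u n x" a] assms by (simp add: algebra_simps)
    also have "\<dots> \<le> (\<bar>a\<bar> + 1) * form_norm B (\<lambda>x. u m x - u n x)"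
      using assms by (intro mult_right_mono) auto
    also have "\<dots> < e" using K[OF that] by (simp add: field_simps)
    finally show ?thesis .
  qed
  thus "\<exists>K. \<forall>m\<ge>K. \<forall>n\<ge>K. form_norm B (\<lambda>x. a * u m x - a * u n x) < e" by blast
qed

lemma form_bilinear_diff:
  assumes "f \<in> V" "g \<in> V" "f' \<in> V" "g' \<in> V"
  shows "B f g - B f' g' = B (\<lambda>x. f x - f' x) g + B f' (\<lambda>x. g x - g' x)"
  using assms by (simp add: form_diff form_diff_right)

lemma cauchy_seq_form_convergent:
  assumes "\<And>n. u n \<in> V" "cauchy_seq u" "\<And>n. v n \<in> V" "cauchy_seq v"
  shows "convergent (\<lambda>n. B (u n) (v n))"
proof -
  obtain C where C: "C > 0" "\<And>n. form_norm B (u n) \<le> C" using cauchy_seq_bounded assms by blast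
  obtain C' where C': "C' > 0" "\<And>n. form_norm B (v n) \<le> C'" using cauchy_seq_bounded assms by blast
  have "Cauchy (\<lambda>n. B (u n) (v n))"
  proof (rule metric_CauchyI)
    fix e :: real assume "e > 0"
    define d where "d = e / (C + C')"
    have "d > 0" using \<open>e > 0\<close> C C' by (simp add: d_def)
    obtain K where K: "\<And>m n. m \<ge> K \<Longrightarrow> n \<ge> K \<Longrightarrow> form_norm B (\<lambda>x. u m x - u n x) < d"
      using assms(2) \<open>d > 0\<close> unfolding cauchy_seq_def by blast
    obtain L where L: "\<And>m n. m \<ge> L \<Longrightarrow> n \<ge> L \<Longrightarrow> form_norm B (\<lambda>x. v m x - v n x) < d"
      using assms(4) \<open>d > 0\<close> unfolding cauchy_seq_def by blast
    have "dist (B (u m) (v m)) (B (u n) (v n)) < e" if mn: "m \<ge> max K L" "n \<ge> max K L" for m n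
    proof -
      have "\<bar>B (\<lambda>x. u m x - u n x) (v m)\<bar> \<le> form_norm B (\<lambda>x. u m x - u n x) * form_norm B (v m)"
        by (rule abs_form_le) (use assms in auto)
      also have "\<dots> \<le> form_norm B (\<lambda>x. u m x - u n x) * C'"
        using C' assms by (intro mult_left_mono) auto
      also have "\<dots> < d * C'" using K[of m n] mn C' by simp
      finally have 1: "\<bar>B (\<lambda>x. u m x - u n x) (v m)\<bar> < d * C'" .
      have "\<bar>B (u n) (\<lambda>x. v m x - v n x)\<bar> \<le> form_norm B (u n) * form_norm B (\<lambda>x. v m x - v n x)"
        by (rule abs_form_le) (use assms in auto)
      also have "\<dots> \<le> C * form_norm B (\<lambda>x. v m x - v n x)"
        using C assms by (intro mult_right_mono) auto
      also have "\<dots> < C * d" using L[of m n] mn C by simp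
      finally have 2: "\<bar>B (u n) (\<lambda>x. v m x - v n x)\<bar> < C * d" .
      have "\<bar>B (u m) (v m) - B (u n) (v n)\<bar> < d * C' + C * d"
        using 1 2 form_bilinear_diff[of "u m" "v m" "u n" "v n"] assms by simp
      also have "\<dots> = d * (C + C')" by (simp add: algebra_simps)
      also have "\<dots> = e" using C C' by (simp add: d_def)
      finally show ?thesis by (simp add: dist_real_def)
    qed
    thus "\<exists>K. \<forall>m\<ge>K. \<forall>n\<ge>K. dist (B (u m) (v m)) (B (u n) (v n)) < e" by blast
  qed
  thus ?thesis by (simp add: Cauchy_convergent_iff)
qed

text \<open>In the seminorm of the form, negligible perturbations of two Cauchy sequences do not
  change the limit of their products. This makes the closure of a form independent of the
  approximating sequences.\<close>

lemma form_limit_perturb: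
  assumes "\<And>n. u n \<in> V" "cauchy_seq u" "\<And>n. v n \<in> V" "cauchy_seq v"
    and "\<And>n. u' n \<in> V" "\<And>n. v' n \<in> V" "cauchy_seq u'"
    and "(\<lambda>n. form_norm B (\<lambda>x. u n x - u' n x)) \<longlonglongrightarrow> 0"
    and "(\<lambda>n. form_norm B (\<lambda>x. v n x - v' n x)) \<longlonglongrightarrow> 0"
    and "(\<lambda>n. B (u' n) (v' n)) \<longlonglongrightarrow> L"
  shows "(\<lambda>n. B (u n) (v n)) \<longlonglongrightarrow> L"
proof -
  obtain C where C: "C > 0" "\<And>n. form_norm B (u' n) \<le> C" using cauchy_seq_bounded assms by blast
  obtain C' where C': "C' > 0" "\<And>n. form_norm B (v n) \<le> C'" using cauchy_seq_bounded assms by blast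
  have "(\<lambda>n. form_norm B (\<lambda>x. u n x - u' n x) * C' + C * form_norm B (\<lambda>x. v n x - v' n x)) \<longlonglongrightarrow> 0 * C' + C * 0"
    by (intro tendsto_intros assms)
  moreover have "norm (B (u n) (v n) - B (u' n) (v' n))
      \<le> form_norm B (\<lambda>x. u n x - u' n x) * C' + C * form_norm B (\<lambda>x. v n x - v' n x)" for n
  proof -
    have "\<bar>B (\<lambda>x. u n x - u' n x) (v n)\<bar> \<le> form_norm B (\<lambda>x. u n x - u' n x) * form_norm B (v n)"
      by (rule abs_form_le) (use assms in auto)
    also have "\<dots> \<le> form_norm B (\<lambda>x. u n x - u' n x) * C'"
      using C' assms by (intro mult_left_mono) auto
    finally have 1: "\<bar>B (\<lambda>x. u n x - u' n x) (v n)\<bar> \<le> form_norm B (\<lambda>x. u n x - u' n x) * C'" .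
    have "\<bar>B (u' n) (\<lambda>x. v n x - v' n x)\<bar> \<le> form_norm B (u' n) * form_norm B (\<lambda>x. v n x - v' n x)"
      by (rule abs_form_le) (use assms in auto)
    also have "\<dots> \<le> C * form_norm B (\<lambda>x. v n x - v' n x)"
      using C assms by (intro mult_right_mono) auto
    finally show ?thesis
      using 1 form_bilinear_diff[of "u n" "v n" "u' n" "v' n"] assms by simp
  qed
  ultimately have "(\<lambda>n. B (u n) (v n) - B (u' n) (v' n)) \<longlonglongrightarrow> 0"
    by - (rule Lim_null_comparison[where g = "\<lambda>n. form_norm B (\<lambda>x. u n x - u' n x) * C' +
      C * form_norm B (\<lambda>x. v n x - v' n x)"], auto)
  from tendsto_add[OF this assms(10)] show ?thesis by simp
qed

text \<open>Near a minimizer of the distance the parallelogram law makes every minimizing sequence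
  Cauchy; its limit is the foot of the perpendicular.\<close>

theorem orthogonal_projection_exists:
  assumes E: "E \<subseteq> V" "(\<lambda>x. 0) \<in> E" "\<And>f g. f \<in> E \<Longrightarrow> g \<in> E \<Longrightarrow> (\<lambda>x. f x + g x) \<in> E"
      "\<And>f a. f \<in> E \<Longrightarrow> (\<lambda>x. a * f x) \<in> E"
    and complete: "\<And>u. (\<And>n. u n \<in> E) \<Longrightarrow> cauchy_seq u \<Longrightarrow> \<exists>h\<in>E. converges_to u h"
    and f: "f \<in> V"
  shows "\<exists>h\<in>E. \<forall>e\<in>E. B (\<lambda>x. f x - h x) e = 0"
proof -
  let ?q = "\<lambda>h. B (\<lambda>x. f x - h x) (\<lambda>x. f x - h x)"
  define d where "d = Inf (?q ` E)"
  have qn: "0 \<le> ?q h" if "h \<in> E" for h using that E(1) f form_nonneg by blast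
  have bdd: "bdd_below (?q ` E)" using qn by (auto intro!: bdd_belowI[of _ 0])
  have d_le: "d \<le> ?q h" if "h \<in> E" for h unfolding d_def using bdd that by (auto intro: cInf_lower)
  have "\<exists>h\<in>E. ?q h < d + 1 / Suc n" for n
  proof -
    have "Inf (?q ` E) < d + 1 / Suc n" unfolding d_def by simp
    thus ?thesis using E(2) bdd by (subst (asm) cInf_less_iff) auto
  qed
  then obtain u where u: "\<And>n. u n \<in> E" "\<And>n. ?q (u n) < d + 1 / Suc n" by metis
  have uV: "u n \<in> V" for n using u E(1) by blast
  have "cauchy_seq u"
  proof (rule cauchy_seqI_square)
    fix e :: real assume "e > 0"
    then obtain K where K: "4 / real (Suc K) < e"
      using reals_Archimedean[of "e/4"] by (auto simp: field_simps)
    have "B (\<lambda>x. u m x - u n x) (\<lambda>x. u m x - u n x) < e" if "m \<ge> K" "n \<ge> K" for m n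
    proof -
      define w where "w = (\<lambda>x. (1/2) * (u m x + u n x))"
      \<comment> \<open>The midpoint \<open>w\<close> belongs to \<open>E\<close>, so its
        distance to \<open>f\<close> is no less than the infimum.\<close>
      have "w \<in> E" unfolding w_def using u E by blast
      hence wV: "w \<in> V" using E by blast
      have "B (\<lambda>x. (f x - u n x) + (f x - u m x)) (\<lambda>x. (f x - u n x) + (f x - u m x)) +
        B (\<lambda>x. (f x - u n x) - (f x - u m x)) (\<lambda>x. (f x - u n x) - (f x - u m x))
        = 2 * ?q (u n) + 2 * ?q (u m)"
        by (rule parallelogram) (use uV f in auto)
      moreover have "(\<lambda>x. (f x - u n x) - (f x - u m x)) = (\<lambda>x. u m x - u n x)" by auto
      moreover have "(\<lambda>x. (f x - u n x) + (f x - u m x)) = (\<lambda>x. 2 * (f x - w x))"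
        by (auto simp: w_def field_simps)
      moreover have "B (\<lambda>x. 2 * (f x - w x)) (\<lambda>x. 2 * (f x - w x)) = 4 * ?q w"
        using form_scale_square[of "\<lambda>x. f x - w x" 2] f wV by simp
      ultimately have "B (\<lambda>x. u m x - u n x) (\<lambda>x. u m x - u n x) = 2 * ?q (u n) + 2 * ?q (u m) - 4 * ?q w"
        by simp
      also have "\<dots> < 2 * (d + 1 / Suc n) + 2 * (d + 1 / Suc m) - 4 * d"
        using u(2)[of n] u(2)[of m] d_le[OF \<open>w \<in> E\<close>] by argo
      also have "\<dots> = 2 / Suc n + 2 / Suc m" by simp
      also have "\<dots> \<le> 2 / Suc K + 2 / Suc K" using that by (intro add_mono divide_left_mono) auto
      also have "\<dots> < e" using K by simp
      finally show ?thesis .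
    qed
    thus "\<exists>K. \<forall>m\<ge>K. \<forall>n\<ge>K. B (\<lambda>x. u m x - u n x) (\<lambda>x. u m x - u n x) < e" by blast
  qed (rule uV)
  then obtain h where h: "h \<in> E" "converges_to u h" using complete u by blast
  have hV: "h \<in> V" using h E by blast
  have "converges_to (\<lambda>n x. f x - u n x) (\<lambda>x. f x - h x)"
    using h(2) form_norm_commute[OF uV hV] by (simp add: converges_to_def)
  hence "(\<lambda>n. ?q (u n)) \<longlonglongrightarrow> ?q h"
    using converges_to_square[of "\<lambda>n x. f x - u n x" "\<lambda>x. f x - h x"] uV hV f by simp
  moreover have "(\<lambda>n. d + 1 / real (Suc n)) \<longlonglongrightarrow> d + 0"
    by (intro tendsto_add tendsto_const LIMSEQ_Suc[OF lim_1_over_n])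
  ultimately have "?q h \<le> d + 0"
    by (rule LIMSEQ_le) (use u(2) less_imp_le in blast)
  hence qh: "?q h \<le> d" by simp
  have "B (\<lambda>x. f x - h x) e = 0" if e: "e \<in> E" for e
  proof (rule form_minimal_imp_orthogonal)
    show "B (\<lambda>x. f x - h x) (\<lambda>x. f x - h x)
      \<le> B (\<lambda>x. f x - h x - t * e x) (\<lambda>x. f x - h x - t * e x)" for t
      using d_le[of "\<lambda>x. h x + t * e x"] qh E(3)[OF h(1) E(4)[OF e]] by (simp add: algebra_simps)
  qed (use f hV e E in auto)
  thus ?thesis using h by blast
qed

end

section \<open>The space of square-integrable functions\<close>

lemma L2_measurable [measurable_dest]: "f \<in> L2 N \<Longrightarrow> f \<in> borel_measurable N"
  by (simp add: L2_def)

lemma L2_integrable_square: "f \<in> L2 N \<Longrightarrow> integrable N (\<lambda>x. (f x)\<^sup>2)"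
  by (simp add: L2_def)

lemma L2_integrable_mult:
  assumes "f \<in> L2 N" "g \<in> L2 N"
  shows "integrable N (\<lambda>x. f x * g x)"
proof (rule Bochner_Integration.integrable_bound)
  show "integrable N (\<lambda>x. (f x)\<^sup>2 + (g x)\<^sup>2)"
    using assms by (simp add: L2_integrable_square)
  show "AE x in N. norm (f x * g x) \<le> norm ((f x)\<^sup>2 + (g x)\<^sup>2)"
  proof (rule AE_I2)
    fix x
    have "2 * \<bar>f x * g x\<bar> \<le> (f x)\<^sup>2 + (g x)\<^sup>2"
      using sum_squares_bound[of "\<bar>f x\<bar>" "\<bar>g x\<bar>"] by (simp add: abs_mult mult.assoc)
    thus "norm (f x * g x) \<le> norm ((f x)\<^sup>2 + (g x)\<^sup>2)"
      unfolding real_norm_def by linarith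
  qed
qed (use assms in measurable)

lemma L2_add: "f \<in> L2 N \<Longrightarrow> g \<in> L2 N \<Longrightarrow> (\<lambda>x. f x + g x) \<in> L2 N"
  using L2_integrable_mult[of f N g] by (auto simp: L2_def power2_sum mult.assoc)

interpretation L2: semi_inner "L2 N" "L2_inner N" for N
proof
  show "(\<lambda>x. 0) \<in> L2 N" by (simp add: L2_def)
  show "(\<lambda>x. f x + g x) \<in> L2 N" if "f \<in> L2 N" "g \<in> L2 N" for f g
    using that by (rule L2_add)
  show "(\<lambda>x. a * f x) \<in> L2 N" if "f \<in> L2 N" for f a
    using that by (auto simp: L2_def power_mult_distrib)
  show "L2_inner N (\<lambda>x. f x + g x) h = L2_inner N f h + L2_inner N g h"
    if "f \<in> L2 N" "g \<in> L2 N" "h \<in> L2 N" for f g h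
    using that by (simp add: L2_inner_def distrib_right L2_integrable_mult)
  show "L2_inner N (\<lambda>x. a * f x) h = a * L2_inner N f h" for f h a
    by (simp add: L2_inner_def mult.assoc)
  show "L2_inner N f g = L2_inner N g f" for f g
    by (simp add: L2_inner_def mult.commute)
  show "0 \<le> L2_inner N f f" for f
    by (simp add: L2_inner_def)
qed

lemma L2_norm_eq_form_norm: "L2_norm N = form_norm (L2_inner N)"
  by (simp add: fun_eq_iff L2_norm_def form_norm_def)

lemma L2_inner_commute: "L2_inner N f g = L2_inner N g f"
  by (simp add: L2_inner_def mult.commute)

lemma L2_cong_AE:
  assumes "f \<in> L2 N" "h \<in> borel_measurable N" "AE x in N. h x = f x"
  shows "h \<in> L2 N"
proof -
  have "integrable N (\<lambda>x. (h x)\<^sup>2) \<longleftrightarrow> integrable N (\<lambda>x. (f x)\<^sup>2)"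
    by (rule integrable_cong_AE) (use assms in \<open>auto dest: L2_measurable\<close>)
  thus ?thesis using assms by (simp add: L2_def)
qed

lemma L2_inner_cong_AE:
  assumes "f \<in> L2 N" "f' \<in> L2 N" "g \<in> L2 N" "g' \<in> L2 N"
    "AE x in N. f x = f' x" "AE x in N. g x = g' x"
  shows "L2_inner N f g = L2_inner N f' g'"
  unfolding L2_inner_def
  by (rule integral_cong_AE) (use assms in \<open>auto dest: L2_measurable\<close>)

lemma L2_norm_cong_AE:
  assumes "f \<in> L2 N" "f' \<in> L2 N" "AE x in N. f x = f' x"
  shows "L2_norm N f = L2_norm N f'"
  unfolding L2_norm_def using L2_inner_cong_AE[OF assms(1,2,1,2,3,3)] by simp

lemma L2_inner_self_eq_0_iff:
  assumes "f \<in> L2 N"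
  shows "L2_inner N f f = 0 \<longleftrightarrow> (AE x in N. f x = 0)"
  using integral_nonneg_eq_0_iff_AE[OF L2_integrable_square[OF assms]]
  by (simp add: L2_inner_def power2_eq_square)

lemma L2_norm_eq_0_iff: "f \<in> L2 N \<Longrightarrow> L2_norm N f = 0 \<longleftrightarrow> (AE x in N. f x = 0)"
  by (simp add: L2_norm_def L2_inner_self_eq_0_iff)

lemma nn_integral_square_eq_L2_inner:
  assumes "f \<in> L2 N"
  shows "(\<integral>\<^sup>+x. ennreal ((f x)\<^sup>2) \<partial>N) = ennreal (L2_inner N f f)"
  using nn_integral_eq_integral[OF L2_integrable_square[OF assms]]
  by (simp add: L2_inner_def power2_eq_square)

lemma L2_I_nn_integral:
  assumes "f \<in> borel_measurable N" "(\<integral>\<^sup>+x. ennreal ((f x)\<^sup>2) \<partial>N) < \<infinity>"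
  shows "f \<in> L2 N"
  using assms by (auto simp: L2_def intro!: integrableI_nonneg)

lemma L2_abs: "f \<in> L2 N \<Longrightarrow> (\<lambda>x. \<bar>f x\<bar>) \<in> L2 N"
  by (auto simp: L2_def)

lemma L2_norm_abs: "L2_norm N (\<lambda>x. \<bar>f x\<bar>) = L2_norm N f"
  by (simp add: L2_norm_def L2_inner_def)

text \<open>A subsequence with summable increments converges almost everywhere, because the sum of
  the absolute increments is square-integrable; Fatou's lemma identifies the pointwise limit
  as the limit in norm.\<close>

theorem L2_complete:
  assumes F: "\<And>n. F n \<in> L2 N" and cauchy: "L2.cauchy_seq N F"
  shows "\<exists>f\<in>L2 N. L2.converges_to N F f"
proof -
  note [measurable] = L2_measurable[OF F]
  have "\<exists>K. \<forall>m\<ge>K. \<forall>n\<ge>K. L2_norm N (\<lambda>x. F m x - F n x) < (1/2)^k" for k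
    using cauchy unfolding L2.cauchy_seq_def L2_norm_eq_form_norm by auto
  then obtain K where K: "\<And>k m n. m \<ge> K k \<Longrightarrow> n \<ge> K k \<Longrightarrow> L2_norm N (\<lambda>x. F m x - F n x) < (1/2)^k"
    by metis
  \<comment> \<open>The sum makes \<open>r\<close> monotone with \<open>K k \<le> r k\<close>,
    the summand \<open>k\<close> makes it unbounded.\<close>
  define r where "r k = (\<Sum>i\<le>k. K i) + k" for k
  have r_K: "K k \<le> r k" for k
    unfolding r_def by (rule trans_le_add1) (rule member_le_sum, auto)
  have r_mono: "r k \<le> r (Suc k)" for k by (simp add: r_def)
  define d where "d k x = \<bar>F (r (Suc k)) x - F (r k) x\<bar>" for k x
  define S where "S n x = (\<Sum>k<n. d k x)" for n x
  have d_L2: "d k \<in> L2 N" for k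
    unfolding d_def by (intro L2_abs L2.diff_in F)
  have d_meas [measurable]: "d k \<in> borel_measurable N" for k using d_L2 by (rule L2_measurable)
  have d_norm: "L2_norm N (d k) \<le> (1/2)^k" for k
  proof -
    have "L2_norm N (d k) = L2_norm N (\<lambda>x. F (r (Suc k)) x - F (r k) x)"
      unfolding d_def by (rule L2_norm_abs)
    also have "\<dots> < (1/2)^k"
      using r_K[of k] r_mono[of k] by (intro K) auto
    finally show ?thesis by simp
  qed
  have S_L2: "S n \<in> L2 N" for n unfolding S_def by (intro L2.sum_in d_L2)
  have S_norm: "L2_norm N (S n) \<le> 2" for n
  proof -
    have "L2_norm N (S n) \<le> (\<Sum>k<n. L2_norm N (d k))"
      unfolding S_def L2_norm_eq_form_norm by (intro L2.form_norm_sum d_L2)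
    also have "\<dots> \<le> (\<Sum>k<n. (1/2)^k)" by (intro sum_mono d_norm)
    also have "\<dots> \<le> (\<Sum>k. (1/2)^k)" by (intro sum_le_suminf) auto
    also have "\<dots> = (2::real)" by (simp add: suminf_geometric)
    finally show ?thesis .
  qed
  have S_mono: "S n x \<le> S (Suc n) x" and S_nonneg: "0 \<le> S n x" for n x
    by (auto simp: S_def d_def intro: sum_nonneg)
  have "incseq (\<lambda>n x. ennreal ((S n x)\<^sup>2))"
    using S_mono S_nonneg by (intro incseq_SucI le_funI ennreal_leI power_mono)
  hence "(\<integral>\<^sup>+x. (SUP n. ennreal ((S n x)\<^sup>2)) \<partial>N) = (SUP n. \<integral>\<^sup>+x. ennreal ((S n x)\<^sup>2) \<partial>N)"
    using L2_measurable[OF S_L2] by (intro nn_integral_monotone_convergence_SUP) auto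
  also have "\<dots> \<le> 4"
  proof (rule SUP_least)
    fix n
    have "L2_inner N (S n) (S n) = (L2_norm N (S n))\<^sup>2"
      using L2.form_norm_square[OF S_L2] by (simp add: L2_norm_eq_form_norm)
    also have "\<dots> \<le> 2\<^sup>2"
      using S_norm L2.form_norm_nonneg[OF S_L2] by (intro power_mono) (auto simp: L2_norm_eq_form_norm)
    finally show "(\<integral>\<^sup>+x. ennreal ((S n x)\<^sup>2) \<partial>N) \<le> 4"
      unfolding nn_integral_square_eq_L2_inner[OF S_L2]
      by (metis ennreal_leI ennreal_numeral numeral_power_eq_of_nat_cancel_iff of_nat_numeral
          power2_eq_square mult_2 numeral_Bit0 mult_numeral_1)
  qed
  finally have "(\<integral>\<^sup>+x. (SUP n. ennreal ((S n x)\<^sup>2)) \<partial>N) < \<infinity>"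
    by (rule order.strict_trans1) simp
  hence "AE x in N. (SUP n. ennreal ((S n x)\<^sup>2)) \<noteq> \<infinity>"
    using L2_measurable[OF S_L2] by (intro nn_integral_PInf_AE) auto
  hence AE_conv: "AE x in N. convergent (\<lambda>k. F (r k) x)"
  proof eventually_elim
    fix x assume fin: "(SUP n. ennreal ((S n x)\<^sup>2)) \<noteq> \<infinity>"
    define c where "c = enn2real (SUP n. ennreal ((S n x)\<^sup>2))"
    have c: "(SUP n. ennreal ((S n x)\<^sup>2)) = ennreal c"
      unfolding c_def by (rule ennreal_enn2real[symmetric]) (use fin in \<open>simp only: infinity_ennreal_def less_top\<close>)
    have c0: "0 \<le> c" by (simp add: c_def)
    have "ennreal ((S n x)\<^sup>2) \<le> ennreal c" for n
      unfolding c[symmetric] by (rule SUP_upper) simp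
    hence "(S n x)\<^sup>2 \<le> c" for n using c0 by simp
    hence le: "S n x \<le> sqrt c" for n using real_le_rsqrt by blast
    have "(\<Sum>k\<le>n. d k x) \<le> sqrt c" for n
      using le[of "Suc n"] by (simp only: S_def lessThan_Suc_atMost)
    hence "summable (\<lambda>k. d k x)"
      by (intro bounded_imp_summable[of _ "sqrt c"])
        (auto simp: d_def)
    hence "summable (\<lambda>k. F (r (Suc k)) x - F (r k) x)"
      unfolding d_def by (rule summable_rabs_cancel)
    hence "convergent (\<lambda>n. \<Sum>k<n. F (r (Suc k)) x - F (r k) x)"
      by (simp add: summable_iff_convergent)
    moreover have "(\<lambda>n. \<Sum>k<n. F (r (Suc k)) x - F (r k) x) = (\<lambda>n. F (r n) x - F (r 0) x)"
      by (rule ext) (rule sum_lessThan_telescope)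
    ultimately have "convergent (\<lambda>n. F (r n) x - F (r 0) x + F (r 0) x)"
      by (intro convergent_add convergent_const) simp
    thus "convergent (\<lambda>k. F (r k) x)" by simp
  qed
  define f where "f x = lim (\<lambda>k. F (r k) x)" for x
  have [measurable]: "f \<in> borel_measurable N"
    unfolding f_def by (rule borel_measurable_lim_metric) measurable
  \<comment> \<open>Comparing with a fixed \<open>F m\<close> before passing to the limit gives
    convergence of the whole sequence, and not only of the subsequence.\<close>
  have fatou: "(\<integral>\<^sup>+x. ennreal ((F m x - f x)\<^sup>2) \<partial>N) \<le> ennreal (e\<^sup>2)"
    if e: "e > 0" and M: "\<And>n. n \<ge> M \<Longrightarrow> L2_norm N (\<lambda>x. F m x - F n x) < e" for m e M
  proof -
    have "(\<integral>\<^sup>+x. ennreal ((F m x - f x)\<^sup>2) \<partial>N)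
        = (\<integral>\<^sup>+x. liminf (\<lambda>k. ennreal ((F m x - F (r k) x)\<^sup>2)) \<partial>N)"
    proof (rule nn_integral_cong_AE)
      show "AE x in N. ennreal ((F m x - f x)\<^sup>2) = liminf (\<lambda>k. ennreal ((F m x - F (r k) x)\<^sup>2))"
        using AE_conv
      proof eventually_elim
        fix x assume "convergent (\<lambda>k. F (r k) x)"
        hence "(\<lambda>k. F (r k) x) \<longlonglongrightarrow> f x" by (simp add: f_def convergent_LIMSEQ_iff)
        hence "(\<lambda>k. ennreal ((F m x - F (r k) x)\<^sup>2)) \<longlonglongrightarrow> ennreal ((F m x - f x)\<^sup>2)"
          by (intro tendsto_intros)
        thus "ennreal ((F m x - f x)\<^sup>2) = liminf (\<lambda>k. ennreal ((F m x - F (r k) x)\<^sup>2))"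
          by (intro lim_imp_Liminf[symmetric]) auto
      qed
    qed
    also have "\<dots> \<le> liminf (\<lambda>k. \<integral>\<^sup>+x. ennreal ((F m x - F (r k) x)\<^sup>2) \<partial>N)"
      by (rule nn_integral_liminf) measurable
    also have "\<dots> \<le> liminf (\<lambda>k::nat. ennreal (e\<^sup>2))"
    proof (rule Liminf_mono, unfold eventually_sequentially, intro exI allI impI)
      fix k assume "k \<ge> M"
      hence "r k \<ge> M" by (simp add: r_def)
      hence lt: "L2_norm N (\<lambda>x. F m x - F (r k) x) < e" by (rule M)
      have in2: "(\<lambda>x. F m x - F (r k) x) \<in> L2 N" by (intro L2.diff_in F)
      have "L2_inner N (\<lambda>x. F m x - F (r k) x) (\<lambda>x. F m x - F (r k) x)
          = (L2_norm N (\<lambda>x. F m x - F (r k) x))\<^sup>2"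
        using L2.form_norm_square[OF in2] by (simp add: L2_norm_eq_form_norm)
      also have "\<dots> \<le> e\<^sup>2"
        using lt L2.form_norm_nonneg[OF in2] by (intro power_mono) (auto simp: L2_norm_eq_form_norm)
      finally show "(\<integral>\<^sup>+x. ennreal ((F m x - F (r k) x)\<^sup>2) \<partial>N) \<le> ennreal (e\<^sup>2)"
        unfolding nn_integral_square_eq_L2_inner[OF in2] by (rule ennreal_leI)
    qed
    also have "\<dots> = ennreal (e\<^sup>2)" by (simp add: Liminf_const)
    finally show ?thesis .
  qed
  have tail: "\<exists>M. \<forall>m\<ge>M. \<forall>n\<ge>M. L2_norm N (\<lambda>x. F m x - F n x) < e" if "e > 0" for e
    using cauchy that unfolding L2.cauchy_seq_def L2_norm_eq_form_norm by blast
  have diff_L2: "(\<lambda>x. F m x - f x) \<in> L2 N \<and> L2_norm N (\<lambda>x. F m x - f x) \<le> e"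
    if "e > 0" and M: "\<And>n. n \<ge> M \<Longrightarrow> L2_norm N (\<lambda>x. F m x - F n x) < e" for m e M
  proof
    have le: "(\<integral>\<^sup>+x. ennreal ((F m x - f x)\<^sup>2) \<partial>N) \<le> ennreal (e\<^sup>2)"
      using fatou[of e M m] that by blast
    show in2: "(\<lambda>x. F m x - f x) \<in> L2 N"
      by (rule L2_I_nn_integral) (use le in \<open>auto intro: le_less_trans\<close>)
    have "L2_inner N (\<lambda>x. F m x - f x) (\<lambda>x. F m x - f x) \<le> e\<^sup>2"
      using le unfolding nn_integral_square_eq_L2_inner[OF in2] by simp
    thus "L2_norm N (\<lambda>x. F m x - f x) \<le> e"
      using \<open>e > 0\<close> unfolding L2_norm_def by (simp add: real_le_lsqrt)
  qed
  obtain M where "\<forall>m\<ge>M. \<forall>n\<ge>M. L2_norm N (\<lambda>x. F m x - F n x) < 1" using tail[of 1] by auto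
  hence "(\<lambda>x. F M x - f x) \<in> L2 N" using diff_L2[of 1 M M] by simp
  from L2.diff_in[OF F[of M] this] have f_L2: "f \<in> L2 N" by simp
  moreover have "L2.converges_to N F f"
    unfolding L2.converges_to_def
  proof (rule LIMSEQ_I)
    fix e :: real assume "e > 0"
    then obtain M where M: "\<forall>m\<ge>M. \<forall>n\<ge>M. L2_norm N (\<lambda>x. F m x - F n x) < e/2" using tail[of "e/2"] by auto
    have "norm (form_norm (L2_inner N) (\<lambda>x. F m x - f x) - 0) < e" if "m \<ge> M" for m
    proof -
      have "L2_norm N (\<lambda>x. F m x - f x) \<le> e / 2"
        using diff_L2[of "e/2" M m] M that \<open>e > 0\<close> by simp
      thus ?thesis using \<open>e > 0\<close> L2.form_norm_nonneg[OF L2.diff_in[OF F f_L2], of m]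
        by (simp add: L2_norm_eq_form_norm)
    qed
    thus "\<exists>M. \<forall>m\<ge>M. norm (form_norm (L2_inner N) (\<lambda>x. F m x - f x) - 0) < e" by blast
  qed
  ultimately show ?thesis by blast
qed

section \<open>A nonnegative form with compact resolvent\<close>

text \<open>An abstract nonnegative Laplacian: on a dense space \<open>X\<close> of test
  functions a symmetric operator \<open>S\<close> represents the energy \<open>D\<close> by
  Green's formula. The assumption \<open>X_compact\<close> is Rellich's compactness in
  quantitative form: up to a small multiple of the energy, the norm is controlled by finitely
  many linear functionals.\<close>

locale energy_form =
  fixes N :: "'m measure" and X :: "('m \<Rightarrow> real) set"
    and D :: "('m \<Rightarrow> real) \<Rightarrow> ('m \<Rightarrow> real) \<Rightarrow> real"
    and S :: "('m \<Rightarrow> real) \<Rightarrow> 'm \<Rightarrow> real"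
  assumes X_subset: "X \<subseteq> L2 N"
    and D_form: "semi_inner X D"
    and S_L2: "\<phi> \<in> X \<Longrightarrow> S \<phi> \<in> L2 N"
    and green: "u \<in> X \<Longrightarrow> \<phi> \<in> X \<Longrightarrow> D u \<phi> = L2_inner N u (S \<phi>)"
    and X_dense: "f \<in> L2 N \<Longrightarrow> e > 0 \<Longrightarrow> \<exists>\<phi>\<in>X. L2_norm N (\<lambda>x. f x - \<phi> x) < e"
    and X_compact: "e > 0 \<Longrightarrow> \<exists>(k::nat) l. (\<forall>i<k. l i \<in> L2 N) \<and>
      (\<forall>u\<in>X. L2_inner N u u \<le> e * D u u + (\<Sum>i<k. (L2_inner N u (l i))\<^sup>2))"

sublocale energy_form \<subseteq> D: semi_inner X D
  by (rule D_form)

context energy_form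
begin

lemma X_L2 [simp]: "u \<in> X \<Longrightarrow> u \<in> L2 N"
  using X_subset by blast

text \<open>The closure of the form \<open>D\<close>. Its domain consists of the limits in
  \<open>L\<^sup>2\<close> of sequences of test functions that are Cauchy for the energy; for the
  Laplacian this is the Sobolev space \<open>H\<^sup>1\<close>. By
  \<open>closed_form_limit\<close>, the value of \<open>closed_form\<close> does not depend on
  the sequences that are chosen.\<close>

definition approximates :: "(nat \<Rightarrow> 'm \<Rightarrow> real) \<Rightarrow> ('m \<Rightarrow> real) \<Rightarrow> bool" where
  "approximates u f \<longleftrightarrow> f \<in> L2 N \<and> (\<forall>n. u n \<in> X) \<and> L2.converges_to N u f \<and> D.cauchy_seq u"

definition form_domain :: "('m \<Rightarrow> real) set" where
  "form_domain = {f. \<exists>u. approximates u f}"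

definition closed_form :: "('m \<Rightarrow> real) \<Rightarrow> ('m \<Rightarrow> real) \<Rightarrow> real" where
  "closed_form f g = lim (\<lambda>n. D ((SOME u. approximates u f) n) ((SOME v. approximates v g) n))"

lemma approximatesD:
  assumes "approximates u f"
  shows "f \<in> L2 N" "u n \<in> X" "L2.converges_to N u f" "D.cauchy_seq u"
  using assms by (auto simp: approximates_def)

lemma form_domain_L2 [simp]: "f \<in> form_domain \<Longrightarrow> f \<in> L2 N"
  by (auto simp: form_domain_def approximates_def)

lemma approximates_const: "u \<in> X \<Longrightarrow> approximates (\<lambda>n. u) u"
  by (auto simp: approximates_def L2.converges_to_def D.cauchy_seq_def)

lemma X_form_domain [simp]: "u \<in> X \<Longrightarrow> u \<in> form_domain"
  using approximates_const by (auto simp: form_domain_def)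

lemma approximates_add:
  assumes "approximates u f" "approximates v g"
  shows "approximates (\<lambda>n x. u n x + v n x) (\<lambda>x. f x + g x)"
  using assms L2.converges_to_add[of u N f v g] D.cauchy_seq_add[of u v]
  by (auto simp: approximates_def)

lemma approximates_scale:
  assumes "approximates u f"
  shows "approximates (\<lambda>n x. a * u n x) (\<lambda>x. a * f x)"
  using assms L2.converges_to_scale[of u N f a] D.cauchy_seq_scale[of u a]
  by (auto simp: approximates_def)

lemma approximates_diff:
  assumes "approximates u f" "approximates v g"
  shows "approximates (\<lambda>n x. u n x - v n x) (\<lambda>x. f x - g x)"
  using approximates_add[OF assms(1) approximates_scale[OF assms(2), of "-1"]] by simp

text \<open>The form is closable because \<open>D w (w m)\<close> is the inner product of \<open>w\<close> with the fixed
  function \<open>S (w m)\<close>, hence continuous in \<open>w\<close> for the norm of \<open>L\<^sup>2\<close>.\<close>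

lemma closable:
  assumes "approximates w (\<lambda>x. 0)"
  shows "(\<lambda>n. form_norm D (w n)) \<longlonglongrightarrow> 0"
proof -
  note w = approximatesD[OF assms]
  obtain C where C: "C > 0" "\<And>n. form_norm D (w n) \<le> C"
    using D.cauchy_seq_bounded w by blast
  have "(\<lambda>n. D (w n) (w n)) \<longlonglongrightarrow> 0"
  proof (rule LIMSEQ_I)
    fix e :: real assume "e > 0"
    hence "e / (2 * C) > 0" using C by simp
    then obtain K where K: "\<And>m n. m \<ge> K \<Longrightarrow> n \<ge> K \<Longrightarrow> form_norm D (\<lambda>x. w m x - w n x) < e / (2 * C)"
      using w(4) unfolding D.cauchy_seq_def by blast
    have "(\<lambda>n. L2_inner N (w n) (S (w K))) \<longlonglongrightarrow> L2_inner N (\<lambda>x. 0) (S (w K))"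
      by (rule L2.converges_to_form) (use w S_L2 in auto)
    hence "(\<lambda>n. L2_inner N (w n) (S (w K))) \<longlonglongrightarrow> 0" by (simp add: L2_inner_def)
    from order_tendstoD(2)[OF this, of "e/2"] \<open>e > 0\<close>
    obtain M where M: "\<And>n. n \<ge> M \<Longrightarrow> L2_inner N (w n) (S (w K)) < e / 2"
      by (auto simp: eventually_sequentially)
    have "norm (D (w n) (w n) - 0) < e" if n: "n \<ge> max K M" for n
    proof -
      \<comment> \<open>In \<open>D (w n) (w n) = D (w n) (w n - w K) + D (w n) (w K)\<close> the
        first term is small by the Cauchy property, the second by Green's formula.\<close>
      have "D (w n) (\<lambda>x. w n x - w K x) \<le> form_norm D (w n) * form_norm D (\<lambda>x. w n x - w K x)"
        using D.abs_form_le[of "w n" "\<lambda>x. w n x - w K x"] w by (simp add: abs_le_iff)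
      also have "\<dots> \<le> C * form_norm D (\<lambda>x. w n x - w K x)"
        using C w by (intro mult_right_mono) auto
      also have "\<dots> \<le> C * (e / (2 * C))"
        using K[of n K] n C by (intro mult_left_mono) auto
      also have "\<dots> = e / 2" using C by simp
      finally have "D (w n) (w n) - D (w n) (w K) \<le> e / 2" using w by (simp add: D.form_diff_right)
      moreover have "D (w n) (w K) < e / 2" using M[of n] n green w by simp
      ultimately show ?thesis using D.form_nonneg[of "w n"] w by simp
    qed
    thus "\<exists>M. \<forall>n\<ge>M. norm (D (w n) (w n) - 0) < e" by blast
  qed
  hence "(\<lambda>n. sqrt (D (w n) (w n))) \<longlonglongrightarrow> sqrt 0" by (intro tendsto_real_sqrt)
  thus ?thesis by (simp add: form_norm_def)
qed

text \<open>Two sequences that approximate the same function differ by one that approximates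
  zero, and is therefore negligible for the energy by \<open>closable\<close>.\<close>

lemma closed_form_limit:
  assumes u: "approximates u f" and v: "approximates v g"
  shows "(\<lambda>n. D (u n) (v n)) \<longlonglongrightarrow> closed_form f g"
proof -
  define u' where "u' = (SOME u. approximates u f)"
  define v' where "v' = (SOME v. approximates v g)"
  have u': "approximates u' f" and v': "approximates v' g"
    unfolding u'_def v'_def
    by (rule someI[of "\<lambda>u. approximates u f", OF u], rule someI[of "\<lambda>v. approximates v g", OF v])
  have "(\<lambda>n. D (u' n) (v' n)) \<longlonglongrightarrow> closed_form f g"
    using D.cauchy_seq_form_convergent[of u' v'] approximatesD[OF u'] approximatesD[OF v']
    unfolding closed_form_def u'_def[symmetric] v'_def[symmetric] by (simp add: convergent_LIMSEQ_iff)
  moreover have "(\<lambda>n. form_norm D (\<lambda>x. u n x - u' n x)) \<longlonglongrightarrow> 0"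
    using closable[of "\<lambda>n x. u n x - u' n x"] approximates_diff[OF u u'] by simp
  moreover have "(\<lambda>n. form_norm D (\<lambda>x. v n x - v' n x)) \<longlonglongrightarrow> 0"
    using closable[of "\<lambda>n x. v n x - v' n x"] approximates_diff[OF v v'] by simp
  ultimately show ?thesis
    using D.form_limit_perturb[of u v u' v'] approximatesD[OF u] approximatesD[OF v]
      approximatesD[OF u'] approximatesD[OF v'] by blast
qed

lemma closed_form_X: "u \<in> X \<Longrightarrow> v \<in> X \<Longrightarrow> closed_form u v = D u v"
  using closed_form_limit[OF approximates_const approximates_const, of u v] LIMSEQ_unique tendsto_const
  by blast

lemma form_domainE:
  assumes "f \<in> form_domain"
  obtains u where "approximates u f"
  using assms by (auto simp: form_domain_def)

end

sublocale energy_form \<subseteq> C: semi_inner form_domain closed_form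
proof
  show "(\<lambda>x. 0) \<in> form_domain" by simp
  show "(\<lambda>x. f x + g x) \<in> form_domain" if "f \<in> form_domain" "g \<in> form_domain" for f g
    using that approximates_add unfolding form_domain_def by blast
  show "(\<lambda>x. a * f x) \<in> form_domain" if "f \<in> form_domain" for f a
    using that approximates_scale unfolding form_domain_def by blast
  show "closed_form (\<lambda>x. f x + g x) h = closed_form f h + closed_form g h"
    if fgh: "f \<in> form_domain" "g \<in> form_domain" "h \<in> form_domain" for f g h
  proof -
    obtain u v w where u: "approximates u f" and v: "approximates v g" and w: "approximates w h"
      using fgh form_domainE by metis
    have "(\<lambda>n. D (\<lambda>x. u n x + v n x) (w n)) \<longlonglongrightarrow> closed_form (\<lambda>x. f x + g x) h"
      using closed_form_limit[OF approximates_add[OF u v] w] .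
    moreover have "(\<lambda>n. D (\<lambda>x. u n x + v n x) (w n)) \<longlonglongrightarrow> closed_form f h + closed_form g h"
      using tendsto_add[OF closed_form_limit[OF u w] closed_form_limit[OF v w]]
        approximatesD(2)[OF u] approximatesD(2)[OF v] approximatesD(2)[OF w] by (simp add: D.form_add)
    ultimately show ?thesis using LIMSEQ_unique by blast
  qed
  show "closed_form (\<lambda>x. a * f x) h = a * closed_form f h"
    if fh: "f \<in> form_domain" "h \<in> form_domain" for f h a
  proof -
    obtain u w where u: "approximates u f" and w: "approximates w h"
      using fh form_domainE by metis
    have "(\<lambda>n. D (\<lambda>x. a * u n x) (w n)) \<longlonglongrightarrow> closed_form (\<lambda>x. a * f x) h"
      using closed_form_limit[OF approximates_scale[OF u] w] .
    moreover have "(\<lambda>n. D (\<lambda>x. a * u n x) (w n)) \<longlonglongrightarrow> a * closed_form f h"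
      using tendsto_mult_left[OF closed_form_limit[OF u w], of a]
        approximatesD(2)[OF u] approximatesD(2)[OF w] by (simp add: D.form_scale)
    ultimately show ?thesis using LIMSEQ_unique by blast
  qed
  show "closed_form f g = closed_form g f"
    if fg: "f \<in> form_domain" "g \<in> form_domain" for f g
  proof -
    obtain u w where u: "approximates u f" and w: "approximates w g"
      using fg form_domainE by metis
    have "(\<lambda>n. D (u n) (w n)) = (\<lambda>n. D (w n) (u n))"
      using D.form_sym approximatesD(2)[OF u] approximatesD(2)[OF w] by blast
    thus ?thesis
      using closed_form_limit[OF u w] closed_form_limit[OF w u] LIMSEQ_unique by metis
  qed
  show "0 \<le> closed_form f f" if "f \<in> form_domain" for f
  proof -
    obtain u where u: "approximates u f" using \<open>f \<in> form_domain\<close> form_domainE by metis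
    show ?thesis
      by (rule LIMSEQ_le_const[OF closed_form_limit[OF u u]])
        (use D.form_nonneg approximatesD(2)[OF u] in blast)
  qed
qed

context energy_form
begin

lemma approximates_converges:
  assumes u: "approximates u f"
  shows "C.converges_to u f"
  unfolding C.converges_to_def
proof (rule LIMSEQ_I)
  note ud = approximatesD[OF u]
  have f: "f \<in> form_domain" using u by (auto simp: form_domain_def)
  fix e :: real assume "e > 0"
  hence "(e/2)\<^sup>2 > 0" by simp
  then obtain K where K: "\<And>m n. m \<ge> K \<Longrightarrow> n \<ge> K \<Longrightarrow> D (\<lambda>x. u m x - u n x) (\<lambda>x. u m x - u n x) < (e/2)\<^sup>2"
    using D.cauchy_seqD_square[of u "(e/2)\<^sup>2"] ud by blast
  have "norm (form_norm closed_form (\<lambda>x. u n x - f x) - 0) < e" if n: "n \<ge> K" for n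
  proof -
    have a: "approximates (\<lambda>m x. u n x - u m x) (\<lambda>x. u n x - f x)"
      by (rule approximates_diff[OF approximates_const u]) (rule ud)
    have "closed_form (\<lambda>x. u n x - f x) (\<lambda>x. u n x - f x) \<le> (e/2)\<^sup>2"
      by (rule LIMSEQ_le_const2[OF closed_form_limit[OF a a]]) (use K n less_imp_le in blast)
    hence "form_norm closed_form (\<lambda>x. u n x - f x) \<le> e / 2"
      using \<open>e > 0\<close> unfolding form_norm_def by (intro real_le_lsqrt) auto
    thus ?thesis using \<open>e > 0\<close> C.form_norm_nonneg[of "\<lambda>x. u n x - f x"] f ud by simp
  qed
  thus "\<exists>K. \<forall>n\<ge>K. norm (form_norm closed_form (\<lambda>x. u n x - f x) - 0) < e" by blast
qed

lemma form_domain_near_X: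
  assumes "f \<in> form_domain" "e > 0"
  shows "\<exists>w\<in>X. L2_norm N (\<lambda>x. w x - f x) < e \<and> form_norm closed_form (\<lambda>x. w x - f x) < e"
proof -
  obtain u where u: "approximates u f" using assms form_domainE by blast
  have "\<forall>\<^sub>F n in sequentially. L2_norm N (\<lambda>x. u n x - f x) < e"
    using approximatesD(3)[OF u] \<open>e > 0\<close> unfolding L2.converges_to_def L2_norm_eq_form_norm
    by (rule order_tendstoD(2))
  moreover have "\<forall>\<^sub>F n in sequentially. form_norm closed_form (\<lambda>x. u n x - f x) < e"
    using approximates_converges[OF u] \<open>e > 0\<close> unfolding C.converges_to_def
    by (rule order_tendstoD(2))
  ultimately have "\<forall>\<^sub>F n in sequentially. L2_norm N (\<lambda>x. u n x - f x) < e \<and>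
      form_norm closed_form (\<lambda>x. u n x - f x) < e"
    by (rule eventually_conj)
  then obtain n where "L2_norm N (\<lambda>x. u n x - f x) < e \<and> form_norm closed_form (\<lambda>x. u n x - f x) < e"
    unfolding eventually_sequentially by blast
  thus ?thesis using approximatesD(2)[OF u] by blast
qed

text \<open>Replacing \<open>F n\<close> by a test function at distance less than \<open>1 / Suc
  n\<close>, both in \<open>L\<^sup>2\<close> and for the energy, gives a sequence that
  approximates the limit.\<close>

theorem closed_form_closed:
  assumes F: "\<And>n. F n \<in> form_domain" and cauchy: "C.cauchy_seq F"
    and f: "f \<in> L2 N" and lim: "L2.converges_to N F f"
  shows "f \<in> form_domain" "C.converges_to F f"
proof -
  have "\<exists>w\<in>X. L2_norm N (\<lambda>x. w x - F n x) < 1 / Suc n \<and>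
      form_norm closed_form (\<lambda>x. w x - F n x) < 1 / Suc n" for n
    using form_domain_near_X[OF F] by simp
  then obtain w where w: "\<And>n. w n \<in> X" "\<And>n. L2_norm N (\<lambda>x. w n x - F n x) < 1 / Suc n"
      "\<And>n. form_norm closed_form (\<lambda>x. w n x - F n x) < 1 / Suc n"
    by metis
  have inv: "(\<lambda>n. 1 / real (Suc n)) \<longlonglongrightarrow> 0" using LIMSEQ_Suc[OF lim_1_over_n] by simp
  have L: "(\<lambda>n. form_norm (L2_inner N) (\<lambda>x. w n x - F n x)) \<longlonglongrightarrow> 0"
  proof (rule tendsto_sandwich[OF _ _ tendsto_const inv])
    show "\<forall>\<^sub>F n in sequentially. form_norm (L2_inner N) (\<lambda>x. w n x - F n x) \<le> 1 / real (Suc n)"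
      using w(2) by (simp add: L2_norm_eq_form_norm less_imp_le)
  qed (use w F in auto)
  have E: "(\<lambda>n. form_norm closed_form (\<lambda>x. w n x - F n x)) \<longlonglongrightarrow> 0"
  proof (rule tendsto_sandwich[OF _ _ tendsto_const inv])
    show "\<forall>\<^sub>F n in sequentially. form_norm closed_form (\<lambda>x. w n x - F n x) \<le> 1 / real (Suc n)"
      using w(3) by (simp add: less_imp_le)
  qed (use w F in auto)
  have "L2.converges_to N w f"
    by (rule L2.converges_to_perturb[OF _ _ f lim L]) (use w F in auto)
  moreover have "C.cauchy_seq w"
    by (rule C.cauchy_seq_perturb[OF _ _ cauchy E]) (use w F in auto)
  hence "D.cauchy_seq w"
    unfolding D.cauchy_seq_def C.cauchy_seq_def using w(1)
    by (simp add: form_norm_def closed_form_X)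
  ultimately have a: "approximates w f" using w f by (simp add: approximates_def)
  show fd: "f \<in> form_domain" using a by (auto simp: form_domain_def)
  have E': "(\<lambda>n. form_norm closed_form (\<lambda>x. F n x - w n x)) \<longlonglongrightarrow> 0"
  proof -
    have "form_norm closed_form (\<lambda>x. F n x - w n x) = form_norm closed_form (\<lambda>x. w n x - F n x)" for n
      by (rule C.form_norm_commute) (use w F in auto)
    thus ?thesis using E by simp
  qed
  show "C.converges_to F f"
    by (rule C.converges_to_perturb[OF _ _ fd approximates_converges[OF a] E']) (use w F in auto)
qed

text \<open>Both sides of Green's formula pass to the limit along an approximating sequence.\<close>

lemma closed_form_test:
  assumes "f \<in> form_domain" "\<phi> \<in> X"
  shows "closed_form f \<phi> = L2_inner N f (S \<phi>)"
proof -
  obtain u where u: "approximates u f" using assms form_domainE by blast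
  have "(\<lambda>n. D (u n) \<phi>) \<longlonglongrightarrow> closed_form f \<phi>"
    by (rule closed_form_limit[OF u approximates_const]) (rule assms)
  moreover have "(\<lambda>n. L2_inner N (u n) (S \<phi>)) \<longlonglongrightarrow> L2_inner N f (S \<phi>)"
    by (rule L2.converges_to_form) (use approximatesD[OF u] S_L2 assms in auto)
  ultimately show ?thesis
    using green approximatesD(2)[OF u] assms LIMSEQ_unique by simp
qed

subsection \<open>Eigenspaces\<close>

text \<open>The eigenvalue equation in its weakest form, in which \<open>S\<close> is applied to
  test functions only. By \<open>eigensp_form\<close> it holds against the whole form domain.\<close>

definition eigensp :: "real \<Rightarrow> ('m \<Rightarrow> real) set" where
  "eigensp l = {f \<in> form_domain. \<forall>\<phi>\<in>X. L2_inner N f (S \<phi>) = l * L2_inner N f \<phi>}"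

lemma eigenspI':
  assumes "f \<in> form_domain" "\<And>\<phi>. \<phi> \<in> X \<Longrightarrow> L2_inner N f (S \<phi>) = l * L2_inner N f \<phi>"
  shows "f \<in> eigensp l"
  using assms by (auto simp: eigensp_def)

lemma eigenspD: "f \<in> eigensp l \<Longrightarrow> \<phi> \<in> X \<Longrightarrow> L2_inner N f (S \<phi>) = l * L2_inner N f \<phi>"
  by (auto simp: eigensp_def)

lemma eigensp_domain [simp]: "f \<in> eigensp l \<Longrightarrow> f \<in> form_domain"
  and eigensp_L2 [simp]: "f \<in> eigensp l \<Longrightarrow> f \<in> L2 N"
  by (auto simp: eigensp_def)

lemma eigensp_form:
  assumes f: "f \<in> eigensp l" and g: "g \<in> form_domain"
  shows "closed_form f g = l * L2_inner N f g"
proof -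
  obtain v where v: "approximates v g" using g form_domainE by blast
  note vd = approximatesD[OF v]
  have "(\<lambda>n. closed_form (v n) f) \<longlonglongrightarrow> closed_form g f"
    by (rule C.converges_to_form[OF _ g approximates_converges[OF v]]) (use f vd in auto)
  moreover have "(\<lambda>n. l * L2_inner N (v n) f) \<longlonglongrightarrow> l * L2_inner N g f"
    by (intro tendsto_mult tendsto_const L2.converges_to_form[OF _ _ vd(3)]) (use f g vd in auto)
  moreover have "closed_form (v n) f = l * L2_inner N (v n) f" for n
    using closed_form_test[of f "v n"] f vd C.form_sym[of f "v n"] L2_inner_commute[of N f "v n"]
    by (simp add: eigenspD)
  ultimately have "closed_form g f = l * L2_inner N g f"
    using LIMSEQ_unique by simp
  thus ?thesis using C.form_sym[of f g] f g L2_inner_commute[of N f g] by simp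
qed

lemma eigenspI:
  assumes "f \<in> form_domain" "\<And>\<phi>. \<phi> \<in> X \<Longrightarrow> closed_form f \<phi> = l * L2_inner N f \<phi>"
  shows "f \<in> eigensp l"
  using assms closed_form_test by (intro eigenspI') auto

lemma eigensp_zero: "(\<lambda>x. 0) \<in> eigensp l"
  by (rule eigenspI') (simp_all add: L2_inner_def)

lemma eigensp_add: "f \<in> eigensp l \<Longrightarrow> g \<in> eigensp l \<Longrightarrow> (\<lambda>x. f x + g x) \<in> eigensp l"
  by (rule eigenspI') (simp_all add: L2.form_add S_L2 distrib_left eigenspD)

lemma eigensp_scale: "f \<in> eigensp l \<Longrightarrow> (\<lambda>x. a * f x) \<in> eigensp l"
  by (rule eigenspI') (simp_all add: L2.form_scale S_L2 eigenspD)

lemma eigensp_diff: "f \<in> eigensp l \<Longrightarrow> g \<in> eigensp l \<Longrightarrow> (\<lambda>x. f x - g x) \<in> eigensp l"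
  using eigensp_add[OF _ eigensp_scale[of g l "-1"], of f] by simp

lemma eigensp_orthogonal:
  assumes "f \<in> eigensp l" "g \<in> eigensp k" "l \<noteq> k"
  shows "L2_inner N f g = 0"
proof -
  have "l * L2_inner N f g = closed_form f g" using assms by (simp add: eigensp_form)
  also have "\<dots> = closed_form g f" using assms by (intro C.form_sym) auto
  also have "\<dots> = k * L2_inner N f g"
    using assms by (simp add: eigensp_form L2_inner_commute[of N g f])
  finally show ?thesis using assms(3) by simp
qed

text \<open>On an eigenspace the energy is a multiple of the square of the norm. A Cauchy
  sequence in \<open>L\<^sup>2\<close> is therefore Cauchy for the energy, so that its limit
  stays in the form domain.\<close>

lemma eigensp_complete:
  assumes u: "\<And>n. u n \<in> eigensp l" and cauchy: "L2.cauchy_seq N u"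
  shows "\<exists>h\<in>eigensp l. L2.converges_to N u h"
proof -
  obtain f where f: "f \<in> L2 N" "L2.converges_to N u f"
    using L2_complete[of u N] eigensp_L2[OF u] cauchy by blast
  have "C.cauchy_seq u"
  proof (rule C.cauchy_seqI_square)
    fix e :: real assume "e > 0"
    hence "e / (\<bar>l\<bar> + 1) > 0" by simp
    then obtain K where K: "\<And>m n. m \<ge> K \<Longrightarrow> n \<ge> K \<Longrightarrow>
        L2_inner N (\<lambda>x. u m x - u n x) (\<lambda>x. u m x - u n x) < e / (\<bar>l\<bar> + 1)"
      using L2.cauchy_seqD_square[of u N "e / (\<bar>l\<bar> + 1)"] eigensp_L2[OF u] cauchy by blast
    have "closed_form (\<lambda>x. u m x - u n x) (\<lambda>x. u m x - u n x) < e" if "m \<ge> K" "n \<ge> K" for m n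
    proof -
      let ?w = "\<lambda>x. u m x - u n x"
      have w: "?w \<in> eigensp l" by (intro eigensp_diff u)
      have "closed_form ?w ?w = l * L2_inner N ?w ?w"
        using w by (intro eigensp_form) auto
      also have "\<dots> \<le> (\<bar>l\<bar> + 1) * L2_inner N ?w ?w"
        using L2.form_nonneg[of ?w N] w by (intro mult_right_mono) auto
      also have "\<dots> < e" using K[OF that] by (simp add: field_simps)
      finally show ?thesis .
    qed
    thus "\<exists>K. \<forall>m\<ge>K. \<forall>n\<ge>K. closed_form (\<lambda>x. u m x - u n x) (\<lambda>x. u m x - u n x) < e" by blast
  qed (rule eigensp_domain[OF u])
  hence fd: "f \<in> form_domain" using closed_form_closed(1)[of u f] f eigensp_domain[OF u] by blast
  have "L2_inner N f (S \<phi>) = l * L2_inner N f \<phi>" if "\<phi> \<in> X" for \<phi>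
  proof -
    have "(\<lambda>n. L2_inner N (u n) (S \<phi>)) \<longlonglongrightarrow> L2_inner N f (S \<phi>)"
      by (rule L2.converges_to_form) (use f eigensp_L2[OF u] S_L2 that in auto)
    moreover have "(\<lambda>n. l * L2_inner N (u n) \<phi>) \<longlonglongrightarrow> l * L2_inner N f \<phi>"
      by (intro tendsto_mult tendsto_const L2.converges_to_form) (use f eigensp_L2[OF u] that in auto)
    moreover have "L2_inner N (u n) (S \<phi>) = l * L2_inner N (u n) \<phi>" for n
      using u[of n] that by (rule eigenspD)
    ultimately show ?thesis using LIMSEQ_unique by simp
  qed
  hence "f \<in> eigensp l" using fd by (intro eigenspI')
  thus ?thesis using f by blast
qed

abbreviation proj :: "real \<Rightarrow> ('m \<Rightarrow> real) \<Rightarrow> 'm \<Rightarrow> real" where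
  "proj l \<equiv> orth_proj N (eigensp l)"

lemma proj_spec:
  assumes "f \<in> L2 N"
  shows "proj l f \<in> eigensp l" "e \<in> eigensp l \<Longrightarrow> L2_inner N (\<lambda>x. f x - proj l f x) e = 0"
proof -
  have "\<exists>h\<in>eigensp l. \<forall>e\<in>eigensp l. L2_inner N (\<lambda>x. f x - h x) e = 0"
    by (rule L2.orthogonal_projection_exists)
      (use assms eigensp_zero eigensp_add eigensp_scale eigensp_complete in auto)
  hence "\<exists>h. h \<in> eigensp l \<and> (\<forall>e\<in>eigensp l. L2_inner N (\<lambda>x. f x - h x) e = 0)" by blast
  from someI_ex[OF this]
  show "proj l f \<in> eigensp l" "e \<in> eigensp l \<Longrightarrow> L2_inner N (\<lambda>x. f x - proj l f x) e = 0"
    unfolding orth_proj_def by auto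
qed

lemma proj_eigensp [simp]: "f \<in> L2 N \<Longrightarrow> proj l f \<in> eigensp l"
  by (rule proj_spec)

lemma proj_L2 [simp]: "f \<in> L2 N \<Longrightarrow> proj l f \<in> L2 N"
  using proj_eigensp eigensp_L2 by blast

lemma proj_domain [simp]: "f \<in> L2 N \<Longrightarrow> proj l f \<in> form_domain"
  using proj_eigensp eigensp_domain by blast

lemma proj_inner:
  assumes "f \<in> L2 N" "e \<in> eigensp l"
  shows "L2_inner N (proj l f) e = L2_inner N f e"
  using proj_spec(2)[OF assms] assms by (simp add: L2.form_diff)

lemma proj_unique:
  assumes f: "f \<in> L2 N" and h: "h \<in> eigensp l" "\<And>e. e \<in> eigensp l \<Longrightarrow> L2_inner N h e = L2_inner N f e"
  shows "AE x in N. proj l f x = h x"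
proof -
  let ?d = "\<lambda>x. proj l f x - h x"
  have d: "?d \<in> eigensp l" using f h(1) by (intro eigensp_diff) simp_all
  have "L2_inner N ?d ?d = 0"
    using proj_inner[OF f d] h(2)[OF d] f eigensp_L2[OF h(1)] eigensp_L2[OF d] by (simp add: L2.form_diff)
  thus ?thesis using L2_inner_self_eq_0_iff[of ?d N] d by simp
qed

lemma proj_norm_unique:
  assumes f: "f \<in> L2 N" and h: "h \<in> eigensp l" "\<And>e. e \<in> eigensp l \<Longrightarrow> L2_inner N h e = L2_inner N f e"
  shows "L2_norm N (proj l f) = L2_norm N h"
  by (rule L2_norm_cong_AE) (use proj_unique[OF assms] f eigensp_L2[OF h(1)] in simp_all)

lemma proj_norm_le:
  assumes "f \<in> L2 N"
  shows "L2_norm N (proj l f) \<le> L2_norm N f"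
proof -
  have p: "proj l f \<in> L2 N" using assms by simp
  have "(L2_norm N (proj l f))\<^sup>2 = L2_inner N f (proj l f)"
    using proj_inner[OF assms proj_spec(1)[OF assms]] L2.form_norm_square[OF p] assms
    by (simp add: L2_norm_eq_form_norm)
  also have "\<dots> \<le> L2_norm N f * L2_norm N (proj l f)"
    using L2.abs_form_le[OF assms p] by (simp add: L2_norm_eq_form_norm)
  finally have *: "L2_norm N (proj l f) * L2_norm N (proj l f) \<le> L2_norm N f * L2_norm N (proj l f)"
    by (simp add: power2_eq_square)
  show ?thesis
  proof (cases "L2_norm N (proj l f) = 0")
    case True
    thus ?thesis using L2.form_norm_nonneg[OF assms] by (simp add: L2_norm_eq_form_norm)
  next
    case False
    hence "L2_norm N (proj l f) > 0"
      using L2.form_norm_nonneg[OF p] by (simp add: L2_norm_eq_form_norm less_le)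
    thus ?thesis using * by simp
  qed
qed

subsection \<open>Compactness\<close>

text \<open>All terms of \<open>X_compact\<close> pass to the limit along an approximating
  sequence.\<close>

lemma form_domain_compact:
  assumes "e > 0"
  shows "\<exists>(k::nat) l. (\<forall>i<k. l i \<in> L2 N) \<and>
      (\<forall>f\<in>form_domain. L2_inner N f f \<le> e * closed_form f f + (\<Sum>i<k. (L2_inner N f (l i))\<^sup>2))"
proof -
  obtain k :: nat and l where l: "\<And>i. i < k \<Longrightarrow> l i \<in> L2 N"
    and le: "\<And>u. u \<in> X \<Longrightarrow> L2_inner N u u \<le> e * D u u + (\<Sum>i<k. (L2_inner N u (l i))\<^sup>2)"
    using X_compact[OF assms] by metis
  have "L2_inner N f f \<le> e * closed_form f f + (\<Sum>i<k. (L2_inner N f (l i))\<^sup>2)"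
    if "f \<in> form_domain" for f
  proof -
    obtain u where u: "approximates u f" using \<open>f \<in> form_domain\<close> form_domainE by blast
    note ud = approximatesD[OF u]
    show ?thesis
    proof (rule LIMSEQ_le)
      show "(\<lambda>n. L2_inner N (u n) (u n)) \<longlonglongrightarrow> L2_inner N f f"
        by (rule L2.converges_to_square) (use ud in auto)
      show "(\<lambda>n. e * D (u n) (u n) + (\<Sum>i<k. (L2_inner N (u n) (l i))\<^sup>2)) \<longlonglongrightarrow>
          e * closed_form f f + (\<Sum>i<k. (L2_inner N f (l i))\<^sup>2)"
      proof (intro tendsto_add tendsto_mult tendsto_const closed_form_limit[OF u u] tendsto_sum tendsto_power)
        fix i assume "i \<in> {..<k}"
        thus "(\<lambda>n. L2_inner N (u n) (l i)) \<longlonglongrightarrow> L2_inner N f (l i)"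
          using l ud(3) X_L2[OF ud(2)] ud(1) by (intro L2.converges_to_form) (assumption | simp)+
      qed
      show "\<exists>n0. \<forall>n\<ge>n0. L2_inner N (u n) (u n) \<le> e * D (u n) (u n) + (\<Sum>i<k. (L2_inner N (u n) (l i))\<^sup>2)"
        using le ud by blast
    qed
  qed
  thus ?thesis using l by blast
qed

text \<open>Rellich's theorem. Along a diagonal subsequence the countably many functionals that
  belong to the errors \<open>1 / Suc j\<close> all converge. Two late members of it have a
  difference whose energy is bounded, and on which the functionals of any one error are small;
  hence the difference is small in \<open>L\<^sup>2\<close>.\<close>

theorem energy_bounded_subsequence:
  assumes u: "\<And>n. u n \<in> form_domain" and B: "\<And>n. closed_form (u n) (u n) \<le> B" "\<And>n. L2_norm N (u n) \<le> B"
  shows "\<exists>r. strict_mono (r :: nat \<Rightarrow> nat) \<and> L2.cauchy_seq N (\<lambda>n. u (r n))"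
proof -
  have "\<exists>(k::nat) l. (\<forall>i<k. l i \<in> L2 N) \<and>
      (\<forall>f\<in>form_domain. L2_inner N f f \<le> (1 / real (Suc j)) * closed_form f f + (\<Sum>i<k. (L2_inner N f (l i))\<^sup>2))" for j
    by (rule form_domain_compact) simp
  then obtain k :: "nat \<Rightarrow> nat" and l where l: "\<And>j i. i < k j \<Longrightarrow> l j i \<in> L2 N"
    and le: "\<And>j f. f \<in> form_domain \<Longrightarrow>
      L2_inner N f f \<le> (1 / real (Suc j)) * closed_form f f + (\<Sum>i<k j. (L2_inner N f (l j i))\<^sup>2)"
    by metis
  \<comment> \<open>All functionals in one sequence; the zero function fills the unused indices.\<close>
  define L where "L n = (case prod_decode n of (j, i) \<Rightarrow> if i < k j then l j i else (\<lambda>x. 0))" for n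
  have L_L2: "L n \<in> L2 N" for n using l by (auto simp: L_def split: prod.split)
  interpret subseqs "\<lambda>n s. convergent (\<lambda>m. L2_inner N (u (s m)) (L n))"
  proof
    fix n :: nat and s :: "nat \<Rightarrow> nat" assume "strict_mono s"
    have "norm (L2_inner N (u (s m)) (L n)) \<le> B * L2_norm N (L n)" for m
    proof -
      have "\<bar>L2_inner N (u (s m)) (L n)\<bar> \<le> L2_norm N (u (s m)) * L2_norm N (L n)"
        using L2.abs_form_le[of "u (s m)" N "L n"] u L_L2 by (simp add: L2_norm_eq_form_norm)
      also have "\<dots> \<le> B * L2_norm N (L n)"
        using B(2) L2.form_norm_nonneg[OF L_L2] by (intro mult_right_mono) (auto simp: L2_norm_eq_form_norm)
      finally show ?thesis by simp
    qed
    hence "bounded (range (\<lambda>m. L2_inner N (u (s m)) (L n)))" by (intro boundedI) auto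
    then obtain c r' where "strict_mono r'" "((\<lambda>m. L2_inner N (u (s m)) (L n)) \<circ> r') \<longlonglongrightarrow> c"
      using bounded_imp_convergent_subsequence by blast
    thus "\<exists>r'. strict_mono r' \<and> convergent (\<lambda>m. L2_inner N (u ((s \<circ> r') m)) (L n))"
      unfolding convergent_def by (auto simp: o_def)
  qed
  have conv: "convergent (\<lambda>m. L2_inner N (u (diagseq m)) (L n))" for n
  proof -
    have "convergent (\<lambda>m. L2_inner N (u ((diagseq \<circ> ((+) (Suc n))) m)) (L n))"
    proof (rule diagseq_holds)
      fix r s :: "nat \<Rightarrow> nat" and n :: nat
      assume "strict_mono r" "convergent (\<lambda>m. L2_inner N (u (s m)) (L n))"
      from convergent_subseq_convergent[OF this(2,1)]
      show "convergent (\<lambda>m. L2_inner N (u ((s \<circ> r) m)) (L n))" by (simp add: o_def)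
    qed
    hence "convergent (\<lambda>m. L2_inner N (u (diagseq (m + Suc n))) (L n))" by (simp add: o_def add.commute)
    thus ?thesis by (subst (asm) convergent_ignore_initial_segment)
  qed
  define v where "v n = u (diagseq n)" for n
  have v: "v n \<in> form_domain" for n using u by (simp add: v_def)
  have B0: "0 \<le> B" using B(1)[of 0] C.form_nonneg[OF u[of 0]] by simp
  have "L2.cauchy_seq N v"
  proof (rule L2.cauchy_seqI_square)
    fix e :: real assume "e > 0"
    \<comment> \<open>A difference has energy at most \<open>4 * B\<close>, which at the error
      \<open>1 / Suc j\<close> contributes at most \<open>e / 2\<close>.\<close>
    obtain j where j: "8 * B / e < real (Suc j)" using reals_Archimedean2 less_Suc_eq
      by (metis of_nat_less_iff order_less_trans)
    have "\<exists>K. \<forall>m\<ge>K. \<forall>n\<ge>K. (\<Sum>i<k j. (L2_inner N (v m) (l j i) - L2_inner N (v n) (l j i))\<^sup>2) < e / 2"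
    proof -
      define d where "d = e / (2 * (real (k j) + 1))"
      have "d > 0" using \<open>e > 0\<close> by (simp add: d_def)
      have "\<exists>K. \<forall>m\<ge>K. \<forall>n\<ge>K. (L2_inner N (v m) (l j i) - L2_inner N (v n) (l j i))\<^sup>2 < d" if "i < k j" for i
      proof -
        have "Cauchy (\<lambda>m. L2_inner N (v m) (l j i))"
          using conv[of "prod_encode (j, i)"] that by (simp add: L_def v_def Cauchy_convergent_iff)
        from metric_CauchyD[OF this, of "sqrt d"] \<open>d > 0\<close>
        obtain K where K: "\<forall>m\<ge>K. \<forall>n\<ge>K. \<bar>L2_inner N (v m) (l j i) - L2_inner N (v n) (l j i)\<bar> < sqrt d"
          by (auto simp: dist_real_def)
        have "(L2_inner N (v m) (l j i) - L2_inner N (v n) (l j i))\<^sup>2 < d" if "m \<ge> K" "n \<ge> K" for m n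
        proof -
          have "\<bar>L2_inner N (v m) (l j i) - L2_inner N (v n) (l j i)\<bar>\<^sup>2 < (sqrt d)\<^sup>2"
            using K that by (intro power_strict_mono) auto
          thus ?thesis using \<open>d > 0\<close> by simp
        qed
        thus ?thesis by blast
      qed
      then obtain K where K: "\<And>i m n. i < k j \<Longrightarrow> m \<ge> K i \<Longrightarrow> n \<ge> K i \<Longrightarrow>
          (L2_inner N (v m) (l j i) - L2_inner N (v n) (l j i))\<^sup>2 < d" by metis
      have "(\<Sum>i<k j. (L2_inner N (v m) (l j i) - L2_inner N (v n) (l j i))\<^sup>2) < e / 2"
        if mn: "m \<ge> (\<Sum>i<k j. K i)" "n \<ge> (\<Sum>i<k j. K i)" for m n
      proof -
        have "(\<Sum>i<k j. (L2_inner N (v m) (l j i) - L2_inner N (v n) (l j i))\<^sup>2) \<le> (\<Sum>i<k j. d)"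
        proof (rule sum_mono)
          fix i assume i: "i \<in> {..<k j}"
          have "K i \<le> (\<Sum>i<k j. K i)" using i by (intro member_le_sum) auto
          thus "(L2_inner N (v m) (l j i) - L2_inner N (v n) (l j i))\<^sup>2 \<le> d"
            using K[of i m n] i mn by simp
        qed
        also have "\<dots> < (real (k j) + 1) * d" using \<open>d > 0\<close> by simp
        also have "\<dots> = e / 2" by (simp add: d_def field_simps)
        finally show ?thesis .
      qed
      thus ?thesis by blast
    qed
    then obtain K where K: "\<And>m n. m \<ge> K \<Longrightarrow> n \<ge> K \<Longrightarrow>
        (\<Sum>i<k j. (L2_inner N (v m) (l j i) - L2_inner N (v n) (l j i))\<^sup>2) < e / 2" by blast
    have "L2_inner N (\<lambda>x. v m x - v n x) (\<lambda>x. v m x - v n x) < e" if mn: "m \<ge> K" "n \<ge> K" for m n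
    proof -
      let ?w = "\<lambda>x. v m x - v n x"
      have "closed_form ?w ?w \<le> 2 * closed_form (v m) (v m) + 2 * closed_form (v n) (v n)"
        using C.parallelogram[OF v[of m] v[of n]] C.form_nonneg[OF C.add_in[OF v[of m] v[of n]]] by simp
      also have "\<dots> \<le> 4 * B" using B(1)[of "diagseq m"] B(1)[of "diagseq n"] by (simp add: v_def)
      finally have "(1 / real (Suc j)) * closed_form ?w ?w \<le> (1 / real (Suc j)) * (4 * B)"
        by (intro mult_left_mono) auto
      also have "\<dots> \<le> e / 2" using j \<open>e > 0\<close> by (simp add: field_simps)
      finally have 1: "(1 / real (Suc j)) * closed_form ?w ?w \<le> e / 2" .
      have "L2_inner N ?w ?w \<le> (1 / real (Suc j)) * closed_form ?w ?w + (\<Sum>i<k j. (L2_inner N ?w (l j i))\<^sup>2)"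
        by (rule le) (use v in auto)
      also have "(\<Sum>i<k j. (L2_inner N ?w (l j i))\<^sup>2) = (\<Sum>i<k j. (L2_inner N (v m) (l j i) - L2_inner N (v n) (l j i))\<^sup>2)"
        by (intro sum.cong refl) (use v l in \<open>simp add: L2.form_diff\<close>)
      also have "(1 / real (Suc j)) * closed_form ?w ?w + \<dots> < e" using 1 K[OF mn] by linarith
      finally show ?thesis .
    qed
    thus "\<exists>K. \<forall>m\<ge>K. \<forall>n\<ge>K. L2_inner N (\<lambda>x. v m x - v n x) (\<lambda>x. v m x - v n x) < e" by blast
  qed (use v in auto)
  thus ?thesis using subseq_diagseq unfolding v_def by blast
qed

end

section \<open>Completeness of the eigenspaces\<close>

locale energy_spectrum = energy_form N X D S for N :: "'m measure" and X D S +
  fixes \<mu> :: "nat \<Rightarrow> real"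
  assumes \<mu>_mono: "strict_mono \<mu>"
    and \<mu>_range: "range \<mu> = {l. \<exists>f\<in>eigensp l. \<not> (AE x in N. f x = 0)}"
begin

definition partial_proj :: "nat \<Rightarrow> ('m \<Rightarrow> real) \<Rightarrow> 'm \<Rightarrow> real" where
  "partial_proj n f = (\<lambda>x. \<Sum>j<n. proj (\<mu> j) f x)"

definition tail_domain :: "nat \<Rightarrow> ('m \<Rightarrow> real) set" where
  "tail_domain n = {f \<in> form_domain. \<forall>j<n. \<forall>e\<in>eigensp (\<mu> j). L2_inner N f e = 0}"

lemma \<mu>_inj: "i \<noteq> j \<Longrightarrow> \<mu> i \<noteq> \<mu> j"
  using strict_mono_eq[OF \<mu>_mono] by blast

lemma partial_proj_L2 [simp]: "f \<in> L2 N \<Longrightarrow> partial_proj n f \<in> L2 N"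
  unfolding partial_proj_def by (intro L2.sum_in proj_L2)

lemma partial_proj_domain [simp]: "f \<in> L2 N \<Longrightarrow> partial_proj n f \<in> form_domain"
  unfolding partial_proj_def by (intro C.sum_in proj_domain)

lemma partial_proj_inner:
  assumes f: "f \<in> L2 N" and e: "e \<in> eigensp (\<mu> k)" and "k < n"
  shows "L2_inner N (partial_proj n f) e = L2_inner N f e"
proof -
  have "L2_inner N (partial_proj n f) e = (\<Sum>j<n. L2_inner N (proj (\<mu> j) f) e)"
    unfolding partial_proj_def using f eigensp_L2[OF e] by (intro L2.form_sum) simp_all
  also have "\<dots> = (\<Sum>j\<in>{k}. L2_inner N (proj (\<mu> j) f) e)"
    using assms \<mu>_inj by (intro sum.mono_neutral_right)
      (auto intro!: eigensp_orthogonal[OF proj_eigensp[OF f] e])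
  finally show ?thesis using proj_inner[OF f e] by simp
qed

lemma partial_proj_orthogonal:
  assumes f: "f \<in> L2 N" and e: "e \<in> eigensp (\<mu> k)" "k < n"
  shows "L2_inner N (\<lambda>x. f x - partial_proj n f x) e = 0"
  using partial_proj_inner[OF assms] f eigensp_L2[OF e(1)] by (simp add: L2.form_diff)

lemma partial_proj_tail:
  assumes "f \<in> form_domain"
  shows "(\<lambda>x. f x - partial_proj n f x) \<in> tail_domain n"
  using assms partial_proj_orthogonal[of f] by (simp add: tail_domain_def)

lemma tail_domainD:
  assumes "f \<in> tail_domain n"
  shows "f \<in> form_domain" "f \<in> L2 N" "j < n \<Longrightarrow> e \<in> eigensp (\<mu> j) \<Longrightarrow> L2_inner N f e = 0"
  using assms by (auto simp: tail_domain_def)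

lemma tail_domain_add: "f \<in> tail_domain n \<Longrightarrow> g \<in> tail_domain n \<Longrightarrow> (\<lambda>x. f x + g x) \<in> tail_domain n"
  by (simp add: tail_domain_def L2.form_add)

lemma tail_domain_scale: "f \<in> tail_domain n \<Longrightarrow> (\<lambda>x. a * f x) \<in> tail_domain n"
  by (simp add: tail_domain_def L2.form_scale)

text \<open>Against an eigenfunction the energy is a multiple of the inner product, so that
  orthogonality in \<open>L\<^sup>2\<close> entails orthogonality for the energy.\<close>

lemma tail_inner_partial_proj:
  assumes "h \<in> tail_domain n" "f \<in> L2 N"
  shows "L2_inner N h (partial_proj n f) = 0" "closed_form h (partial_proj n f) = 0"
proof -
  note h = tail_domainD[OF assms(1)]
  have "L2_inner N h (partial_proj n f) = (\<Sum>j<n. L2_inner N h (proj (\<mu> j) f))"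
    unfolding partial_proj_def using assms h by (intro L2.form_sum_right) simp_all
  also have "\<dots> = 0" using h(3) assms(2) by (intro sum.neutral) simp
  finally show "L2_inner N h (partial_proj n f) = 0" .
  have "closed_form h (partial_proj n f) = (\<Sum>j<n. closed_form h (proj (\<mu> j) f))"
    unfolding partial_proj_def using assms h by (intro C.form_sum_right) simp_all
  also have "\<dots> = 0"
  proof (intro sum.neutral ballI)
    fix j assume j: "j \<in> {..<n}"
    have "closed_form h (proj (\<mu> j) f) = closed_form (proj (\<mu> j) f) h"
      using assms h by (intro C.form_sym) simp_all
    also have "\<dots> = \<mu> j * L2_inner N (proj (\<mu> j) f) h"
      by (rule eigensp_form) (use assms h in simp_all)
    also have "\<dots> = 0" using h(3)[of j "proj (\<mu> j) f"] j assms(2) by (simp add: L2_inner_commute)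
    finally show "closed_form h (proj (\<mu> j) f) = 0" .
  qed
  finally show "closed_form h (partial_proj n f) = 0" .
qed

text \<open>If the Rayleigh quotient could drop below \<open>\<mu> n\<close> on the orthogonal complement of the first
  \<open>n\<close> eigenspaces, then its infimum there would be attained by compactness, and the minimizer
  would be an eigenfunction whose eigenvalue is below \<open>\<mu> n\<close> but is none of the first \<open>n\<close>.\<close>

theorem rayleigh_bound:
  assumes f: "f \<in> tail_domain n"
  shows "\<mu> n * L2_inner N f f \<le> closed_form f f"
proof (rule ccontr)
  assume neg: "\<not> ?thesis"
  define unit where "unit = {h \<in> tail_domain n. L2_inner N h h = 1}"
  define lam where "lam = Inf ((\<lambda>h. closed_form h h) ` unit)"
  have bdd: "bdd_below ((\<lambda>h. closed_form h h) ` unit)"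
    using C.form_nonneg tail_domainD(1) by (auto intro!: bdd_belowI[of _ 0] simp: unit_def)
  note fd = tail_domainD[OF f]
  have fpos: "L2_inner N f f > 0"
  proof (rule ccontr)
    assume "\<not> L2_inner N f f > 0"
    hence "L2_inner N f f = 0" using L2.form_nonneg[OF fd(2)] by simp
    thus False using neg C.form_nonneg[OF fd(1)] by simp
  qed
  have normalize: "(\<lambda>x. 1 / sqrt (L2_inner N h h) * h x) \<in> unit"
      "closed_form (\<lambda>x. 1 / sqrt (L2_inner N h h) * h x) (\<lambda>x. 1 / sqrt (L2_inner N h h) * h x)
        = closed_form h h / L2_inner N h h"
    if h: "h \<in> tail_domain n" "L2_inner N h h > 0" for h
    using tail_domain_scale[OF h(1), of "1 / sqrt (L2_inner N h h)"] h(2)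
      L2.form_scale_square[OF tail_domainD(2)[OF h(1)], of "1 / sqrt (L2_inner N h h)"]
      C.form_scale_square[OF tail_domainD(1)[OF h(1)], of "1 / sqrt (L2_inner N h h)"]
    by (simp_all add: unit_def power_divide)
  have lam_le: "lam * L2_inner N h h \<le> closed_form h h" if h: "h \<in> tail_domain n" for h
  proof (cases "L2_inner N h h > 0")
    case True
    have "lam \<le> closed_form h h / L2_inner N h h"
      unfolding lam_def normalize(2)[OF h True, symmetric]
      by (intro cInf_lower imageI normalize bdd h True)
    thus ?thesis using True by (simp add: field_simps)
  next
    case False
    hence "L2_inner N h h = 0" using L2.form_nonneg[OF tail_domainD(2)[OF h]] by simp
    thus ?thesis using C.form_nonneg[OF tail_domainD(1)[OF h]] by simp
  qed
  have unit_ne: "unit \<noteq> {}" using normalize(1)[OF f fpos] by blast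
  have lam0: "0 \<le> lam"
    unfolding lam_def using unit_ne C.form_nonneg tail_domainD(1)
    by (intro cInf_greatest) (auto simp: unit_def)
  have "closed_form f f < \<mu> n * L2_inner N f f" using neg by simp
  hence lam_less: "lam < \<mu> n"
    using lam_le[OF f] fpos by (metis mult_less_cancel_right_pos order_le_less_trans)
  have "\<exists>h\<in>unit. closed_form h h < lam + 1 / Suc k" for k
  proof -
    have "Inf ((\<lambda>h. closed_form h h) ` unit) < lam + 1 / Suc k" unfolding lam_def by simp
    thus ?thesis using unit_ne bdd by (subst (asm) cInf_less_iff) auto
  qed
  then obtain u where u: "\<And>k. u k \<in> unit" "\<And>k. closed_form (u k) (u k) < lam + 1 / Suc k" by metis
  have ut: "u k \<in> tail_domain n" and u1: "L2_inner N (u k) (u k) = 1" for k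
    using u(1) by (auto simp: unit_def)
  have ud: "u k \<in> form_domain" for k using tail_domainD(1)[OF ut] .
  have "closed_form (u k) (u k) \<le> lam + 1" for k
  proof -
    have "1 / real (Suc k) \<le> 1" by simp
    thus ?thesis using u(2)[of k] by linarith
  qed
  moreover have "L2_norm N (u k) \<le> lam + 1" for k using u1 lam0 by (simp add: L2_norm_def)
  ultimately obtain r where r: "strict_mono r" "L2.cauchy_seq N (\<lambda>k. u (r k))"
    using energy_bounded_subsequence[of u "lam + 1"] ud by blast
  define v where "v k = u (r k)" for k
  have vt: "v k \<in> tail_domain n" and v1: "L2_inner N (v k) (v k) = 1" for k
    using ut u1 by (auto simp: v_def)
  have vd: "v k \<in> form_domain" and vL: "v k \<in> L2 N" for k using tail_domainD[OF vt] by auto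
  have v_lt: "closed_form (v k) (v k) < lam + 1 / Suc k" for k
  proof -
    have "k \<le> r k" using r(1) by (rule seq_suble)
    hence "1 / real (Suc (r k)) \<le> 1 / real (Suc k)" by (intro divide_left_mono) auto
    thus ?thesis using u(2)[of "r k"] by (simp add: v_def)
  qed
  have v_cauchy: "L2.cauchy_seq N v" using r(2) unfolding v_def[abs_def] .
  obtain h where h: "h \<in> L2 N" "L2.converges_to N v h"
    using L2_complete[OF vL v_cauchy] by blast
  \<comment> \<open>The sum \<open>?s\<close> of two almost minimizers has energy at least
    \<open>lam\<close> times its squared norm; by the parallelogram law little energy remains for
    their difference \<open>?d\<close>.\<close>
  have Cv: "C.cauchy_seq v"
  proof (rule C.cauchy_seqI_square[OF vd])
    fix e :: real assume "e > 0"
    hence "e / (2 * (lam + 1)) > 0" using lam0 by simp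
    from L2.cauchy_seqD_square[OF vL v_cauchy this]
    obtain K where K: "\<And>p q. p \<ge> K \<Longrightarrow> q \<ge> K \<Longrightarrow>
        L2_inner N (\<lambda>x. v p x - v q x) (\<lambda>x. v p x - v q x) < e / (2 * (lam + 1))" by blast
    obtain M where M: "4 / real (Suc M) < e / 2"
      using reals_Archimedean[of "e/8"] \<open>e > 0\<close> by (auto simp: field_simps)
    have "closed_form (\<lambda>x. v p x - v q x) (\<lambda>x. v p x - v q x) < e" if pq: "p \<ge> max K M" "q \<ge> max K M" for p q
    proof -
      let ?d = "\<lambda>x. v p x - v q x" and ?s = "\<lambda>x. v p x + v q x"
      have Mp: "1 / real (Suc p) \<le> 1 / real (Suc M)" "1 / real (Suc q) \<le> 1 / real (Suc M)"
        using pq by (auto intro!: divide_left_mono)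
      have "L2_inner N ?s ?s + L2_inner N ?d ?d = 4"
        using L2.parallelogram[OF vL[of p] vL[of q]] v1 by simp
      hence "lam * (4 - L2_inner N ?d ?d) \<le> closed_form ?s ?s"
        using lam_le[OF tail_domain_add[OF vt[of p] vt[of q]]] by (metis add_diff_cancel_right')
      hence "closed_form ?d ?d \<le> 2 * closed_form (v p) (v p) + 2 * closed_form (v q) (v q)
          - lam * (4 - L2_inner N ?d ?d)"
        using C.parallelogram[OF vd[of p] vd[of q]] by simp
      also have "\<dots> \<le> 2 * (lam + 1 / Suc M) + 2 * (lam + 1 / Suc M) - lam * (4 - L2_inner N ?d ?d)"
        using order_trans[OF less_imp_le[OF v_lt[of p]] add_left_mono[OF Mp(1)]]
          order_trans[OF less_imp_le[OF v_lt[of q]] add_left_mono[OF Mp(2)]]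
        by (intro diff_right_mono add_mono mult_left_mono) auto
      also have "\<dots> = 4 / Suc M + lam * L2_inner N ?d ?d" by (simp add: algebra_simps)
      also have "\<dots> \<le> 4 / Suc M + (lam + 1) * L2_inner N ?d ?d"
        using L2.form_nonneg[OF L2.diff_in[OF vL[of p] vL[of q]]] by (simp add: algebra_simps)
      also have "(lam + 1) * L2_inner N ?d ?d < (lam + 1) * (e / (2 * (lam + 1)))"
        using K[of p q] pq lam0 by (intro mult_strict_left_mono) auto
      also have "\<dots> = e / 2"
      proof -
        have *: "c * (e / (2 * c)) = e / 2" if "c \<noteq> 0" for c :: real using that by simp
        show ?thesis by (rule *) (use lam0 in simp)
      qed
      finally show ?thesis using M by simp
    qed
    thus "\<exists>K. \<forall>p\<ge>K. \<forall>q\<ge>K. closed_form (\<lambda>x. v p x - v q x) (\<lambda>x. v p x - v q x) < e" by blast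
  qed
  note closed = closed_form_closed[OF vd Cv h]
  have h1: "L2_inner N h h = 1"
    using L2.converges_to_square[OF vL h] v1 by (simp add: LIMSEQ_const_iff)
  have ht: "h \<in> tail_domain n"
  proof -
    have "L2_inner N h e = 0" if "j < n" "e \<in> eigensp (\<mu> j)" for j e
      using L2.converges_to_form[OF vL h eigensp_L2[OF that(2)]] tail_domainD(3)[OF vt that]
      by (simp add: LIMSEQ_const_iff)
    thus ?thesis using closed by (simp add: tail_domain_def)
  qed
  have h_lam: "closed_form h h \<le> lam"
  proof (rule LIMSEQ_le[OF C.converges_to_square[OF vd closed]])
    show "(\<lambda>k. lam + 1 / real (Suc k)) \<longlonglongrightarrow> lam"
      using tendsto_add[OF tendsto_const LIMSEQ_Suc[OF lim_1_over_n], of lam] by simp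
    show "\<exists>K. \<forall>k\<ge>K. closed_form (v k) (v k) \<le> lam + 1 / real (Suc k)"
      using v_lt less_imp_le by blast
  qed
  \<comment> \<open>Subtracting \<open>lam\<close> times the inner product leaves a nonnegative
    form that vanishes at the minimizer \<open>h\<close>; by the Cauchy-Schwarz inequality
    \<open>h\<close> is then orthogonal to everything for this form. This is the eigenvalue
    equation against the tail; against the first eigenspaces both sides are zero.\<close>
  interpret Q: semi_inner "tail_domain n" "\<lambda>f g. closed_form f g - lam * L2_inner N f g"
  proof
    show "(\<lambda>x. 0) \<in> tail_domain n" by (simp add: tail_domain_def L2.form_zero)
    show "0 \<le> closed_form f f - lam * L2_inner N f f" if "f \<in> tail_domain n" for f
      using lam_le[OF that] by simp
    show "closed_form f g - lam * L2_inner N f g = closed_form g f - lam * L2_inner N g f"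
      if "f \<in> tail_domain n" "g \<in> tail_domain n" for f g
      using C.form_sym[of f g] that tail_domainD L2_inner_commute by metis
    show "closed_form (\<lambda>x. f x + g x) k - lam * L2_inner N (\<lambda>x. f x + g x) k =
       closed_form f k - lam * L2_inner N f k + (closed_form g k - lam * L2_inner N g k)"
      if "f \<in> tail_domain n" "g \<in> tail_domain n" "k \<in> tail_domain n" for f g k
      using tail_domainD(1,2)[OF that(1)] tail_domainD(1,2)[OF that(2)] tail_domainD(1,2)[OF that(3)]
      by (simp add: C.form_add L2.form_add algebra_simps)
    show "closed_form (\<lambda>x. a * f x) k - lam * L2_inner N (\<lambda>x. a * f x) k =
       a * (closed_form f k - lam * L2_inner N f k)"
      if "f \<in> tail_domain n" "k \<in> tail_domain n" for f k a
      using tail_domainD(1,2)[OF that(1)] tail_domainD(1,2)[OF that(2)]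
      by (simp add: C.form_scale L2.form_scale algebra_simps)
  qed (use tail_domain_add tail_domain_scale in blast)+
  have Q0: "closed_form h g = lam * L2_inner N h g" if g: "g \<in> tail_domain n" for g
  proof -
    have "closed_form h h - lam * L2_inner N h h = 0"
      using h_lam h1 Q.form_nonneg[OF ht] by simp
    hence "(closed_form h g - lam * L2_inner N h g)\<^sup>2 \<le> 0"
      using Q.Cauchy_Schwarz[OF ht g] by simp
    thus ?thesis by simp
  qed
  have "h \<in> eigensp lam"
  proof (rule eigenspI)
    show "h \<in> form_domain" using closed by simp
    fix \<phi> assume \<phi>: "\<phi> \<in> X"
    let ?t = "\<lambda>x. \<phi> x - partial_proj n \<phi> x"
    have "closed_form h ?t = lam * L2_inner N h ?t"
      by (intro Q0 partial_proj_tail) (use \<phi> in simp)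
    thus "closed_form h \<phi> = lam * L2_inner N h \<phi>"
      using tail_inner_partial_proj[OF ht, of \<phi>] \<phi> tail_domainD(1,2)[OF ht]
      by (simp add: C.form_diff_right L2.form_diff_right)
  qed
  moreover have "\<not> (AE x in N. h x = 0)" using h1 L2_inner_self_eq_0_iff[OF h(1)] by simp
  ultimately have "lam \<in> range \<mu>" unfolding \<mu>_range by blast
  then obtain j where j: "lam = \<mu> j" by blast
  hence "j < n" using lam_less strict_mono_less[OF \<mu>_mono] by simp
  hence "L2_inner N h h = 0" using tail_domainD(3)[OF ht] \<open>h \<in> eigensp lam\<close> j by simp
  thus False using h1 by simp
qed

lemma \<mu>_nonneg: "0 \<le> \<mu> j"
proof -
  have "\<mu> j \<in> range \<mu>" by blast
  then obtain f where f: "f \<in> eigensp (\<mu> j)" "\<not> (AE x in N. f x = 0)" unfolding \<mu>_range by blast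
  have "0 \<le> closed_form f f" using f by (intro C.form_nonneg) simp
  also have "\<dots> = \<mu> j * L2_inner N f f" using f by (simp add: eigensp_form)
  finally show ?thesis
    using f L2_inner_self_eq_0_iff[of f N] L2.form_nonneg[of f N] by (simp add: zero_le_mult_iff)
qed

text \<open>Orthonormal eigenfunctions are at mutual distance \<open>sqrt 2\<close>, so bounded eigenvalues would
  contradict compactness.\<close>

lemma \<mu>_unbounded: "\<exists>n. \<mu> n > B"
proof (rule ccontr)
  assume "\<not> ?thesis"
  hence B: "\<mu> n \<le> B" for n using not_less by blast
  have "\<exists>e\<in>eigensp (\<mu> j). L2_inner N e e = 1" for j
  proof -
    have "\<mu> j \<in> range \<mu>" by blast
    then obtain f where f: "f \<in> eigensp (\<mu> j)" "\<not> (AE x in N. f x = 0)" unfolding \<mu>_range by blast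
    hence pos: "L2_inner N f f > 0"
      using L2_inner_self_eq_0_iff[of f N] L2.form_nonneg[of f N] by (simp add: less_le)
    have "L2_inner N (\<lambda>x. 1 / sqrt (L2_inner N f f) * f x) (\<lambda>x. 1 / sqrt (L2_inner N f f) * f x) = 1"
      using L2.form_scale_square[OF eigensp_L2[OF f(1)], of "1 / sqrt (L2_inner N f f)"] pos
      by (simp add: power_divide)
    thus ?thesis using eigensp_scale[OF f(1)] by blast
  qed
  then obtain e where e: "\<And>j. e j \<in> eigensp (\<mu> j)" "\<And>j. L2_inner N (e j) (e j) = 1" by metis
  have ed: "e j \<in> form_domain" and eL: "e j \<in> L2 N" for j
    using eigensp_domain[OF e(1)] eigensp_L2[OF e(1)] by auto
  have "closed_form (e j) (e j) \<le> \<bar>B\<bar> + 1" for j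
    using eigensp_form[OF e(1) ed, of j j] e(2)[of j] B[of j] by simp
  moreover have "L2_norm N (e j) \<le> \<bar>B\<bar> + 1" for j using e(2) by (simp add: L2_norm_def)
  ultimately obtain r where r: "strict_mono r" "L2.cauchy_seq N (\<lambda>k. e (r k))"
    using energy_bounded_subsequence[of e "\<bar>B\<bar> + 1"] ed by blast
  from L2.cauchy_seqD_square[OF eL r(2), of 1]
  obtain K where K: "\<And>m n. m \<ge> K \<Longrightarrow> n \<ge> K \<Longrightarrow>
      L2_inner N (\<lambda>x. e (r m) x - e (r n) x) (\<lambda>x. e (r m) x - e (r n) x) < 1" by auto
  have "r K \<noteq> r (Suc K)" using strict_mono_eq[OF r(1)] by simp
  hence "L2_inner N (e (r K)) (e (r (Suc K))) = 0"
    by (intro eigensp_orthogonal[OF e(1) e(1)] \<mu>_inj)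
  hence "L2_inner N (\<lambda>x. e (r K) x - e (r (Suc K)) x) (\<lambda>x. e (r K) x - e (r (Suc K)) x) = 2"
    using eL e(2) by (simp add: L2.form_square_diff)
  thus False using K[of K "Suc K"] by simp
qed

lemma partial_proj_contraction:
  assumes f: "f \<in> L2 N"
  shows "L2_norm N (\<lambda>x. f x - partial_proj n f x) \<le> L2_norm N f"
proof -
  let ?t = "\<lambda>x. f x - partial_proj n f x" and ?p = "partial_proj n f"
  have tp: "L2_inner N ?t ?p = 0"
  proof -
    have "L2_inner N ?t ?p = (\<Sum>j<n. L2_inner N ?t (proj (\<mu> j) f))"
      unfolding partial_proj_def[of n f]
      using f partial_proj_L2[OF f, of n] unfolding partial_proj_def by (intro L2.form_sum_right) simp_all
    also have "\<dots> = 0" by (intro sum.neutral ballI partial_proj_orthogonal[OF f]) (use f in auto)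
    finally show ?thesis .
  qed
  have "L2_inner N (\<lambda>x. ?t x + ?p x) (\<lambda>x. ?t x + ?p x) = L2_inner N ?t ?t + L2_inner N ?p ?p"
    using f tp by (subst L2.form_square_add) simp_all
  hence "L2_inner N f f = L2_inner N ?t ?t + L2_inner N ?p ?p" by simp
  hence "L2_inner N ?t ?t \<le> L2_inner N f f"
    using L2.form_nonneg[OF partial_proj_L2[OF f]] by simp
  thus ?thesis by (simp add: L2_norm_def)
qed

text \<open>The remainder of \<open>\<phi>\<close> is orthogonal to the partial sum for the
  energy too. Its energy is therefore at most that of \<open>\<phi>\<close>, and at least
  \<open>\<mu> n\<close> times its squared norm by \<open>rayleigh_bound\<close>.\<close>

lemma partial_proj_error_X:
  assumes \<phi>: "\<phi> \<in> X"
  shows "\<mu> n * (L2_norm N (\<lambda>x. \<phi> x - partial_proj n \<phi> x))\<^sup>2 \<le> D \<phi> \<phi>"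
proof -
  let ?t = "\<lambda>x. \<phi> x - partial_proj n \<phi> x" and ?p = "partial_proj n \<phi>"
  have L: "\<phi> \<in> L2 N" and d: "\<phi> \<in> form_domain" using \<phi> by auto
  have t: "?t \<in> tail_domain n" using d by (rule partial_proj_tail)
  have "closed_form (\<lambda>x. ?t x + ?p x) (\<lambda>x. ?t x + ?p x) = closed_form ?t ?t + closed_form ?p ?p"
    using tail_inner_partial_proj(2)[OF t L] tail_domainD(1)[OF t] L
    by (subst C.form_square_add) simp_all
  hence "closed_form ?t ?t \<le> D \<phi> \<phi>"
    using C.form_nonneg[OF partial_proj_domain[OF L], of n] \<phi> by (simp add: closed_form_X)
  moreover have "(L2_norm N ?t)\<^sup>2 = L2_inner N ?t ?t"
    using L2.form_norm_square[OF tail_domainD(2)[OF t]] by (simp add: L2_norm_eq_form_norm)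
  ultimately show ?thesis using rayleigh_bound[OF t] by simp
qed

text \<open>Completeness of the eigenspaces. For a test function the remainder tends to zero
  because \<open>\<mu> n\<close> tends to infinity; passing to the remainder does not increase
  norms, so density of the test functions gives the general case.\<close>

theorem partial_proj_converges:
  assumes f: "f \<in> L2 N"
  shows "(\<lambda>n. L2_norm N (\<lambda>x. f x - partial_proj n f x)) \<longlonglongrightarrow> 0"
proof (rule LIMSEQ_I)
  fix e :: real assume "e > 0"
  then obtain \<phi> where \<phi>: "\<phi> \<in> X" "L2_norm N (\<lambda>x. f x - \<phi> x) < e / 2"
    using X_dense[OF f, of "e/2"] by auto
  have L: "\<phi> \<in> L2 N" using \<phi> by simp
  have D0: "0 \<le> D \<phi> \<phi>" using \<phi> by (simp add: D.form_nonneg)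
  obtain M where M: "\<mu> M > (D \<phi> \<phi> + 1) / (e/2)\<^sup>2" using \<mu>_unbounded by blast
  have "norm (L2_norm N (\<lambda>x. f x - partial_proj n f x) - 0) < e" if n: "n \<ge> M" for n
  proof -
    define c where "c = L2_norm N (\<lambda>x. \<phi> x - partial_proj n \<phi> x)"
    have "\<mu> n \<ge> \<mu> M" using n \<mu>_mono by (simp add: strict_mono_less_eq)
    hence "\<mu> n > (D \<phi> \<phi> + 1) / (e/2)\<^sup>2" using M by simp
    hence *: "\<mu> n * (e/2)\<^sup>2 > D \<phi> \<phi> + 1" using \<open>e > 0\<close> by (simp add: field_simps)
    have "c < e / 2"
    proof (rule ccontr)
      assume "\<not> c < e / 2"
      hence "(e/2)\<^sup>2 \<le> c\<^sup>2" using \<open>e > 0\<close> by (intro power_mono) auto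
      hence "\<mu> n * (e/2)\<^sup>2 \<le> \<mu> n * c\<^sup>2" using \<mu>_nonneg by (intro mult_left_mono)
      also have "\<dots> \<le> D \<phi> \<phi>" unfolding c_def by (rule partial_proj_error_X[OF \<phi>(1)])
      finally show False using * by simp
    qed
    have P: "partial_proj n \<phi> \<in> L2 N" "partial_proj n f \<in> L2 N" using L f by simp_all
    define w where "w = (\<lambda>x. f x - \<phi> x)"
    have w: "w \<in> L2 N" unfolding w_def using f L by simp
    \<comment> \<open>A projection is determined only up to null sets, so it is linear only
      almost everywhere.\<close>
    have ae: "AE x in N. f x - partial_proj n f x = (w x - partial_proj n w x) + (\<phi> x - partial_proj n \<phi> x)"
    proof -
      have "AE x in N. \<forall>j<n. proj (\<mu> j) w x = proj (\<mu> j) f x - proj (\<mu> j) \<phi> x"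
      proof (subst AE_all_countable, intro allI)
        fix j
        have "AE x in N. proj (\<mu> j) w x = (\<lambda>x. proj (\<mu> j) f x - proj (\<mu> j) \<phi> x) x"
        proof (rule proj_unique[OF w])
          show "(\<lambda>x. proj (\<mu> j) f x - proj (\<mu> j) \<phi> x) \<in> eigensp (\<mu> j)"
            using f L by (intro eigensp_diff) simp_all
          fix g assume g: "g \<in> eigensp (\<mu> j)"
          show "L2_inner N (\<lambda>x. proj (\<mu> j) f x - proj (\<mu> j) \<phi> x) g = L2_inner N w g"
            unfolding w_def using f L eigensp_L2[OF g] proj_inner[OF f g] proj_inner[OF L g]
            by (simp add: L2.form_diff)
        qed
        thus "AE x in N. j < n \<longrightarrow> proj (\<mu> j) w x = proj (\<mu> j) f x - proj (\<mu> j) \<phi> x"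
          by eventually_elim simp
      qed
      thus ?thesis
      proof eventually_elim
        case (elim x)
        hence "partial_proj n w x = partial_proj n f x - partial_proj n \<phi> x"
          by (simp add: partial_proj_def sum_subtractf)
        thus ?case by (simp add: w_def)
      qed
    qed
    have "L2_norm N (\<lambda>x. f x - partial_proj n f x)
        = L2_norm N (\<lambda>x. (w x - partial_proj n w x) + (\<phi> x - partial_proj n \<phi> x))"
      by (rule L2_norm_cong_AE[OF _ _ ae]) (use f w L in simp_all)
    also have "\<dots> \<le> L2_norm N (\<lambda>x. w x - partial_proj n w x) + c"
      unfolding c_def L2_norm_eq_form_norm using w L by (intro L2.form_norm_triangle) simp_all
    also have "\<dots> \<le> L2_norm N w + c" using partial_proj_contraction[OF w] by simp
    also have "\<dots> < e" using \<phi>(2) \<open>c < e / 2\<close> by (simp add: w_def)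
    finally show ?thesis
      using L2.form_norm_nonneg[of "\<lambda>x. f x - partial_proj n f x" N] f P by (simp add: L2_norm_eq_form_norm)
  qed
  thus "\<exists>M. \<forall>n\<ge>M. norm (L2_norm N (\<lambda>x. f x - partial_proj n f x) - 0) < e" by blast
qed

end

section \<open>The weighted spectral norms\<close>

context energy_spectrum
begin

definition coeff_norm :: "nat \<Rightarrow> ('m \<Rightarrow> real) \<Rightarrow> real" where
  "coeff_norm j f = L2_norm N (proj (\<mu> j) f)"

definition weight :: "real \<Rightarrow> nat \<Rightarrow> real" where
  "weight s j = (1 + \<mu> j) powr (s / 2)"

definition spec_norm :: "real \<Rightarrow> ('m \<Rightarrow> real) \<Rightarrow> ennreal" where
  "spec_norm s f = (\<Sum>j. ennreal (weight s j * coeff_norm j f))"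

definition spec_space :: "real \<Rightarrow> ('m \<Rightarrow> real) set" where
  "spec_space s = {f \<in> L2 N. spec_norm s f < \<infinity>}"

definition spec_nrm :: "real \<Rightarrow> ('m \<Rightarrow> real) \<Rightarrow> real" where
  "spec_nrm s f = enn2real (spec_norm s f)"

lemma coeff_norm_nonneg [simp]: "0 \<le> coeff_norm j f"
  by (simp add: coeff_norm_def L2_norm_def L2_inner_def)

lemma weight_nonneg [simp]: "0 \<le> weight s j"
  by (simp add: weight_def)

lemma weight_mono: "s \<le> t \<Longrightarrow> weight s j \<le> weight t j"
  unfolding weight_def using \<mu>_nonneg[of j] by (intro powr_mono) auto

lemma weight_ge_1: "0 \<le> s \<Longrightarrow> 1 \<le> weight s j"
  using weight_mono[of 0 s j] \<mu>_nonneg[of j] by (simp add: weight_def)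

lemma coeff_norm_eqI:
  assumes "f \<in> L2 N" "h \<in> eigensp (\<mu> j)" "\<And>e. e \<in> eigensp (\<mu> j) \<Longrightarrow> L2_inner N h e = L2_inner N f e"
  shows "coeff_norm j f = L2_norm N h"
  unfolding coeff_norm_def by (rule proj_norm_unique[OF assms])

lemma coeff_norm_cong:
  assumes f: "f \<in> L2 N" "g \<in> L2 N"
    and eq: "\<And>e. e \<in> eigensp (\<mu> j) \<Longrightarrow> L2_inner N f e = L2_inner N g e"
  shows "coeff_norm j f = coeff_norm j g"
proof -
  have "coeff_norm j f = L2_norm N (proj (\<mu> j) g)"
  proof (rule coeff_norm_eqI[OF f(1)])
    show "proj (\<mu> j) g \<in> eigensp (\<mu> j)" using f by simp
    show "L2_inner N (proj (\<mu> j) g) e = L2_inner N f e" if "e \<in> eigensp (\<mu> j)" for e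
      using proj_inner[OF f(2) that] eq[OF that] by simp
  qed
  thus ?thesis by (simp add: coeff_norm_def)
qed

lemma coeff_norm_zero:
  assumes f: "f \<in> L2 N" and eq: "\<And>e. e \<in> eigensp (\<mu> j) \<Longrightarrow> L2_inner N f e = 0"
  shows "coeff_norm j f = 0"
proof -
  have "coeff_norm j f = L2_norm N (\<lambda>x. 0)"
    by (rule coeff_norm_eqI[OF f eigensp_zero]) (simp add: L2.form_zero eq)
  thus ?thesis by (simp add: L2_norm_def L2_inner_def)
qed

lemma coeff_norm_scale:
  assumes f: "f \<in> L2 N"
  shows "coeff_norm j (\<lambda>x. a * f x) = \<bar>a\<bar> * coeff_norm j f"
proof -
  have "coeff_norm j (\<lambda>x. a * f x) = L2_norm N (\<lambda>x. a * proj (\<mu> j) f x)"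
  proof (rule coeff_norm_eqI)
    show "(\<lambda>x. a * proj (\<mu> j) f x) \<in> eigensp (\<mu> j)" using f by (intro eigensp_scale) simp
    show "L2_inner N (\<lambda>x. a * proj (\<mu> j) f x) e = L2_inner N (\<lambda>x. a * f x) e"
      if "e \<in> eigensp (\<mu> j)" for e
      using f eigensp_L2[OF that] proj_inner[OF f that] by (simp add: L2.form_scale)
  qed (use f in simp)
  thus ?thesis using f by (simp add: coeff_norm_def L2_norm_eq_form_norm L2.form_norm_scale)
qed

lemma coeff_norm_triangle:
  assumes f: "f \<in> L2 N" and g: "g \<in> L2 N"
  shows "coeff_norm j (\<lambda>x. f x + g x) \<le> coeff_norm j f + coeff_norm j g"
proof -
  have "coeff_norm j (\<lambda>x. f x + g x) = L2_norm N (\<lambda>x. proj (\<mu> j) f x + proj (\<mu> j) g x)"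
  proof (rule coeff_norm_eqI)
    show "(\<lambda>x. proj (\<mu> j) f x + proj (\<mu> j) g x) \<in> eigensp (\<mu> j)" using f g by (intro eigensp_add) simp_all
    show "L2_inner N (\<lambda>x. proj (\<mu> j) f x + proj (\<mu> j) g x) e = L2_inner N (\<lambda>x. f x + g x) e"
      if "e \<in> eigensp (\<mu> j)" for e
      using f g eigensp_L2[OF that] proj_inner[OF f that] proj_inner[OF g that] by (simp add: L2.form_add)
  qed (use f g in simp)
  thus ?thesis using f g by (simp add: coeff_norm_def L2_norm_eq_form_norm L2.form_norm_triangle)
qed

lemma coeff_norm_le: "f \<in> L2 N \<Longrightarrow> coeff_norm j f \<le> L2_norm N f"
  unfolding coeff_norm_def by (rule proj_norm_le)

lemma spec_norm_le_iff:
  assumes "0 \<le> c"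
  shows "spec_norm s f \<le> ennreal c \<longleftrightarrow> (\<forall>n. (\<Sum>j<n. weight s j * coeff_norm j f) \<le> c)"
  unfolding spec_norm_def suminf_eq_SUP SUP_le_iff using assms
  by (simp add: sum_ennreal sum_nonneg)

lemma spec_space_L2: "f \<in> spec_space s \<Longrightarrow> f \<in> L2 N"
  by (simp add: spec_space_def)

lemma spec_norm_eq_nrm: "f \<in> spec_space s \<Longrightarrow> spec_norm s f = ennreal (spec_nrm s f)"
  by (simp add: spec_space_def spec_nrm_def)

lemma spec_nrm_nonneg [simp]: "0 \<le> spec_nrm s f"
  by (simp add: spec_nrm_def)

lemma spec_spaceI:
  assumes "f \<in> L2 N" "\<And>n. (\<Sum>j<n. weight s j * coeff_norm j f) \<le> c" "0 \<le> c"
  shows "f \<in> spec_space s" "spec_nrm s f \<le> c"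
proof -
  have le: "spec_norm s f \<le> ennreal c" using assms by (simp add: spec_norm_le_iff)
  thus "f \<in> spec_space s" using assms(1) by (auto simp: spec_space_def intro: le_less_trans)
  from spec_norm_eq_nrm[OF this] show "spec_nrm s f \<le> c" using le assms(3) by simp
qed

lemma spec_nrm_partial_sum:
  assumes "f \<in> spec_space s"
  shows "(\<Sum>j<n. weight s j * coeff_norm j f) \<le> spec_nrm s f"
  using spec_norm_le_iff[of "spec_nrm s f" s f] spec_norm_eq_nrm[OF assms] by simp

lemma L2_norm_nonneg [simp]: "0 \<le> L2_norm N f"
  by (simp add: L2_norm_def L2_inner_def)

text \<open>The function \<open>f\<close> is the limit of its partial sums, whose norms are
  bounded by the sum of the coefficients, and no weight is below \<open>1\<close> as the
  eigenvalues are nonnegative.\<close>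

theorem L2_norm_le_spec_norm:
  assumes f: "f \<in> L2 N" and s: "0 \<le> s"
  shows "ennreal (L2_norm N f) \<le> spec_norm s f"
proof (cases "spec_norm s f = \<infinity>")
  case False
  hence fs: "f \<in> spec_space s" using f by (simp add: spec_space_def less_top)
  have "L2_norm N f \<le> L2_norm N (\<lambda>x. f x - partial_proj n f x) + spec_nrm s f" for n
  proof -
    have "L2_norm N f \<le> L2_norm N (\<lambda>x. f x - partial_proj n f x) + L2_norm N (partial_proj n f)"
      using L2.form_norm_triangle[of "\<lambda>x. f x - partial_proj n f x" N "partial_proj n f"] f
      by (simp add: L2_norm_eq_form_norm)
    also have "L2_norm N (partial_proj n f) \<le> (\<Sum>j<n. coeff_norm j f)"
      unfolding partial_proj_def coeff_norm_def L2_norm_eq_form_norm using f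
      by (intro L2.form_norm_sum) simp
    also have "\<dots> \<le> (\<Sum>j<n. weight s j * coeff_norm j f)"
      using weight_ge_1[OF s] by (intro sum_mono) (simp add: mult_le_cancel_right1 less_le_not_le)
    also have "\<dots> \<le> spec_nrm s f" by (rule spec_nrm_partial_sum[OF fs])
    finally show ?thesis by simp
  qed
  moreover have "(\<lambda>n. L2_norm N (\<lambda>x. f x - partial_proj n f x) + spec_nrm s f) \<longlonglongrightarrow> 0 + spec_nrm s f"
    by (intro tendsto_add tendsto_const partial_proj_converges f)
  ultimately have "L2_norm N f \<le> 0 + spec_nrm s f"
    by (intro LIMSEQ_le_const) auto
  thus ?thesis using spec_norm_eq_nrm[OF fs] by simp
qed simp

lemma L2_norm_le_spec_nrm:
  assumes "f \<in> spec_space s" "0 \<le> s"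
  shows "L2_norm N f \<le> spec_nrm s f"
  using L2_norm_le_spec_norm[OF spec_space_L2[OF assms(1)] assms(2)] spec_norm_eq_nrm[OF assms(1)] by simp

lemma spec_norm_mono:
  assumes "s \<le> t"
  shows "spec_norm s f \<le> spec_norm t f"
  unfolding spec_norm_def
  by (intro suminf_le ennreal_leI mult_right_mono weight_mono assms) auto

lemma spec_norm_cong:
  assumes "f \<in> L2 N" "g \<in> L2 N"
    and "\<And>j e. e \<in> eigensp (\<mu> j) \<Longrightarrow> L2_inner N f e = L2_inner N g e"
  shows "spec_norm s f = spec_norm s g"
  unfolding spec_norm_def using coeff_norm_cong[OF assms] by simp

lemma spec_norm_cong_AE:
  assumes "f \<in> L2 N" "g \<in> L2 N" "AE x in N. f x = g x"
  shows "spec_norm s f = spec_norm s g"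
proof (rule spec_norm_cong[OF assms(1,2)])
  fix j e assume e: "e \<in> eigensp (\<mu> j)"
  show "L2_inner N f e = L2_inner N g e"
    using L2_inner_cong_AE[OF assms(1,2) eigensp_L2[OF e] eigensp_L2[OF e] assms(3)] by simp
qed

lemma spec_scale:
  assumes f: "f \<in> spec_space s"
  shows "(\<lambda>x. a * f x) \<in> spec_space s" "spec_nrm s (\<lambda>x. a * f x) = \<bar>a\<bar> * spec_nrm s f"
proof -
  have "spec_norm s (\<lambda>x. a * f x) = (\<Sum>j. ennreal \<bar>a\<bar> * ennreal (weight s j * coeff_norm j f))"
    unfolding spec_norm_def coeff_norm_scale[OF spec_space_L2[OF f]]
    by (simp add: ennreal_mult[symmetric] algebra_simps)
  also have "\<dots> = ennreal \<bar>a\<bar> * spec_norm s f" by (simp add: spec_norm_def)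
  also have "\<dots> = ennreal (\<bar>a\<bar> * spec_nrm s f)" by (simp add: spec_norm_eq_nrm[OF f] ennreal_mult)
  finally have eq: "spec_norm s (\<lambda>x. a * f x) = ennreal (\<bar>a\<bar> * spec_nrm s f)" .
  thus "(\<lambda>x. a * f x) \<in> spec_space s" using spec_space_L2[OF f] by (simp add: spec_space_def)
  show "spec_nrm s (\<lambda>x. a * f x) = \<bar>a\<bar> * spec_nrm s f"
    unfolding spec_nrm_def[of s "\<lambda>x. a * f x"] eq by simp
qed

lemma spec_add:
  assumes f: "f \<in> spec_space s" and g: "g \<in> spec_space s"
  shows "(\<lambda>x. f x + g x) \<in> spec_space s" "spec_nrm s (\<lambda>x. f x + g x) \<le> spec_nrm s f + spec_nrm s g"
proof -
  have L: "f \<in> L2 N" "g \<in> L2 N" using f g by (simp_all add: spec_space_L2)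
  have le: "(\<Sum>j<n. weight s j * coeff_norm j (\<lambda>x. f x + g x)) \<le> spec_nrm s f + spec_nrm s g" for n
  proof -
    have "(\<Sum>j<n. weight s j * coeff_norm j (\<lambda>x. f x + g x))
        \<le> (\<Sum>j<n. weight s j * (coeff_norm j f + coeff_norm j g))"
      using L by (intro sum_mono mult_left_mono coeff_norm_triangle) auto
    also have "\<dots> = (\<Sum>j<n. weight s j * coeff_norm j f) + (\<Sum>j<n. weight s j * coeff_norm j g)"
      by (simp add: distrib_left sum.distrib)
    also have "\<dots> \<le> spec_nrm s f + spec_nrm s g"
      by (intro add_mono spec_nrm_partial_sum f g)
    finally show ?thesis .
  qed
  show "(\<lambda>x. f x + g x) \<in> spec_space s" "spec_nrm s (\<lambda>x. f x + g x) \<le> spec_nrm s f + spec_nrm s g"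
    using spec_spaceI[OF L2.add_in[OF L] le] by auto
qed

lemma spec_diff:
  assumes f: "f \<in> spec_space s" and g: "g \<in> spec_space s"
  shows "(\<lambda>x. f x - g x) \<in> spec_space s"
  using spec_add(1)[OF f spec_scale(1)[OF g, of "-1"]] by simp

text \<open>The partial sums of the norm of \<open>F m - F n\<close> pass to the limit \<open>n \<rightarrow> \<infinity>\<close> one coefficient at a
  time, because convergence in \<open>L\<^sup>2\<close> controls each coefficient.\<close>

theorem spec_space_complete:
  assumes s: "0 \<le> s" and F: "\<And>n. F n \<in> spec_space s"
    and cauchy: "\<And>e. e > 0 \<Longrightarrow> \<exists>K. \<forall>m\<ge>K. \<forall>n\<ge>K. spec_nrm s (\<lambda>x. F m x - F n x) < e"
  shows "\<exists>f\<in>spec_space s. (\<lambda>n. spec_nrm s (\<lambda>x. F n x - f x)) \<longlonglongrightarrow> 0"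
proof -
  have FL: "F n \<in> L2 N" for n using F by (rule spec_space_L2)
  have cL: "L2.cauchy_seq N F"
    unfolding L2.cauchy_seq_def L2_norm_eq_form_norm[symmetric]
  proof (intro allI impI)
    fix e :: real assume "e > 0"
    then obtain K where K: "\<forall>m\<ge>K. \<forall>n\<ge>K. spec_nrm s (\<lambda>x. F m x - F n x) < e" using cauchy by blast
    have "L2_norm N (\<lambda>x. F m x - F n x) < e" if "m \<ge> K" "n \<ge> K" for m n
      by (rule le_less_trans[OF L2_norm_le_spec_nrm[OF spec_diff[OF F F] s]]) (rule K[rule_format, OF that])
    thus "\<exists>K. \<forall>m\<ge>K. \<forall>n\<ge>K. L2_norm N (\<lambda>x. F m x - F n x) < e" by blast
  qed
  obtain f where f: "f \<in> L2 N" "L2.converges_to N F f"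
    using L2_complete[where F = F, OF FL cL] by (elim bexE)
  have lim: "(\<lambda>n. L2_norm N (\<lambda>x. F n x - f x)) \<longlonglongrightarrow> 0"
    using f(2) by (simp add: L2.converges_to_def L2_norm_eq_form_norm)
  have tail: "(\<lambda>x. F m x - f x) \<in> spec_space s \<and> spec_nrm s (\<lambda>x. F m x - f x) \<le> e"
    if "e > 0" and K: "\<And>n. n \<ge> K \<Longrightarrow> spec_nrm s (\<lambda>x. F m x - F n x) < e" for m e K
  proof -
    have "(\<Sum>j<J. weight s j * coeff_norm j (\<lambda>x. F m x - f x)) \<le> e" for J
    proof (rule LIMSEQ_le_const)
      show "(\<lambda>n. (\<Sum>j<J. weight s j * (L2_norm N (\<lambda>x. F n x - f x))) + e) \<longlonglongrightarrow> e"
        using tendsto_add[OF tendsto_sum[of "{..<J}" "\<lambda>j n. weight s j * L2_norm N (\<lambda>x. F n x - f x)" "\<lambda>j. weight s j * 0"] tendsto_const[of e]]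
          tendsto_mult_left[OF lim] by simp
      have "(\<Sum>j<J. weight s j * coeff_norm j (\<lambda>x. F m x - f x))
          \<le> (\<Sum>j<J. weight s j * (L2_norm N (\<lambda>x. F n x - f x))) + e" if n: "n \<ge> K" for n
      proof -
        have "coeff_norm j (\<lambda>x. F m x - f x)
            \<le> L2_norm N (\<lambda>x. F n x - f x) + coeff_norm j (\<lambda>x. F m x - F n x)" for j
          using coeff_norm_triangle[of "\<lambda>x. F m x - F n x" "\<lambda>x. F n x - f x" j]
            coeff_norm_le[of "\<lambda>x. F n x - f x" j] FL f by simp
        hence "(\<Sum>j<J. weight s j * coeff_norm j (\<lambda>x. F m x - f x))
          \<le> (\<Sum>j<J. weight s j * (L2_norm N (\<lambda>x. F n x - f x) + coeff_norm j (\<lambda>x. F m x - F n x)))"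
          by (intro sum_mono mult_left_mono) auto
        also have "\<dots> = (\<Sum>j<J. weight s j * (L2_norm N (\<lambda>x. F n x - f x)))
            + (\<Sum>j<J. weight s j * coeff_norm j (\<lambda>x. F m x - F n x))"
          by (simp add: distrib_left sum.distrib)
        also have "(\<Sum>j<J. weight s j * coeff_norm j (\<lambda>x. F m x - F n x)) \<le> e"
          using spec_nrm_partial_sum[OF spec_diff[OF F F], of m n J] K[OF n] by linarith
        finally show ?thesis by simp
      qed
      thus "\<exists>M. \<forall>n\<ge>M. (\<Sum>j<J. weight s j * coeff_norm j (\<lambda>x. F m x - f x))
          \<le> (\<Sum>j<J. weight s j * (L2_norm N (\<lambda>x. F n x - f x))) + e" by blast
    qed
    thus ?thesis using spec_spaceI[of "\<lambda>x. F m x - f x" s e] FL f \<open>e > 0\<close> by simp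
  qed
  obtain K where "\<forall>m\<ge>K. \<forall>n\<ge>K. spec_nrm s (\<lambda>x. F m x - F n x) < 1" using cauchy[of 1] by auto
  hence "(\<lambda>x. F K x - f x) \<in> spec_space s" using tail[of 1 K K] by simp
  from spec_diff[OF F[of K] this] have fs: "f \<in> spec_space s" by simp
  have "(\<lambda>n. spec_nrm s (\<lambda>x. F n x - f x)) \<longlonglongrightarrow> 0"
  proof (rule LIMSEQ_I)
    fix e :: real assume "e > 0"
    then obtain K where K: "\<forall>m\<ge>K. \<forall>n\<ge>K. spec_nrm s (\<lambda>x. F m x - F n x) < e/2" using cauchy[of "e/2"] by auto
    have "norm (spec_nrm s (\<lambda>x. F m x - f x) - 0) < e" if "m \<ge> K" for m
      using tail[of "e/2" K m] K that \<open>e > 0\<close> by simp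
    thus "\<exists>K. \<forall>m\<ge>K. norm (spec_nrm s (\<lambda>x. F m x - f x) - 0) < e" by blast
  qed
  thus ?thesis using fs by blast
qed

theorem spec_space_banach:
  assumes s: "0 \<le> s"
  shows "banach_space_ae N (spec_space s) (spec_nrm s)"
  unfolding banach_space_ae_def
proof (intro conjI ballI allI impI)
  show "spec_space s \<subseteq> borel_measurable N" using spec_space_L2 L2_measurable by blast
  fix f h assume "f \<in> spec_space s" "h \<in> borel_measurable N" "AE x in N. h x = f x"
  moreover from this have "h \<in> L2 N" using L2_cong_AE spec_space_L2 by blast
  moreover from calculation have "spec_norm s h = spec_norm s f"
    by (intro spec_norm_cong_AE) (auto simp: spec_space_L2)
  ultimately show "h \<in> spec_space s" "spec_nrm s h = spec_nrm s f"
    by (simp_all add: spec_space_def spec_nrm_def)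
next
  show "(\<lambda>x. 0) \<in> spec_space s"
    using spec_spaceI(1)[of "\<lambda>x. 0" s 0] coeff_norm_zero[of "\<lambda>x. 0"] by (simp add: L2_inner_def)
next
  fix f assume f: "f \<in> spec_space s"
  show "spec_nrm s f = 0 \<longleftrightarrow> (AE x in N. f x = 0)"
  proof
    assume "spec_nrm s f = 0"
    hence "L2_norm N f = 0" using L2_norm_le_spec_nrm[OF f s] L2_norm_nonneg[of f] by simp
    thus "AE x in N. f x = 0" using L2_norm_eq_0_iff spec_space_L2[OF f] by blast
  next
    assume "AE x in N. f x = 0"
    hence "spec_norm s f = spec_norm s (\<lambda>x. 0)"
      using spec_space_L2[OF f] by (intro spec_norm_cong_AE) auto
    also have "\<dots> = 0" using coeff_norm_zero[of "\<lambda>x. 0"] by (simp add: spec_norm_def L2_inner_def)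
    finally show "spec_nrm s f = 0" by (simp add: spec_nrm_def)
  qed
next
  fix F :: "nat \<Rightarrow> 'm \<Rightarrow> real" assume "(\<forall>n. F n \<in> spec_space s) \<and>
    (\<forall>e>0. \<exists>K. \<forall>m\<ge>K. \<forall>n\<ge>K. spec_nrm s (\<lambda>x. F m x - F n x) < e)"
  thus "\<exists>f\<in>spec_space s. (\<lambda>n. spec_nrm s (\<lambda>x. F n x - f x)) \<longlonglongrightarrow> 0"
    using spec_space_complete[OF s, of F] by blast
qed (simp_all add: spec_add spec_scale)

text \<open>Removing the \<open>n\<close>-th partial sum from \<open>f\<close> leaves the tail of
  the convergent series that is the norm of \<open>f\<close>.\<close>

theorem spec_sums_dense:
  assumes s: "0 \<le> s"
  shows "dense_in_norm {f. \<exists>J e. finite J \<and> (\<forall>j\<in>J. e j \<in> eigensp (\<mu> j)) \<and> f = (\<lambda>p. \<Sum>j\<in>J. e j p)}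
    (spec_space s) (spec_nrm s)"
  unfolding dense_in_norm_def
proof (intro conjI ballI allI impI subsetI)
  fix f assume "f \<in> {f. \<exists>J e. finite J \<and> (\<forall>j\<in>J. e j \<in> eigensp (\<mu> j)) \<and> f = (\<lambda>p. \<Sum>j\<in>J. e j p)}"
  then obtain J e where J: "finite J" "\<And>j. j \<in> J \<Longrightarrow> e j \<in> eigensp (\<mu> j)"
    and f: "f = (\<lambda>p. \<Sum>j\<in>J. e j p)" by blast
  have eL: "e j \<in> L2 N" if "j \<in> J" for j using J(2)[OF that] by simp
  have fL: "f \<in> L2 N" unfolding f using eL by (rule L2.sum_in)
  have "coeff_norm k f = 0" if "k \<notin> J" for k
  proof (rule coeff_norm_zero[OF fL])
    fix g assume g: "g \<in> eigensp (\<mu> k)"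
    have "L2_inner N f g = (\<Sum>j\<in>J. L2_inner N (e j) g)"
      unfolding f using eL eigensp_L2[OF g] by (rule L2.form_sum)
    also have "\<dots> = 0"
    proof (intro sum.neutral ballI)
      fix j assume "j \<in> J"
      with that have "j \<noteq> k" by blast
      thus "L2_inner N (e j) g = 0"
        using eigensp_orthogonal[OF J(2)[OF \<open>j \<in> J\<close>] g \<mu>_inj] by blast
    qed
    finally show "L2_inner N f g = 0" .
  qed
  hence "spec_norm s f = (\<Sum>j\<in>J. ennreal (weight s j * coeff_norm j f))"
    unfolding spec_norm_def using J(1) by (intro suminf_finite) auto
  also have "\<dots> < \<infinity>" using J(1) by (simp add: sum_ennreal)
  finally show "f \<in> spec_space s" using fL by (simp add: spec_space_def)
next
  fix f and e :: real assume f: "f \<in> spec_space s" and "e > 0"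
  have fL: "f \<in> L2 N" using f by (rule spec_space_L2)
  define b where "b j = weight s j * coeff_norm j f" for j
  have b0: "0 \<le> b j" for j by (simp add: b_def)
  have "(\<Sum>j. ennreal (b j)) \<noteq> top"
    using f by (simp add: spec_space_def spec_norm_def b_def less_top)
  hence sb: "summable b" by (rule summable_suminf_not_top[OF b0])
  obtain n where n: "norm (\<Sum>j. b (j + n)) < e" using suminf_exist_split[OF \<open>e > 0\<close> sb] by blast
  define h where "h = partial_proj n f"
  have "h \<in> {f. \<exists>J e. finite J \<and> (\<forall>j\<in>J. e j \<in> eigensp (\<mu> j)) \<and> f = (\<lambda>p. \<Sum>j\<in>J. e j p)}"
    unfolding h_def partial_proj_def using fL
    by (intro CollectI exI[of _ "{..<n}"] exI[of _ "\<lambda>j. proj (\<mu> j) f"]) simp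
  moreover have "spec_nrm s (\<lambda>x. f x - h x) < e"
  proof -
    have hL: "h \<in> L2 N" using fL by (simp add: h_def)
    have low: "coeff_norm k (\<lambda>x. f x - h x) = 0" if "k < n" for k
      unfolding h_def
      by (rule coeff_norm_zero) (use fL partial_proj_orthogonal[OF fL _ that] in simp_all)
    have high: "coeff_norm k (\<lambda>x. f x - h x) = coeff_norm k f" if "k \<ge> n" for k
    proof (rule coeff_norm_cong)
      fix g assume g: "g \<in> eigensp (\<mu> k)"
      have "L2_inner N h g = (\<Sum>j<n. L2_inner N (proj (\<mu> j) f) g)"
        unfolding h_def partial_proj_def using fL eigensp_L2[OF g] by (intro L2.form_sum) simp_all
      also have "\<dots> = 0"
        using that by (intro sum.neutral ballI eigensp_orthogonal[OF proj_eigensp[OF fL] g] \<mu>_inj) auto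
      finally show "L2_inner N (\<lambda>x. f x - h x) g = L2_inner N f g"
        using fL hL eigensp_L2[OF g] by (simp add: L2.form_diff)
    qed (use fL hL in simp_all)
    have tail_le: "(\<Sum>j<m. weight s j * coeff_norm j (\<lambda>x. f x - h x)) \<le> (\<Sum>j. b (j + n))" for m
    proof -
      have "(\<Sum>j<m. weight s j * coeff_norm j (\<lambda>x. f x - h x))
          \<le> (\<Sum>j<m + n. weight s j * coeff_norm j (\<lambda>x. f x - h x))"
        by (intro sum_mono2) auto
      also have "\<dots> = (\<Sum>j\<in>{n..<m + n}. b j)"
        using low high by (intro sum.mono_neutral_cong_right) (auto simp: b_def)
      also have "\<dots> = (\<Sum>j<m. b (j + n))"
        using sum.shift_bounds_nat_ivl[of b 0 n m] by (simp add: atLeast0LessThan)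
      also have "\<dots> \<le> (\<Sum>j. b (j + n))"
        using sb b0 by (intro sum_le_suminf) (auto simp: summable_iff_shift)
      finally show ?thesis .
    qed
    have "spec_nrm s (\<lambda>x. f x - h x) \<le> (\<Sum>j. b (j + n))"
    proof (rule spec_spaceI(2)[OF L2.diff_in[OF fL hL] tail_le])
      show "0 \<le> (\<Sum>j. b (j + n))" using sb b0 by (intro suminf_nonneg) (auto simp: summable_iff_shift)
    qed
    thus ?thesis using n by simp
  qed
  ultimately show "\<exists>h\<in>{f. \<exists>J e. finite J \<and> (\<forall>j\<in>J. e j \<in> eigensp (\<mu> j)) \<and> f = (\<lambda>p. \<Sum>j\<in>J. e j p)}.
      spec_nrm s (\<lambda>x. f x - h x) < e" by (intro bexI[of _ h])
qed

theorem spec_space_embedded: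
  assumes "s \<le> t"
  shows "continuously_embedded (spec_space t) (spec_nrm t) (spec_space s) (spec_nrm s)"
  unfolding continuously_embedded_def
proof (intro conjI ballI allI impI)
  show sub: "spec_space t \<subseteq> spec_space s"
    using spec_norm_mono[OF assms] by (auto simp: spec_space_def intro: le_less_trans)
  fix f and e :: real assume f: "f \<in> spec_space t" and "e > 0"
  have "spec_nrm s (\<lambda>x. h x - f x) \<le> spec_nrm t (\<lambda>x. h x - f x)" if h: "h \<in> spec_space t" for h
    using spec_norm_mono[OF assms, of "\<lambda>x. h x - f x"] spec_diff[OF h f]
    unfolding spec_nrm_def by (intro enn2real_mono) (simp_all add: spec_space_def)
  thus "\<exists>d>0. \<forall>h\<in>spec_space t. spec_nrm t (\<lambda>x. h x - f x) < d \<longrightarrow> spec_nrm s (\<lambda>x. h x - f x) < e"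
    using \<open>e > 0\<close> by (meson le_less_trans)
qed

end

subsection \<open>Symmetries\<close>

context energy_form
begin

definition symmetry :: "('m \<Rightarrow> 'm) \<Rightarrow> bool" where
  "symmetry T \<longleftrightarrow> (\<forall>f\<in>L2 N. f \<circ> T \<in> L2 N) \<and>
     (\<forall>f\<in>L2 N. \<forall>g\<in>L2 N. L2_inner N (f \<circ> T) (g \<circ> T) = L2_inner N f g) \<and>
     (\<forall>u\<in>X. u \<circ> T \<in> X) \<and> (\<forall>u\<in>X. \<forall>v\<in>X. D (u \<circ> T) (v \<circ> T) = D u v)"

text \<open>Composition with \<open>T\<close> preserves approximating sequences. A test function
  has the form \<open>\<psi> \<circ> T\<close> with \<open>\<psi> = \<phi> \<circ> T'\<close>, so
  that \<open>T\<close> can be dropped from both arguments of the form.\<close>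

lemma symmetry_eigensp:
  assumes T: "symmetry T" and T': "symmetry T'" "T' \<circ> T = id" and f: "f \<in> eigensp l"
  shows "f \<circ> T \<in> eigensp l"
proof -
  obtain u where u: "approximates u f" using form_domainE[OF eigensp_domain[OF f]] by blast
  note ud = approximatesD[OF u]
  have sub: "(\<lambda>x. (u m \<circ> T) x - (u n \<circ> T) x) = (\<lambda>x. u m x - u n x) \<circ> T" for m n
    by (simp add: o_def)
  have "form_norm (L2_inner N) (\<lambda>x. (u n \<circ> T) x - (f \<circ> T) x) = form_norm (L2_inner N) (\<lambda>x. u n x - f x)" for n
  proof -
    have "(\<lambda>x. (u n \<circ> T) x - (f \<circ> T) x) = (\<lambda>x. u n x - f x) \<circ> T" by (simp add: o_def)
    moreover have "(\<lambda>x. u n x - f x) \<in> L2 N" using ud by (intro L2.diff_in) simp_all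
    ultimately show ?thesis using T unfolding form_norm_def symmetry_def by metis
  qed
  moreover have "form_norm D (\<lambda>x. (u m \<circ> T) x - (u n \<circ> T) x) = form_norm D (\<lambda>x. u m x - u n x)" for m n
    unfolding sub form_norm_def using T D.diff_in[OF ud(2)[of m] ud(2)[of n]] by (simp add: symmetry_def)
  ultimately have a: "approximates (\<lambda>n. u n \<circ> T) (f \<circ> T)"
    using ud T unfolding approximates_def L2.converges_to_def D.cauchy_seq_def
    by (simp add: symmetry_def)
  show ?thesis
  proof (rule eigenspI)
    show "f \<circ> T \<in> form_domain" using a by (auto simp: form_domain_def)
    fix \<phi> assume \<phi>: "\<phi> \<in> X"
    define \<psi> where "\<psi> = \<phi> \<circ> T'"
    have \<psi>: "\<psi> \<in> X" "\<psi> \<circ> T = \<phi>" using \<phi> T' by (auto simp: \<psi>_def symmetry_def o_assoc[symmetric])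
    have "(\<lambda>n. D (u n \<circ> T) \<phi>) \<longlonglongrightarrow> closed_form (f \<circ> T) \<phi>"
      by (rule closed_form_limit[OF a approximates_const[OF \<phi>]])
    moreover have "D (u n \<circ> T) \<phi> = D (u n) \<psi>" for n
      using T ud(2) \<psi> unfolding symmetry_def by metis
    moreover have "(\<lambda>n. D (u n) \<psi>) \<longlonglongrightarrow> closed_form f \<psi>"
      by (rule closed_form_limit[OF u approximates_const[OF \<psi>(1)]])
    ultimately have "closed_form (f \<circ> T) \<phi> = closed_form f \<psi>" using LIMSEQ_unique by simp
    also have "\<dots> = l * L2_inner N f \<psi>" by (rule eigensp_form[OF f]) (use \<psi> in simp)
    also have "L2_inner N f \<psi> = L2_inner N (f \<circ> T) (\<psi> \<circ> T)"
      using T eigensp_L2[OF f] X_L2[OF \<psi>(1)] by (simp add: symmetry_def)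
    finally show "closed_form (f \<circ> T) \<phi> = l * L2_inner N (f \<circ> T) \<phi>" by (simp only: \<psi>(2))
  qed
qed

end

text \<open>As \<open>T\<close> preserves inner products and each eigenspace, composition with
  \<open>T\<close> commutes with the projections.\<close>

lemma (in energy_spectrum) spec_norm_symmetry:
  assumes T: "symmetry T" and T': "symmetry T'" and inv: "T' \<circ> T = id" "T \<circ> T' = id" and f: "f \<in> L2 N"
  shows "spec_norm s (f \<circ> T) = spec_norm s f"
proof -
  have fT: "f \<circ> T \<in> L2 N" using T f by (simp add: symmetry_def)
  have "coeff_norm j (f \<circ> T) = coeff_norm j f" for j
  proof -
    have "coeff_norm j (f \<circ> T) = L2_norm N (proj (\<mu> j) f \<circ> T)"
    proof (rule coeff_norm_eqI[OF fT])
      show "proj (\<mu> j) f \<circ> T \<in> eigensp (\<mu> j)"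
        by (rule symmetry_eigensp[OF T T' inv(1)]) (use f in simp)
      fix e assume e: "e \<in> eigensp (\<mu> j)"
      have e': "e \<circ> T' \<in> eigensp (\<mu> j)" by (rule symmetry_eigensp[OF T' T inv(2) e])
      have eT: "e = (e \<circ> T') \<circ> T" using inv(1) by (simp add: o_assoc[symmetric])
      have "L2_inner N (proj (\<mu> j) f \<circ> T) ((e \<circ> T') \<circ> T) = L2_inner N (proj (\<mu> j) f) (e \<circ> T')"
        using T f eigensp_L2[OF e'] unfolding symmetry_def by simp
      also have "\<dots> = L2_inner N f (e \<circ> T')" by (rule proj_inner[OF f e'])
      also have "\<dots> = L2_inner N (f \<circ> T) ((e \<circ> T') \<circ> T)"
        using T f eigensp_L2[OF e'] unfolding symmetry_def by simp
      finally show "L2_inner N (proj (\<mu> j) f \<circ> T) e = L2_inner N (f \<circ> T) e" using eT by simp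
    qed
    also have "\<dots> = coeff_norm j f"
      using T f by (simp add: coeff_norm_def L2_norm_def symmetry_def)
    finally show ?thesis .
  qed
  thus ?thesis by (simp add: spec_norm_def)
qed

section \<open>Calculus of smooth functions\<close>

text \<open>The derivative \<open>F\<close> that has been found agrees with
  \<open>frechet_derivative f\<close> on \<open>S\<close> only. The premise \<open>cong\<close>
  bridges this; it breaks the circle with the congruence rule \<open>Ck_on_cong\<close>, whose
  induction step needs the present lemma.\<close>

lemma Ck_on_SucI:
  fixes f :: "'a::euclidean_space \<Rightarrow> 'b::real_normed_vector"
  assumes "\<And>x. x \<in> S \<Longrightarrow> (f has_derivative F x) (at x)" "open S" "\<And>v. Ck_on k (\<lambda>x. F x v) S"
    and cong: "\<And>g h :: 'a \<Rightarrow> 'b. (\<And>x. x \<in> S \<Longrightarrow> g x = h x) \<Longrightarrow> Ck_on k g S \<Longrightarrow> Ck_on k h S"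
  shows "Ck_on (Suc k) f S"
proof -
  have "frechet_derivative f (at x) = F x" if "x \<in> S" for x
    using frechet_derivative_at[OF assms(1)[OF that]] by simp
  hence "Ck_on k (\<lambda>x. frechet_derivative f (at x) v) S" for v
    using cong[of "\<lambda>x. F x v" "\<lambda>x. frechet_derivative f (at x) v"] assms(3) by simp
  moreover have "f differentiable (at x)" if "x \<in> S" for x
    using assms(1)[OF that] by (auto simp: differentiable_def)
  ultimately show ?thesis by simp
qed

lemma Ck_on_SucD:
  assumes "Ck_on (Suc k) f S"
  shows "x \<in> S \<Longrightarrow> (f has_derivative frechet_derivative f (at x)) (at x)"
    "Ck_on k (\<lambda>x. frechet_derivative f (at x) v) S"
  using assms by (auto simp: frechet_derivative_works)

lemma Ck_on_cong:
  assumes "open S" "\<And>x. x \<in> S \<Longrightarrow> f x = g x" "Ck_on k f S"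
  shows "Ck_on k g S"
  using assms(2,3)
proof (induction k arbitrary: f g)
  case 0
  thus ?case using continuous_on_cong[of S S f g] by simp
next
  case (Suc k)
  show ?case
  proof (rule Ck_on_SucI)
    show "(g has_derivative frechet_derivative f (at x)) (at x)" if "x \<in> S" for x
      using has_derivative_transform_within_open[OF Ck_on_SucD(1)[OF Suc.prems(2) that] \<open>open S\<close> that]
        Suc.prems(1) by blast
    show "Ck_on k (\<lambda>x. frechet_derivative f (at x) v) S" for v
      by (rule Ck_on_SucD[OF Suc.prems(2)])
    show "Ck_on k h S" if "\<And>x. x \<in> S \<Longrightarrow> g x = h x" "Ck_on k g S" for g h :: "'a \<Rightarrow> 'b"
      using Suc.IH that by blast
  qed fact
qed

lemma Ck_onI:
  assumes "open S" "\<And>x. x \<in> S \<Longrightarrow> (f has_derivative F x) (at x)" "\<And>v. Ck_on k (\<lambda>x. F x v) S"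
  shows "Ck_on (Suc k) f S"
proof (rule Ck_on_SucI[OF assms(2,1,3)])
  show "Ck_on k h S" if "\<And>x. x \<in> S \<Longrightarrow> g x = h x" "Ck_on k g S" for g h :: "'a \<Rightarrow> 'b"
    by (rule Ck_on_cong[OF assms(1) that])
qed

lemma Ck_on_Suc_imp: "Ck_on (Suc k) f S \<Longrightarrow> Ck_on k f S"
proof (induction k arbitrary: f)
  case 0
  thus ?case
    by (auto intro!: continuous_at_imp_continuous_on differentiable_imp_continuous_within)
next
  case (Suc k)
  thus ?case by (metis Ck_on.simps(2))
qed

lemma Ck_on_subset: "Ck_on k f S \<Longrightarrow> T \<subseteq> S \<Longrightarrow> Ck_on k f T"
  by (induction k arbitrary: f) (auto intro: continuous_on_subset)

lemma Ck_on_locally: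
  assumes "\<And>x. x \<in> S \<Longrightarrow> \<exists>U. open U \<and> x \<in> U \<and> Ck_on k f U"
  shows "Ck_on k f S"
  using assms
proof (induction k arbitrary: f)
  case 0
  have "isCont f x" if x: "x \<in> S" for x
    using 0[OF x] by (auto simp: continuous_on_eq_continuous_at)
  thus ?case by (simp add: continuous_at_imp_continuous_on)
next
  case (Suc k)
  show ?case
    unfolding Ck_on.simps
  proof (intro conjI ballI allI)
    fix x assume "x \<in> S"
    thus "f differentiable at x" using Suc.prems[of x] by auto
  next
    fix v
    show "Ck_on k (\<lambda>x. frechet_derivative f (at x) v) S"
    proof (rule Suc.IH)
      fix x assume "x \<in> S"
      thus "\<exists>U. open U \<and> x \<in> U \<and> Ck_on k (\<lambda>x. frechet_derivative f (at x) v) U"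
        using Suc.prems[of x] by auto
    qed
  qed
qed

lemma Ck_on_const: "Ck_on k (\<lambda>x. c) S"
  by (induction k arbitrary: c) auto

lemma Ck_on_linear:
  assumes "bounded_linear f" "open S"
  shows "Ck_on k f S"
proof (cases k)
  case 0
  thus ?thesis using assms by (simp add: linear_continuous_on)
next
  case (Suc j)
  show ?thesis unfolding Suc
    by (rule Ck_onI[OF assms(2) bounded_linear_imp_has_derivative[OF assms(1)] Ck_on_const])
qed

lemma Ck_on_compose_linear:
  assumes "bounded_linear L" "open S" "Ck_on k f S"
  shows "Ck_on k (\<lambda>x. L (f x)) S"
  using assms(3)
proof (induction k arbitrary: f)
  case 0
  thus ?case using bounded_linear.continuous_on[OF assms(1)] by auto
next
  case (Suc k)
  show ?case
  proof (rule Ck_onI[OF assms(2)])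
    show "((\<lambda>x. L (f x)) has_derivative (\<lambda>v. L (frechet_derivative f (at x) v))) (at x)" if "x \<in> S" for x
      by (rule bounded_linear.has_derivative[OF assms(1) Ck_on_SucD(1)[OF Suc.prems that]])
    show "Ck_on k (\<lambda>x. L (frechet_derivative f (at x) v)) S" for v
      by (rule Suc.IH[OF Ck_on_SucD(2)[OF Suc.prems]])
  qed
qed

lemma Ck_on_add:
  assumes "open S" "Ck_on k f S" "Ck_on k g S"
  shows "Ck_on k (\<lambda>x. f x + g x) S"
  using assms(2,3)
proof (induction k arbitrary: f g)
  case (Suc k)
  show ?case
  proof (rule Ck_onI[OF assms(1)])
    show "((\<lambda>x. f x + g x) has_derivative
        (\<lambda>v. frechet_derivative f (at x) v + frechet_derivative g (at x) v)) (at x)" if "x \<in> S" for x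
      using Suc.prems that by (intro has_derivative_add Ck_on_SucD(1))
    show "Ck_on k (\<lambda>x. frechet_derivative f (at x) v + frechet_derivative g (at x) v) S" for v
      using Suc.prems by (intro Suc.IH Ck_on_SucD(2))
  qed
qed (auto intro: continuous_on_add)

lemma Ck_on_sum:
  assumes "open S" "\<And>i. i \<in> I \<Longrightarrow> Ck_on k (f i) S"
  shows "Ck_on k (\<lambda>x. \<Sum>i\<in>I. f i x) S"
  using assms(2)
  by (induction I rule: infinite_finite_induct) (simp_all add: Ck_on_const Ck_on_add[OF assms(1)])

lemma Ck_on_mult:
  fixes f g :: "'a::euclidean_space \<Rightarrow> real"
  assumes "open S" "Ck_on k f S" "Ck_on k g S"
  shows "Ck_on k (\<lambda>x. f x * g x) S"
  using assms(2,3)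
proof (induction k arbitrary: f g)
  case (Suc k)
  show ?case
  proof (rule Ck_onI[OF assms(1)])
    show "((\<lambda>x. f x * g x) has_derivative
        (\<lambda>v. f x * frechet_derivative g (at x) v + frechet_derivative f (at x) v * g x)) (at x)"
      if "x \<in> S" for x
      using Suc.prems that by (intro has_derivative_mult Ck_on_SucD(1))
    show "Ck_on k (\<lambda>x. f x * frechet_derivative g (at x) v + frechet_derivative f (at x) v * g x) S" for v
      using Suc.prems assms(1)
      by (intro Ck_on_add Suc.IH Ck_on_SucD(2) Ck_on_Suc_imp[of k f] Ck_on_Suc_imp[of k g])
  qed
qed (auto intro: continuous_on_mult)

text \<open>The derivative of \<open>1 / f\<close> is built from \<open>1 / f\<close> and a
  derivative of \<open>f\<close> by multiplication, which allows an induction on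
  \<open>k\<close>; likewise for the square root.\<close>

lemma Ck_on_inverse:
  fixes f :: "'a::euclidean_space \<Rightarrow> real"
  assumes "open S" "Ck_on k f S" "\<And>x. x \<in> S \<Longrightarrow> f x \<noteq> 0"
  shows "Ck_on k (\<lambda>x. inverse (f x)) S"
  using assms(2)
proof (induction k)
  case (Suc k)
  show ?case
  proof (rule Ck_onI[OF assms(1)])
    show "((\<lambda>x. inverse (f x)) has_derivative
        (\<lambda>v. - 1 * (inverse (f x) * frechet_derivative f (at x) v * inverse (f x)))) (at x)"
      if "x \<in> S" for x
      using Deriv.has_derivative_inverse[OF assms(3)[OF that] Ck_on_SucD(1)[OF Suc.prems that]] by simp
    show "Ck_on k (\<lambda>x. - 1 * (inverse (f x) * frechet_derivative f (at x) v * inverse (f x))) S" for v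
      using Suc.prems assms(1)
      by (intro Ck_on_mult Ck_on_const Ck_on_SucD(2)[of k f S v] Suc.IH Ck_on_Suc_imp[of k f])
  qed
qed (use assms(3) in \<open>auto intro: continuous_on_inverse\<close>)

lemma Ck_on_sqrt:
  fixes f :: "'a::euclidean_space \<Rightarrow> real"
  assumes "open S" "Ck_on k f S" "\<And>x. x \<in> S \<Longrightarrow> 0 < f x"
  shows "Ck_on k (\<lambda>x. sqrt (f x)) S"
  using assms(2)
proof (induction k)
  case (Suc k)
  show ?case
  proof (rule Ck_onI[OF assms(1)])
    show "((\<lambda>x. sqrt (f x)) has_derivative
        (\<lambda>v. frechet_derivative f (at x) v * (inverse (sqrt (f x)) * (1 / 2)))) (at x)" if "x \<in> S" for x
      using has_derivative_real_sqrt[OF assms(3)[OF that] Ck_on_SucD(1)[OF Suc.prems that]]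
      by simp
    show "Ck_on k (\<lambda>x. frechet_derivative f (at x) v * (inverse (sqrt (f x)) * (1 / 2))) S" for v
      using Suc.prems assms(1)
    proof (intro Ck_on_mult Ck_on_inverse Ck_on_const Ck_on_SucD(2)[of k f S v] Suc.IH Ck_on_Suc_imp[of k f])
      show "sqrt (f x) \<noteq> 0" if "x \<in> S" for x using assms(3)[OF that] by simp
    qed
  qed
qed (auto intro: continuous_on_real_sqrt)

lemma smooth_on_Ck: "smooth_on f S \<Longrightarrow> Ck_on k f S"
  by (simp add: smooth_on_def)

lemma smooth_on_subset: "smooth_on f S \<Longrightarrow> T \<subseteq> S \<Longrightarrow> smooth_on f T"
  unfolding smooth_on_def using Ck_on_subset by blast

lemma smooth_on_cong: "open S \<Longrightarrow> (\<And>x. x \<in> S \<Longrightarrow> f x = g x) \<Longrightarrow> smooth_on f S \<Longrightarrow> smooth_on g S"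
  unfolding smooth_on_def using Ck_on_cong by blast

lemma smooth_on_locally:
  "(\<And>x. x \<in> S \<Longrightarrow> \<exists>U. open U \<and> x \<in> U \<and> smooth_on f U) \<Longrightarrow> smooth_on f S"
  unfolding smooth_on_def by (intro allI Ck_on_locally) metis

lemma smooth_on_const: "smooth_on (\<lambda>x. c) S"
  by (simp add: smooth_on_def Ck_on_const)

lemma smooth_on_linear: "bounded_linear f \<Longrightarrow> open S \<Longrightarrow> smooth_on f S"
  by (simp add: smooth_on_def Ck_on_linear)

lemma smooth_on_add: "open S \<Longrightarrow> smooth_on f S \<Longrightarrow> smooth_on g S \<Longrightarrow> smooth_on (\<lambda>x. f x + g x) S"
  by (simp add: smooth_on_def Ck_on_add)

lemma smooth_on_mult:
  fixes f g :: "'a::euclidean_space \<Rightarrow> real"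
  shows "open S \<Longrightarrow> smooth_on f S \<Longrightarrow> smooth_on g S \<Longrightarrow> smooth_on (\<lambda>x. f x * g x) S"
  by (simp add: smooth_on_def Ck_on_mult)

lemma smooth_on_diff:
  fixes f g :: "'a::euclidean_space \<Rightarrow> real"
  assumes "open S" "smooth_on f S" "smooth_on g S"
  shows "smooth_on (\<lambda>x. f x - g x) S"
  using smooth_on_add[OF assms(1,2) smooth_on_mult[OF assms(1) smooth_on_const[of "-1"] assms(3)]] by simp

lemma smooth_on_sum:
  assumes "open S" "\<And>i. i \<in> I \<Longrightarrow> smooth_on (f i) S"
  shows "smooth_on (\<lambda>x. \<Sum>i\<in>I. f i x) S"
  using assms(2)
  by (induction I rule: infinite_finite_induct) (auto intro: smooth_on_const smooth_on_add assms(1))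

lemma smooth_on_prod:
  fixes f :: "'i \<Rightarrow> 'a::euclidean_space \<Rightarrow> real"
  assumes "open S" "\<And>i. i \<in> I \<Longrightarrow> smooth_on (f i) S"
  shows "smooth_on (\<lambda>x. \<Prod>i\<in>I. f i x) S"
  using assms(2)
  by (induction I rule: infinite_finite_induct) (auto intro: smooth_on_const smooth_on_mult assms(1))

lemma smooth_on_inverse:
  fixes f :: "'a::euclidean_space \<Rightarrow> real"
  shows "open S \<Longrightarrow> smooth_on f S \<Longrightarrow> (\<And>x. x \<in> S \<Longrightarrow> f x \<noteq> 0) \<Longrightarrow> smooth_on (\<lambda>x. inverse (f x)) S"
  by (simp add: smooth_on_def Ck_on_inverse)

lemma smooth_on_divide:
  fixes f g :: "'a::euclidean_space \<Rightarrow> real"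
  shows "open S \<Longrightarrow> smooth_on f S \<Longrightarrow> smooth_on g S \<Longrightarrow> (\<And>x. x \<in> S \<Longrightarrow> g x \<noteq> 0) \<Longrightarrow>
    smooth_on (\<lambda>x. f x / g x) S"
  unfolding divide_inverse by (intro smooth_on_mult smooth_on_inverse)

lemma smooth_on_sqrt:
  fixes f :: "'a::euclidean_space \<Rightarrow> real"
  shows "open S \<Longrightarrow> smooth_on f S \<Longrightarrow> (\<And>x. x \<in> S \<Longrightarrow> 0 < f x) \<Longrightarrow> smooth_on (\<lambda>x. sqrt (f x)) S"
  by (simp add: smooth_on_def Ck_on_sqrt)

lemma smooth_on_derivative: "smooth_on f S \<Longrightarrow> smooth_on (\<lambda>x. frechet_derivative f (at x) v) S"
  unfolding smooth_on_def by (metis Ck_on_SucD(2))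

lemma smooth_on_has_derivative:
  "smooth_on f S \<Longrightarrow> x \<in> S \<Longrightarrow> (f has_derivative frechet_derivative f (at x)) (at x)"
  unfolding smooth_on_def by (metis Ck_on_SucD(1))

lemma smooth_on_continuous: "smooth_on f S \<Longrightarrow> continuous_on S f"
  using smooth_on_Ck[of f S 0] by simp

text \<open>By the chain rule a directional derivative of \<open>f \<circ> g\<close> is a sum of products of a partial
  derivative of \<open>f\<close> at \<open>g x\<close> with a component of a derivative of \<open>g\<close>, so that the regularity of
  the composition follows by induction from that of products.\<close>

lemma Ck_on_compose:
  fixes f :: "'b::euclidean_space \<Rightarrow> real" and g :: "'a::euclidean_space \<Rightarrow> 'b"
  assumes S: "open S" and T: "open T" and g: "smooth_on g S" and img: "g ` S \<subseteq> T"
    and f: "Ck_on k f T"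
  shows "Ck_on k (\<lambda>x. f (g x)) S"
  using f
proof (induction k arbitrary: f)
  case 0
  thus ?case
    using continuous_on_compose2[OF _ smooth_on_continuous[OF g] img, of f] by simp
next
  case (Suc k)
  let ?F = "\<lambda>x v. \<Sum>b\<in>Basis. frechet_derivative f (at (g x)) b * (frechet_derivative g (at x) v \<bullet> b)"
  show ?case
  proof (rule Ck_onI[OF S])
    fix x assume x: "x \<in> S"
    have gx: "g x \<in> T" using img x by blast
    note Df = Ck_on_SucD(1)[OF Suc.prems gx]
    have chain: "((\<lambda>x. f (g x)) has_derivative (\<lambda>v. frechet_derivative f (at (g x)) (frechet_derivative g (at x) v))) (at x)"
      using has_derivative_compose[OF smooth_on_has_derivative[OF g x] Df] .
    have expand: "frechet_derivative f (at (g x)) w = (\<Sum>b\<in>Basis. frechet_derivative f (at (g x)) b * (w \<bullet> b))" for w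
    proof -
      interpret bounded_linear "frechet_derivative f (at (g x))" by (rule has_derivative_bounded_linear[OF Df])
      have "frechet_derivative f (at (g x)) (\<Sum>b\<in>Basis. (w \<bullet> b) *\<^sub>R b)
          = (\<Sum>b\<in>Basis. frechet_derivative f (at (g x)) b * (w \<bullet> b))"
        by (simp add: sum scaleR mult.commute)
      thus ?thesis by (simp add: euclidean_representation)
    qed
    have "(\<lambda>v. frechet_derivative f (at (g x)) (frechet_derivative g (at x) v)) = ?F x"
      by (rule ext) (rule expand)
    with chain show "((\<lambda>x. f (g x)) has_derivative ?F x) (at x)" by (simp only:)
  next
    fix v
    have "Ck_on k (\<lambda>x. frechet_derivative f (at (g x)) b * (frechet_derivative g (at x) v \<bullet> b)) S" for b
      by (intro Ck_on_mult[OF S] Suc.IH Ck_on_SucD(2)[OF Suc.prems]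
          Ck_on_compose_linear[OF bounded_linear_inner_left S] smooth_on_Ck smooth_on_derivative g)
    thus "Ck_on k (\<lambda>x. ?F x v) S" by (rule Ck_on_sum[OF S])
  qed
qed

lemma smooth_on_compose:
  fixes f :: "'b::euclidean_space \<Rightarrow> real" and g :: "'a::euclidean_space \<Rightarrow> 'b"
  assumes "open S" "open T" "smooth_on g S" "g ` S \<subseteq> T" "smooth_on f T"
  shows "smooth_on (\<lambda>x. f (g x)) S"
  using Ck_on_compose[OF assms(1-4)] assms(5) by (simp add: smooth_on_def)

lemma frechet_derivative_zero_open:
  fixes f :: "'a::euclidean_space \<Rightarrow> real"
  assumes "open W" "x \<in> W" "\<And>y. y \<in> W \<Longrightarrow> f y = 0"
  shows "frechet_derivative f (at x) = (\<lambda>v. 0)"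
proof -
  have "(f has_derivative (\<lambda>v. 0)) (at x)"
    by (rule has_derivative_transform_within_open[OF _ assms(1,2), of "\<lambda>y. 0"]) (use assms(3) in auto)
  from frechet_derivative_at[OF this] show ?thesis by simp
qed

subsection \<open>A flat function\<close>

text \<open>The function \<open>exp (- 1 / t)\<close> for positive \<open>t\<close>, extended by
  zero. The factor \<open>1 / t ^ m\<close> makes the family closed under differentiation up to
  linear combinations.\<close>

definition flat :: "nat \<Rightarrow> real \<Rightarrow> real" where
  "flat m t = (if t \<le> 0 then 0 else exp (- 1 / t) / t ^ m)"

lemma flat_pos: "0 < t \<Longrightarrow> 0 < flat m t"
  and flat_zero: "t \<le> 0 \<Longrightarrow> flat m t = 0"
  and flat_nonneg: "0 \<le> flat m t"
  by (auto simp: flat_def)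

text \<open>A single term of the exponential series at \<open>1 / t\<close> beats the pole. A
  quadratic bound is what makes the derivative at \<open>0\<close> vanish.\<close>

lemma flat_bound: "flat m t \<le> fact (m + 2) * t\<^sup>2"
proof (cases "t \<le> 0")
  case False
  hence t: "0 < t" by simp
  define c :: real where "c = fact (m + 2)"
  have c: "c > 0" by (simp add: c_def)
  have "(1 / t) ^ (m + 2) /\<^sub>R c \<le> exp (1 / t)"
    using sums_le[OF _ sums_finite[of "{m + 2}" "\<lambda>n. if n = m + 2 then (1/t) ^ n /\<^sub>R fact n else 0"]
        exp_converges[of "1/t"]] t unfolding c_def by simp
  hence "1 \<le> c * exp (1 / t) * t ^ (m + 2)" using t c by (simp add: field_simps)
  hence "exp (- (1 / t)) * 1 \<le> exp (- (1 / t)) * (c * exp (1 / t) * t ^ (m + 2))"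
    by (intro mult_left_mono) auto
  also have "\<dots> = c * t ^ (m + 2)" by (simp add: exp_minus field_simps)
  finally have "exp (- 1 / t) / t ^ m \<le> c * t ^ (m + 2) / t ^ m"
    using t by (intro divide_right_mono) auto
  also have "\<dots> = c * t\<^sup>2" using t by (simp add: power_add power2_eq_square)
  finally show ?thesis using t unfolding c_def by (simp add: flat_def)
qed (simp add: flat_zero)

lemma flat_has_derivative:
  "(flat m has_field_derivative flat (m + 2) t - real m * flat (m + 1) t) (at t)"
proof -
  consider "t < 0" | "t = 0" | "t > 0" by linarith
  thus ?thesis
  proof cases
    case 1
    have "((\<lambda>x. 0) has_field_derivative 0) (at t)" by simp
    hence "(flat m has_field_derivative 0) (at t)"
      by (rule DERIV_cong_ev[THEN iffD1, rotated 3])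
        (use 1 in \<open>auto simp: flat_zero intro!: eventually_mono[OF eventually_nhds_in_open[of "{..<0}"]]\<close>)
    thus ?thesis using 1 by (simp add: flat_zero)
  next
    case 2
    have "(\<lambda>h. (flat m h - flat m 0) / h) \<midarrow>0\<rightarrow> 0"
    proof (rule Lim_null_comparison)
      show "\<forall>\<^sub>F h in at 0. norm ((flat m h - flat m 0) / h) \<le> fact (m + 2) * \<bar>h\<bar>"
      proof (rule always_eventually, rule allI)
        fix h :: real
        have "\<bar>flat m h\<bar> \<le> fact (m + 2) * \<bar>h\<bar> * \<bar>h\<bar>"
          using flat_bound[of m h] flat_nonneg[of m h] by (simp add: power2_eq_square mult.assoc)
        thus "norm ((flat m h - flat m 0) / h) \<le> fact (m + 2) * \<bar>h\<bar>"
          by (cases "h = 0") (simp_all add: flat_zero field_simps)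
      qed
      show "((\<lambda>h. fact (m + 2) * \<bar>h\<bar>) \<longlongrightarrow> (0::real)) (at 0)"
        by (auto intro!: tendsto_eq_intros)
    qed
    thus ?thesis using 2 by (simp add: DERIV_def flat_zero)
  next
    case 3
    have "((\<lambda>x. exp (- 1 / x) / x ^ m) has_field_derivative
        exp (- 1 / t) / t ^ (m + 2) - real m * (exp (- 1 / t) / t ^ (m + 1))) (at t)"
    proof (induction m)
      case 0
      show ?case using 3 by (auto intro!: derivative_eq_intros simp: power2_eq_square)
    next
      case (Suc m)
      have "((\<lambda>x. exp (- 1 / x) / x ^ m * inverse x) has_field_derivative
          exp (- 1 / t) / t ^ m * - (inverse t ^ Suc (Suc 0)) +
          (exp (- 1 / t) / t ^ (m + 2) - real m * (exp (- 1 / t) / t ^ (m + 1))) * inverse t) (at t)"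
        using 3 by (intro DERIV_mult' Suc.IH DERIV_inverse) simp
      moreover have "e / p * - (inverse t ^ Suc (Suc 0)) + (e / (p * (t * t)) - real m * (e / (p * t))) * inverse t
          = e / (p * (t * t * t)) - real (Suc m) * (e / (p * (t * t)))" if "p \<noteq> 0" for e p :: real
        using that 3 by (simp add: field_simps)
      from this[of "t ^ m" "exp (- 1 / t)"] have
        "exp (- 1 / t) / t ^ m * - (inverse t ^ Suc (Suc 0)) +
          (exp (- 1 / t) / t ^ (m + 2) - real m * (exp (- 1 / t) / t ^ (m + 1))) * inverse t
        = exp (- 1 / t) / t ^ (Suc m + 2) - real (Suc m) * (exp (- 1 / t) / t ^ (Suc m + 1))"
        using 3 by (simp add: power_add ac_simps)
      moreover have "(\<lambda>x::real. exp (- 1 / x) / x ^ m * inverse x) = (\<lambda>x. exp (- 1 / x) / x ^ Suc m)"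
        by (rule ext) (simp add: inverse_eq_divide mult.commute)
      ultimately show ?case by simp
    qed
    hence "(flat m has_field_derivative exp (- 1 / t) / t ^ (m + 2) - real m * (exp (- 1 / t) / t ^ (m + 1))) (at t)"
      by (rule DERIV_cong_ev[THEN iffD1, rotated 3])
        (use 3 in \<open>auto simp: flat_def intro!: eventually_mono[OF eventually_nhds_in_open[of "{0<..}"]]\<close>)
    thus ?thesis using 3 by (simp add: flat_def)
  qed
qed

text \<open>By \<open>flat_has_derivative\<close> differentiation leads to other members of the
  family, whence the induction on \<open>k\<close> for all \<open>m\<close> at once.\<close>

lemma Ck_on_flat:
  fixes q :: "'a::euclidean_space \<Rightarrow> real"
  assumes S: "open S" and q: "smooth_on q S"
  shows "Ck_on k (\<lambda>x. flat m (q x)) S"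
proof (induction k arbitrary: m)
  case 0
  have "isCont (flat m) t" for t using flat_has_derivative DERIV_isCont by blast
  hence "continuous_on UNIV (flat m)" by (simp add: continuous_at_imp_continuous_on)
  thus ?case
    using continuous_on_compose2[OF _ smooth_on_continuous[OF q], of UNIV "flat m"] by simp
next
  case (Suc k)
  show ?case
  proof (rule Ck_onI[OF S])
    fix x assume x: "x \<in> S"
    show "((\<lambda>x. flat m (q x)) has_derivative
      (\<lambda>v. (flat (m + 2) (q x) + (- real m) * flat (m + 1) (q x)) * frechet_derivative q (at x) v)) (at x)"
      using has_derivative_compose[OF smooth_on_has_derivative[OF q x]
          flat_has_derivative[unfolded has_field_derivative_def]] by simp
  next
    show "Ck_on k (\<lambda>x. (flat (m + 2) (q x) + (- real m) * flat (m + 1) (q x)) * frechet_derivative q (at x) v) S" for v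
      by (intro Ck_on_mult[OF S] Ck_on_add[OF S] Ck_on_const Suc.IH smooth_on_Ck smooth_on_derivative q)
  qed
qed

lemma smooth_on_flat:
  fixes q :: "'a::euclidean_space \<Rightarrow> real"
  shows "open S \<Longrightarrow> smooth_on q S \<Longrightarrow> smooth_on (\<lambda>x. flat m (q x)) S"
  by (simp add: smooth_on_def Ck_on_flat)

section \<open>Change of variables for an arbitrary finite index type\<close>

text \<open>The formula \<open>has_absolute_integral_change_of_variables\<close> concerns index
  types that carry a well-order. To transfer it to \<open>real ^ 'n\<close>, coordinates are
  renumbered by a copy of the first \<open>CARD('n)\<close> natural numbers.\<close>

typedef 'n::finite coord = "{..<CARD('n)}"
  morphisms coord_nat nat_coord
  by (rule exI[of _ 0]) simp

instance coord :: (finite) finite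
proof
  have "range (coord_nat :: 'a coord \<Rightarrow> nat) \<subseteq> {..<CARD('a)}" using coord_nat by blast
  hence "finite (range (coord_nat :: 'a coord \<Rightarrow> nat))" using finite_subset by blast
  thus "finite (UNIV :: 'a coord set)"
    by (rule finite_imageD) (simp add: inj_on_def coord_nat_inject)
qed

instantiation coord :: (finite) wellorder
begin

definition less_eq_coord :: "'a coord \<Rightarrow> 'a coord \<Rightarrow> bool" where
  "less_eq_coord i j \<longleftrightarrow> coord_nat i \<le> coord_nat j"

definition less_coord :: "'a coord \<Rightarrow> 'a coord \<Rightarrow> bool" where
  "less_coord i j \<longleftrightarrow> coord_nat i < coord_nat j"

instance
proof
  fix P :: "'a coord \<Rightarrow> bool" and a :: "'a coord"
  assume step: "\<And>x. (\<And>y. y < x \<Longrightarrow> P y) \<Longrightarrow> P x"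
  show "P a"
  proof (induction "coord_nat a" arbitrary: a rule: less_induct)
    case less
    show ?case by (rule step) (use less in \<open>simp add: less_coord_def\<close>)
  qed
qed (auto simp: less_eq_coord_def less_coord_def coord_nat_inject)

end

lemma CARD_coord: "CARD('n::finite coord) = CARD('n)"
  using type_definition.card[OF type_definition_coord[where 'n = 'n]] by simp

lemma ex_coord_bij: "\<exists>r :: 'n::finite coord \<Rightarrow> 'n. bij r"
  using CARD_coord[where 'n = 'n] by (intro finite_same_card_bij) auto

text \<open>Conjugation by \<open>r\<close> matches the permutations of the two index types and
  keeps their signs.\<close>

lemma det_renumber:
  fixes A :: "real ^ 'n::finite ^ 'n" and r :: "'m::finite \<Rightarrow> 'n"
  assumes r: "bij r"
  shows "det (\<chi> i j. A $ r i $ r j) = det A"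
proof -
  have bb: "bij_betw (map_permutation UNIV r) {p. p permutes UNIV} {p. p permutes (UNIV :: 'n set)}"
  proof (rule bij_betw_byWitness[where f' = "map_permutation UNIV (inv r)"])
    have r': "bij (inv r)" using r by (rule bij_imp_bij_inv)
    show "\<forall>p\<in>{p. p permutes UNIV}. map_permutation UNIV (inv r) (map_permutation UNIV r p) = p"
      using map_permutation_compose_inv[OF r] r by (auto simp: bij_is_inj)
    show "\<forall>p\<in>{p. p permutes UNIV}. map_permutation UNIV r (map_permutation UNIV (inv r) p) = p"
      using map_permutation_compose_inv[OF r'] r by (auto simp: bij_is_surj surj_f_inv_f)
    show "map_permutation UNIV r ` {p. p permutes UNIV} \<subseteq> {p. p permutes UNIV}"
      using map_permutation_permutes[OF r] by blast
    show "map_permutation UNIV (inv r) ` {p. p permutes UNIV} \<subseteq> {p. p permutes UNIV}"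
      using map_permutation_permutes[OF r'] by blast
  qed
  have "det A = (\<Sum>q | q permutes (UNIV :: 'n set). of_int (sign q) * (\<Prod>i\<in>UNIV. A $ i $ q i))"
    by (simp add: det_def)
  also have "\<dots> = (\<Sum>p | p permutes (UNIV :: 'm set). of_int (sign (map_permutation UNIV r p)) *
      (\<Prod>i\<in>UNIV. A $ i $ map_permutation UNIV r p i))"
    by (rule sum.reindex_bij_betw[OF bb, symmetric])
  also have "\<dots> = (\<Sum>p | p permutes (UNIV :: 'm set). of_int (sign p) * (\<Prod>i\<in>UNIV. A $ r i $ r (p i)))"
  proof (rule sum.cong[OF refl])
    fix p :: "'m \<Rightarrow> 'm" assume "p \<in> {p. p permutes UNIV}"
    hence p: "p permutes UNIV" by simp
    have "(\<Prod>i\<in>UNIV. A $ i $ map_permutation UNIV r p i)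
        = (\<Prod>i\<in>UNIV. A $ r i $ map_permutation UNIV r p (r i))"
      by (rule prod.reindex_bij_betw[OF r, symmetric])
    also have "\<dots> = (\<Prod>i\<in>UNIV. A $ r i $ r (p i))"
      using r by (simp add: map_permutation_apply bij_is_inj)
    finally show "of_int (sign (map_permutation UNIV r p)) * (\<Prod>i\<in>UNIV. A $ i $ map_permutation UNIV r p i)
        = of_int (sign p) * (\<Prod>i\<in>UNIV. A $ r i $ r (p i))"
      using sign_map_permutation[of r UNIV p] r p by (simp add: bij_is_inj)
  qed
  finally show ?thesis by (simp add: det_def)
qed

lemma prod_Basis_cart:
  fixes v :: "real ^ 'n::finite"
  shows "(\<Prod>b\<in>Basis. v \<bullet> b) = (\<Prod>i\<in>UNIV. v $ i)"
  by (simp add: Basis_vec_def cart_eq_inner_axis axis_eq_axis prod.UNION_disjoint)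

lemma lborel_renumber:
  fixes r :: "'m::finite \<Rightarrow> 'n::finite"
  assumes r: "bij r"
  shows "distr lborel borel (\<lambda>x. (\<chi> i. x $ inv r i) :: real ^ 'n) = (lborel :: (real ^ 'n) measure)"
proof (rule lborel_eqI[symmetric])
  let ?f = "\<lambda>x :: real ^ 'm. (\<chi> i. x $ inv r i) :: real ^ 'n"
  have meas: "?f \<in> borel_measurable borel"
    by (intro borel_measurable_continuous_onI continuous_on_vec_lambda continuous_intros)
  fix l u :: "real ^ 'n" assume le: "\<And>b. b \<in> Basis \<Longrightarrow> l \<bullet> b \<le> u \<bullet> b"
  let ?l = "(\<chi> j. l $ r j) :: real ^ 'm" and ?u = "(\<chi> j. u $ r j) :: real ^ 'm"
  have le': "l $ i \<le> u $ i" for i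
    using le[of "axis i 1"] by (simp add: cart_eq_inner_axis)
  have inv: "inv r (r j) = j" "r (inv r i) = i" for i j
    using r by (simp_all add: bij_is_inj bij_is_surj surj_f_inv_f)
  have "?f -` box l u = box ?l ?u"
    unfolding mem_box_cart set_eq_iff by (auto simp: mem_box_cart) (metis inv)+
  hence "emeasure (distr lborel borel ?f) (box l u) = emeasure lborel (box ?l ?u)"
    using meas by (simp add: emeasure_distr)
  also have "\<dots> = (\<Prod>b\<in>Basis. (?u - ?l) \<bullet> b)"
    using le' by (intro emeasure_lborel_box) (auto simp: Basis_vec_def cart_eq_inner_axis[symmetric])
  also have "(\<Prod>b\<in>Basis. (?u - ?l) \<bullet> b) = (\<Prod>j\<in>UNIV. (u - l) $ r j)"
    by (subst prod_Basis_cart) simp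
  also have "\<dots> = (\<Prod>i\<in>UNIV. (u - l) $ i)" by (rule prod.reindex_bij_betw[OF r])
  also have "\<dots> = (\<Prod>b\<in>Basis. (u - l) \<bullet> b)" by (rule prod_Basis_cart[symmetric])
  finally show "emeasure (distr lborel borel ?f) (box l u) = (\<Prod>b\<in>Basis. (u - l) \<bullet> b)" .
qed simp

lemma change_of_variables_wellorder:
  fixes f :: "real ^ 'm::{finite,wellorder} \<Rightarrow> real" and g :: "real ^ 'm::_ \<Rightarrow> real ^ 'm::_"
  assumes "S \<in> sets lebesgue" "\<And>x. x \<in> S \<Longrightarrow> (g has_derivative g' x) (at x within S)" "inj_on g S"
  shows "(\<lambda>x. \<bar>det (matrix (g' x))\<bar> * f (g x)) absolutely_integrable_on S \<and>
      integral S (\<lambda>x. \<bar>det (matrix (g' x))\<bar> * f (g x)) = b \<longleftrightarrow>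
    f absolutely_integrable_on (g ` S) \<and> integral (g ` S) f = b"
  using has_absolute_integral_change_of_variables[OF assms, of "\<lambda>x. vec (f x) :: real ^ 1" "vec b"]
  by (simp add: absolutely_integrable_on_1_iff integral_on_1_eq vec_eq_iff)

lemma absolutely_integrable_on_nonneg_iff:
  fixes h :: "'a::euclidean_space \<Rightarrow> real"
  assumes h: "(\<lambda>x. indicator S x * h x) \<in> borel_measurable borel" "\<And>x. x \<in> S \<Longrightarrow> 0 \<le> h x"
  shows "h absolutely_integrable_on S \<longleftrightarrow> (\<integral>\<^sup>+x. ennreal (indicator S x * h x) \<partial>lborel) < \<infinity>"
    and "h absolutely_integrable_on S \<Longrightarrow>
      (\<integral>\<^sup>+x. ennreal (indicator S x * h x) \<partial>lborel) = ennreal (integral S h)"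
proof -
  have nn: "0 \<le> indicator S x * h x" for x using h(2) by (auto simp: indicator_def)
  have iff: "h absolutely_integrable_on S \<longleftrightarrow> integrable lborel (\<lambda>x. indicator S x * h x)"
    unfolding set_integrable_def using h(1) by (simp add: integrable_completion)
  have "integrable lborel (\<lambda>x. indicator S x * h x) \<longleftrightarrow>
      (\<integral>\<^sup>+x. ennreal (indicator S x * h x) \<partial>lborel) < \<infinity>"
    using h(1) nn by (subst integrable_iff_bounded) simp
  thus "h absolutely_integrable_on S \<longleftrightarrow> (\<integral>\<^sup>+x. ennreal (indicator S x * h x) \<partial>lborel) < \<infinity>"
    using iff by simp
  assume abs: "h absolutely_integrable_on S"
  have "integral S h = (LINT x:S|lebesgue. h x)"
    using set_lebesgue_integral_eq_integral(2)[OF abs] by simp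
  also have "\<dots> = (LINT x|lborel. indicator S x * h x)"
    unfolding set_lebesgue_integral_def using h(1) by (simp add: integral_completion)
  finally show "(\<integral>\<^sup>+x. ennreal (indicator S x * h x) \<partial>lborel) = ennreal (integral S h)"
    using nn_integral_eq_integral[of lborel "\<lambda>x. indicator S x * h x"] abs iff nn by simp
qed

text \<open>Integrability is transferred together with the value, so if one side is infinite,
  then so is the other.\<close>

lemma nn_integral_change_of_variables_wellorder:
  fixes f :: "real ^ 'm::{finite,wellorder} \<Rightarrow> real" and g :: "real ^ 'm::_ \<Rightarrow> real ^ 'm::_"
  assumes S: "S \<in> sets borel" and der: "\<And>x. x \<in> S \<Longrightarrow> (g has_derivative g' x) (at x within S)"
    and inj: "inj_on g S" and nn: "\<And>y. y \<in> g ` S \<Longrightarrow> 0 \<le> f y"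
    and meas: "(\<lambda>y. indicator (g ` S) y * f y) \<in> borel_measurable borel"
      "(\<lambda>x. indicator S x * (\<bar>det (matrix (g' x))\<bar> * f (g x))) \<in> borel_measurable borel"
  shows "(\<integral>\<^sup>+y. ennreal (indicator (g ` S) y * f y) \<partial>lborel) =
    (\<integral>\<^sup>+x. ennreal (indicator S x * (\<bar>det (matrix (g' x))\<bar> * f (g x))) \<partial>lborel)"
proof -
  let ?F = "\<lambda>x. \<bar>det (matrix (g' x))\<bar> * f (g x)"
  have S': "S \<in> sets lebesgue" using S by simp
  have nn': "0 \<le> ?F x" if "x \<in> S" for x using nn that by simp
  note F = absolutely_integrable_on_nonneg_iff[OF meas(2) nn']
  note f = absolutely_integrable_on_nonneg_iff[OF meas(1) nn]
  note cov = change_of_variables_wellorder[OF S' der inj, where f = f]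
  show ?thesis
  proof (cases "f absolutely_integrable_on (g ` S)")
    case True
    hence "?F absolutely_integrable_on S" "integral S ?F = integral (g ` S) f"
      using cov[of "integral (g ` S) f"] by auto
    thus ?thesis using F(2) f(2) True by simp
  next
    case False
    hence "\<not> ?F absolutely_integrable_on S" using cov[of "integral S ?F"] by auto
    thus ?thesis using F(1) f(1) False by (simp add: less_top[symmetric])
  qed
qed

theorem nn_integral_change_of_variables:
  fixes f :: "real ^ 'n::finite \<Rightarrow> real" and g :: "real ^ 'n \<Rightarrow> real ^ 'n"
  assumes S: "S \<in> sets borel" and der: "\<And>x. x \<in> S \<Longrightarrow> (g has_derivative g' x) (at x within S)"
    and inj: "inj_on g S" and nn: "\<And>y. y \<in> g ` S \<Longrightarrow> 0 \<le> f y"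
    and meas: "(\<lambda>y. indicator (g ` S) y * f y) \<in> borel_measurable borel"
      "(\<lambda>x. indicator S x * (\<bar>det (matrix (g' x))\<bar> * f (g x))) \<in> borel_measurable borel"
  shows "(\<integral>\<^sup>+y. ennreal (indicator (g ` S) y * f y) \<partial>lborel) =
    (\<integral>\<^sup>+x. ennreal (indicator S x * (\<bar>det (matrix (g' x))\<bar> * f (g x))) \<partial>lborel)"
proof -
  obtain r :: "'n coord \<Rightarrow> 'n" where r: "bij r" using ex_coord_bij by blast
  define P :: "real ^ 'n \<Rightarrow> real ^ 'n coord" where "P x = (\<chi> j. x $ r j)" for x
  define Q :: "real ^ 'n coord \<Rightarrow> real ^ 'n" where "Q y = (\<chi> i. y $ inv r i)" for y
  have inv: "inv r (r j) = j" "r (inv r i) = i" for i j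
    using r by (simp_all add: bij_is_inj bij_is_surj surj_f_inv_f)
  have PQ [simp]: "P (Q y) = y" and QP [simp]: "Q (P x) = x" for x y
    by (simp_all add: P_def Q_def vec_eq_iff inv)
  have linP: "linear P" and linQ: "linear Q"
    by (auto intro!: linearI simp: P_def Q_def vec_eq_iff)
  have blP: "bounded_linear P" and blQ: "bounded_linear Q"
    using linP linQ by (simp_all add: linear_conv_bounded_linear)
  have measQ [measurable]: "Q \<in> borel_measurable borel" and measP [measurable]: "P \<in> borel_measurable borel"
    using linear_continuous_on[OF blQ] linear_continuous_on[OF blP]
    by (simp_all add: borel_measurable_continuous_onI)
  have pres: "(\<integral>\<^sup>+x. H x \<partial>lborel) = (\<integral>\<^sup>+y. H (Q y) \<partial>lborel)" if "H \<in> borel_measurable borel" for H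
  proof -
    have "(\<integral>\<^sup>+x. H x \<partial>lborel) = (\<integral>\<^sup>+x. H x \<partial>distr lborel borel Q)"
      using lborel_renumber[OF r] by (simp add: Q_def[abs_def])
    thus ?thesis using that by (simp add: nn_integral_distr)
  qed
  define S' where "S' = Q -` S"
  define h where "h = P \<circ> g \<circ> Q"
  define h' where "h' y = P \<circ> g' (Q y) \<circ> Q" for y
  have S': "S' \<in> sets borel" using S measurable_sets[OF measQ, of S] by (simp add: S'_def)
  have hS: "h ` S' = Q -` (g ` S)"
  proof (intro equalityI subsetI)
    fix z assume "z \<in> Q -` (g ` S)"
    then obtain x where x: "x \<in> S" "Q z = g x" by auto
    hence "z = h (P x)" by (metis PQ QP comp_apply h_def)
    moreover have "P x \<in> S'" using x by (simp add: S'_def)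
    ultimately show "z \<in> h ` S'" by blast
  qed (auto simp: h_def S'_def)
  have det_h: "det (matrix (h' y)) = det (matrix (g' (Q y)))" if y: "y \<in> S'" for y
  proof -
    have lin: "linear (g' (Q y))"
      using der[of "Q y"] y has_derivative_linear by (auto simp: S'_def)
    have "Q (axis j 1) = axis (r j) 1" for j
      by (simp add: Q_def axis_def vec_eq_iff) (metis inv)
    hence "matrix (h' y) = (\<chi> i j. matrix (g' (Q y)) $ r i $ r j)"
      by (simp add: matrix_def h'_def P_def)
    thus ?thesis using det_renumber[OF r] by simp
  qed
  have "(\<integral>\<^sup>+y. ennreal (indicator (g ` S) y * f y) \<partial>lborel)
      = (\<integral>\<^sup>+y. ennreal (indicator (h ` S') y * f (Q y)) \<partial>lborel)"
    using meas(1) by (subst pres) (simp_all add: hS indicator_def)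
  also have "\<dots> = (\<integral>\<^sup>+x. ennreal (indicator S' x * (\<bar>det (matrix (h' x))\<bar> * f (Q (h x)))) \<partial>lborel)"
  proof (rule nn_integral_change_of_variables_wellorder[OF S'])
    show "(h has_derivative h' y) (at y within S')" if "y \<in> S'" for y
    proof -
      have 1: "(Q has_derivative Q) (at y within S')"
        by (rule bounded_linear_imp_has_derivative[OF blQ])
      have 2: "(g has_derivative g' (Q y)) (at (Q y) within Q ` S')"
        by (rule has_derivative_subset[OF der]) (use that in \<open>auto simp: S'_def\<close>)
      have "(g \<circ> Q has_derivative g' (Q y) \<circ> Q) (at y within S')"
        by (rule diff_chain_within[OF 1 2])
      from bounded_linear.has_derivative[OF blP this]
      show ?thesis by (simp add: h_def h'_def o_def)
    qed
    show "inj_on h S'"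
    proof (rule inj_onI)
      fix x y assume xy: "x \<in> S'" "y \<in> S'" "h x = h y"
      hence "g (Q x) = g (Q y)" by (metis QP comp_apply h_def)
      hence "Q x = Q y" using inj xy by (auto simp: S'_def dest: inj_onD)
      thus "x = y" by (metis PQ)
    qed
    show "0 \<le> f (Q z)" if "z \<in> h ` S'" for z using that nn by (simp add: hS)
    have "(\<lambda>y. indicator (g ` S) (Q y) * f (Q y)) \<in> borel_measurable borel"
      using measurable_compose[OF measQ meas(1)] by simp
    thus "(\<lambda>y. indicator (h ` S') y * f (Q y)) \<in> borel_measurable borel"
      by (simp add: hS indicator_def)
    have "(\<lambda>y. indicator S (Q y) * (\<bar>det (matrix (g' (Q y)))\<bar> * f (g (Q y)))) \<in> borel_measurable borel"
      using measurable_compose[OF measQ meas(2)] by simp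
    moreover have "(\<lambda>y. indicator S (Q y) * (\<bar>det (matrix (g' (Q y)))\<bar> * f (g (Q y)))) =
        (\<lambda>x. indicator S' x * (\<bar>det (matrix (h' x))\<bar> * f (Q (h x))))"
      using det_h by (auto simp: fun_eq_iff indicator_def S'_def h_def)
    ultimately show "(\<lambda>x. indicator S' x * (\<bar>det (matrix (h' x))\<bar> * f (Q (h x)))) \<in> borel_measurable borel"
      by simp
  qed
  also have "\<dots> = (\<integral>\<^sup>+y. ennreal (indicator S (Q y) * (\<bar>det (matrix (g' (Q y)))\<bar> * f (g (Q y)))) \<partial>lborel)"
    using det_h by (intro nn_integral_cong) (auto simp: indicator_def S'_def h_def)
  also have "\<dots> = (\<integral>\<^sup>+x. ennreal (indicator S x * (\<bar>det (matrix (g' x))\<bar> * f (g x))) \<partial>lborel)"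
    using meas(2) by (subst pres) simp_all
  finally show ?thesis .
qed

section \<open>Integration in Euclidean space\<close>

text \<open>The integral of \<open>h (x + t v)\<close> does not depend on \<open>t\<close>; differentiation at \<open>t = 0\<close> under the
  integral sign gives the claim.\<close>

lemma integral_directional_derivative_eq_0:
  fixes h :: "'a::euclidean_space \<Rightarrow> real"
  assumes der: "\<And>x. (h has_derivative h' x) (at x)" and cont: "continuous_on UNIV (\<lambda>x. h' x v)"
    and K: "compact K" and supp: "\<And>x. x \<notin> K \<Longrightarrow> h x = 0"
  shows "(\<integral>x. h' x v \<partial>lborel) = 0"
proof -
  obtain R where "\<forall>x\<in>K. norm x \<le> R"
    using compact_imp_bounded[OF K] by (auto simp: bounded_iff)
  hence R: "K \<subseteq> cball 0 R" by auto
  let ?L = "R + norm v"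
  have "compact ((\<lambda>x. h' x v) ` cball 0 (?L + norm v))"
    by (intro compact_continuous_image continuous_on_subset[OF cont]) auto
  then obtain B where B: "\<And>x. x \<in> cball 0 (?L + norm v) \<Longrightarrow> \<bar>h' x v\<bar> \<le> B"
    using compact_imp_bounded bounded_iff by (metis image_eqI real_norm_def)
  have hcont: "continuous_on UNIV h"
    using der has_derivative_continuous by (fastforce intro: continuous_at_imp_continuous_on)
  have [measurable]: "h \<in> borel_measurable borel" using hcont by (rule borel_measurable_continuous_onI)
  have [measurable]: "(\<lambda>x. h' x v) \<in> borel_measurable borel" using cont by (rule borel_measurable_continuous_onI)
  have "integrable lborel (\<lambda>x. indicator K x *\<^sub>R h x)"
    by (rule borel_integrable_compact[OF K continuous_on_subset[OF hcont]]) simp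
  moreover have "(\<lambda>x. indicator K x *\<^sub>R h x) = h" using supp by (auto simp: fun_eq_iff indicator_def)
  ultimately have int_h: "integrable lborel h" by simp
  have shift: "integrable lborel (\<lambda>x. h (x + c))" "(\<integral>x. h (x + c) \<partial>lborel) = (\<integral>x. h x \<partial>lborel)" for c
  proof -
    have "integrable (distr lborel borel ((+) c)) h" using int_h by (simp add: lborel_distr_plus)
    thus "integrable lborel (\<lambda>x. h (x + c))" by (subst (asm) integrable_distr_eq) (auto simp: add.commute)
    have "(\<integral>x. h x \<partial>lborel) = (\<integral>x. h x \<partial>distr lborel borel ((+) c))" by (simp add: lborel_distr_plus)
    also have "\<dots> = (\<integral>x. h (c + x) \<partial>lborel)" by (subst integral_distr) auto
    finally show "(\<integral>x. h (x + c) \<partial>lborel) = (\<integral>x. h x \<partial>lborel)" by (simp add: add.commute)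
  qed
  define s where "s n = 1 / real (Suc n)" for n
  have s: "0 < s n" "s n \<le> 1" for n by (auto simp: s_def)
  define q where "q n x = (h (x + s n *\<^sub>R v) - h x) / s n" for n x
  have line: "((\<lambda>t. h (x + t *\<^sub>R v)) has_real_derivative h' (x + t *\<^sub>R v) v) (at t)" for x t
  proof -
    have "((\<lambda>t. x + t *\<^sub>R v) has_derivative (\<lambda>t. t *\<^sub>R v)) (at t)"
      by (auto intro!: derivative_eq_intros)
    from has_derivative_compose[OF this der]
    have "((\<lambda>t. h (x + t *\<^sub>R v)) has_derivative (\<lambda>\<tau>. h' (x + t *\<^sub>R v) (\<tau> *\<^sub>R v))) (at t)" .
    moreover have "h' (x + t *\<^sub>R v) (\<tau> *\<^sub>R v) = h' (x + t *\<^sub>R v) v * \<tau>" for \<tau>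
      using linear_scale[OF has_derivative_linear[OF der]] by simp
    ultimately show ?thesis by (simp add: has_field_derivative_def)
  qed
  have "(\<lambda>n. \<integral>x. q n x \<partial>lborel) \<longlonglongrightarrow> (\<integral>x. h' x v \<partial>lborel)"
  proof (rule integral_dominated_convergence)
    show "integrable lborel (\<lambda>x. indicator (cball 0 ?L) x *\<^sub>R B)"
      by (rule borel_integrable_compact) auto
    show "AE x in lborel. (\<lambda>n. q n x) \<longlonglongrightarrow> h' x v"
    proof (rule AE_I2)
      fix x
      have "((\<lambda>t. (h (x + t *\<^sub>R v) - h x) / t) \<longlongrightarrow> h' x v) (at 0)"
        using line[of x 0] by (simp add: DERIV_def)
      moreover have "filterlim s (at 0) sequentially"
      proof (rule filterlim_atI)
        show "s \<longlonglongrightarrow> 0" unfolding s_def using LIMSEQ_Suc[OF lim_1_over_n] by simp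
        show "\<forall>\<^sub>F n in sequentially. s n \<noteq> 0" using s(1) by (simp add: less_imp_neq[symmetric])
      qed
      ultimately show "(\<lambda>n. q n x) \<longlonglongrightarrow> h' x v"
        unfolding q_def by (rule filterlim_compose)
    qed
    show "AE x in lborel. norm (q n x) \<le> indicator (cball 0 ?L) x *\<^sub>R B" for n
    proof (rule AE_I2)
      fix x
      show "norm (q n x) \<le> indicator (cball 0 ?L) x *\<^sub>R B"
      proof (cases "norm x \<le> ?L")
        case False
        have "norm x \<le> norm (x + s n *\<^sub>R v) + norm v"
        proof -
          have "norm x \<le> norm (x + s n *\<^sub>R v) + norm (s n *\<^sub>R v)"
            by (metis add_diff_cancel_right' norm_triangle_ineq4)
          moreover have "norm (s n *\<^sub>R v) \<le> norm v" using s[of n] by (simp add: mult_left_le_one_le)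
          ultimately show ?thesis by linarith
        qed
        hence "norm (x + s n *\<^sub>R v) > R" using False by linarith
        hence "x + s n *\<^sub>R v \<notin> K" using R by auto
        moreover have "norm x > R" using False norm_ge_zero[of v] by linarith
        hence "x \<notin> K" using R by auto
        ultimately have "q n x = 0" using supp by (simp add: q_def)
        thus ?thesis using False by simp
      next
        case True
        obtain t where t: "0 < t" "t < s n" "h (x + s n *\<^sub>R v) - h (x + 0 *\<^sub>R v) = (s n - 0) * h' (x + t *\<^sub>R v) v"
          using MVT2[of 0 "s n" "\<lambda>t. h (x + t *\<^sub>R v)" "\<lambda>t. h' (x + t *\<^sub>R v) v"] s line by blast
        hence "q n x = h' (x + t *\<^sub>R v) v" using s[of n] by (simp add: q_def)
        moreover have "norm (x + t *\<^sub>R v) \<le> ?L + norm v"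
        proof -
          have "norm (t *\<^sub>R v) \<le> norm v" using t s(2)[of n] by (simp add: mult_left_le_one_le)
          thus ?thesis using True norm_triangle_ineq[of x "t *\<^sub>R v"] by linarith
        qed
        ultimately show ?thesis using B[of "x + t *\<^sub>R v"] True by simp
      qed
    qed
  qed (auto simp: q_def)
  moreover have "(\<integral>x. q n x \<partial>lborel) = 0" for n
    unfolding q_def using shift[of "s n *\<^sub>R v"] int_h by simp
  ultimately show ?thesis using LIMSEQ_unique[OF tendsto_const] by fastforce
qed

lemma nn_integral_continuous_compact:
  fixes f :: "'a::euclidean_space \<Rightarrow> real"
  assumes S: "compact S" "continuous_on S f" "\<And>x. x \<in> S \<Longrightarrow> 0 \<le> f x"
  shows "(\<integral>\<^sup>+x. ennreal (indicator S x * f x) \<partial>lborel) = ennreal (integral S f)"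
proof -
  have int: "integrable lborel (\<lambda>x. indicator S x * f x)"
    using borel_integrable_compact[OF S(1,2)] by simp
  have "(\<integral>\<^sup>+x. ennreal (indicator S x * f x) \<partial>lborel) = ennreal (\<integral>x. indicator S x * f x \<partial>lborel)"
    using S(3) by (intro nn_integral_eq_integral[OF int] AE_I2) (auto simp: indicator_def)
  also have "(\<integral>x. indicator S x * f x \<partial>lborel) = integral S f"
    using set_borel_integral_eq_integral(2)[of S f] int
    by (simp add: set_integrable_def set_lebesgue_integral_def)
  finally show ?thesis .
qed

lemma integrable_on_continuous_compact:
  fixes f :: "'a::euclidean_space \<Rightarrow> real"
  assumes S: "compact S" "continuous_on S f"
  shows "f integrable_on S"
  using set_borel_integral_eq_integral(1)[of S f] borel_integrable_compact[OF S]
  by (simp add: set_integrable_def)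

lemma nn_integral_affine_le:
  fixes H :: "'a::euclidean_space \<Rightarrow> ennreal"
  assumes [measurable]: "H \<in> borel_measurable borel" and c: "1 / 2 \<le> c"
  shows "(\<integral>\<^sup>+x. H (s + c *\<^sub>R x) \<partial>lborel) \<le> ennreal (2 ^ DIM('a)) * (\<integral>\<^sup>+x. H x \<partial>lborel)"
proof -
  have c0: "c \<noteq> 0" using c by simp
  have "(\<integral>\<^sup>+x. H x \<partial>lborel) = (\<integral>\<^sup>+x. H x \<partial>density (distr lborel borel (\<lambda>x. s + c *\<^sub>R x)) (\<lambda>_. \<bar>c\<bar> ^ DIM('a)))"
    using lborel_affine[OF c0, of s] by simp
  also have "\<dots> = ennreal (\<bar>c\<bar> ^ DIM('a)) * (\<integral>\<^sup>+x. H (s + c *\<^sub>R x) \<partial>lborel)"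
    by (simp add: nn_integral_density nn_integral_distr nn_integral_cmult)
  finally have eq: "(\<integral>\<^sup>+x. H x \<partial>lborel) = ennreal (\<bar>c\<bar> ^ DIM('a)) * (\<integral>\<^sup>+x. H (s + c *\<^sub>R x) \<partial>lborel)" .
  have "1 \<le> (2 * \<bar>c\<bar>) ^ DIM('a)" using c by (intro one_le_power) auto
  hence "1 \<le> ennreal (2 ^ DIM('a)) * ennreal (\<bar>c\<bar> ^ DIM('a))"
  proof -
    assume "1 \<le> (2 * \<bar>c\<bar>) ^ DIM('a)"
    hence "ennreal 1 \<le> ennreal ((2 * \<bar>c\<bar>) ^ DIM('a))" by (rule ennreal_leI)
    also have "\<dots> = ennreal (2 ^ DIM('a)) * ennreal (\<bar>c\<bar> ^ DIM('a))"
      unfolding power_mult_distrib by (rule ennreal_mult) auto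
    finally show ?thesis by simp
  qed
  hence "1 * (\<integral>\<^sup>+x. H (s + c *\<^sub>R x) \<partial>lborel)
      \<le> ennreal (2 ^ DIM('a)) * ennreal (\<bar>c\<bar> ^ DIM('a)) * (\<integral>\<^sup>+x. H (s + c *\<^sub>R x) \<partial>lborel)"
    by (rule mult_right_mono) simp
  thus ?thesis by (simp add: eq mult.assoc)
qed

text \<open>The function \<open>g\<close> is a continuous majorant of the squared Euclidean
  length of the gradient of \<open>u\<close>. On a Riemannian manifold a multiple of
  \<open>\<langle>\<nabla>u, \<nabla>u\<rangle>\<close> will serve.\<close>

definition gradient_bound :: "'a::euclidean_space set \<Rightarrow> ('a \<Rightarrow> real) \<Rightarrow> ('a \<Rightarrow> real) \<Rightarrow> bool" where
  "gradient_bound Q u g \<longleftrightarrow> continuous_on Q g \<and>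
     (\<exists>u'. (\<forall>x\<in>Q. (u has_derivative u' x) (at x)) \<and> (\<forall>w. continuous_on Q (\<lambda>x. u' x w)) \<and>
       (\<forall>x\<in>Q. \<forall>w. (u' x w)\<^sup>2 \<le> g x * (norm w)\<^sup>2))"

lemma gradient_bound_subset: "gradient_bound Q u g \<Longrightarrow> R \<subseteq> Q \<Longrightarrow> gradient_bound R u g"
  unfolding gradient_bound_def by (meson continuous_on_subset subsetD)

lemma gradient_bound_continuous: "gradient_bound Q u g \<Longrightarrow> continuous_on Q u"
  unfolding gradient_bound_def
  by (meson continuous_at_imp_continuous_on has_derivative_continuous)

lemma gradient_bound_nonneg:
  assumes "gradient_bound Q u g" "x \<in> Q"
  shows "0 \<le> g x"
proof -
  obtain b :: 'a where "b \<in> Basis" using nonempty_Basis by blast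
  moreover from this have "norm b = 1" by simp
  ultimately show ?thesis
    using assms unfolding gradient_bound_def by (metis mult.right_neutral one_power2 zero_le_power2 order_trans)
qed

text \<open>The increment of \<open>u\<close> is the mean of the derivative \<open>p\<close>
  along the segment, and the square of a mean is at most the mean of the squares.\<close>

lemma segment_estimate:
  fixes u g :: "'a::euclidean_space \<Rightarrow> real"
  assumes Q: "convex Q" and u: "gradient_bound Q u g" and xy: "x \<in> Q" "y \<in> Q" and d: "norm (x - y) \<le> d"
  shows "ennreal ((u x - u y)\<^sup>2) \<le> ennreal (d\<^sup>2) * (\<integral>\<^sup>+t. ennreal (indicator {0..1} t * g (y + t *\<^sub>R (x - y))) \<partial>lborel)"
proof -
  obtain u' where u': "\<And>z. z \<in> Q \<Longrightarrow> (u has_derivative u' z) (at z)" "\<And>w. continuous_on Q (\<lambda>z. u' z w)"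
    "\<And>z w. z \<in> Q \<Longrightarrow> (u' z w)\<^sup>2 \<le> g z * (norm w)\<^sup>2" and g: "continuous_on Q g"
    using u unfolding gradient_bound_def by blast
  define c where "c t = y + t *\<^sub>R (x - y)" for t
  have cQ: "c t \<in> Q" if "t \<in> {0..1}" for t
  proof -
    have "c t = (1 - t) *\<^sub>R y + t *\<^sub>R x" by (simp add: c_def algebra_simps)
    thus ?thesis using convexD_alt[OF Q xy(2,1), of t] that by simp
  qed
  have cc: "continuous_on {0..1} c" unfolding c_def by (intro continuous_intros)
  define p where "p t = u' (c t) (x - y)" for t
  have pc: "continuous_on {0..1} p"
    unfolding p_def using continuous_on_compose2[OF u'(2) cc] cQ by blast
  have gc: "continuous_on {0..1} (\<lambda>t. g (c t))" using continuous_on_compose2[OF g cc] cQ by blast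
  have "((\<lambda>t. u (c t)) has_vector_derivative p t) (at t within {0..1})" if t: "t \<in> {0..1}" for t
  proof -
    have "(c has_derivative (\<lambda>\<tau>. \<tau> *\<^sub>R (x - y))) (at t within {0..1})"
      unfolding c_def by (auto intro!: derivative_eq_intros)
    from has_derivative_compose[OF this u'(1)[OF cQ[OF t]]]
    have "((\<lambda>t. u (c t)) has_derivative (\<lambda>\<tau>. u' (c t) (\<tau> *\<^sub>R (x - y)))) (at t within {0..1})" .
    moreover have "u' (c t) (\<tau> *\<^sub>R (x - y)) = \<tau> *\<^sub>R p t" for \<tau>
      using linear_scale[OF has_derivative_linear[OF u'(1)[OF cQ[OF t]]]] by (simp add: p_def)
    ultimately show ?thesis by (simp add: has_vector_derivative_def)
  qed
  from fundamental_theorem_of_calculus[OF _ this]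
  have ftc: "(p has_integral (u x - u y)) {0..1}" by (simp add: c_def)
  define D where "D = u x - u y"
  have p2: "(\<lambda>t. (p t)\<^sup>2) integrable_on {0..1}"
    by (rule integrable_on_continuous_compact) (auto intro!: continuous_intros pc)
  have "0 \<le> integral {0..1} (\<lambda>t. (p t - D)\<^sup>2)"
    by (rule integral_nonneg) (auto intro!: integrable_on_continuous_compact continuous_intros pc)
  also have "(\<lambda>t. (p t - D)\<^sup>2) = (\<lambda>t. (p t)\<^sup>2 - 2 * D * p t + D\<^sup>2)"
    by (simp add: fun_eq_iff power2_diff algebra_simps)
  also have "integral {0..1} (\<lambda>t. (p t)\<^sup>2 - 2 * D * p t + D\<^sup>2) = integral {0..1} (\<lambda>t. (p t)\<^sup>2) - 2 * D * D + D\<^sup>2"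
  proof (rule integral_unique)
    have "((\<lambda>t. (p t)\<^sup>2 - 2 * D * p t + D\<^sup>2) has_integral
        (integral {0..1} (\<lambda>t. (p t)\<^sup>2) - 2 * D * D + measure lborel {0..1::real} *\<^sub>R D\<^sup>2)) {0..1}"
      using has_integral_const_real[of "D\<^sup>2" 0 1]
      by (intro has_integral_add has_integral_diff integrable_integral[OF p2] has_integral_mult_right)
        (use ftc in \<open>simp_all add: D_def\<close>)
    thus "((\<lambda>t. (p t)\<^sup>2 - 2 * D * p t + D\<^sup>2) has_integral
        (integral {0..1} (\<lambda>t. (p t)\<^sup>2) - 2 * D * D + D\<^sup>2)) {0..1}" by simp
  qed
  finally have "D\<^sup>2 \<le> integral {0..1} (\<lambda>t. (p t)\<^sup>2)" by (simp add: power2_eq_square)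
  also have "\<dots> \<le> integral {0..1} (\<lambda>t. d\<^sup>2 * g (c t))"
  proof (rule integral_le[OF p2])
    show "(\<lambda>t. d\<^sup>2 * g (c t)) integrable_on {0..1}"
      by (rule integrable_on_continuous_compact) (auto intro!: continuous_intros gc)
    fix t :: real assume t: "t \<in> {0..1}"
    have "(p t)\<^sup>2 \<le> g (c t) * (norm (x - y))\<^sup>2" unfolding p_def by (rule u'(3)[OF cQ[OF t]])
    also have "\<dots> \<le> g (c t) * d\<^sup>2"
      using d gradient_bound_nonneg[OF u cQ[OF t]] by (intro mult_left_mono power_mono) auto
    finally show "(p t)\<^sup>2 \<le> d\<^sup>2 * g (c t)" by (simp add: mult.commute)
  qed
  also have "\<dots> = d\<^sup>2 * integral {0..1} (\<lambda>t. g (c t))" by simp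
  finally have "ennreal (D\<^sup>2) \<le> ennreal (d\<^sup>2) * ennreal (integral {0..1} (\<lambda>t. g (c t)))"
    by (simp add: ennreal_mult'[symmetric] ennreal_leI)
  also have "ennreal (integral {0..1} (\<lambda>t. g (c t)))
      = (\<integral>\<^sup>+t. ennreal (indicator {0..1} t * g (c t)) \<partial>lborel)"
    by (rule nn_integral_continuous_compact[symmetric])
      (use gc gradient_bound_nonneg[OF u cQ] in auto)
  finally show ?thesis by (simp add: D_def c_def)
qed

text \<open>Poincare's inequality. The integral of \<open>(u x - u y)\<^sup>2\<close> over all
  \<open>x\<close> and \<open>y\<close> in \<open>Q\<close> is twice the difference of the two
  terms without \<open>g\<close>. The integrand is estimated along the segment from
  \<open>y\<close> to \<open>x\<close>. For fixed \<open>t\<close>, the point of the segment at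
  the parameter \<open>t\<close> depends on \<open>x\<close> by a dilation with factor
  \<open>t\<close> and on \<open>y\<close> by one with factor \<open>1 - t\<close>. Substituting
  for \<open>x\<close> if \<open>t \<ge> 1 / 2\<close>, and for \<open>y\<close> otherwise, costs
  at most the factor \<open>2 ^ DIM('a)\<close>.\<close>

theorem poincare_convex:
  fixes u g :: "'a::euclidean_space \<Rightarrow> real"
  assumes Q: "compact Q" "convex Q" and u: "gradient_bound Q u g"
    and d: "\<And>x y. x \<in> Q \<Longrightarrow> y \<in> Q \<Longrightarrow> norm (x - y) \<le> d"
  shows "measure lborel Q * integral Q (\<lambda>x. (u x)\<^sup>2)
    \<le> (integral Q u)\<^sup>2 + 2 ^ DIM('a) * d\<^sup>2 * measure lborel Q * integral Q g"
proof -
  let ?m = "measure lborel Q" and ?n = "2 ^ DIM('a) :: real"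
  define A where "A = integral Q (\<lambda>x. (u x)\<^sup>2)"
  define B where "B = integral Q u"
  define I where "I = integral Q g"
  note uc = gradient_bound_continuous[OF u]
  have gc: "continuous_on Q g" using u by (simp add: gradient_bound_def)
  have g0: "0 \<le> g x" if "x \<in> Q" for x using gradient_bound_nonneg[OF u that] .
  have [measurable]: "Q \<in> sets borel" using Q(1) by (simp add: compact_imp_closed borel_closed)
  have Qfin: "emeasure lborel Q < \<infinity>" using emeasure_bounded_finite[OF compact_imp_bounded[OF Q(1)]] .
  have hi: "((\<lambda>x. (u x)\<^sup>2) has_integral A) Q" "(u has_integral B) Q"
    unfolding A_def B_def
    by (auto intro!: integrable_integral integrable_on_continuous_compact Q continuous_intros uc)
  have hc: "((\<lambda>x. c) has_integral ?m * c) Q" for c :: real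
  proof -
    have "(1::real) * c = c" by simp
    have "((\<lambda>x. 1) has_integral ?m) Q"
      using has_integral_measure_lborel[of Q] Qfin by simp
    from has_integral_mult_left[OF this, of c] show ?thesis by simp
  qed
  define GQ where "GQ z = ennreal (indicator Q z * g z)" for z
  have "(\<lambda>z. indicator Q z *\<^sub>R g z) \<in> borel_measurable borel"
    by (rule borel_measurable_continuous_on_indicator[OF _ gc]) measurable
  hence [measurable]: "GQ \<in> borel_measurable borel" unfolding GQ_def[abs_def] by simp
  have GQ_int: "(\<integral>\<^sup>+z. GQ z \<partial>lborel) = ennreal I"
    unfolding GQ_def I_def by (rule nn_integral_continuous_compact[OF Q(1) gc g0])
  have I0: "0 \<le> I" unfolding I_def using g0 integrable_on_continuous_compact[OF Q(1) gc] by (intro integral_nonneg) auto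
  have inner: "(\<integral>\<^sup>+x. ennreal (indicator Q x * (u x - u y)\<^sup>2) \<partial>lborel) = ennreal (A - 2 * u y * B + ?m * (u y)\<^sup>2)" for y
  proof -
    have "((\<lambda>x. (u x)\<^sup>2 - 2 * u y * u x + (u y)\<^sup>2) has_integral (A - 2 * u y * B + ?m * (u y)\<^sup>2)) Q"
      by (intro has_integral_add has_integral_diff has_integral_mult_right hi hc)
    moreover have "(\<lambda>x. (u x)\<^sup>2 - 2 * u y * u x + (u y)\<^sup>2) = (\<lambda>x. (u x - u y)\<^sup>2)"
      by (simp add: fun_eq_iff power2_diff algebra_simps)
    ultimately have "integral Q (\<lambda>x. (u x - u y)\<^sup>2) = A - 2 * u y * B + ?m * (u y)\<^sup>2"
      by (simp add: integral_unique)
    moreover have "(\<integral>\<^sup>+x. ennreal (indicator Q x * (u x - u y)\<^sup>2) \<partial>lborel) = ennreal (integral Q (\<lambda>x. (u x - u y)\<^sup>2))"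
      by (rule nn_integral_continuous_compact[OF Q(1)]) (auto intro!: continuous_intros uc)
    ultimately show ?thesis by simp
  qed
  have pos: "0 \<le> A - 2 * u y * B + ?m * (u y)\<^sup>2" for y
  proof -
    have "((\<lambda>x. (u x)\<^sup>2 - 2 * u y * u x + (u y)\<^sup>2) has_integral (A - 2 * u y * B + ?m * (u y)\<^sup>2)) Q"
      by (intro has_integral_add has_integral_diff has_integral_mult_right hi hc)
    moreover have "(\<lambda>x. (u x)\<^sup>2 - 2 * u y * u x + (u y)\<^sup>2) = (\<lambda>x. (u x - u y)\<^sup>2)"
      by (simp add: fun_eq_iff power2_diff algebra_simps)
    ultimately have "((\<lambda>x. (u x - u y)\<^sup>2) has_integral (A - 2 * u y * B + ?m * (u y)\<^sup>2)) Q"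
      by simp
    thus ?thesis by (rule has_integral_nonneg) simp
  qed
  have outer: "(\<integral>\<^sup>+y. ennreal (indicator Q y * (A - 2 * u y * B + ?m * (u y)\<^sup>2)) \<partial>lborel)
      = ennreal (2 * (?m * A - B\<^sup>2))"
  proof -
    have "((\<lambda>y. A - 2 * B * u y + ?m * (u y)\<^sup>2) has_integral (?m * A - 2 * B * B + ?m * A)) Q"
      by (intro has_integral_add has_integral_diff has_integral_mult_right hi hc)
    moreover have "(\<lambda>y. A - 2 * B * u y + ?m * (u y)\<^sup>2) = (\<lambda>y. A - 2 * u y * B + ?m * (u y)\<^sup>2)"
      by (simp add: fun_eq_iff mult.commute mult.left_commute)
    ultimately have "integral Q (\<lambda>y. A - 2 * u y * B + ?m * (u y)\<^sup>2) = ?m * A - 2 * B * B + ?m * A"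
      by (simp add: integral_unique)
    also have "\<dots> = 2 * (?m * A - B\<^sup>2)" by (simp add: power2_eq_square)
    finally have "integral Q (\<lambda>y. A - 2 * u y * B + ?m * (u y)\<^sup>2) = 2 * (?m * A - B\<^sup>2)" .
    moreover have "(\<integral>\<^sup>+y. ennreal (indicator Q y * (A - 2 * u y * B + ?m * (u y)\<^sup>2)) \<partial>lborel)
      = ennreal (integral Q (\<lambda>y. A - 2 * u y * B + ?m * (u y)\<^sup>2))"
      by (rule nn_integral_continuous_compact[OF Q(1)]) (auto intro!: continuous_intros uc pos)
    ultimately show ?thesis by simp
  qed
  define F where "F t x y = (indicator {0..1} t :: ennreal) * indicator Q x * indicator Q y * GQ (y + t *\<^sub>R (x - y))" for t :: real and x y
  have [measurable]: "(\<lambda>(x, t). F t x y) \<in> borel_measurable (lborel \<Otimes>\<^sub>M lborel)" for y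
    unfolding F_def by measurable
  have [measurable]: "(\<lambda>(y, x). F t x y) \<in> borel_measurable (lborel \<Otimes>\<^sub>M lborel)" for t
    unfolding F_def by measurable
  have [measurable]: "(\<lambda>(y, t). \<integral>\<^sup>+x. F t x y \<partial>lborel) \<in> borel_measurable (lborel \<Otimes>\<^sub>M lborel)"
    unfolding F_def by measurable
  have [measurable]: "(\<lambda>t. F t x y) \<in> borel_measurable lborel" for x y
    unfolding F_def by measurable
  have "ennreal (2 * (?m * A - B\<^sup>2)) = (\<integral>\<^sup>+y. \<integral>\<^sup>+x. indicator Q y * ennreal (indicator Q x * (u x - u y)\<^sup>2) \<partial>lborel \<partial>lborel)"
  proof -
    have "(\<lambda>x. indicator Q x *\<^sub>R u x) \<in> borel_measurable borel"
      by (rule borel_measurable_continuous_on_indicator[OF _ uc]) measurable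
    hence [measurable]: "(\<lambda>x. indicator Q x * u x) \<in> borel_measurable borel" by simp
    have "(\<lambda>x. ennreal (indicator Q x * (u x - u y)\<^sup>2)) = (\<lambda>x. ennreal (indicator Q x * (indicator Q x * u x - u y)\<^sup>2))" for y
      by (auto simp: fun_eq_iff indicator_def)
    hence "(\<lambda>x. ennreal (indicator Q x * (u x - u y)\<^sup>2)) \<in> borel_measurable borel" for y by simp
    hence "(\<integral>\<^sup>+x. indicator Q y * ennreal (indicator Q x * (u x - u y)\<^sup>2) \<partial>lborel)
        = indicator Q y * (\<integral>\<^sup>+x. ennreal (indicator Q x * (u x - u y)\<^sup>2) \<partial>lborel)" for y
      by (intro nn_integral_cmult) simp
    also have "\<dots> y = ennreal (indicator Q y * (A - 2 * u y * B + ?m * (u y)\<^sup>2))" for y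
      unfolding inner using pos[of y] by (simp add: indicator_def)
    finally show ?thesis using outer by simp
  qed
  also have "\<dots> \<le> (\<integral>\<^sup>+y. \<integral>\<^sup>+x. ennreal (d\<^sup>2) * (\<integral>\<^sup>+t. F t x y \<partial>lborel) \<partial>lborel \<partial>lborel)"
  proof (intro nn_integral_mono)
    fix x y
    show "indicator Q y * ennreal (indicator Q x * (u x - u y)\<^sup>2) \<le> ennreal (d\<^sup>2) * (\<integral>\<^sup>+t. F t x y \<partial>lborel)"
    proof (cases "x \<in> Q \<and> y \<in> Q")
      case True
      have "y + t *\<^sub>R (x - y) \<in> Q" if "t \<in> {0..1}" for t
        using convexD_alt[OF Q(2), of y x t] True that by (simp add: algebra_simps)
      hence "(\<integral>\<^sup>+t. F t x y \<partial>lborel) = (\<integral>\<^sup>+t. ennreal (indicator {0..1} t * g (y + t *\<^sub>R (x - y))) \<partial>lborel)"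
        using True by (intro nn_integral_cong) (auto simp: F_def GQ_def indicator_def)
      thus ?thesis using segment_estimate[OF Q(2) u, of x y d] d[of x y] True by simp
    qed auto
  qed
  also have "\<dots> = ennreal (d\<^sup>2) * (\<integral>\<^sup>+y. \<integral>\<^sup>+x. \<integral>\<^sup>+t. F t x y \<partial>lborel \<partial>lborel \<partial>lborel)"
  proof -
    have [measurable]: "(\<lambda>x. \<integral>\<^sup>+t. F t x y \<partial>lborel) \<in> borel_measurable lborel" for y
      unfolding F_def by measurable
    have [measurable]: "(\<lambda>y. \<integral>\<^sup>+x. \<integral>\<^sup>+t. F t x y \<partial>lborel \<partial>lborel) \<in> borel_measurable lborel"
      unfolding F_def by measurable
    show ?thesis by (simp add: nn_integral_cmult)
  qed
  also have "(\<integral>\<^sup>+y. \<integral>\<^sup>+x. \<integral>\<^sup>+t. F t x y \<partial>lborel \<partial>lborel \<partial>lborel)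
      = (\<integral>\<^sup>+y. \<integral>\<^sup>+t. \<integral>\<^sup>+x. F t x y \<partial>lborel \<partial>lborel \<partial>lborel)"
    by (intro nn_integral_cong lborel_pair.Fubini'[symmetric]) measurable
  also have "\<dots> = (\<integral>\<^sup>+t. \<integral>\<^sup>+y. \<integral>\<^sup>+x. F t x y \<partial>lborel \<partial>lborel \<partial>lborel)"
    by (rule lborel_pair.Fubini'[symmetric]) measurable
  also have "\<dots> \<le> (\<integral>\<^sup>+(t::real). indicator {0..1} t * (ennreal ?n * ennreal I * ennreal ?m) \<partial>lborel)"
  proof (rule nn_integral_mono)
    fix t :: real
    show "(\<integral>\<^sup>+y. \<integral>\<^sup>+x. F t x y \<partial>lborel \<partial>lborel) \<le> indicator {0..1} t * (ennreal ?n * ennreal I * ennreal ?m)"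
    proof (cases "t \<in> {0..1}")
      case t: True
      have mQ: "(\<integral>\<^sup>+y. ennreal ?n * ennreal I * indicator Q y \<partial>lborel) = ennreal ?n * ennreal I * ennreal ?m"
        using Qfin by (simp add: nn_integral_cmult emeasure_eq_ennreal_measure less_top)
      show ?thesis
      proof (cases "t \<ge> 1/2")
        case True
        have "(\<integral>\<^sup>+x. F t x y \<partial>lborel) \<le> ennreal ?n * ennreal I * indicator Q y" for y
        proof -
          have "(\<integral>\<^sup>+x. F t x y \<partial>lborel) \<le> (\<integral>\<^sup>+x. indicator Q y * GQ ((1 - t) *\<^sub>R y + t *\<^sub>R x) \<partial>lborel)"
            by (intro nn_integral_mono) (auto simp: F_def indicator_def algebra_simps)
          also have "\<dots> = indicator Q y * (\<integral>\<^sup>+x. GQ ((1 - t) *\<^sub>R y + t *\<^sub>R x) \<partial>lborel)"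
            by (rule nn_integral_cmult) measurable
          also have "\<dots> \<le> indicator Q y * (ennreal ?n * (\<integral>\<^sup>+x. GQ x \<partial>lborel))"
            by (intro mult_left_mono nn_integral_affine_le True) auto
          finally show ?thesis by (simp add: GQ_int mult.commute mult.left_commute)
        qed
        hence "(\<integral>\<^sup>+y. \<integral>\<^sup>+x. F t x y \<partial>lborel \<partial>lborel) \<le> (\<integral>\<^sup>+y. ennreal ?n * ennreal I * indicator Q y \<partial>lborel)"
          by (intro nn_integral_mono)
        thus ?thesis using mQ t by simp
      next
        case False
        have "(\<integral>\<^sup>+y. F t x y \<partial>lborel) \<le> ennreal ?n * ennreal I * indicator Q x" for x
        proof -
          have "(\<integral>\<^sup>+y. F t x y \<partial>lborel) \<le> (\<integral>\<^sup>+y. indicator Q x * GQ (t *\<^sub>R x + (1 - t) *\<^sub>R y) \<partial>lborel)"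
            by (intro nn_integral_mono) (auto simp: F_def indicator_def algebra_simps)
          also have "\<dots> = indicator Q x * (\<integral>\<^sup>+y. GQ (t *\<^sub>R x + (1 - t) *\<^sub>R y) \<partial>lborel)"
            by (rule nn_integral_cmult) measurable
          also have "\<dots> \<le> indicator Q x * (ennreal ?n * (\<integral>\<^sup>+x. GQ x \<partial>lborel))"
            using False by (intro mult_left_mono nn_integral_affine_le) auto
          finally show ?thesis by (simp add: GQ_int mult.commute mult.left_commute)
        qed
        hence "(\<integral>\<^sup>+x. \<integral>\<^sup>+y. F t x y \<partial>lborel \<partial>lborel) \<le> (\<integral>\<^sup>+y. ennreal ?n * ennreal I * indicator Q y \<partial>lborel)"
          by (intro nn_integral_mono)
        moreover have "(\<integral>\<^sup>+y. \<integral>\<^sup>+x. F t x y \<partial>lborel \<partial>lborel) = (\<integral>\<^sup>+x. \<integral>\<^sup>+y. F t x y \<partial>lborel \<partial>lborel)"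
          by (rule lborel_pair.Fubini'[symmetric]) measurable
        ultimately show ?thesis using mQ t by simp
      qed
    qed (simp add: F_def)
  qed
  also have "\<dots> = ennreal ?n * ennreal I * ennreal ?m"
    by (simp add: nn_integral_multc)
  finally have "ennreal (2 * (?m * A - B\<^sup>2)) \<le> ennreal (d\<^sup>2) * (ennreal ?n * ennreal I * ennreal ?m)"
    by (simp add: mult_left_mono)
  also have "\<dots> = ennreal (d\<^sup>2 * (?n * I * ?m))"
    using I0 by (simp add: ennreal_mult[symmetric] del: ennreal_power)
  finally have "2 * (?m * A - B\<^sup>2) \<le> d\<^sup>2 * (?n * I * ?m)"
    using I0 by simp
  moreover have "0 \<le> d\<^sup>2 * (?n * I * ?m)" using I0 by simp
  moreover have "a \<le> b" if "2 * a \<le> b" "0 \<le> b" for a b :: real using that by linarith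
  ultimately have "?m * A - B\<^sup>2 \<le> d\<^sup>2 * (?n * I * ?m)" by blast
  thus ?thesis by (simp add: A_def B_def I_def mult.commute mult.left_commute)
qed

text \<open>By Poincare's inequality on each piece, subdividing the box finely enough makes the
  gradient term as small as desired, at the price of finitely many mean values. The index set is
  a tagged division of the box, whence the pairs.\<close>

lemma box_coercive:
  fixes a b :: "'a::euclidean_space"
  assumes e: "e > 0"
  shows "\<exists>\<Q> :: ('a \<times> 'a set) set. finite \<Q> \<and> (\<forall>Q\<in>\<Q>. compact (snd Q) \<and> snd Q \<subseteq> cbox a b) \<and>
    (\<forall>u g. gradient_bound (cbox a b) u g \<longrightarrow>
      integral (cbox a b) (\<lambda>x. (u x)\<^sup>2) \<le> e * integral (cbox a b) g +
        (\<Sum>Q\<in>\<Q>. (integral (snd Q) u)\<^sup>2 / measure lborel (snd Q)))"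
proof -
  \<comment> \<open>The diameter of the pieces for which the constant in Poincare's inequality is
    \<open>e\<close>.\<close>
  define d where "d = sqrt (e / 2 ^ DIM('a))"
  have d: "d > 0" "2 ^ DIM('a) * d\<^sup>2 = e" using e by (auto simp: d_def)
  obtain p where p: "p tagged_division_of cbox a b" "(\<lambda>x. ball x (d / 2)) fine p"
    using fine_division_exists[OF gauge_ball, of "d / 2" a b] d by auto
  have sub: "k \<subseteq> cbox a b" and box: "\<exists>\<alpha> \<beta>. k = cbox \<alpha> \<beta>" if "(x, k) \<in> p" for x k
    using tagged_division_ofD(3,4)[OF p(1) that] by auto
  have "integral (cbox a b) (\<lambda>x. (u x)\<^sup>2) \<le> e * integral (cbox a b) g +
        (\<Sum>Q\<in>p. (integral (snd Q) u)\<^sup>2 / measure lborel (snd Q))"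
    if u: "gradient_bound (cbox a b) u g" for u g
  proof -
    have gc: "continuous_on (cbox a b) g" using u by (simp add: gradient_bound_def)
    have uc: "continuous_on (cbox a b) u" using u by (rule gradient_bound_continuous)
    have "integral (cbox a b) (\<lambda>x. (u x)\<^sup>2) = (\<Sum>(x, k)\<in>p. integral k (\<lambda>x. (u x)\<^sup>2))"
      by (intro integral_combine_tagged_division_topdown p integrable_continuous continuous_intros uc)
    also have "\<dots> \<le> (\<Sum>(x, k)\<in>p. e * integral k g + (integral k u)\<^sup>2 / measure lborel k)"
    proof (intro sum_mono, clarify)
      fix x k assume xk: "(x, k) \<in> p"
      obtain \<alpha> \<beta> where k: "k = cbox \<alpha> \<beta>" using box[OF xk] by blast
      have "k \<subseteq> ball x (d / 2)" using p(2) xk by (auto simp: fine_def)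
      hence diam: "norm (y - z) \<le> d" if "y \<in> k" "z \<in> k" for y z
      proof -
        have "dist x y < d / 2" "dist x z < d / 2" using that \<open>k \<subseteq> ball x (d / 2)\<close> by auto
        thus ?thesis using dist_triangle3[of y z x] by (simp add: dist_norm)
      qed
      have "measure lborel k * integral k (\<lambda>x. (u x)\<^sup>2)
        \<le> (integral k u)\<^sup>2 + 2 ^ DIM('a) * d\<^sup>2 * measure lborel k * integral k g"
        using poincare_convex[OF _ _ gradient_bound_subset[OF u sub[OF xk]] diam] k by simp
      hence *: "measure lborel k * integral k (\<lambda>x. (u x)\<^sup>2) \<le> (integral k u)\<^sup>2 + e * measure lborel k * integral k g"
        using d by simp
      show "integral k (\<lambda>x. (u x)\<^sup>2) \<le> e * integral k g + (integral k u)\<^sup>2 / measure lborel k"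
      proof (cases "measure lborel k = 0")
        case True
        \<comment> \<open>On a degenerate box all integrals vanish, and so does the quotient, by
          the convention \<open>x / 0 = 0\<close>.\<close>
        hence "measure lborel (cbox \<alpha> \<beta>) = 0" using k by simp
        hence "integral k f = 0" for f :: "'a \<Rightarrow> real"
          unfolding k by (rule integral_null)
        thus ?thesis by simp
      next
        case False
        hence "measure lborel k > 0" using measure_nonneg[of lborel k] by linarith
        thus ?thesis using * by (simp add: field_simps)
      qed
    qed
    also have "\<dots> = e * (\<Sum>(x, k)\<in>p. integral k g) + (\<Sum>Q\<in>p. (integral (snd Q) u)\<^sup>2 / measure lborel (snd Q))"
      by (simp add: sum.distrib sum_distrib_left split_def)
    also have "(\<Sum>(x, k)\<in>p. integral k g) = integral (cbox a b) g"
      by (intro integral_combine_tagged_division_topdown[symmetric] p integrable_continuous gc)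
    finally show ?thesis .
  qed
  note est = this
  have fin: "finite p" using p(1) by blast
  show ?thesis
  proof (intro exI[of _ p] conjI ballI allI impI)
    fix Q assume "Q \<in> p"
    hence "(fst Q, snd Q) \<in> p" by simp
    from sub[OF this] box[OF this] show "compact (snd Q)" "snd Q \<subseteq> cbox a b" by auto
  qed (use fin est in auto)
qed

section \<open>Symmetric positive definite matrices\<close>

definition pos_def :: "real ^ 'n::finite ^ 'n \<Rightarrow> bool" where
  "pos_def M \<longleftrightarrow> transpose M = M \<and> (\<forall>v. v \<noteq> 0 \<longrightarrow> 0 < v \<bullet> (M *v v))"

lemma pos_def_imp_det_nonzero:
  assumes "\<And>v. v \<noteq> 0 \<Longrightarrow> 0 < v \<bullet> (M *v v)"
  shows "det (M :: real ^ 'n::finite ^ 'n) \<noteq> 0"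
proof -
  have "inj ((*v) M)"
  proof (rule linear_injective_0[THEN iffD2, rule_format])
    fix x assume "M *v x = 0"
    hence "x \<bullet> (M *v x) = 0" by simp
    thus "x = 0" using assms[of x] by fastforce
  qed simp
  thus ?thesis by (simp add: det_nz_iff_inj[symmetric] det_nz_iff_inj)
qed

text \<open>The determinant does not vanish along the segment from the identity to \<open>M\<close>, so it keeps the
  sign that it has at the identity.\<close>

lemma pos_def_det_pos:
  assumes M: "pos_def (M :: real ^ 'n::finite ^ 'n)"
  shows "0 < det M"
proof (rule ccontr)
  assume neg: "\<not> 0 < det M"
  define f where "f t = det ((1 - t) *\<^sub>R mat 1 + t *\<^sub>R M)" for t :: real
  have "continuous_on {0..1} f"
    unfolding f_def det_def by (intro continuous_intros)
  moreover have "f 0 = 1" "f 1 = det M" by (simp_all add: f_def)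
  ultimately obtain t where t: "0 \<le> t" "t \<le> 1" "f t = 0"
    using IVT2'[of f 1 0 0] neg by auto
  have "f t \<noteq> 0"
    unfolding f_def
  proof (rule pos_def_imp_det_nonzero)
    fix v :: "real ^ 'n" assume v: "v \<noteq> 0"
    have "v \<bullet> (((1 - t) *\<^sub>R mat 1 + t *\<^sub>R M) *v v) = (1 - t) * (v \<bullet> v) + t * (v \<bullet> (M *v v))"
      by (simp add: matrix_vector_mult_add_rdistrib scaleR_matrix_vector_assoc[symmetric] inner_add_right)
    moreover have "0 < v \<bullet> v" "0 < v \<bullet> (M *v v)" using M v by (auto simp: pos_def_def)
    ultimately show "0 < v \<bullet> (((1 - t) *\<^sub>R mat 1 + t *\<^sub>R M) *v v)"
      using t(1,2) by (cases "t = 0") (simp_all add: add_nonneg_pos)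
  qed
  thus False using t by simp
qed

lemma pos_def_invertible: "pos_def M \<Longrightarrow> invertible M"
  using pos_def_det_pos[of M] by (simp add: invertible_det_nz)

lemma matrix_inv_mult:
  assumes "invertible (M :: real ^ 'n::finite ^ 'n)"
  shows "M *v (matrix_inv M *v x) = x" "matrix_inv M *v (M *v x) = x"
proof -
  have "M ** matrix_inv M = mat 1 \<and> matrix_inv M ** M = mat 1"
    unfolding matrix_inv_def by (rule someI_ex) (use assms in \<open>simp add: invertible_def\<close>)
  thus "M *v (matrix_inv M *v x) = x" "matrix_inv M *v (M *v x) = x"
    by (simp_all add: matrix_vector_mul_assoc)
qed

lemma inner_transpose: "(transpose J *v a) \<bullet> w = a \<bullet> (J *v (w :: real ^ 'n::finite))"
  by (simp add: transpose_matrix_vector dot_lmul_matrix)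

text \<open>Exhibits the entries of the inverse as rational functions of those of
  \<open>M\<close>; hence the inverse of a smooth matrix function is smooth.\<close>

lemma matrix_inv_cramer:
  assumes "det (M :: real ^ 'n::finite ^ 'n) \<noteq> 0"
  shows "matrix_inv M $ i $ j = det (\<chi> k l. if l = i then axis j 1 $ k else M $ k $ l) / det M"
proof -
  have "M *v (matrix_inv M *v axis j 1) = axis j 1"
    using assms by (simp add: matrix_inv_mult invertible_det_nz)
  hence "matrix_inv M *v axis j 1 = (\<chi> i. det (\<chi> k l. if l = i then axis j 1 $ k else M $ k $ l) / det M)"
    using cramer[OF assms] by blast
  moreover have "(matrix_inv M *v axis j 1) $ i = matrix_inv M $ i $ j"
    by (simp add: matrix_vector_mul_component axis_def inner_vec_def if_distrib cong: if_cong)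
  ultimately show ?thesis by simp
qed

text \<open>How the inverse metric and the volume density transform: if \<open>M *v w = transpose
  J *v b\<close>, then \<open>N *v (J *v w) = b\<close>, because \<open>transpose J\<close> can
  be cancelled.\<close>

lemma congruence_inverse_form:
  fixes M N J :: "real ^ 'n::finite ^ 'n"
  assumes M: "pos_def M" "pos_def N" and eq: "M = transpose J ** N ** J"
  shows "(transpose J *v a) \<bullet> (matrix_inv M *v (transpose J *v b)) = a \<bullet> (matrix_inv N *v b)"
    and "det J \<noteq> 0" "sqrt (det M) = \<bar>det J\<bar> * sqrt (det N)"
proof -
  have det: "det M = (det J)\<^sup>2 * det N" by (simp add: eq det_mul power2_eq_square)
  show J: "det J \<noteq> 0" using det pos_def_det_pos[OF M(1)] by auto
  show "sqrt (det M) = \<bar>det J\<bar> * sqrt (det N)" by (simp add: det real_sqrt_mult)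
  define w where "w = matrix_inv M *v (transpose J *v b)"
  have iM: "invertible M" and iN: "invertible N" using M by (auto intro: pos_def_invertible)
  have iJ: "invertible (transpose J)" using J by (simp add: invertible_det_nz det_transpose)
  have "M *v w = transpose J *v b" unfolding w_def by (rule matrix_inv_mult[OF iM])
  hence "transpose J *v (N *v (J *v w)) = transpose J *v b"
    by (simp add: eq matrix_vector_mul_assoc matrix_mul_assoc)
  hence "N *v (J *v w) = b" by (metis matrix_inv_mult(2)[OF iJ])
  hence "J *v w = matrix_inv N *v b" by (metis matrix_inv_mult(2)[OF iN])
  thus "(transpose J *v a) \<bullet> (matrix_inv M *v (transpose J *v b)) = a \<bullet> (matrix_inv N *v b)"
    unfolding w_def[symmetric] inner_transpose by simp
qed

lemma pos_def_inverse_sym: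
  assumes M: "pos_def M"
  shows "a \<bullet> (matrix_inv M *v b) = b \<bullet> (matrix_inv M *v a)"
proof -
  note inv = matrix_inv_mult[OF pos_def_invertible[OF M]]
  have "a \<bullet> (matrix_inv M *v b) = (M *v (matrix_inv M *v a)) \<bullet> (matrix_inv M *v b)" by (simp add: inv)
  also have "\<dots> = (transpose M *v (matrix_inv M *v a)) \<bullet> (matrix_inv M *v b)"
    using M by (simp add: pos_def_def)
  also have "\<dots> = (matrix_inv M *v a) \<bullet> (M *v (matrix_inv M *v b))" by (rule inner_transpose)
  finally show ?thesis by (simp add: inv inner_commute)
qed

lemma pos_def_inverse_nonneg:
  assumes M: "pos_def M"
  shows "0 \<le> a \<bullet> (matrix_inv M *v a)"
proof -
  note inv = matrix_inv_mult[OF pos_def_invertible[OF M]]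
  have "0 \<le> (matrix_inv M *v a) \<bullet> (M *v (matrix_inv M *v a))"
    using M by (cases "matrix_inv M *v a = 0") (auto simp: pos_def_def less_imp_le)
  thus ?thesis by (simp add: inv inner_commute)
qed

section \<open>Charts, isometries and the volume measure\<close>

locale riemannian =
  fixes A :: "('m::{t2_space,second_countable_topology}, 'n::finite) chart set"
    and G :: "('m, 'n) metric_tensor"
  assumes atlas: "smooth_atlas A" and metric: "riemannian_metric A G"
    and compact_UNIV: "compact (UNIV :: 'm set)"
begin

abbreviation cim :: "('m, 'n) chart \<Rightarrow> (real ^ 'n) set" where
  "cim c \<equiv> chart_map c ` chart_dom c"

definition rho :: "('m, 'n) chart \<Rightarrow> real ^ 'n \<Rightarrow> real" where
  "rho c x = sqrt (det (G c (chart_inv c x)))"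

lemma charts_cover: "\<exists>c\<in>A. p \<in> chart_dom c"
  using atlas unfolding smooth_atlas_def by blast

lemma chart_at: "chart_at A p \<in> A" "p \<in> chart_dom (chart_at A p)"
proof -
  have "chart_at A p \<in> A \<and> p \<in> chart_dom (chart_at A p)"
    unfolding chart_at_def by (rule someI_ex) (use charts_cover[of p] in blast)
  thus "chart_at A p \<in> A" "p \<in> chart_dom (chart_at A p)" by auto
qed

lemma
  assumes "c \<in> A"
  shows open_dom: "open (chart_dom c)" and open_cim: "open (cim c)"
    and chart_homeo: "homeomorphism (chart_dom c) (cim c) (chart_map c) (chart_inv c)"
  using atlas assms unfolding smooth_atlas_def by auto

lemma
  assumes "c \<in> A"
  shows chart_inv_map [simp]: "p \<in> chart_dom c \<Longrightarrow> chart_inv c (chart_map c p) = p"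
    and chart_map_inv [simp]: "x \<in> cim c \<Longrightarrow> chart_map c (chart_inv c x) = x"
    and chart_inv_dom: "x \<in> cim c \<Longrightarrow> chart_inv c x \<in> chart_dom c"
    and cont_map: "continuous_on (chart_dom c) (chart_map c)"
    and cont_inv: "continuous_on (cim c) (chart_inv c)"
  using chart_homeo[OF assms] unfolding homeomorphism_def by auto

lemma chart_image_eq:
  assumes "c \<in> A" "B \<subseteq> chart_dom c"
  shows "chart_map c ` B = cim c \<inter> chart_inv c -` B"
proof (intro equalityI subsetI)
  fix x assume "x \<in> chart_map c ` B"
  then obtain p where "p \<in> B" "x = chart_map c p" by blast
  thus "x \<in> cim c \<inter> chart_inv c -` B" using assms by auto
next
  fix x assume "x \<in> cim c \<inter> chart_inv c -` B"
  hence "chart_inv c x \<in> B" "x = chart_map c (chart_inv c x)" using assms by auto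
  thus "x \<in> chart_map c ` B" by blast
qed

lemma open_chart_image:
  assumes "c \<in> A" "open U" "U \<subseteq> chart_dom c"
  shows "open (chart_map c ` U)"
  unfolding chart_image_eq[OF assms(1,3)]
  by (rule continuous_open_preimage[OF cont_inv[OF assms(1)] open_cim[OF assms(1)] assms(2)])

lemma open_chart_preimage:
  assumes "c \<in> A" "open W"
  shows "open (chart_dom c \<inter> chart_map c -` W)"
  by (rule continuous_open_preimage[OF cont_map[OF assms(1)] open_dom[OF assms(1)] assms(2)])

lemma borel_chart_image:
  assumes c: "c \<in> A" and B: "B \<in> sets borel" "B \<subseteq> chart_dom c"
  shows "chart_map c ` B \<in> sets borel"
proof -
  have "chart_inv c \<in> borel_measurable (restrict_space borel (cim c))"
    by (rule borel_measurable_continuous_on_restrict[OF cont_inv[OF c]])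
  from measurable_sets[OF this B(1)]
  have "chart_inv c -` B \<inter> cim c \<in> sets (restrict_space borel (cim c))" by (simp add: space_restrict_space)
  hence "chart_inv c -` B \<inter> cim c \<in> sets borel"
    using open_cim[OF c] by (subst (asm) sets_restrict_space_iff) auto
  thus ?thesis by (simp add: chart_image_eq[OF c B(2)] Int_commute)
qed

lemma metric_pos_def: "c \<in> A \<Longrightarrow> p \<in> chart_dom c \<Longrightarrow> pos_def (G c p)"
  using metric unfolding riemannian_metric_def pos_def_def by blast

lemma smooth_metric: "c \<in> A \<Longrightarrow> smooth_on (\<lambda>x. G c (chart_inv c x) $ i $ j) (cim c)"
  using metric unfolding riemannian_metric_def by blast

lemma smooth_det:
  assumes "open S" "\<And>i j. smooth_on (\<lambda>x. F x $ i $ j) S"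
  shows "smooth_on (\<lambda>x. det (F x :: real ^ 'n ^ 'n)) (S :: (real ^ 'n) set)"
  unfolding det_def
  by (intro smooth_on_sum smooth_on_mult smooth_on_prod smooth_on_const assms)

lemma smooth_metric_det: "c \<in> A \<Longrightarrow> smooth_on (\<lambda>x. det (G c (chart_inv c x))) (cim c)"
  by (intro smooth_det open_cim smooth_metric)

lemma metric_det_pos: "c \<in> A \<Longrightarrow> x \<in> cim c \<Longrightarrow> 0 < det (G c (chart_inv c x))"
  by (intro pos_def_det_pos metric_pos_def chart_inv_dom)

lemma smooth_rho: "c \<in> A \<Longrightarrow> smooth_on (rho c) (cim c)"
  unfolding rho_def[abs_def] by (intro smooth_on_sqrt open_cim smooth_metric_det metric_det_pos)

lemma rho_pos: "c \<in> A \<Longrightarrow> x \<in> cim c \<Longrightarrow> 0 < rho c x"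
  by (simp add: rho_def metric_det_pos)

lemma rho_cont: "c \<in> A \<Longrightarrow> continuous_on (cim c) (rho c)"
  by (intro smooth_on_continuous smooth_rho)

lemma smooth_metric_inv:
  assumes c: "c \<in> A"
  shows "smooth_on (\<lambda>x. matrix_inv (G c (chart_inv c x)) $ i $ j) (cim c)"
proof (rule smooth_on_cong[OF open_cim[OF c]])
  let ?F = "\<lambda>x. \<chi> k l. if l = i then axis j 1 $ k else G c (chart_inv c x) $ k $ l"
  show "smooth_on (\<lambda>x. det (?F x) / det (G c (chart_inv c x))) (cim c)"
  proof (intro smooth_on_divide open_cim c smooth_metric_det smooth_det)
    show "smooth_on (\<lambda>x. ?F x $ k $ l) (cim c)" for k l
      by (cases "l = i") (simp_all add: smooth_on_const smooth_metric[OF c])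
    show "det (G c (chart_inv c x)) \<noteq> 0" if "x \<in> cim c" for x
      using metric_det_pos[OF c that] by simp
  qed
  show "det (?F x) / det (G c (chart_inv c x)) = matrix_inv (G c (chart_inv c x)) $ i $ j" if "x \<in> cim c" for x
    using metric_det_pos[OF c that] by (subst matrix_inv_cramer) auto
qed

subsection \<open>Isometries\<close>

text \<open>The identity is an isometry, by the transformation laws of the atlas and of the metric. What
  is shown for isometries therefore covers changes of charts.\<close>

lemma isometry_id: "riemannian_isometry A G id"
proof -
  have a: "\<forall>c\<in>A. \<forall>d\<in>A. smooth_on (chart_map d \<circ> chart_inv c) (chart_map c ` (chart_dom c \<inter> chart_dom d))"
    using atlas unfolding smooth_atlas_def by (elim conjE)
  have b: "\<forall>c\<in>A. \<forall>d\<in>A. \<forall>p \<in> chart_dom c \<inter> chart_dom d.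
        (let J = jacobian (chart_map d \<circ> chart_inv c) (at (chart_map c p))
         in G c p = transpose J ** G d p ** J)"
    using metric unfolding riemannian_metric_def by (elim conjE)
  have "smooth_map A id"
    unfolding smooth_map_def comp_id vimage_id id_apply by (intro conjI a continuous_on_id)
  thus ?thesis
    unfolding riemannian_isometry_def comp_id vimage_id inv_id using b by simp
qed

definition local_rep :: "('m \<Rightarrow> 'm) \<Rightarrow> ('m, 'n) chart \<Rightarrow> ('m, 'n) chart \<Rightarrow> real ^ 'n \<Rightarrow> real ^ 'n" where
  "local_rep T c d = chart_map d \<circ> T \<circ> chart_inv c"

definition rep_dom :: "('m \<Rightarrow> 'm) \<Rightarrow> ('m, 'n) chart \<Rightarrow> ('m, 'n) chart \<Rightarrow> (real ^ 'n) set" where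
  "rep_dom T c d = chart_map c ` (chart_dom c \<inter> T -` chart_dom d)"

definition jac :: "('m \<Rightarrow> 'm) \<Rightarrow> ('m, 'n) chart \<Rightarrow> ('m, 'n) chart \<Rightarrow> real ^ 'n \<Rightarrow> real ^ 'n ^ 'n" where
  "jac T c d x = jacobian (local_rep T c d) (at x)"

lemma smooth_local_rep:
  "smooth_map A T \<Longrightarrow> c \<in> A \<Longrightarrow> d \<in> A \<Longrightarrow> smooth_on (local_rep T c d) (rep_dom T c d)"
  unfolding smooth_map_def local_rep_def rep_dom_def by blast

lemma open_rep_dom:
  assumes T: "smooth_map A T" and cd: "c \<in> A" "d \<in> A"
  shows "open (rep_dom T c d)"
proof -
  have "open (T -` chart_dom d)"
    using T open_dom[OF cd(2)] unfolding smooth_map_def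
    by (intro continuous_open_vimage) (auto simp: continuous_on_eq_continuous_at)
  thus ?thesis unfolding rep_dom_def using open_dom[OF cd(1)] by (intro open_chart_image cd) auto
qed

lemma rep_dom_subset: "rep_dom T c d \<subseteq> cim c"
  by (auto simp: rep_dom_def)

lemma local_rep_range: "c \<in> A \<Longrightarrow> local_rep T c d ` rep_dom T c d \<subseteq> cim d"
  by (auto simp: rep_dom_def local_rep_def)

context
  fixes T assumes T: "riemannian_isometry A G T"
begin

lemma isometry_smooth: "smooth_map A T"
  and isometry_bij: "bij T"
  and isometry_cont: "continuous_on UNIV T"
  and isometry_inv_cont: "continuous_on UNIV (inv T)"
  using T by (auto simp: riemannian_isometry_def smooth_map_def)

lemma local_rep_deriv:
  assumes cd: "c \<in> A" "d \<in> A" and x: "x \<in> rep_dom T c d"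
  shows "(local_rep T c d has_derivative (\<lambda>v. jac T c d x *v v)) (at x)"
  using smooth_on_has_derivative[OF smooth_local_rep[OF isometry_smooth cd] x]
  unfolding jac_def by (simp add: jacobian_works[symmetric] differentiable_def) blast

lemma isometry_metric:
  assumes cd: "c \<in> A" "d \<in> A" and x: "x \<in> rep_dom T c d"
  shows "G c (chart_inv c x) = transpose (jac T c d x) ** G d (chart_inv d (local_rep T c d x)) ** jac T c d x"
proof -
  obtain p where p: "p \<in> chart_dom c" "T p \<in> chart_dom d" "x = chart_map c p"
    using x by (auto simp: rep_dom_def)
  have "G c p = transpose (jac T c d x) ** G d (T p) ** jac T c d x"
    using T cd p unfolding riemannian_isometry_def jac_def local_rep_def by (simp add: Let_def)
  thus ?thesis using p cd by (simp add: local_rep_def)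
qed

lemma isometry_pos_defs:
  assumes cd: "c \<in> A" "d \<in> A" and x: "x \<in> rep_dom T c d"
  shows "pos_def (G c (chart_inv c x))" "pos_def (G d (chart_inv d (local_rep T c d x)))"
proof -
  have "x \<in> cim c" "local_rep T c d x \<in> cim d"
    using x rep_dom_subset[of T c d] local_rep_range[OF cd(1), of T d] by auto
  thus "pos_def (G c (chart_inv c x))" "pos_def (G d (chart_inv d (local_rep T c d x)))"
    using cd by (auto intro!: metric_pos_def chart_inv_dom)
qed

lemma isometry_rho:
  assumes cd: "c \<in> A" "d \<in> A" and x: "x \<in> rep_dom T c d"
  shows "rho c x = \<bar>det (jac T c d x)\<bar> * rho d (local_rep T c d x)"
  unfolding rho_def
  by (rule congruence_inverse_form(3)[OF isometry_pos_defs[OF assms] isometry_metric[OF assms]])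

lemma isometry_image_borel: "B \<in> sets borel \<Longrightarrow> T ` B \<in> sets borel"
proof -
  assume "B \<in> sets borel"
  moreover have "inv T \<in> borel_measurable borel" using isometry_inv_cont by (rule borel_measurable_continuous_onI)
  ultimately have "inv T -` B \<in> sets borel" using measurable_sets[of "inv T" borel borel B] by simp
  moreover have "inv T -` B = T ` B"
    using isometry_bij by (simp add: bij_vimage_eq_inv_image bij_imp_bij_inv inv_inv_eq)
  ultimately show ?thesis by simp
qed

text \<open>By \<open>isometry_rho\<close> the density picks up exactly the Jacobian determinant
  of the change of variables.\<close>

lemma isometry_chart_volume:
  assumes cd: "c \<in> A" "d \<in> A" and B: "B \<in> sets borel" "B \<subseteq> chart_dom c" "T ` B \<subseteq> chart_dom d"
  shows "(\<integral>\<^sup>+x. ennreal (rho d x) * indicator (chart_map d ` (T ` B)) x \<partial>lborel) =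
    (\<integral>\<^sup>+x. ennreal (rho c x) * indicator (chart_map c ` B) x \<partial>lborel)"
proof -
  let ?S = "chart_map c ` B"
  have S: "?S \<in> sets borel" by (rule borel_chart_image[OF cd(1) B(1,2)])
  have sub: "?S \<subseteq> rep_dom T c d" using B unfolding rep_dom_def by blast
  have img: "local_rep T c d ` ?S = chart_map d ` (T ` B)"
  proof -
    have "local_rep T c d (chart_map c p) = chart_map d (T p)" if "p \<in> B" for p
      using that B cd by (auto simp: local_rep_def)
    thus ?thesis by (simp add: image_image)
  qed
  have imgd: "chart_map d ` (T ` B) \<subseteq> cim d" using B(3) by blast
  have "(\<integral>\<^sup>+y. ennreal (indicator (local_rep T c d ` ?S) y * rho d y) \<partial>lborel) =
    (\<integral>\<^sup>+x. ennreal (indicator ?S x * (\<bar>det (matrix (\<lambda>v. jac T c d x *v v))\<bar> * rho d (local_rep T c d x))) \<partial>lborel)"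
  proof (rule nn_integral_change_of_variables[OF S])
    show "(local_rep T c d has_derivative (\<lambda>v. jac T c d x *v v)) (at x within ?S)" if "x \<in> ?S" for x
      using local_rep_deriv[OF cd] sub that has_derivative_at_withinI by blast
    show "inj_on (local_rep T c d) ?S"
    proof (rule inj_onI)
      fix x y assume "x \<in> ?S" "y \<in> ?S" and eq: "local_rep T c d x = local_rep T c d y"
      then obtain p q where pq: "p \<in> B" "q \<in> B" "x = chart_map c p" "y = chart_map c q" by blast
      have "p \<in> chart_dom c" "q \<in> chart_dom c" using pq B by blast+
      hence "chart_map d (T p) = chart_map d (T q)" using eq pq cd by (auto simp: local_rep_def)
      hence "T p = T q" using pq B(3) cd by (metis chart_inv_map image_subset_iff)
      hence "p = q" using isometry_bij by (simp add: bij_def inj_eq)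
      thus "x = y" using pq by simp
    qed
    show "0 \<le> rho d y" if "y \<in> local_rep T c d ` ?S" for y
      by (rule less_imp_le[OF rho_pos[OF cd(2)]]) (use that img imgd in blast)
    have "chart_map d ` (T ` B) \<in> sets borel"
      by (intro borel_chart_image cd isometry_image_borel B)
    hence "(\<lambda>y. indicator (chart_map d ` (T ` B)) y *\<^sub>R rho d y) \<in> borel_measurable borel"
      using continuous_on_subset[OF rho_cont[OF cd(2)] imgd] by (rule borel_measurable_continuous_on_indicator)
    thus "(\<lambda>y. indicator (local_rep T c d ` ?S) y * rho d y) \<in> borel_measurable borel" by (simp add: img)
    have "(\<lambda>x. indicator ?S x *\<^sub>R rho c x) \<in> borel_measurable borel"
      using S continuous_on_subset[OF rho_cont[OF cd(1)]] sub rep_dom_subset[of T c d]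
      by (intro borel_measurable_continuous_on_indicator) blast+
    moreover have "(\<lambda>x. indicator ?S x *\<^sub>R rho c x) =
        (\<lambda>x. indicator ?S x * (\<bar>det (matrix (\<lambda>v. jac T c d x *v v))\<bar> * rho d (local_rep T c d x)))"
      using isometry_rho[OF cd] sub by (auto simp: fun_eq_iff indicator_def)
    ultimately show "(\<lambda>x. indicator ?S x * (\<bar>det (matrix (\<lambda>v. jac T c d x *v v))\<bar> * rho d (local_rep T c d x)))
        \<in> borel_measurable borel" by simp
  qed
  moreover have "(\<lambda>x. ennreal (indicator ?S x * (\<bar>det (matrix (\<lambda>v. jac T c d x *v v))\<bar> * rho d (local_rep T c d x))))
      = (\<lambda>x. ennreal (indicator ?S x * rho c x))"
    using isometry_rho[OF cd] sub by (auto simp: fun_eq_iff indicator_def)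
  ultimately have "(\<integral>\<^sup>+y. ennreal (indicator (chart_map d ` (T ` B)) y * rho d y) \<partial>lborel) =
      (\<integral>\<^sup>+x. ennreal (indicator ?S x * rho c x) \<partial>lborel)" by (simp only: img)
  moreover have "ennreal (indicator X y * r) = ennreal r * indicator X y" for X :: "(real ^ 'n) set" and y r
    by (auto simp: indicator_def)
  ultimately show ?thesis by simp
qed

end

end

subsection \<open>The volume measure\<close>

context riemannian
begin

definition chart_volume :: "('m, 'n) chart \<Rightarrow> 'm set \<Rightarrow> ennreal" where
  "chart_volume c B = (\<integral>\<^sup>+x. ennreal (rho c x) * indicator (chart_map c ` B) x \<partial>lborel)"

text \<open>Extended to all of \<open>real ^ 'n\<close>, the inverse of a chart and its volume
  density become Borel functions. Off the image of the chart the density is zero, so the value of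
  \<open>inv_total\<close> there does not affect any integral.\<close>

definition inv_total :: "('m, 'n) chart \<Rightarrow> real ^ 'n \<Rightarrow> 'm" where
  "inv_total c x = (if x \<in> cim c then chart_inv c x else undefined)"

definition rho_total :: "('m, 'n) chart \<Rightarrow> real ^ 'n \<Rightarrow> real" where
  "rho_total c x = indicator (cim c) x * rho c x"

definition chart_measure :: "('m, 'n) chart \<Rightarrow> 'm measure" where
  "chart_measure c = distr (density lborel (\<lambda>x. ennreal (rho_total c x))) borel (inv_total c)"

lemma sets_chart_measure [simp, measurable_cong]: "sets (chart_measure c) = sets borel"
  by (simp add: chart_measure_def)

lemma rho_total_measurable [measurable]: "c \<in> A \<Longrightarrow> rho_total c \<in> borel_measurable borel"
  using borel_measurable_continuous_on_indicator[OF _ rho_cont, of c] open_cim[of c]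
  unfolding rho_total_def[abs_def] by simp

lemma inv_total_measurable [measurable]: "c \<in> A \<Longrightarrow> inv_total c \<in> borel_measurable borel"
proof -
  assume c: "c \<in> A"
  have "chart_inv c \<in> borel_measurable (restrict_space borel (cim c))"
    by (rule borel_measurable_continuous_on_restrict[OF cont_inv[OF c]])
  thus ?thesis
    unfolding inv_total_def[abs_def] using open_cim[OF c]
    by (subst measurable_If_restrict_space_iff) auto
qed

lemma rho_total_nonneg: "c \<in> A \<Longrightarrow> 0 \<le> rho_total c x"
  using rho_pos[of c x] by (auto simp: rho_total_def indicator_def less_imp_le)

lemma emeasure_chart_measure:
  assumes c: "c \<in> A" and B: "B \<in> sets borel"
  shows "emeasure (chart_measure c) B = chart_volume c (B \<inter> chart_dom c)"
proof -
  note [measurable] = rho_total_measurable[OF c] inv_total_measurable[OF c] B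
  have "emeasure (chart_measure c) B = emeasure (density lborel (\<lambda>x. ennreal (rho_total c x))) (inv_total c -` B)"
    unfolding chart_measure_def by (subst emeasure_distr) auto
  also have "\<dots> = (\<integral>\<^sup>+x. ennreal (rho_total c x) * indicator (inv_total c -` B) x \<partial>lborel)"
    using measurable_sets[OF inv_total_measurable[OF c] B] by (intro emeasure_density) auto
  also have "\<dots> = chart_volume c (B \<inter> chart_dom c)"
    unfolding chart_volume_def
  proof (rule nn_integral_cong)
    fix x
    have "chart_map c ` (B \<inter> chart_dom c) = cim c \<inter> chart_inv c -` (B \<inter> chart_dom c)"
      using c by (intro chart_image_eq) auto
    thus "ennreal (rho_total c x) * indicator (inv_total c -` B) x
        = ennreal (rho c x) * indicator (chart_map c ` (B \<inter> chart_dom c)) x"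
      using chart_inv_dom[OF c, of x] by (auto simp: rho_total_def inv_total_def indicator_def)
  qed
  finally show ?thesis .
qed

definition is_volume :: "'m measure \<Rightarrow> bool" where
  "is_volume V \<longleftrightarrow> sets V = sets borel \<and>
     (\<forall>c\<in>A. \<forall>B\<in>sets borel. B \<subseteq> chart_dom c \<longrightarrow> emeasure V B = chart_volume c B)"

text \<open>Finitely many charts cover the manifold. Disjoint Borel pieces of their domains carry the
  construction of the volume and the proof of its uniqueness.\<close>

lemma chart_partition:
  obtains k :: nat and c P where "\<And>i. i < k \<Longrightarrow> c i \<in> A" "\<And>i. i < k \<Longrightarrow> P i \<in> sets borel"
    "\<And>i. i < k \<Longrightarrow> P i \<subseteq> chart_dom (c i)" "disjoint_family_on P {..<k}" "(\<Union>i<k. P i) = (UNIV :: 'm set)"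
proof -
  have cover: "(UNIV :: 'm set) \<subseteq> (\<Union>c\<in>A. chart_dom c)" using charts_cover by blast
  obtain C where C: "C \<subseteq> A" "finite C" "UNIV \<subseteq> (\<Union>c\<in>C. chart_dom c)"
    by (rule compactE_image[OF compact_UNIV open_dom cover])
  obtain c :: "nat \<Rightarrow> ('m, 'n) chart" where c: "bij_betw c {..<card C} C"
    using ex_bij_betw_nat_finite[OF C(2)] by (auto simp: atLeast0LessThan)
  define P where "P i = chart_dom (c i) - (\<Union>j<i. chart_dom (c j))" for i
  have cA: "c i \<in> A" if "i < card C" for i using c C(1) that by (auto simp: bij_betw_def)
  show ?thesis
  proof (rule that[of "card C" c P])
    show "c i \<in> A" if "i < card C" for i using cA that .
    show "P i \<in> sets borel" if "i < card C" for i
      unfolding P_def using open_dom[OF cA] that by (intro sets.Diff sets.finite_UN) auto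
    show "P i \<subseteq> chart_dom (c i)" for i by (auto simp: P_def)
    show "disjoint_family_on P {..<card C}"
      unfolding disjoint_family_on_def
    proof (intro ballI impI)
      fix i j :: nat assume "i \<noteq> j"
      then consider "i < j" | "j < i" by linarith
      thus "P i \<inter> P j = {}" by cases (auto simp: P_def)
    qed
    show "(\<Union>i<card C. P i) = UNIV"
    proof (intro equalityI subsetI)
      fix p :: 'm
      obtain e where "e \<in> C" "p \<in> chart_dom e" using C(3) by blast
      moreover from this obtain i0 where "i0 < card C" "e = c i0"
        using bij_betw_imp_surj_on[OF c] by blast
      ultimately have ex: "\<exists>i. i < card C \<and> p \<in> chart_dom (c i)" by blast
      define i where "i = (LEAST i. i < card C \<and> p \<in> chart_dom (c i))"
      have i: "i < card C" "p \<in> chart_dom (c i)" using LeastI_ex[OF ex] by (auto simp: i_def)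
      have "p \<notin> chart_dom (c j)" if "j < i" for j
        using not_less_Least[of j "\<lambda>i. i < card C \<and> p \<in> chart_dom (c i)"] that i by (auto simp: i_def)
      thus "p \<in> (\<Union>i<card C. P i)" using i by (auto simp: P_def)
    qed simp
  qed
qed

lemma measure_partition_sum:
  assumes P: "\<And>i. i < k \<Longrightarrow> P i \<in> sets M" "disjoint_family_on P {..<k}" "B \<subseteq> (\<Union>i<(k::nat). P i)" "B \<in> sets M"
  shows "emeasure M B = (\<Sum>i<k. emeasure M (B \<inter> P i))"
proof -
  have "emeasure M (\<Union>i<k. B \<inter> P i) = (\<Sum>i<k. emeasure M (B \<inter> P i))"
    using P by (intro sum_emeasure[symmetric]) (auto simp: disjoint_family_on_def)
  moreover have "(\<Union>i<k. B \<inter> P i) = B" using P(3) by auto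
  ultimately show ?thesis by simp
qed

lemma chart_volume_change:
  assumes "c \<in> A" "d \<in> A" "B \<in> sets borel" "B \<subseteq> chart_dom c" "B \<subseteq> chart_dom d"
  shows "chart_volume c B = chart_volume d B"
  using isometry_chart_volume[OF isometry_id assms(1-4)] assms(5) by (simp add: chart_volume_def)

text \<open>The measures of the charts are glued along a partition. By
  \<open>chart_volume_change\<close> the result has the right values in all other charts.\<close>

lemma volume_exists: "\<exists>V. is_volume V"
proof -
  obtain k :: nat and c P where c: "\<And>i. i < k \<Longrightarrow> c i \<in> A" and P: "\<And>i. i < k \<Longrightarrow> P i \<in> sets borel"
    "\<And>i. i < k \<Longrightarrow> P i \<subseteq> chart_dom (c i)" "disjoint_family_on P {..<k}" "(\<Union>i<k. P i) = (UNIV :: 'm set)"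
    using chart_partition by blast
  define m where "m B = (\<Sum>i<k. emeasure (chart_measure (c i)) (B \<inter> P i))" for B
  define V :: "'m measure" where "V = measure_of UNIV (sets borel) m"
  have sets_V: "sets V = sets borel"
    unfolding V_def using sets.space_closed[of "borel :: 'm measure"] sets.sigma_sets_eq[of "borel :: 'm measure"]
    by (subst sets_measure_of) auto
  have "countably_additive (sets borel) m"
  proof (rule countably_additiveI)
    fix F :: "nat \<Rightarrow> 'm set" assume F: "range F \<subseteq> sets borel" "disjoint_family F"
    have "(\<Sum>n. m (F n)) = (\<Sum>i<k. \<Sum>n. emeasure (chart_measure (c i)) (F n \<inter> P i))"
      unfolding m_def by (rule suminf_sum) simp
    also have "\<dots> = (\<Sum>i<k. emeasure (chart_measure (c i)) (\<Union>n. F n \<inter> P i))"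
      using F P(1) by (intro sum.cong refl suminf_emeasure) (auto simp: disjoint_family_on_def)
    also have "\<dots> = m (\<Union> (range F))" by (simp add: m_def)
    finally show "(\<Sum>n. m (F n)) = m (\<Union> (range F))" .
  qed
  moreover have "positive (sets borel) m" by (simp add: positive_def m_def)
  ultimately have eV: "emeasure V B = m B" if "B \<in> sets borel" for B
    unfolding V_def using sets.sigma_algebra_axioms[of "borel :: 'm measure"] that
    by (intro emeasure_measure_of_sigma) simp_all
  have "emeasure V B = chart_volume d B" if d: "d \<in> A" and B: "B \<in> sets borel" "B \<subseteq> chart_dom d" for d B
  proof -
    have "emeasure (chart_measure (c i)) (B \<inter> P i) = emeasure (chart_measure d) (B \<inter> P i)" if i: "i < k" for i
    proof -
      have BP: "B \<inter> P i \<in> sets borel" using B P(1)[OF i] by simp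
      have "B \<inter> P i \<inter> chart_dom (c i) = B \<inter> P i" "B \<inter> P i \<inter> chart_dom d = B \<inter> P i"
        using P(2)[OF i] B by auto
      thus ?thesis
        using chart_volume_change[OF c[OF i] d BP] P(2)[OF i] B BP
        by (auto simp: emeasure_chart_measure c[OF i] d)
    qed
    hence "emeasure V B = (\<Sum>i<k. emeasure (chart_measure d) (B \<inter> P i))"
      by (simp add: eV B m_def)
    also have "\<dots> = emeasure (chart_measure d) B"
      by (rule measure_partition_sum[symmetric]) (use P B in auto)
    also have "\<dots> = chart_volume d B"
      using B by (simp add: emeasure_chart_measure d Int_absorb2)
    finally show ?thesis .
  qed
  thus ?thesis using sets_V unfolding is_volume_def by blast
qed

lemma volume_unique:
  assumes V: "is_volume V" "is_volume V'"
  shows "V = V'"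
proof (rule measure_eqI)
  show "sets V = sets V'" using V by (simp add: is_volume_def)
  fix B assume "B \<in> sets V"
  hence B: "B \<in> sets borel" using V by (simp add: is_volume_def)
  obtain k :: nat and c P where c: "\<And>i. i < k \<Longrightarrow> c i \<in> A" and P: "\<And>i. i < k \<Longrightarrow> P i \<in> sets borel"
    "\<And>i. i < k \<Longrightarrow> P i \<subseteq> chart_dom (c i)" "disjoint_family_on P {..<k}" "(\<Union>i<k. P i) = (UNIV :: 'm set)"
    using chart_partition by blast
  have "emeasure W B = (\<Sum>i<k. chart_volume (c i) (B \<inter> P i))" if W: "is_volume W" for W
  proof -
    have "emeasure W B = (\<Sum>i<k. emeasure W (B \<inter> P i))"
      by (rule measure_partition_sum) (use P B W in \<open>auto simp: is_volume_def\<close>)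
    also have "\<dots> = (\<Sum>i<k. chart_volume (c i) (B \<inter> P i))"
    proof (rule sum.cong[OF refl])
      fix i assume "i \<in> {..<k}"
      hence i: "i < k" by simp
      have "B \<inter> P i \<in> sets borel" "B \<inter> P i \<subseteq> chart_dom (c i)" using B P(1,2)[OF i] by auto
      thus "emeasure W (B \<inter> P i) = chart_volume (c i) (B \<inter> P i)"
        using W c[OF i] unfolding is_volume_def by blast
    qed
    finally show ?thesis .
  qed
  thus "emeasure V B = emeasure V' B" using V by simp
qed

abbreviation vol :: "'m measure" where "vol \<equiv> riemannian_volume A G"

lemma is_volume_vol: "is_volume vol"
proof -
  have "vol = (THE V. is_volume V)"
    unfolding riemannian_volume_def is_volume_def chart_volume_def rho_def ..
  thus ?thesis using theI'[of is_volume] volume_exists volume_unique by metis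
qed

lemma sets_vol [simp, measurable_cong]: "sets vol = sets borel"
  and emeasure_vol: "c \<in> A \<Longrightarrow> B \<in> sets borel \<Longrightarrow> B \<subseteq> chart_dom c \<Longrightarrow> emeasure vol B = chart_volume c B"
  using is_volume_vol by (auto simp: is_volume_def)

lemma space_vol [simp]: "space vol = UNIV"
  using sets_eq_imp_space_eq[OF sets_vol] by simp

lemma vol_finite: "emeasure vol UNIV < \<infinity>"
proof -
  have "\<exists>U. open U \<and> p \<in> U \<and> emeasure vol U < \<infinity>" for p
  proof -
    obtain c where c: "c \<in> A" "p \<in> chart_dom c" using charts_cover by blast
    let ?x = "chart_map c p"
    obtain r where r: "r > 0" "cball ?x r \<subseteq> cim c"
      using open_cim[OF c(1)] c(2) open_contains_cball by blast
    define U where "U = chart_dom c \<inter> chart_map c -` ball ?x r"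
    have U: "open U" "p \<in> U" "U \<subseteq> chart_dom c"
      using open_chart_preimage[OF c(1)] c r by (auto simp: U_def)
    have "emeasure vol U = (\<integral>\<^sup>+x. ennreal (rho c x) * indicator (chart_map c ` U) x \<partial>lborel)"
      using U c by (simp add: emeasure_vol chart_volume_def)
    also have "\<dots> \<le> (\<integral>\<^sup>+x. ennreal (indicator (cball ?x r) x * rho c x) \<partial>lborel)"
      by (intro nn_integral_mono) (auto simp: U_def indicator_def)
    also have "\<dots> = ennreal (integral (cball ?x r) (rho c))"
    proof (rule nn_integral_continuous_compact)
      show "continuous_on (cball ?x r) (rho c)" by (rule continuous_on_subset[OF rho_cont[OF c(1)] r(2)])
      show "0 \<le> rho c x" if "x \<in> cball ?x r" for x using rho_pos[OF c(1)] r(2) that less_imp_le by blast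
    qed simp
    also have "\<dots> < \<infinity>" by simp
    finally show ?thesis using U by blast
  qed
  then obtain U where U: "\<And>p. open (U p)" "\<And>p. p \<in> U p" "\<And>p. emeasure vol (U p) < \<infinity>" by metis
  obtain F where F: "finite F" "UNIV \<subseteq> (\<Union>p\<in>F. U p)"
    using compactE_image[OF compact_UNIV, of UNIV U] U by (metis UNIV_I UN_I subsetI)
  have "emeasure vol UNIV \<le> emeasure vol (\<Union>p\<in>F. U p)"
    using F U by (intro emeasure_mono) (auto intro!: sets.finite_UN)
  also have "\<dots> \<le> (\<Sum>p\<in>F. emeasure vol (U p))"
    using F U by (intro emeasure_subadditive_finite) auto
  also have "\<dots> < \<infinity>" using F U by simp
  finally show ?thesis .
qed

lemma vol_open_pos:
  assumes U: "open U" "U \<noteq> {}"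
  shows "0 < emeasure vol U"
proof -
  obtain p where p: "p \<in> U" using U by blast
  obtain c where c: "c \<in> A" "p \<in> chart_dom c" using charts_cover by blast
  define W where "W = U \<inter> chart_dom c"
  have "open W" unfolding W_def by (intro open_Int U open_dom c)
  hence W: "open W" "W \<subseteq> chart_dom c" "p \<in> W" using c p by (auto simp: W_def)
  have oW: "open (chart_map c ` W)" by (rule open_chart_image[OF c(1) W(1,2)])
  have "emeasure vol W \<noteq> 0"
  proof
    assume "emeasure vol W = 0"
    hence "(\<integral>\<^sup>+x. ennreal (rho c x) * indicator (chart_map c ` W) x \<partial>lborel) = 0"
      using W c by (simp add: emeasure_vol chart_volume_def)
    moreover have "(\<lambda>x. ennreal (rho c x) * indicator (chart_map c ` W) x)
        = (\<lambda>x. ennreal (rho_total c x) * indicator (chart_map c ` W) x)"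
      using W(2) by (auto simp: rho_total_def indicator_def fun_eq_iff)
    ultimately have "(\<integral>\<^sup>+x. ennreal (rho_total c x) * indicator (chart_map c ` W) x \<partial>lborel) = 0" by simp
    moreover have "(\<lambda>x. ennreal (rho_total c x) * indicator (chart_map c ` W) x) \<in> borel_measurable lborel"
      using rho_total_measurable[OF c(1)] oW by simp
    ultimately have "AE x in lborel. ennreal (rho_total c x) * indicator (chart_map c ` W) x = 0"
      by (subst (asm) nn_integral_0_iff_AE)
    hence "AE x in lborel. x \<notin> chart_map c ` W"
    proof eventually_elim
      case (elim x)
      show ?case
      proof
        assume x: "x \<in> chart_map c ` W"
        hence "x \<in> cim c" using W by blast
        thus False using elim x rho_pos[OF c(1), of x] by (simp add: rho_total_def)
      qed
    qed
    hence "emeasure lborel (chart_map c ` W) = 0"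
      using oW by (subst (asm) AE_iff_measurable[of "chart_map c ` W"]) auto
    moreover have "emeasure lborel (chart_map c ` W) \<noteq> 0"
      using open_not_negligible[OF oW] W(3) oW by (auto simp: negligible_iff_null_sets null_sets_def)
    ultimately show False by simp
  qed
  moreover have "emeasure vol W \<le> emeasure vol U"
    using U W by (intro emeasure_mono) (auto simp: W_def)
  ultimately show ?thesis by (simp add: zero_less_iff_neq_zero) (metis le_zero_eq)
qed

abbreviation N :: "'m measure" where "N \<equiv> normalized_volume A G"

definition kappa :: real where "kappa = 1 / measure vol UNIV"

lemma vol_measure_pos: "0 < measure vol UNIV"
  using vol_finite vol_open_pos[of UNIV] by (simp add: measure_def enn2real_positive_iff)

lemma kappa_pos: "0 < kappa"
  using vol_measure_pos by (simp add: kappa_def)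

lemma sets_N [simp, measurable_cong]: "sets N = sets borel"
  by (simp add: normalized_volume_def)

lemma space_N [simp]: "space N = UNIV"
  using sets_eq_imp_space_eq[OF sets_N] by simp

lemma emeasure_N: "emeasure N B = ennreal kappa * emeasure vol B"
proof -
  have "emeasure vol UNIV = ennreal (measure vol UNIV)"
    using vol_finite by (simp add: emeasure_eq_ennreal_measure less_top)
  hence "1 / emeasure vol UNIV = ennreal kappa"
    using vol_measure_pos by (simp add: kappa_def divide_ennreal[symmetric])
  thus ?thesis by (simp add: normalized_volume_def)
qed

lemma N_finite: "finite_measure N"
  using vol_finite by (intro finite_measureI) (simp add: emeasure_N ennreal_mult_eq_top_iff less_top)

lemma N_open_pos: "open U \<Longrightarrow> U \<noteq> {} \<Longrightarrow> 0 < emeasure N U"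
  using vol_open_pos[of U] kappa_pos by (simp add: emeasure_N ennreal_zero_less_mult_iff)

text \<open>Stated as an identity of measures, so that integrability and the value of an integral
  can both be transferred to the image of the chart.\<close>

lemma density_N_chart:
  assumes c: "c \<in> A"
  shows "density N (indicator (chart_dom c)) = distr (density lborel (\<lambda>x. ennreal (kappa * rho_total c x))) borel (inv_total c)"
proof (rule measure_eqI)
  note [measurable] = rho_total_measurable[OF c] inv_total_measurable[OF c]
  have dm: "chart_dom c \<in> sets borel" using open_dom[OF c] by simp
  show "sets (density N (indicator (chart_dom c))) =
    sets (distr (density lborel (\<lambda>x. ennreal (kappa * rho_total c x))) borel (inv_total c))" by simp
  fix B assume "B \<in> sets (density N (indicator (chart_dom c)))"
  hence B [measurable]: "B \<in> sets borel" by simp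
  have "emeasure (density N (indicator (chart_dom c))) B = emeasure N (B \<inter> chart_dom c)"
    using dm B by (subst emeasure_density) (auto simp: indicator_inter_arith[symmetric] Int_commute intro!: nn_integral_indicator)
  also have "\<dots> = ennreal kappa * emeasure (chart_measure c) B"
    using dm B c by (simp add: emeasure_N emeasure_vol emeasure_chart_measure)
  also have "\<dots> = ennreal kappa * (\<integral>\<^sup>+x. ennreal (rho_total c x) * indicator (inv_total c -` B) x \<partial>lborel)"
    using measurable_sets[OF inv_total_measurable[OF c] B] unfolding chart_measure_def
    by (subst emeasure_distr) (auto simp: emeasure_density)
  also have "\<dots> = (\<integral>\<^sup>+x. ennreal kappa * (ennreal (rho_total c x) * indicator (inv_total c -` B) x) \<partial>lborel)"
    using measurable_sets[OF inv_total_measurable[OF c] B] by (intro nn_integral_cmult[symmetric]) auto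
  also have "\<dots> = (\<integral>\<^sup>+x. ennreal (kappa * rho_total c x) * indicator (inv_total c -` B) x \<partial>lborel)"
    using kappa_pos by (simp add: ennreal_mult' mult.assoc)
  also have "\<dots> = emeasure (distr (density lborel (\<lambda>x. ennreal (kappa * rho_total c x))) borel (inv_total c)) B"
    using measurable_sets[OF inv_total_measurable[OF c] B]
    by (subst emeasure_distr) (auto simp: emeasure_density)
  finally show "emeasure (density N (indicator (chart_dom c))) B =
    emeasure (distr (density lborel (\<lambda>x. ennreal (kappa * rho_total c x))) borel (inv_total c)) B" .
qed

lemma integral_N_chart:
  fixes f :: "'m \<Rightarrow> real"
  assumes c: "c \<in> A" and f: "f \<in> borel_measurable borel" and supp: "\<And>p. p \<notin> chart_dom c \<Longrightarrow> f p = 0"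
  shows "integrable N f \<longleftrightarrow> integrable lborel (\<lambda>x. indicator (cim c) x * (kappa * rho c x * f (chart_inv c x)))"
    and "(\<integral>p. f p \<partial>N) = (\<integral>x. indicator (cim c) x * (kappa * rho c x * f (chart_inv c x)) \<partial>lborel)"
proof -
  note [measurable] = rho_total_measurable[OF c] inv_total_measurable[OF c] f
  have dm: "chart_dom c \<in> sets borel" using open_dom[OF c] by simp
  have f1: "(\<lambda>p. indicator (chart_dom c) p * f p) = f" using supp by (auto simp: fun_eq_iff indicator_def)
  have f2: "(\<lambda>x. kappa * rho_total c x * f (inv_total c x))
      = (\<lambda>x. indicator (cim c) x * (kappa * rho c x * f (chart_inv c x)))"
    by (auto simp: fun_eq_iff indicator_def rho_total_def inv_total_def)
  have dens: "density N (indicator (chart_dom c)) = density N (\<lambda>p. ennreal (indicator (chart_dom c) p))"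
    by (simp add: ennreal_indicator)
  have kr: "0 \<le> kappa * rho_total c x" for x using kappa_pos rho_total_nonneg[OF c] by simp
  have "integrable N f \<longleftrightarrow> integrable (density N (\<lambda>p. ennreal (indicator (chart_dom c) p))) f"
    using dm by (subst integrable_density) (auto simp: f1)
  also have "\<dots> \<longleftrightarrow> integrable (density lborel (\<lambda>x. ennreal (kappa * rho_total c x))) (\<lambda>x. f (inv_total c x))"
    unfolding dens[symmetric] density_N_chart[OF c] by (rule integrable_distr_eq) measurable
  also have "\<dots> \<longleftrightarrow> integrable lborel (\<lambda>x. indicator (cim c) x * (kappa * rho c x * f (chart_inv c x)))"
    using kr by (subst integrable_density) (auto simp: f2[symmetric])
  finally show "integrable N f \<longleftrightarrow> integrable lborel (\<lambda>x. indicator (cim c) x * (kappa * rho c x * f (chart_inv c x)))" .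
  have "(\<integral>p. f p \<partial>N) = (\<integral>p. f p \<partial>density N (\<lambda>p. ennreal (indicator (chart_dom c) p)))"
    using dm by (subst integral_density) (auto simp: f1)
  also have "\<dots> = (\<integral>x. f (inv_total c x) \<partial>density lborel (\<lambda>x. ennreal (kappa * rho_total c x)))"
    unfolding dens[symmetric] density_N_chart[OF c] by (rule integral_distr) measurable
  also have "\<dots> = (\<integral>x. indicator (cim c) x * (kappa * rho c x * f (chart_inv c x)) \<partial>lborel)"
    using kr by (subst integral_density) (auto simp: f2[symmetric])
  finally show "(\<integral>p. f p \<partial>N) = (\<integral>x. indicator (cim c) x * (kappa * rho c x * f (chart_inv c x)) \<partial>lborel)" .
qed

text \<open>The transported measure satisfies the characterization of the volume: a Borel set in
  the domain of a chart is cut into pieces, each of which \<open>T\<close> maps into the domain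
  of a single chart.\<close>

lemma isometry_vol:
  assumes T: "riemannian_isometry A G T"
  shows "distr vol borel (inv T) = vol"
proof (rule volume_unique[OF _ is_volume_vol])
  have mT: "inv T \<in> borel_measurable borel"
    using isometry_inv_cont[OF T] by (rule borel_measurable_continuous_onI)
  have cT: "T \<in> borel_measurable borel"
    using isometry_cont[OF T] by (rule borel_measurable_continuous_onI)
  have "emeasure (distr vol borel (inv T)) B = chart_volume c B"
    if c: "c \<in> A" and B: "B \<in> sets borel" "B \<subseteq> chart_dom c" for c B
  proof -
    obtain k :: nat and d P where d: "\<And>i. i < k \<Longrightarrow> d i \<in> A" and P: "\<And>i. i < k \<Longrightarrow> P i \<in> sets borel"
      "\<And>i. i < k \<Longrightarrow> P i \<subseteq> chart_dom (d i)" "disjoint_family_on P {..<k}" "(\<Union>i<k. P i) = (UNIV :: 'm set)"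
      using chart_partition by blast
    have TB: "T ` B \<in> sets borel" by (rule isometry_image_borel[OF T B(1)])
    have TP: "T -` P i \<in> sets borel" if "i < k" for i using measurable_sets[OF cT P(1)[OF that]] by simp
    have "inv T -` B = T ` B"
      using isometry_bij[OF T] by (simp add: bij_vimage_eq_inv_image bij_imp_bij_inv inv_inv_eq)
    hence "emeasure (distr vol borel (inv T)) B = emeasure vol (T ` B)"
      using mT B by (subst emeasure_distr) auto
    also have "\<dots> = (\<Sum>i<k. emeasure vol (T ` B \<inter> P i))"
      by (rule measure_partition_sum) (use P TB in auto)
    also have "\<dots> = (\<Sum>i<k. emeasure vol (B \<inter> T -` P i))"
    proof (rule sum.cong[OF refl])
      fix i assume "i \<in> {..<k}"
      hence i: "i < k" by simp
      have eq: "T ` B \<inter> P i = T ` (B \<inter> T -` P i)" by auto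
      have BT: "B \<inter> T -` P i \<in> sets borel" using B TP[OF i] by simp
      have "emeasure vol (T ` B \<inter> P i) = chart_volume (d i) (T ` B \<inter> P i)"
        using TB P(1,2)[OF i] d[OF i] by (intro emeasure_vol) auto
      also have "\<dots> = chart_volume c (B \<inter> T -` P i)"
        unfolding eq chart_volume_def using P(2)[OF i] B
        by (intro isometry_chart_volume[OF T c d[OF i] BT]) auto
      also have "\<dots> = emeasure vol (B \<inter> T -` P i)"
        using BT B c by (intro emeasure_vol[symmetric]) auto
      finally show "emeasure vol (T ` B \<inter> P i) = emeasure vol (B \<inter> T -` P i)" .
    qed
    also have "\<dots> = emeasure vol B"
    proof (rule measure_partition_sum[symmetric])
      show "disjoint_family_on (\<lambda>i. T -` P i) {..<k}" using P(3) by (auto simp: disjoint_family_on_def)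
      show "B \<subseteq> (\<Union>i<k. T -` P i)" using P(4) by blast
    qed (use TP B in auto)
    also have "\<dots> = chart_volume c B" using B c by (simp add: emeasure_vol)
    finally show ?thesis .
  qed
  thus "is_volume (distr vol borel (inv T))" by (simp add: is_volume_def)
qed

lemma isometry_N:
  assumes T: "riemannian_isometry A G T"
  shows "distr N borel T = N"
proof (rule measure_eqI)
  have mT: "inv T \<in> borel_measurable borel"
    using isometry_inv_cont[OF T] by (rule borel_measurable_continuous_onI)
  have cT: "T \<in> borel_measurable borel"
    using isometry_cont[OF T] by (rule borel_measurable_continuous_onI)
  fix B assume "B \<in> sets (distr N borel T)"
  hence B: "B \<in> sets borel" by simp
  have TB: "T -` B \<in> sets borel" using measurable_sets[OF cT B] by simp
  have "emeasure vol (T -` B) = emeasure (distr vol borel (inv T)) (T -` B)"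
    by (simp add: isometry_vol[OF T])
  also have "\<dots> = emeasure vol (inv T -` (T -` B))"
    using mT TB by (subst emeasure_distr) auto
  also have "inv T -` (T -` B) = B"
    using isometry_bij[OF T] by (auto simp: bij_is_surj surj_f_inv_f)
  finally have "emeasure vol (T -` B) = emeasure vol B" .
  thus "emeasure (distr N borel T) B = emeasure N B"
    using cT B by (subst emeasure_distr) (auto simp: emeasure_N)
qed simp

end

section \<open>Smooth functions on the manifold\<close>

context riemannian
begin

lemma smooth_funD: "smooth_fun A u \<Longrightarrow> c \<in> A \<Longrightarrow> smooth_on (u \<circ> chart_inv c) (cim c)"
  by (simp add: smooth_fun_def)

lemma smooth_pullback:
  assumes T: "smooth_map A T" and cd: "c \<in> A" "d \<in> A"
    and W: "open W" "W \<subseteq> rep_dom T c d" and U: "open U" "local_rep T c d ` W \<subseteq> U"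
    and u: "smooth_on ((u :: 'm \<Rightarrow> real) \<circ> chart_inv d) U"
  shows "smooth_on (u \<circ> T \<circ> chart_inv c) W"
proof (rule smooth_on_cong[OF W(1)])
  show "smooth_on (\<lambda>x. (u \<circ> chart_inv d) (local_rep T c d x)) W"
    by (rule smooth_on_compose[OF W(1) U(1) smooth_on_subset[OF smooth_local_rep[OF T cd] W(2)] U(2) u])
  fix x assume "x \<in> W"
  hence "T (chart_inv c x) \<in> chart_dom d" using W(2) cd by (auto simp: rep_dom_def)
  thus "(u \<circ> chart_inv d) (local_rep T c d x) = (u \<circ> T \<circ> chart_inv c) x"
    using cd by (simp add: local_rep_def)
qed

lemma smooth_fun_pullback:
  assumes T: "smooth_map A T" and u: "smooth_fun A u"
  shows "smooth_fun A (u \<circ> T)"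
  unfolding smooth_fun_def
proof (intro ballI smooth_on_locally)
  fix c x assume c: "c \<in> A" and x: "x \<in> cim c"
  then obtain p where p: "p \<in> chart_dom c" "x = chart_map c p" by blast
  obtain d where d: "d \<in> A" "T p \<in> chart_dom d" using charts_cover by blast
  have "smooth_on (u \<circ> T \<circ> chart_inv c) (rep_dom T c d)"
    using smooth_pullback[OF T c d(1) open_rep_dom[OF T c d(1)] _ open_cim[OF d(1)] local_rep_range[OF c]
        smooth_funD[OF u d(1)]] by blast
  moreover have "x \<in> rep_dom T c d" using p d by (auto simp: rep_dom_def)
  ultimately show "\<exists>U. open U \<and> x \<in> U \<and> smooth_on (u \<circ> T \<circ> chart_inv c) U"
    using open_rep_dom[OF T c d(1)] by blast
qed

text \<open>Smoothness in one chart passes to the others by composition with a change of charts,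
  that is, by pullback along the identity.\<close>

lemma smooth_funI_local:
  assumes loc: "\<And>p. \<exists>c\<in>A. \<exists>U. open U \<and> p \<in> U \<and> U \<subseteq> chart_dom c \<and> smooth_on (u \<circ> chart_inv c) (chart_map c ` U)"
  shows "smooth_fun A u"
  unfolding smooth_fun_def
proof (intro ballI smooth_on_locally)
  fix d x assume d: "d \<in> A" and x: "x \<in> cim d"
  then obtain p where p: "p \<in> chart_dom d" "x = chart_map d p" by blast
  obtain c U where c: "c \<in> A" and U: "open U" "p \<in> U" "U \<subseteq> chart_dom c"
    and u: "smooth_on (u \<circ> chart_inv c) (chart_map c ` U)" using loc[of p] by blast
  let ?W = "chart_map d ` (U \<inter> chart_dom d)"
  have W: "open ?W" using U open_dom[OF d] by (intro open_chart_image[OF d]) auto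
  have sub: "?W \<subseteq> rep_dom id d c" using U by (auto simp: rep_dom_def)
  have img: "local_rep id d c ` ?W \<subseteq> chart_map c ` U" using d by (auto simp: local_rep_def)
  have "smooth_on (u \<circ> id \<circ> chart_inv d) ?W"
    by (rule smooth_pullback[OF isometry_smooth[OF isometry_id] d c W sub open_chart_image[OF c U(1,3)] img u])
  thus "\<exists>U. open U \<and> x \<in> U \<and> smooth_on (u \<circ> chart_inv d) U" using W p U by auto
qed

lemma smooth_fun_continuous:
  assumes u: "smooth_fun A u"
  shows "continuous_on UNIV u"
proof -
  have "isCont u p" for p
  proof -
    obtain c where c: "c \<in> A" "p \<in> chart_dom c" using charts_cover by blast
    have "continuous_on (chart_dom c) (\<lambda>q. (u \<circ> chart_inv c) (chart_map c q))"
      by (rule continuous_on_compose2[OF smooth_on_continuous[OF smooth_funD[OF u c(1)]] cont_map[OF c(1)]]) simp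
    hence "continuous_on (chart_dom c) u"
      by (rule continuous_on_cong[THEN iffD1, rotated 2]) (use c in auto)
    thus ?thesis using continuous_on_eq_continuous_at[OF open_dom[OF c(1)]] c by blast
  qed
  thus ?thesis by (simp add: continuous_at_imp_continuous_on)
qed

lemma smooth_fun_measurable [measurable]: "smooth_fun A u \<Longrightarrow> u \<in> borel_measurable borel"
  using smooth_fun_continuous by (rule borel_measurable_continuous_onI)

lemma continuous_bounded:
  assumes "continuous_on UNIV (u :: 'm \<Rightarrow> real)"
  obtains B where "\<And>p. \<bar>u p\<bar> \<le> B"
  using compact_imp_bounded[OF compact_continuous_image[OF assms compact_UNIV]]
  by (auto simp: bounded_iff)

lemma continuous_integrable:
  assumes "continuous_on UNIV (u :: 'm \<Rightarrow> real)"
  shows "integrable N u"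
proof -
  obtain B where B: "\<And>p. \<bar>u p\<bar> \<le> B" using continuous_bounded[OF assms] by blast
  interpret finite_measure N by (rule N_finite)
  have "u \<in> borel_measurable N" using borel_measurable_continuous_onI[OF assms] by simp
  thus ?thesis using B by (intro integrable_const_bound[of _ B]) auto
qed

lemma smooth_fun_integrable: "smooth_fun A u \<Longrightarrow> integrable N u"
  by (intro continuous_integrable smooth_fun_continuous)

lemma smooth_fun_const: "smooth_fun A (\<lambda>p. a)"
  by (simp add: smooth_fun_def o_def smooth_on_const)

lemma smooth_fun_add: "smooth_fun A u \<Longrightarrow> smooth_fun A v \<Longrightarrow> smooth_fun A (\<lambda>p. u p + v p)"
  unfolding smooth_fun_def o_def by (auto intro!: smooth_on_add open_cim)

lemma smooth_fun_mult: "smooth_fun A u \<Longrightarrow> smooth_fun A v \<Longrightarrow> smooth_fun A (\<lambda>p. u p * v p)"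
  unfolding smooth_fun_def o_def by (auto intro!: smooth_on_mult open_cim)

lemma smooth_fun_scale: "smooth_fun A u \<Longrightarrow> smooth_fun A (\<lambda>p. a * u p)"
  by (intro smooth_fun_mult smooth_fun_const)

lemma smooth_fun_divide:
  "smooth_fun A u \<Longrightarrow> smooth_fun A v \<Longrightarrow> (\<And>p. v p \<noteq> 0) \<Longrightarrow> smooth_fun A (\<lambda>p. u p / v p)"
  unfolding smooth_fun_def o_def by (auto intro!: smooth_on_divide open_cim)

lemma smooth_fun_sum: "(\<And>i. i \<in> I \<Longrightarrow> smooth_fun A (u i)) \<Longrightarrow> smooth_fun A (\<lambda>p. \<Sum>i\<in>I. u i p)"
  unfolding smooth_fun_def o_def by (auto intro!: smooth_on_sum open_cim)

lemma smooth_fun_L2: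
  assumes "smooth_fun A u"
  shows "u \<in> L2 N"
  using smooth_fun_integrable[OF smooth_fun_mult[OF assms assms]] smooth_fun_measurable[OF assms]
  by (simp add: L2_def power2_eq_square)

subsection \<open>Bump functions and partitions of unity\<close>

text \<open>In a chart with \<open>a\<close> the image of \<open>p\<close>, compose \<open>flat
  0\<close> with \<open>r\<^sup>2 - (norm (x - a))\<^sup>2\<close>. Away from the closed ball of
  radius \<open>r\<close> the function is zero, so that its extension by zero is smooth.\<close>

lemma bump_function:
  assumes U: "open U" "p \<in> U"
  obtains \<psi> K where "smooth_fun A \<psi>" "\<And>q. 0 \<le> \<psi> q" "0 < \<psi> p" "compact K" "K \<subseteq> U" "\<And>q. q \<notin> K \<Longrightarrow> \<psi> q = 0"
proof -
  obtain c where c: "c \<in> A" "p \<in> chart_dom c" using charts_cover by blast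
  let ?a = "chart_map c p" and ?W = "chart_map c ` (U \<inter> chart_dom c)"
  have W: "open ?W" using U open_dom[OF c(1)] by (intro open_chart_image[OF c(1)]) auto
  have "?a \<in> ?W" using U c by blast
  then obtain r where r: "r > 0" "cball ?a r \<subseteq> ?W" using W open_contains_cball by blast
  \<comment> \<open>Written in coordinates, so that \<open>q\<close> is visibly a polynomial.\<close>
  define q where "q x = r\<^sup>2 - (\<Sum>i\<in>UNIV. (x $ i - ?a $ i) * (x $ i - ?a $ i))" for x :: "real ^ 'n"
  have q: "q x = r\<^sup>2 - (norm (x - ?a))\<^sup>2" for x
    by (simp add: q_def power2_norm_eq_inner inner_vec_def)
  have q_smooth: "smooth_on q (cim c)"
    unfolding q_def
    by (intro smooth_on_diff smooth_on_sum smooth_on_mult smooth_on_const open_cim c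
        smooth_on_linear bounded_linear_vec_nth)
  define \<psi> where "\<psi> y = (if y \<in> chart_dom c then flat 0 (q (chart_map c y)) else 0)" for y
  define K where "K = chart_inv c ` cball ?a r"
  have rc: "cball ?a r \<subseteq> cim c" using r by auto
  have K: "compact K"
    unfolding K_def by (rule compact_continuous_image[OF continuous_on_subset[OF cont_inv[OF c(1)] rc]]) simp
  have KU: "K \<subseteq> U \<inter> chart_dom c" unfolding K_def using r c by auto
  have off: "\<psi> y = 0" if "y \<notin> K" for y
  proof (cases "y \<in> chart_dom c")
    case True
    have "chart_map c y \<notin> cball ?a r"
    proof
      assume "chart_map c y \<in> cball ?a r"
      hence "chart_inv c (chart_map c y) \<in> K" unfolding K_def by blast
      thus False using that True c by simp
    qed
    hence "r < norm (chart_map c y - ?a)" by (simp add: dist_norm norm_minus_commute)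
    hence "r\<^sup>2 \<le> (norm (chart_map c y - ?a))\<^sup>2" using r by (intro power_mono) auto
    thus ?thesis by (simp add: \<psi>_def q flat_zero)
  qed (simp add: \<psi>_def)
  have "smooth_fun A \<psi>"
  proof (rule smooth_funI_local)
    fix y
    show "\<exists>e\<in>A. \<exists>V. open V \<and> y \<in> V \<and> V \<subseteq> chart_dom e \<and> smooth_on (\<psi> \<circ> chart_inv e) (chart_map e ` V)"
    proof (cases "y \<in> chart_dom c")
      case True
      have "smooth_on (\<psi> \<circ> chart_inv c) (cim c)"
        by (rule smooth_on_cong[OF open_cim[OF c(1)] _ smooth_on_flat[OF open_cim[OF c(1)] q_smooth, of 0]])
          (use c in \<open>auto simp: \<psi>_def\<close>)
      thus ?thesis using True c open_dom[OF c(1)] by blast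
    next
      case False
      obtain e where e: "e \<in> A" "y \<in> chart_dom e" using charts_cover by blast
      let ?V = "chart_dom e - K"
      have V: "open ?V" using open_dom[OF e(1)] compact_imp_closed[OF K] by (rule open_Diff)
      have "smooth_on (\<psi> \<circ> chart_inv e) (chart_map e ` ?V)"
      proof (rule smooth_on_cong[OF open_chart_image[OF e(1) V] _ smooth_on_const[of 0]])
        fix x assume "x \<in> chart_map e ` ?V"
        thus "0 = (\<psi> \<circ> chart_inv e) x" using e off by auto
      qed auto
      thus ?thesis using V e False KU by blast
    qed
  qed
  moreover have "0 < \<psi> p" using c r by (simp add: \<psi>_def q flat_pos)
  moreover have "0 \<le> \<psi> y" for y by (simp add: \<psi>_def flat_nonneg)
  ultimately show ?thesis using that[of \<psi> K] K KU off by blast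
qed

text \<open>By compactness, finitely many bump functions have a positive sum, by which they are
  divided.\<close>

lemma partition_of_unity:
  obtains I :: "'m set" and \<theta> c K where "finite I" "\<And>i. i \<in> I \<Longrightarrow> smooth_fun A (\<theta> i)"
    "\<And>i. i \<in> I \<Longrightarrow> c i \<in> A" "\<And>i. i \<in> I \<Longrightarrow> compact (K i)" "\<And>i. i \<in> I \<Longrightarrow> K i \<subseteq> chart_dom (c i)"
    "\<And>i p. i \<in> I \<Longrightarrow> p \<notin> K i \<Longrightarrow> \<theta> i p = (0::real)" "\<And>p. (\<Sum>i\<in>I. \<theta> i p) = 1"
proof -
  have "\<exists>c \<psi> K. c \<in> A \<and> smooth_fun A \<psi> \<and> (\<forall>q. 0 \<le> \<psi> q) \<and> 0 < \<psi> p \<and> compact K \<and> K \<subseteq> chart_dom c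
      \<and> (\<forall>q. q \<notin> K \<longrightarrow> \<psi> q = 0)" for p
  proof -
    obtain c where c: "c \<in> A" "p \<in> chart_dom c" using charts_cover by blast
    obtain \<psi> K where "smooth_fun A \<psi>" "\<And>q. 0 \<le> \<psi> q" "0 < \<psi> p" "compact K" "K \<subseteq> chart_dom c"
      "\<And>q. q \<notin> K \<Longrightarrow> \<psi> q = 0" by (rule bump_function[OF open_dom[OF c(1)] c(2)]) blast
    thus ?thesis using c by blast
  qed
  then obtain c \<psi> K where c: "\<And>p. c p \<in> A" and \<psi>: "\<And>p. smooth_fun A (\<psi> p)" "\<And>p q. 0 \<le> \<psi> p q" "\<And>p. 0 < \<psi> p p"
    and K: "\<And>p. compact (K p)" "\<And>p. K p \<subseteq> chart_dom (c p)" "\<And>p q. q \<notin> K p \<Longrightarrow> \<psi> p q = 0"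
    by metis
  have op: "open (\<psi> p -` {0<..})" for p
    using continuous_open_vimage[of "{0<..}" "\<psi> p"] smooth_fun_continuous[OF \<psi>(1)]
    by (simp add: continuous_on_eq_continuous_at)
  have cov: "(UNIV :: 'm set) \<subseteq> (\<Union>p\<in>UNIV. \<psi> p -` {0<..})" using \<psi>(3) by auto
  obtain I where I: "finite I" "UNIV \<subseteq> (\<Union>p\<in>I. \<psi> p -` {0<..})"
    by (rule compactE_image[OF compact_UNIV op cov])
  define s where "s q = (\<Sum>p\<in>I. \<psi> p q)" for q
  have s_pos: "0 < s q" for q
  proof -
    obtain p where "p \<in> I" "0 < \<psi> p q" using I(2) by auto
    moreover from this have "\<psi> p q \<le> s q" unfolding s_def using I(1) \<psi>(2) by (intro member_le_sum) auto
    ultimately show ?thesis by linarith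
  qed
  have s_smooth: "smooth_fun A s" unfolding s_def using \<psi>(1) by (intro smooth_fun_sum)
  show ?thesis
  proof (rule that[of I "\<lambda>p q. \<psi> p q / s q" c K])
    show "smooth_fun A (\<lambda>q. \<psi> p q / s q)" for p
      by (intro smooth_fun_divide \<psi> s_smooth) (use s_pos in \<open>simp add: less_imp_neq[symmetric]\<close>)
    show "(\<Sum>p\<in>I. \<psi> p q / s q) = 1" for q
      using s_pos[of q] by (simp add: sum_divide_distrib[symmetric] s_def[symmetric])
  qed (use I(1) c K in auto)
qed

subsection \<open>The gradient pairing\<close>

lemma frechet_eq_inner_partials:
  fixes f :: "real ^ 'n \<Rightarrow> real"
  assumes "(f has_derivative f') (at x)"
  shows "f' w = w \<bullet> (\<chi> i. partial_deriv i f x)"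
proof -
  have lin: "linear f'" using assms by (rule has_derivative_linear)
  have f': "f' = frechet_derivative f (at x)" using assms by (rule frechet_derivative_at)
  have "f' w = f' (\<Sum>i\<in>UNIV. w $ i *\<^sub>R axis i 1)"
    by (simp add: basis_expansion scalar_mult_eq_scaleR[symmetric])
  also have "\<dots> = (\<Sum>i\<in>UNIV. w $ i * f' (axis i 1))"
    by (simp add: linear_sum[OF lin] linear_scale[OF lin])
  finally show ?thesis by (simp add: inner_vec_def partial_deriv_def f')
qed

definition pairing :: "('m, 'n) chart \<Rightarrow> ('m \<Rightarrow> real) \<Rightarrow> ('m \<Rightarrow> real) \<Rightarrow> real ^ 'n \<Rightarrow> real" where
  "pairing c u v x = coord_differential c u x \<bullet> (matrix_inv (G c (chart_inv c x)) *v coord_differential c v x)"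

lemma coord_differential_isometry:
  assumes T: "riemannian_isometry A G T" and u: "smooth_fun A u"
    and cd: "c \<in> A" "d \<in> A" and x: "x \<in> rep_dom T c d"
  shows "coord_differential c (u \<circ> T) x = transpose (jac T c d x) *v coord_differential d u (local_rep T c d x)"
proof -
  let ?y = "local_rep T c d x"
  have y: "?y \<in> cim d" using x local_rep_range[OF cd(1)] by blast
  note Dr = local_rep_deriv[OF T cd x]
  note Du = smooth_on_has_derivative[OF smooth_funD[OF u cd(2)] y]
  have "((\<lambda>x. (u \<circ> chart_inv d) (local_rep T c d x)) has_derivative
      (\<lambda>v. frechet_derivative (u \<circ> chart_inv d) (at ?y) (jac T c d x *v v))) (at x)"
    by (rule has_derivative_compose[OF Dr Du])
  moreover have "(u \<circ> chart_inv d) (local_rep T c d z) = (u \<circ> T \<circ> chart_inv c) z" if "z \<in> rep_dom T c d" for z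
    using that cd by (auto simp: rep_dom_def local_rep_def)
  ultimately have D: "(u \<circ> T \<circ> chart_inv c has_derivative
      (\<lambda>v. frechet_derivative (u \<circ> chart_inv d) (at ?y) (jac T c d x *v v))) (at x)"
    using has_derivative_transform_within_open[OF _ open_rep_dom[OF isometry_smooth[OF T] cd] x] by blast
  have "partial_deriv i (u \<circ> T \<circ> chart_inv c) x
      = (transpose (jac T c d x) *v coord_differential d u ?y) $ i" for i
  proof -
    have "partial_deriv i (u \<circ> T \<circ> chart_inv c) x
        = frechet_derivative (u \<circ> chart_inv d) (at ?y) (jac T c d x *v axis i 1)"
      unfolding partial_deriv_def using frechet_derivative_at[OF D] by metis
    also have "\<dots> = (jac T c d x *v axis i 1) \<bullet> coord_differential d u ?y"
      unfolding coord_differential_def by (rule frechet_eq_inner_partials[OF Du])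
    also have "\<dots> = (transpose (jac T c d x) *v coord_differential d u ?y) \<bullet> axis i 1"
      by (metis inner_transpose inner_commute)
    also have "\<dots> = (transpose (jac T c d x) *v coord_differential d u ?y) $ i"
      by (simp add: cart_eq_inner_axis)
    finally show ?thesis .
  qed
  thus ?thesis by (simp add: coord_differential_def vec_eq_iff)
qed

text \<open>Differentials are pulled back with the transposed Jacobian matrix, the metric by
  congruence, and the two cancel by \<open>congruence_inverse_form\<close>.\<close>

lemma pairing_isometry:
  assumes T: "riemannian_isometry A G T" and uv: "smooth_fun A u" "smooth_fun A v"
    and cd: "c \<in> A" "d \<in> A" and x: "x \<in> rep_dom T c d"
  shows "pairing c (u \<circ> T) (v \<circ> T) x = pairing d u v (local_rep T c d x)"
  unfolding pairing_def coord_differential_isometry[OF T uv(1) cd x] coord_differential_isometry[OF T uv(2) cd x]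
  by (rule congruence_inverse_form(1)[OF isometry_pos_defs[OF T cd x] isometry_metric[OF T cd x]])

lemma grad_inner_eq: "grad_inner A G u v p = pairing (chart_at A p) u v (chart_map (chart_at A p) p)"
  using chart_at by (simp add: grad_inner_def pairing_def Let_def)

lemma grad_inner_isometry_chart:
  assumes T: "riemannian_isometry A G T" and uv: "smooth_fun A u" "smooth_fun A v"
    and c: "c \<in> A" "p \<in> chart_dom c"
  shows "pairing c (u \<circ> T) (v \<circ> T) (chart_map c p) = grad_inner A G u v (T p)"
proof -
  let ?d = "chart_at A (T p)"
  have x: "chart_map c p \<in> rep_dom T c ?d" using c chart_at by (auto simp: rep_dom_def)
  have "pairing c (u \<circ> T) (v \<circ> T) (chart_map c p) = pairing ?d u v (local_rep T c ?d (chart_map c p))"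
    by (rule pairing_isometry[OF T uv c(1) chart_at(1) x])
  also have "local_rep T c ?d (chart_map c p) = chart_map ?d (T p)" using c by (simp add: local_rep_def)
  finally show ?thesis by (simp only: grad_inner_eq)
qed

lemma grad_inner_chart:
  assumes uv: "smooth_fun A u" "smooth_fun A v" and c: "c \<in> A" "p \<in> chart_dom c"
  shows "grad_inner A G u v p = pairing c u v (chart_map c p)"
  using grad_inner_isometry_chart[OF isometry_id uv c] by simp

lemma grad_inner_isometry:
  assumes T: "riemannian_isometry A G T" and uv: "smooth_fun A u" "smooth_fun A v"
  shows "grad_inner A G (u \<circ> T) (v \<circ> T) p = grad_inner A G u v (T p)"
  using grad_inner_chart[OF smooth_fun_pullback[OF isometry_smooth[OF T] uv(1)] smooth_fun_pullback[OF isometry_smooth[OF T] uv(2)] chart_at]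
    grad_inner_isometry_chart[OF T uv chart_at] by simp

lemma smooth_coord_differential:
  "smooth_fun A u \<Longrightarrow> c \<in> A \<Longrightarrow> smooth_on (\<lambda>x. coord_differential c u x $ i) (cim c)"
  by (simp add: coord_differential_def partial_deriv_def smooth_on_derivative smooth_funD)

lemma smooth_raised_gradient:
  assumes "smooth_fun A u" "c \<in> A"
  shows "smooth_on (\<lambda>x. (matrix_inv (G c (chart_inv c x)) *v coord_differential c u x) $ i) (cim c)"
  unfolding matrix_vector_mult_def vec_lambda_beta
  by (intro smooth_on_sum smooth_on_mult smooth_metric_inv smooth_coord_differential open_cim assms)

lemma smooth_pairing:
  assumes "smooth_fun A u" "smooth_fun A v" "c \<in> A"
  shows "smooth_on (pairing c u v) (cim c)"
  unfolding pairing_def[abs_def] inner_vec_def inner_real_def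
  by (intro smooth_on_sum smooth_on_mult smooth_raised_gradient smooth_coord_differential open_cim assms)

lemma smooth_grad_inner:
  assumes "smooth_fun A u" "smooth_fun A v"
  shows "smooth_fun A (grad_inner A G u v)"
  unfolding smooth_fun_def
proof
  fix c assume c: "c \<in> A"
  show "smooth_on (grad_inner A G u v \<circ> chart_inv c) (cim c)"
    by (rule smooth_on_cong[OF open_cim[OF c] _ smooth_pairing[OF assms c]])
      (use grad_inner_chart[OF assms c chart_inv_dom[OF c]] c in simp)
qed

lemma coord_differential_add:
  assumes uv: "smooth_fun A u" "smooth_fun A v" and c: "c \<in> A" and x: "x \<in> cim c"
  shows "coord_differential c (\<lambda>p. u p + v p) x = coord_differential c u x + coord_differential c v x"
proof -
  note D = has_derivative_add[OF smooth_on_has_derivative[OF smooth_funD[OF uv(1) c] x]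
      smooth_on_has_derivative[OF smooth_funD[OF uv(2) c] x]]
  have "frechet_derivative ((\<lambda>p. u p + v p) \<circ> chart_inv c) (at x) =
      (\<lambda>w. frechet_derivative (u \<circ> chart_inv c) (at x) w + frechet_derivative (v \<circ> chart_inv c) (at x) w)"
    using frechet_derivative_at[OF D] by (simp add: o_def)
  thus ?thesis by (simp add: coord_differential_def partial_deriv_def vec_eq_iff)
qed

lemma coord_differential_scale:
  assumes u: "smooth_fun A u" and c: "c \<in> A" and x: "x \<in> cim c"
  shows "coord_differential c (\<lambda>p. a * u p) x = a *\<^sub>R coord_differential c u x"
proof -
  note D = has_derivative_mult_right[OF smooth_on_has_derivative[OF smooth_funD[OF u c] x], of a]
  have "frechet_derivative ((\<lambda>p. a * u p) \<circ> chart_inv c) (at x) =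
      (\<lambda>w. a * frechet_derivative (u \<circ> chart_inv c) (at x) w)"
    using frechet_derivative_at[OF D] by (simp add: o_def)
  thus ?thesis by (simp add: coord_differential_def partial_deriv_def vec_eq_iff)
qed

lemma chart_at_image: "chart_map (chart_at A p) p \<in> cim (chart_at A p)"
  using chart_at by blast

lemma grad_inner_add:
  assumes "smooth_fun A u" "smooth_fun A v"
  shows "grad_inner A G (\<lambda>p. u p + v p) w p = grad_inner A G u w p + grad_inner A G v w p"
  unfolding grad_inner_eq pairing_def coord_differential_add[OF assms chart_at(1) chart_at_image]
  by (simp add: inner_add_left)

lemma grad_inner_scale:
  assumes "smooth_fun A u"
  shows "grad_inner A G (\<lambda>p. a * u p) w p = a * grad_inner A G u w p"
  unfolding grad_inner_eq pairing_def coord_differential_scale[OF assms chart_at(1) chart_at_image]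
  by simp

lemma grad_inner_sym: "grad_inner A G u v p = grad_inner A G v u p"
  unfolding grad_inner_eq pairing_def using chart_at by (intro pos_def_inverse_sym metric_pos_def) simp_all

lemma grad_inner_nonneg: "0 \<le> grad_inner A G u u p"
  unfolding grad_inner_eq pairing_def using chart_at by (intro pos_def_inverse_nonneg metric_pos_def) simp_all

lemma grad_inner_zero_open:
  assumes U: "open U" "p \<in> U" "\<And>q. q \<in> U \<Longrightarrow> u q = 0"
  shows "grad_inner A G u v p = 0"
proof -
  let ?c = "chart_at A p"
  have c: "?c \<in> A" "p \<in> chart_dom ?c" by (rule chart_at)+
  let ?W = "chart_map ?c ` (U \<inter> chart_dom ?c)"
  have W: "open ?W" using U open_dom[OF c(1)] by (intro open_chart_image[OF c(1)]) auto
  have "partial_deriv i (u \<circ> chart_inv ?c) (chart_map ?c p) = 0" for i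
    unfolding partial_deriv_def by (subst frechet_derivative_zero_open[OF W]) (use U c in auto)
  hence "coord_differential ?c u (chart_map ?c p) = 0"
    by (simp add: coord_differential_def vec_eq_iff)
  thus ?thesis by (simp add: grad_inner_eq pairing_def)
qed

end

section \<open>Green's formula\<close>

lemma integrable_compact_support:
  fixes g :: "'a::euclidean_space \<Rightarrow> real"
  assumes "compact K" "K \<subseteq> S" "continuous_on S g" "\<And>x. x \<in> S - K \<Longrightarrow> g x = 0"
  shows "integrable lborel (\<lambda>x. indicator S x * g x)"
proof -
  have "integrable lborel (\<lambda>x. indicator K x *\<^sub>R g x)"
    by (rule borel_integrable_compact[OF assms(1) continuous_on_subset[OF assms(3,2)]])
  moreover have "(\<lambda>x. indicator K x *\<^sub>R g x) = (\<lambda>x. indicator S x * g x)"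
    using assms(2,4) by (auto simp: fun_eq_iff indicator_def)
  ultimately show ?thesis by simp
qed

text \<open>The product \<open>f * F\<close>, extended by zero, is differentiable everywhere and
  has compact support, so its directional derivatives have integral zero.\<close>

lemma integration_by_parts:
  fixes f F :: "'a::euclidean_space \<Rightarrow> real"
  assumes S: "open S" and K: "compact K" "K \<subseteq> S" and f: "smooth_on f S" and F: "smooth_on F S"
    and supp: "\<And>x. x \<in> S - K \<Longrightarrow> f x = 0"
  shows "integrable lborel (\<lambda>x. indicator S x * (f x * frechet_derivative F (at x) v))"
    and "integrable lborel (\<lambda>x. indicator S x * (frechet_derivative f (at x) v * F x))"
    and "(\<integral>x. indicator S x * (f x * frechet_derivative F (at x) v) \<partial>lborel)
      = - (\<integral>x. indicator S x * (frechet_derivative f (at x) v * F x) \<partial>lborel)"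
proof -
  have oK: "open (- K)" using compact_imp_closed[OF K(1)] by (simp add: open_Compl)
  have supp': "frechet_derivative f (at x) = (\<lambda>v. 0)" if "x \<in> S - K" for x
    by (rule frechet_derivative_zero_open[of "S - K"]) (use that supp S K in \<open>auto intro: open_Diff compact_imp_closed\<close>)
  have c1: "continuous_on S (\<lambda>x. f x * frechet_derivative F (at x) v)"
    and c2: "continuous_on S (\<lambda>x. frechet_derivative f (at x) v * F x)"
    by (intro continuous_intros smooth_on_continuous smooth_on_derivative f F)+
  show i1: "integrable lborel (\<lambda>x. indicator S x * (f x * frechet_derivative F (at x) v))"
    by (rule integrable_compact_support[OF K c1]) (simp add: supp)
  show i2: "integrable lborel (\<lambda>x. indicator S x * (frechet_derivative f (at x) v * F x))"
    by (rule integrable_compact_support[OF K c2]) (simp add: supp')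
  define h where "h x = indicator S x * (f x * F x)" for x
  define h' where "h' x w = indicator S x * (f x * frechet_derivative F (at x) w + frechet_derivative f (at x) w * F x)" for x w
  have "(\<integral>x. h' x v \<partial>lborel) = 0"
  proof (rule integral_directional_derivative_eq_0[OF _ _ K(1), of h])
    fix x
    show "(h has_derivative h' x) (at x)"
    proof (cases "x \<in> S")
      case True
      have "((\<lambda>x. f x * F x) has_derivative
          (\<lambda>w. f x * frechet_derivative F (at x) w + frechet_derivative f (at x) w * F x)) (at x)"
        by (intro has_derivative_mult smooth_on_has_derivative[OF f True] smooth_on_has_derivative[OF F True])
      hence "(h has_derivative (\<lambda>w. f x * frechet_derivative F (at x) w + frechet_derivative f (at x) w * F x)) (at x)"
        by (rule has_derivative_transform_within_open[OF _ S True]) (simp add: h_def)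
      thus ?thesis using True by (simp add: h'_def[abs_def])
    next
      case False
      have "(h has_derivative (\<lambda>w. 0)) (at x)"
        by (rule has_derivative_transform_within_open[OF _ oK, of "\<lambda>y. 0"])
          (use False K supp in \<open>auto simp: h_def indicator_def\<close>)
      thus ?thesis using False by (simp add: h'_def[abs_def])
    qed
  next
    have "continuous_on S (\<lambda>x. h' x v)"
      by (rule continuous_on_cong[THEN iffD1, OF refl _ continuous_on_add[OF c1 c2]]) (simp add: h'_def)
    moreover have "continuous_on (- K) (\<lambda>x. h' x v)"
      by (rule continuous_on_cong[THEN iffD1, OF refl _ continuous_on_const[of "- K" 0]])
        (auto simp: h'_def indicator_def supp supp')
    ultimately have "continuous_on (S \<union> - K) (\<lambda>x. h' x v)" using S oK by (intro continuous_on_open_Un)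
    moreover have "S \<union> - K = UNIV" using K by auto
    ultimately show "continuous_on UNIV (\<lambda>x. h' x v)" by simp
  next
    fix x assume "x \<notin> K"
    thus "h x = 0" using supp by (auto simp: h_def indicator_def)
  qed
  moreover have "(\<integral>x. h' x v \<partial>lborel) = (\<integral>x. indicator S x * (f x * frechet_derivative F (at x) v) \<partial>lborel)
      + (\<integral>x. indicator S x * (frechet_derivative f (at x) v * F x) \<partial>lborel)"
    unfolding h'_def distrib_left by (rule Bochner_Integration.integral_add[OF i1 i2])
  ultimately show "(\<integral>x. indicator S x * (f x * frechet_derivative F (at x) v) \<partial>lborel)
      = - (\<integral>x. indicator S x * (frechet_derivative f (at x) v * F x) \<partial>lborel)" by simp
qed

context riemannian
begin

text \<open>The components of \<open>rho c\<close> times the gradient of \<open>u\<close>; the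
  Laplacian \<open>lap\<close> in a chart is their divergence, divided by \<open>rho c\<close>.\<close>

definition flux :: "('m, 'n) chart \<Rightarrow> ('m \<Rightarrow> real) \<Rightarrow> 'n \<Rightarrow> real ^ 'n \<Rightarrow> real" where
  "flux c u i y = rho c y * (matrix_inv (G c (chart_inv c y)) *v coord_differential c u y) $ i"

definition lap :: "('m, 'n) chart \<Rightarrow> ('m \<Rightarrow> real) \<Rightarrow> real ^ 'n \<Rightarrow> real" where
  "lap c u x = (1 / rho c x) * (\<Sum>i\<in>UNIV. partial_deriv i (flux c u i) x)"

lemma laplace_beltrami_eq: "laplace_beltrami A G u p = lap (chart_at A p) u (chart_map (chart_at A p) p)"
  unfolding laplace_beltrami_def Let_def lap_def flux_def[abs_def] rho_def[abs_def] ..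

lemma smooth_flux: "smooth_fun A u \<Longrightarrow> c \<in> A \<Longrightarrow> smooth_on (flux c u i) (cim c)"
  unfolding flux_def[abs_def] by (intro smooth_on_mult open_cim smooth_rho smooth_raised_gradient)

lemma smooth_lap:
  assumes "smooth_fun A u" "c \<in> A"
  shows "smooth_on (lap c u) (cim c)"
  unfolding lap_def[abs_def] partial_deriv_def
  by (intro smooth_on_mult smooth_on_divide smooth_on_const smooth_on_sum smooth_on_derivative
      smooth_flux smooth_rho open_cim assms) (use rho_pos[OF assms(2)] in \<open>simp add: less_imp_neq[symmetric]\<close>)

lemma continuous_on_product_support:
  fixes \<psi> g :: "'m \<Rightarrow> real"
  assumes "open W" "compact K" "K \<subseteq> W" "\<And>p. p \<notin> K \<Longrightarrow> \<psi> p = 0" "continuous_on W \<psi>" "continuous_on W g"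
  shows "continuous_on UNIV (\<lambda>p. \<psi> p * g p)"
proof -
  have "continuous_on (- K) (\<lambda>p. \<psi> p * g p)"
    by (rule continuous_on_cong[THEN iffD1, OF refl _ continuous_on_const[of "- K" 0]]) (simp add: assms(4))
  moreover have "continuous_on W (\<lambda>p. \<psi> p * g p)" using assms by (intro continuous_intros)
  ultimately have "continuous_on (W \<union> - K) (\<lambda>p. \<psi> p * g p)"
    using assms(1) compact_imp_closed[OF assms(2)] by (intro continuous_on_open_Un) (auto simp: open_Compl)
  moreover have "W \<union> - K = UNIV" using assms by auto
  ultimately show ?thesis by simp
qed

lemma lap_chart_continuous:
  assumes "smooth_fun A u" "c \<in> A"
  shows "continuous_on (chart_dom c) (\<lambda>p. lap c u (chart_map c p))"
  by (rule continuous_on_compose2[OF smooth_on_continuous[OF smooth_lap[OF assms]] cont_map[OF assms(2)]]) simp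

text \<open>In the chart, the density \<open>rho c\<close> of the volume cancels the division in
  \<open>lap\<close>, and integration by parts moves the derivatives from the flux of
  \<open>u\<close> to \<open>\<psi>\<close>. The Laplacian enters through any \<open>g\<close>
  that represents it on this chart, since its independence of the chart is only derived from this
  lemma.\<close>

lemma chart_green:
  assumes c: "c \<in> A" and u: "smooth_fun A u" and \<psi>: "smooth_fun A \<psi>"
    and K: "compact K" "K \<subseteq> chart_dom c" "\<And>p. p \<notin> K \<Longrightarrow> \<psi> p = 0"
    and g: "\<And>p. p \<in> chart_dom c \<Longrightarrow> g p = lap c u (chart_map c p)"
  shows "(\<integral>p. \<psi> p * g p \<partial>N) = - (\<integral>p. grad_inner A G \<psi> u p \<partial>N)"
proof -
  let ?f = "\<psi> \<circ> chart_inv c" and ?K = "chart_map c ` K"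
  let ?d = "\<lambda>i x. frechet_derivative ?f (at x) (axis i 1)"
  let ?D = "\<lambda>i x. frechet_derivative (flux c u i) (at x) (axis i 1)"
  have "continuous_on (chart_dom c) g"
    by (rule continuous_on_cong[THEN iffD1, OF refl _ lap_chart_continuous[OF u c]]) (simp add: g)
  hence "continuous_on UNIV (\<lambda>p. \<psi> p * g p)"
    using K open_dom[OF c] continuous_on_subset[OF smooth_fun_continuous[OF \<psi>]]
    by (intro continuous_on_product_support) auto
  hence meas: "(\<lambda>p. \<psi> p * g p) \<in> borel_measurable borel" by (rule borel_measurable_continuous_onI)
  have cK: "compact ?K" by (rule compact_continuous_image[OF continuous_on_subset[OF cont_map[OF c] K(2)] K(1)])
  have sub: "?K \<subseteq> cim c" using K(2) by blast
  have f0: "?f x = 0" if "x \<in> cim c - ?K" for x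
  proof -
    have "chart_inv c x \<notin> K" using that c by (metis Diff_iff chart_map_inv image_eqI)
    thus ?thesis using K(3) by simp
  qed
  note ibp = integration_by_parts[OF open_cim[OF c] cK sub smooth_funD[OF \<psi> c] smooth_flux[OF u c] f0]
  have i1: "integrable lborel (\<lambda>x. indicator (cim c) x * (?f x * ?D i x))" for i by (rule ibp(1))
  have i2: "integrable lborel (\<lambda>x. indicator (cim c) x * (?d i x * flux c u i x))" for i by (rule ibp(2))
  have lap_x: "kappa * rho c x * (?f x * lap c u x) = kappa * (\<Sum>i\<in>UNIV. ?f x * ?D i x)" if "x \<in> cim c" for x
    using rho_pos[OF c that] by (simp add: lap_def partial_deriv_def sum_distrib_left)
  have pair_x: "kappa * rho c x * pairing c \<psi> u x = kappa * (\<Sum>i\<in>UNIV. ?d i x * flux c u i x)" for x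
    by (simp add: pairing_def flux_def inner_vec_def coord_differential_def partial_deriv_def sum_distrib_left
        mult.assoc mult.commute mult.left_commute)
  have "(\<integral>p. \<psi> p * g p \<partial>N) = (\<integral>x. indicator (cim c) x * (kappa * rho c x * (\<psi> (chart_inv c x) * g (chart_inv c x))) \<partial>lborel)"
    by (rule integral_N_chart(2)[OF c meas]) (use K in auto)
  also have "\<dots> = (\<integral>x. kappa * (\<Sum>i\<in>UNIV. indicator (cim c) x * (?f x * ?D i x)) \<partial>lborel)"
  proof (rule Bochner_Integration.integral_cong[OF refl])
    fix x
    show "indicator (cim c) x * (kappa * rho c x * (\<psi> (chart_inv c x) * g (chart_inv c x)))
        = kappa * (\<Sum>i\<in>UNIV. indicator (cim c) x * (?f x * ?D i x))"
    proof (cases "x \<in> cim c")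
      case True
      thus ?thesis using lap_x[OF True] g[OF chart_inv_dom[OF c True]] c by simp
    qed simp
  qed
  also have "\<dots> = kappa * (\<Sum>i\<in>UNIV. \<integral>x. indicator (cim c) x * (?f x * ?D i x) \<partial>lborel)"
    by (subst integral_mult_right_zero, subst Bochner_Integration.integral_sum[OF i1], rule refl)
  also have "\<dots> = - (kappa * (\<Sum>i\<in>UNIV. \<integral>x. indicator (cim c) x * (?d i x * flux c u i x) \<partial>lborel))"
    by (simp only: ibp(3) sum_negf mult_minus_right)
  also have "kappa * (\<Sum>i\<in>UNIV. \<integral>x. indicator (cim c) x * (?d i x * flux c u i x) \<partial>lborel)
      = (\<integral>x. kappa * (\<Sum>i\<in>UNIV. indicator (cim c) x * (?d i x * flux c u i x)) \<partial>lborel)"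
    by (subst integral_mult_right_zero, subst Bochner_Integration.integral_sum[OF i2], rule refl)
  also have "\<dots> = (\<integral>x. indicator (cim c) x * (kappa * rho c x * grad_inner A G \<psi> u (chart_inv c x)) \<partial>lborel)"
  proof (rule Bochner_Integration.integral_cong[OF refl])
    fix x
    show "kappa * (\<Sum>i\<in>UNIV. indicator (cim c) x * (?d i x * flux c u i x))
        = indicator (cim c) x * (kappa * rho c x * grad_inner A G \<psi> u (chart_inv c x))"
    proof (cases "x \<in> cim c")
      case True
      thus ?thesis using pair_x[of x, symmetric] grad_inner_chart[OF \<psi> u c chart_inv_dom[OF c True]] c by simp
    qed simp
  qed
  also have "\<dots> = (\<integral>p. grad_inner A G \<psi> u p \<partial>N)"
  proof (rule integral_N_chart(2)[OF c, symmetric])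
    show "grad_inner A G \<psi> u \<in> borel_measurable borel"
      by (intro smooth_fun_measurable smooth_grad_inner \<psi> u)
    fix p assume "p \<notin> chart_dom c"
    thus "grad_inner A G \<psi> u p = 0"
      using K compact_imp_closed[OF K(1)] by (intro grad_inner_zero_open[of "- K"]) auto
  qed
  finally show ?thesis .
qed

text \<open>By the chart-wise Green formula, the integral of either side against a bump function
  is expressed by an integral that refers to no chart. Hence the difference of the two sides
  integrates to zero against every bump function and cannot be positive anywhere. Exchanging the
  charts gives equality.\<close>

lemma lap_le_chart:
  assumes u: "smooth_fun A u" and c: "c \<in> A" "p \<in> chart_dom c" and d: "d \<in> A" "p \<in> chart_dom d"
  shows "lap c u (chart_map c p) \<le> lap d u (chart_map d p)"
proof (rule ccontr)
  assume neg: "\<not> ?thesis"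
  define W where "W = chart_dom c \<inter> chart_dom d"
  define f where "f q = lap c u (chart_map c q) - lap d u (chart_map d q)" for q
  have W: "open W" unfolding W_def by (intro open_Int open_dom c d)
  have fc: "continuous_on W f"
    unfolding f_def using lap_chart_continuous[OF u c(1)] lap_chart_continuous[OF u d(1)]
    by (intro continuous_on_diff) (auto intro: continuous_on_subset simp: W_def)
  define U where "U = W \<inter> f -` {0<..}"
  have U: "open U" unfolding U_def by (rule continuous_open_preimage[OF fc W]) simp
  have p: "p \<in> U" using neg c d by (simp add: U_def W_def f_def)
  obtain \<psi> K where \<psi>: "smooth_fun A \<psi>" "\<And>q. 0 \<le> \<psi> q" "0 < \<psi> p" and K: "compact K" "K \<subseteq> U" "\<And>q. q \<notin> K \<Longrightarrow> \<psi> q = 0"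
    by (rule bump_function[OF U p]) blast
  let ?g = "\<lambda>e q. lap e u (chart_map e q)"
  have cont: "continuous_on UNIV (\<lambda>q. \<psi> q * ?g e q)" if "e \<in> {c, d}" for e
  proof (rule continuous_on_product_support[OF open_dom K(1) _ K(3)])
    show "e \<in> A" "K \<subseteq> chart_dom e" using that c d K by (auto simp: U_def W_def)
    thus "continuous_on (chart_dom e) (\<lambda>q. lap e u (chart_map e q))" by (intro lap_chart_continuous u)
    show "continuous_on (chart_dom e) \<psi>" using continuous_on_subset[OF smooth_fun_continuous[OF \<psi>(1)]] by blast
  qed auto
  have green: "(\<integral>q. \<psi> q * ?g e q \<partial>N) = - (\<integral>q. grad_inner A G \<psi> u q \<partial>N)" if "e \<in> {c, d}" for e
    by (rule chart_green[OF _ u \<psi>(1) K(1) _ K(3)]) (use that c d K in \<open>auto simp: U_def W_def\<close>)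
  let ?h = "\<lambda>q. \<psi> q * f q"
  have h_eq: "?h = (\<lambda>q. \<psi> q * ?g c q - \<psi> q * ?g d q)" by (simp add: f_def right_diff_distrib)
  have hc: "continuous_on UNIV ?h" unfolding h_eq by (intro continuous_on_diff cont) auto
  have "(\<integral>q. ?h q \<partial>N) = (\<integral>q. \<psi> q * ?g c q \<partial>N) - (\<integral>q. \<psi> q * ?g d q \<partial>N)"
    unfolding h_eq by (intro Bochner_Integration.integral_diff continuous_integrable cont) auto
  also have "\<dots> = 0" using green by simp
  finally have h0: "(\<integral>q. ?h q \<partial>N) = 0" .
  have hn: "0 \<le> ?h q" for q
    using \<psi>(2)[of q] K(2) K(3)[of q] by (cases "q \<in> K") (auto simp: U_def)
  have "AE q in N. ?h q = 0"
    using integral_nonneg_eq_0_iff_AE[OF continuous_integrable[OF hc]] h0 hn by simp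
  moreover have oh: "open (?h -` {0<..})"
    using hc by (intro continuous_open_vimage) (auto simp: continuous_on_eq_continuous_at)
  ultimately have "AE q in N. q \<notin> ?h -` {0<..}" by (auto elim!: eventually_mono)
  hence "emeasure N (?h -` {0<..}) = 0"
    using oh by (subst (asm) AE_iff_measurable[of "?h -` {0<..}"]) auto
  moreover have "p \<in> ?h -` {0<..}" using \<psi>(3) p by (simp add: U_def)
  ultimately show False using N_open_pos[OF oh] by fastforce
qed

lemma laplace_beltrami_chart:
  assumes "smooth_fun A u" "c \<in> A" "p \<in> chart_dom c"
  shows "laplace_beltrami A G u p = lap c u (chart_map c p)"
  unfolding laplace_beltrami_eq
  by (intro order.antisym lap_le_chart assms chart_at)

lemma smooth_laplace_beltrami:
  assumes u: "smooth_fun A u"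
  shows "smooth_fun A (laplace_beltrami A G u)"
  unfolding smooth_fun_def
proof
  fix c assume c: "c \<in> A"
  show "smooth_on (laplace_beltrami A G u \<circ> chart_inv c) (cim c)"
    by (rule smooth_on_cong[OF open_cim[OF c] _ smooth_lap[OF u c]])
      (use laplace_beltrami_chart[OF u c chart_inv_dom[OF c]] c in simp)
qed

text \<open>A partition of unity splits \<open>v\<close> into functions with support in the
  domain of one chart.\<close>

theorem green_formula:
  assumes v: "smooth_fun A v" and u: "smooth_fun A u"
  shows "(\<integral>p. v p * laplace_beltrami A G u p \<partial>N) = - (\<integral>p. grad_inner A G v u p \<partial>N)"
proof -
  obtain I :: "'m set" and \<theta> c K where I: "finite I" and \<theta>: "\<And>i. i \<in> I \<Longrightarrow> smooth_fun A (\<theta> i)"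
    "\<And>i. i \<in> I \<Longrightarrow> c i \<in> A" "\<And>i. i \<in> I \<Longrightarrow> compact (K i)" "\<And>i. i \<in> I \<Longrightarrow> K i \<subseteq> chart_dom (c i)"
    "\<And>i p. i \<in> I \<Longrightarrow> p \<notin> K i \<Longrightarrow> \<theta> i p = (0::real)" "\<And>p. (\<Sum>i\<in>I. \<theta> i p) = 1"
    by (rule partition_of_unity) blast
  have \<theta>v: "smooth_fun A (\<lambda>p. \<theta> i p * v p)" if "i \<in> I" for i by (intro smooth_fun_mult \<theta> v that)
  have split: "v = (\<lambda>p. \<Sum>i\<in>I. \<theta> i p * v p)"
    using \<theta>(6) by (simp add: sum_distrib_right[symmetric])
  have grad_sum: "J \<subseteq> I \<Longrightarrow> grad_inner A G (\<lambda>p. \<Sum>i\<in>J. \<theta> i p * v p) u p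
      = (\<Sum>i\<in>J. grad_inner A G (\<lambda>p. \<theta> i p * v p) u p)" for J p
  proof (induction J rule: infinite_finite_induct)
    case (infinite J)
    thus ?case using I finite_subset by blast
  next
    case empty
    show ?case using grad_inner_zero_open[of UNIV p "\<lambda>p. 0" u] by simp
  next
    case (insert i J)
    thus ?case
      using grad_inner_add[of "\<lambda>p. \<theta> i p * v p" "\<lambda>p. \<Sum>i\<in>J. \<theta> i p * v p" u p] \<theta>v
      by (simp add: smooth_fun_sum subset_iff)
  qed
  note \<Delta> = smooth_laplace_beltrami[OF u]
  have "(\<integral>p. v p * laplace_beltrami A G u p \<partial>N) = (\<integral>p. (\<Sum>i\<in>I. \<theta> i p * v p * laplace_beltrami A G u p) \<partial>N)"
    by (subst split) (simp add: sum_distrib_right)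
  also have "\<dots> = (\<Sum>i\<in>I. \<integral>p. \<theta> i p * v p * laplace_beltrami A G u p \<partial>N)"
    by (intro Bochner_Integration.integral_sum smooth_fun_integrable smooth_fun_mult \<theta>v \<theta> v \<Delta>)
  also have "\<dots> = (\<Sum>i\<in>I. - (\<integral>p. grad_inner A G (\<lambda>p. \<theta> i p * v p) u p \<partial>N))"
  proof (rule sum.cong[OF refl])
    fix i assume i: "i \<in> I"
    show "(\<integral>p. \<theta> i p * v p * laplace_beltrami A G u p \<partial>N) = - (\<integral>p. grad_inner A G (\<lambda>p. \<theta> i p * v p) u p \<partial>N)"
      by (rule chart_green[OF \<theta>(2)[OF i] u \<theta>v[OF i] \<theta>(3,4)[OF i]])
        (use \<theta>(5)[OF i] laplace_beltrami_chart[OF u \<theta>(2)[OF i]] in auto)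
  qed
  also have "\<dots> = - (\<integral>p. (\<Sum>i\<in>I. grad_inner A G (\<lambda>p. \<theta> i p * v p) u p) \<partial>N)"
    by (subst Bochner_Integration.integral_sum)
      (auto simp: sum_negf intro!: smooth_fun_integrable smooth_grad_inner \<theta>v u)
  also have "(\<lambda>p. \<Sum>i\<in>I. grad_inner A G (\<lambda>p. \<theta> i p * v p) u p) = grad_inner A G v u"
  proof
    fix p
    have "grad_inner A G v u p = grad_inner A G (\<lambda>p. \<Sum>i\<in>I. \<theta> i p * v p) u p"
      by (rule arg_cong[OF split, of "\<lambda>v. grad_inner A G v u p"])
    thus "(\<Sum>i\<in>I. grad_inner A G (\<lambda>p. \<theta> i p * v p) u p) = grad_inner A G v u p"
      using grad_sum[of I p] by simp
  qed
  finally show ?thesis .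
qed

end

section \<open>Density of the smooth functions\<close>

context riemannian
begin

lemma bounded_L2:
  assumes "f \<in> borel_measurable borel" "\<And>p. \<bar>f p\<bar> \<le> B"
  shows "f \<in> L2 N"
proof -
  interpret finite_measure N by (rule N_finite)
  have "(f p)\<^sup>2 \<le> B\<^sup>2" for p using power_mono[OF assms(2) abs_ge_zero, of p 2] by simp
  hence "integrable N (\<lambda>p. (f p)\<^sup>2)"
    using assms(1) by (intro integrable_const_bound[of _ "B\<^sup>2"]) auto
  thus ?thesis using assms(1) by (simp add: L2_def)
qed

lemma L2_integrable: "g \<in> L2 N \<Longrightarrow> integrable N g"
  using L2_integrable_mult[of g N "\<lambda>p. 1"] bounded_L2[of "\<lambda>p. 1" 1] by simp

text \<open>The indicator of an open set is the bounded pointwise limit of the smooth functions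
  \<open>s n / (s n + 1 / Suc n)\<close>, where \<open>s n\<close> is a partial sum of bump
  functions in \<open>U\<close>. Countably many of these suffice for one of them to be positive
  at each point of \<open>U\<close>.\<close>

lemma orthogonal_to_smooth_open:
  assumes g: "g \<in> L2 N" and orth: "\<And>\<phi>. smooth_fun A \<phi> \<Longrightarrow> L2_inner N g \<phi> = 0" and U: "open U"
  shows "(\<integral>p. g p * indicator U p \<partial>N) = 0"
proof (cases "U = {}")
  case False
  have "\<exists>\<psi> K. smooth_fun A \<psi> \<and> (\<forall>q. 0 \<le> \<psi> q) \<and> 0 < \<psi> p \<and> K \<subseteq> U \<and> (\<forall>q. q \<notin> K \<longrightarrow> \<psi> q = 0)" if "p \<in> U" for p
    using bump_function[OF U that] by metis
  then obtain \<psi> K where \<psi>: "\<And>p. p \<in> U \<Longrightarrow> smooth_fun A (\<psi> p)" "\<And>p q. p \<in> U \<Longrightarrow> 0 \<le> \<psi> p q"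
    "\<And>p. p \<in> U \<Longrightarrow> 0 < \<psi> p p" "\<And>p q. p \<in> U \<Longrightarrow> q \<notin> U \<Longrightarrow> \<psi> p q = (0::real)"
    by (metis subsetD)
  let ?V = "\<lambda>p. \<psi> p -` {0<..}"
  have op: "open (?V p)" if "p \<in> U" for p
    using continuous_open_vimage[of "{0<..}" "\<psi> p"] smooth_fun_continuous[OF \<psi>(1)[OF that]]
    by (simp add: continuous_on_eq_continuous_at)
  obtain F' where F': "F' \<subseteq> ?V ` U" "countable F'" "\<Union> F' = \<Union> (?V ` U)"
    using Lindelof[of "?V ` U"] op by blast
  obtain P where P: "P \<subseteq> U" "countable P" "F' = ?V ` P"
    using countable_subset_image[of F' ?V U] F' by blast
  have cov: "U \<subseteq> (\<Union>p\<in>P. ?V p)" using F'(3) P(3) \<psi>(3) by auto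
  have Pne: "P \<noteq> {}" using cov False by blast
  define b where "b i = \<psi> (from_nat_into P i)" for i
  have bU: "from_nat_into P i \<in> U" for i using from_nat_into[OF Pne] P(1) by blast
  have b: "smooth_fun A (b i)" "0 \<le> b i q" "q \<notin> U \<Longrightarrow> b i q = 0" for i q
    using \<psi> bU by (auto simp: b_def)
  have b_pos: "\<exists>i. 0 < b i q" if q: "q \<in> U" for q
  proof -
    obtain p where p: "p \<in> P" "0 < \<psi> p q" using cov q by auto
    obtain i where "from_nat_into P i = p" using from_nat_into_surj[OF P(2) p(1)] by blast
    thus ?thesis using p by (auto simp: b_def)
  qed
  define s where "s n q = (\<Sum>i\<le>n. b i q)" for n q
  define e where "e n = 1 / real (Suc n)" for n
  define \<phi> where "\<phi> n q = s n q / (s n q + e n)" for n q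
  have e: "0 < e n" for n by (simp add: e_def)
  have s0: "0 \<le> s n q" for n q unfolding s_def using b(2) by (intro sum_nonneg)
  have se: "0 < s n q + e n" for n q using s0[of n q] e[of n] by linarith
  have \<phi>_smooth: "smooth_fun A (\<phi> n)" for n
    unfolding \<phi>_def s_def
    by (intro smooth_fun_divide smooth_fun_sum smooth_fun_add smooth_fun_const b)
      (use se[of n] in \<open>simp add: s_def less_imp_neq[symmetric]\<close>)
  have \<phi>_bound: "0 \<le> \<phi> n q" "\<phi> n q \<le> 1" for n q
    using s0[of n q] e[of n] se[of n q] by (simp_all add: \<phi>_def)
  have lim: "(\<lambda>n. \<phi> n q) \<longlonglongrightarrow> indicator U q" for q
  proof (cases "q \<in> U")
    case False
    hence "\<phi> n q = 0" for n using b(3) by (simp add: \<phi>_def s_def)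
    thus ?thesis using False by simp
  next
    case True
    then obtain i where i: "0 < b i q" using b_pos by blast
    have "\<bar>\<phi> n q - 1\<bar> \<le> e n / b i q" if "n \<ge> i" for n
    proof -
      have "b i q \<le> s n q" unfolding s_def using that b(2) by (intro member_le_sum) auto
      moreover have "\<bar>\<phi> n q - 1\<bar> = e n / (s n q + e n)"
        using se[of n q] e[of n] by (simp add: \<phi>_def field_simps)
      ultimately show ?thesis using i e[of n] by (auto intro!: divide_left_mono mult_pos_pos)
    qed
    hence "\<forall>\<^sub>F n in sequentially. norm (\<phi> n q - 1) \<le> e n / b i q"
      unfolding eventually_sequentially by auto
    moreover have "(\<lambda>n. e n / b i q) \<longlonglongrightarrow> 0"
      using tendsto_divide_zero[OF LIMSEQ_Suc[OF lim_1_over_n]] by (simp add: e_def)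
    ultimately have "(\<lambda>n. \<phi> n q - 1) \<longlonglongrightarrow> 0" by (rule Lim_null_comparison)
    thus ?thesis using True by (simp add: LIM_zero_iff)
  qed
  have "(\<lambda>n. \<integral>p. g p * \<phi> n p \<partial>N) \<longlonglongrightarrow> (\<integral>p. g p * indicator U p \<partial>N)"
  proof (rule integral_dominated_convergence)
    show "integrable N (\<lambda>p. \<bar>g p\<bar>)" using L2_integrable[OF g] by simp
    show "(\<lambda>p. g p * indicator U p) \<in> borel_measurable N" using U
      by (intro borel_measurable_times L2_measurable[OF g] borel_measurable_indicator) simp
    show "(\<lambda>p. g p * \<phi> n p) \<in> borel_measurable N" for n
      by (intro borel_measurable_times L2_measurable[OF g] L2_measurable[OF smooth_fun_L2] \<phi>_smooth)
    show "AE p in N. (\<lambda>n. g p * \<phi> n p) \<longlonglongrightarrow> g p * indicator U p"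
      by (intro AE_I2 tendsto_mult tendsto_const lim)
    show "AE p in N. norm (g p * \<phi> n p) \<le> \<bar>g p\<bar>" for n
      using \<phi>_bound by (intro AE_I2) (simp add: abs_mult mult_left_le)
  qed
  moreover have "(\<integral>p. g p * \<phi> n p \<partial>N) = 0" for n
    using orth[OF \<phi>_smooth[of n]] by (simp add: L2_inner_def)
  ultimately show ?thesis using LIMSEQ_unique[OF tendsto_const] by fastforce
qed simp

text \<open>The integral of \<open>g\<close> over open sets vanishes. These form an
  intersection-stable generator of the Borel sets, so the integral over every Borel set vanishes,
  in particular over the sets where \<open>g\<close> has a fixed sign.\<close>

lemma orthogonal_to_smooth_zero:
  assumes g: "g \<in> L2 N" and orth: "\<And>\<phi>. smooth_fun A \<phi> \<Longrightarrow> L2_inner N g \<phi> = 0"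
  shows "AE p in N. g p = 0"
proof -
  have gi: "integrable N g" by (rule L2_integrable[OF g])
  have gB: "integrable N (\<lambda>p. g p * indicator B p)" if "B \<in> sets borel" for B
    using integrable_real_mult_indicator[of B N g] gi that by simp
  have zero: "(\<integral>p. g p * indicator B p \<partial>N) = 0" if "B \<in> sets borel" for B
  proof -
    have st: "Int_stable {U :: 'm set. open U}" "{U :: 'm set. open U} \<subseteq> Pow UNIV" by (auto simp: Int_stable_def)
    have "B \<in> sigma_sets UNIV {U. open U}" using that by (simp add: borel_def)
    with st show ?thesis
    proof (induction rule: sigma_sets_induct_disjoint)
      case (basic U)
      thus ?case using orthogonal_to_smooth_open[OF g orth] by simp
    next
      case empty
      show ?case by simp
    next
      case (compl B)
      hence B: "B \<in> sets borel" by (simp add: borel_def)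
      have "(\<integral>p. g p * indicator (UNIV - B) p \<partial>N) = (\<integral>p. g p * indicator UNIV p - g p * indicator B p \<partial>N)"
        by (intro Bochner_Integration.integral_cong) (auto simp: indicator_def)
      also have "\<dots> = (\<integral>p. g p * indicator UNIV p \<partial>N) - (\<integral>p. g p * indicator B p \<partial>N)"
        using gB[of UNIV] gB[OF B] by (intro Bochner_Integration.integral_diff) auto
      finally show ?case using orthogonal_to_smooth_open[OF g orth open_UNIV] compl by simp
    next
      case (union F)
      have F: "F i \<in> sets borel" for i using union by (auto simp: borel_def)
      have "(LINT p:(\<Union>i. F i)|N. g p) = (\<Sum>i. (LINT p:F i|N. g p))"
      proof (rule lebesgue_integral_countable_add)
        show "F i \<in> sets N" for i using F by simp
        show "F i \<inter> F j = {}" if "i \<noteq> j" for i j using union(1) that by (auto simp: disjoint_family_on_def)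
        show "set_integrable N (\<Union> (range F)) g"
          using gB[of "\<Union> (range F)"] F by (simp add: set_integrable_def mult.commute)
      qed
      thus ?case using union by (simp add: set_lebesgue_integral_def mult.commute)
    qed
  qed
  have gm: "g \<in> borel_measurable borel" using L2_measurable[OF g] by simp
  have ae: "AE p in N. g p * indicator B p = 0" if B: "B \<in> sets borel" and s: "\<And>p. p \<in> B \<Longrightarrow> 0 \<le> r * g p" "r \<noteq> 0" for B and r :: real
  proof -
    have "AE p in N. r * (g p * indicator B p) = 0"
    proof (subst integral_nonneg_eq_0_iff_AE[symmetric])
      show "integrable N (\<lambda>p. r * (g p * indicator B p))" using gB[OF B] by simp
      show "AE p in N. 0 \<le> r * (g p * indicator B p)" using s by (intro AE_I2) (simp add: indicator_def)
      show "(\<integral>p. r * (g p * indicator B p) \<partial>N) = 0" using zero[OF B] by simp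
    qed
    thus ?thesis using s(2) by simp
  qed
  have m1: "g -` {0..} \<in> sets borel" and m2: "g -` {..0} \<in> sets borel"
    using measurable_sets[OF gm, of "{0..}"] measurable_sets[OF gm, of "{..0}"] by simp_all
  have "AE p in N. g p * indicator (g -` {0..}) p = 0" by (rule ae[OF m1, of 1]) auto
  moreover have "AE p in N. g p * indicator (g -` {..0}) p = 0" by (rule ae[OF m2, of "-1"]) auto
  ultimately show ?thesis
  proof eventually_elim
    case (elim p)
    thus ?case by (cases "0 \<le> g p") auto
  qed
qed

text \<open>The closure of the smooth functions in \<open>L\<^sup>2\<close> is complete; a function minus its projection to
  this closure is orthogonal to all smooth functions, hence zero.\<close>

theorem smooth_dense:
  assumes f: "f \<in> L2 N" and e: "e > 0"
  shows "\<exists>\<phi>. smooth_fun A \<phi> \<and> L2_norm N (\<lambda>p. f p - \<phi> p) < e"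
proof -
  define E where "E = {f \<in> L2 N. \<forall>e>0. \<exists>\<phi>. smooth_fun A \<phi> \<and> form_norm (L2_inner N) (\<lambda>p. f p - \<phi> p) < e}"
  have smooth_E: "\<phi> \<in> E" if "smooth_fun A \<phi>" for \<phi>
    using that by (auto simp: E_def smooth_fun_L2 intro!: exI[of _ \<phi>])
  have EL: "E \<subseteq> L2 N" by (auto simp: E_def)
  have E_add: "(\<lambda>p. f p + g p) \<in> E" if fg: "f \<in> E" "g \<in> E" for f g
  proof -
    have L: "f \<in> L2 N" "g \<in> L2 N" using fg EL by auto
    have "\<exists>\<phi>. smooth_fun A \<phi> \<and> form_norm (L2_inner N) (\<lambda>p. f p + g p - \<phi> p) < e" if "e > 0" for e
    proof -
      have "e / 2 > 0" using that by simp
      obtain \<phi> where \<phi>: "smooth_fun A \<phi>" "form_norm (L2_inner N) (\<lambda>p. f p - \<phi> p) < e / 2"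
        using fg(1) \<open>e / 2 > 0\<close> unfolding E_def by blast
      obtain \<psi> where \<psi>: "smooth_fun A \<psi>" "form_norm (L2_inner N) (\<lambda>p. g p - \<psi> p) < e / 2"
        using fg(2) \<open>e / 2 > 0\<close> unfolding E_def by blast
      have "form_norm (L2_inner N) (\<lambda>p. (f p - \<phi> p) + (g p - \<psi> p))
          \<le> form_norm (L2_inner N) (\<lambda>p. f p - \<phi> p) + form_norm (L2_inner N) (\<lambda>p. g p - \<psi> p)"
        using L smooth_fun_L2[OF \<phi>(1)] smooth_fun_L2[OF \<psi>(1)] by (intro L2.form_norm_triangle L2.diff_in)
      moreover have "(\<lambda>p. (f p - \<phi> p) + (g p - \<psi> p)) = (\<lambda>p. f p + g p - (\<phi> p + \<psi> p))" by auto
      ultimately show ?thesis using \<phi> \<psi> smooth_fun_add[OF \<phi>(1) \<psi>(1)]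
        by (intro exI[of _ "\<lambda>p. \<phi> p + \<psi> p"]) simp
    qed
    thus ?thesis using L by (simp add: E_def)
  qed
  have E_scale: "(\<lambda>p. a * f p) \<in> E" if f: "f \<in> E" for f a
  proof -
    have L: "f \<in> L2 N" using f EL by auto
    have "\<exists>\<phi>. smooth_fun A \<phi> \<and> form_norm (L2_inner N) (\<lambda>p. a * f p - \<phi> p) < e" if "e > 0" for e
    proof -
      have "e / (\<bar>a\<bar> + 1) > 0" using that by simp
      then obtain \<phi> where \<phi>: "smooth_fun A \<phi>" "form_norm (L2_inner N) (\<lambda>p. f p - \<phi> p) < e / (\<bar>a\<bar> + 1)"
        using f unfolding E_def by blast
      have in2: "(\<lambda>p. f p - \<phi> p) \<in> L2 N" using L smooth_fun_L2[OF \<phi>(1)] by (rule L2.diff_in)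
      have "form_norm (L2_inner N) (\<lambda>p. a * f p - a * \<phi> p) = \<bar>a\<bar> * form_norm (L2_inner N) (\<lambda>p. f p - \<phi> p)"
        using L2.form_norm_scale[OF in2, of a] by (simp add: right_diff_distrib)
      also have "\<dots> \<le> (\<bar>a\<bar> + 1) * form_norm (L2_inner N) (\<lambda>p. f p - \<phi> p)"
        using L2.form_norm_nonneg[OF in2] by (intro mult_right_mono) auto
      also have "\<dots> < e" using \<phi>(2) by (simp add: field_simps)
      finally show ?thesis using smooth_fun_scale[OF \<phi>(1)] by blast
    qed
    thus ?thesis using L by (simp add: E_def)
  qed
  have E_complete: "\<exists>h\<in>E. L2.converges_to N u h" if u: "\<And>n. u n \<in> E" and cauchy: "L2.cauchy_seq N u" for u
  proof -
    have uL: "u n \<in> L2 N" for n using u EL by auto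
    obtain h where h: "h \<in> L2 N" "L2.converges_to N u h"
      using L2_complete[where F = u, OF uL cauchy] by (elim bexE)
    have "\<exists>\<phi>. smooth_fun A \<phi> \<and> form_norm (L2_inner N) (\<lambda>p. h p - \<phi> p) < e" if "e > 0" for e
    proof -
      have "e / 2 > 0" using that by simp
      then obtain n where n: "form_norm (L2_inner N) (\<lambda>p. u n p - h p) < e / 2"
        using order_tendstoD(2)[OF h(2)[unfolded L2.converges_to_def]] unfolding eventually_sequentially by blast
      obtain \<phi> where \<phi>: "smooth_fun A \<phi>" "form_norm (L2_inner N) (\<lambda>p. u n p - \<phi> p) < e / 2"
        using u[of n] \<open>e / 2 > 0\<close> unfolding E_def by blast
      have "form_norm (L2_inner N) (\<lambda>p. h p - \<phi> p)
          \<le> form_norm (L2_inner N) (\<lambda>p. h p - u n p) + form_norm (L2_inner N) (\<lambda>p. u n p - \<phi> p)"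
        by (intro L2.form_norm_triangle3 h uL smooth_fun_L2 \<phi>)
      also have "form_norm (L2_inner N) (\<lambda>p. h p - u n p) = form_norm (L2_inner N) (\<lambda>p. u n p - h p)"
        by (intro L2.form_norm_commute h uL)
      finally show ?thesis using \<phi> n by (intro exI[of _ \<phi>]) simp
    qed
    thus ?thesis using h by (intro bexI[of _ h]) (simp_all add: E_def)
  qed
  have E0: "(\<lambda>p. 0) \<in> E" using smooth_E[OF smooth_fun_const[of 0]] .
  obtain h where h: "h \<in> E" "\<And>e. e \<in> E \<Longrightarrow> L2_inner N (\<lambda>p. f p - h p) e = 0"
    using L2.orthogonal_projection_exists[OF EL E0 E_add E_scale E_complete f] by blast
  have hL: "h \<in> L2 N" using h EL by auto
  have "AE p in N. f p - h p = 0"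
    by (rule orthogonal_to_smooth_zero[OF L2.diff_in[OF f hL]]) (intro h smooth_E)
  moreover obtain \<phi> where \<phi>: "smooth_fun A \<phi>" "form_norm (L2_inner N) (\<lambda>p. h p - \<phi> p) < e"
    using h(1) e unfolding E_def by blast
  ultimately have "L2_norm N (\<lambda>p. f p - \<phi> p) = L2_norm N (\<lambda>p. h p - \<phi> p)"
    using f hL smooth_fun_L2[OF \<phi>(1)] by (intro L2_norm_cong_AE L2.diff_in) auto
  thus ?thesis using \<phi> by (auto simp: L2_norm_eq_form_norm)
qed

end

section \<open>Compactness\<close>

lemma matrix_form_le:
  fixes M :: "real ^ 'n::finite ^ 'n"
  shows "z \<bullet> (M *v z) \<le> (\<Sum>i\<in>UNIV. \<Sum>j\<in>UNIV. \<bar>M $ i $ j\<bar>) * (norm z)\<^sup>2"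
proof -
  have "z \<bullet> (M *v z) = (\<Sum>i\<in>UNIV. \<Sum>j\<in>UNIV. M $ i $ j * (z $ i * z $ j))"
    by (simp add: inner_vec_def matrix_vector_mult_def sum_distrib_left mult.commute mult.left_commute)
  also have "\<dots> \<le> (\<Sum>i\<in>UNIV. \<Sum>j\<in>UNIV. \<bar>M $ i $ j\<bar> * (norm z)\<^sup>2)"
  proof (intro sum_mono)
    fix i j
    have "M $ i $ j * (z $ i * z $ j) \<le> \<bar>M $ i $ j\<bar> * (\<bar>z $ i\<bar> * \<bar>z $ j\<bar>)"
      by (metis abs_ge_self abs_mult)
    also have "\<dots> \<le> \<bar>M $ i $ j\<bar> * (norm z * norm z)"
      by (intro mult_left_mono mult_mono component_le_norm_cart) auto
    finally show "M $ i $ j * (z $ i * z $ j) \<le> \<bar>M $ i $ j\<bar> * (norm z)\<^sup>2" by (simp add: power2_eq_square)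
  qed
  finally show ?thesis by (simp add: sum_distrib_right)
qed

text \<open>With \<open>w = matrix_inv M *v v\<close>, expand the nonnegative value of the
  quadratic form of \<open>M\<close> at \<open>w - v / \<Lambda>\<close>.\<close>

lemma pos_def_inverse_lower:
  fixes M :: "real ^ 'n::finite ^ 'n"
  assumes M: "pos_def M" and \<Lambda>: "\<Lambda> > 0" "\<And>z. z \<bullet> (M *v z) \<le> \<Lambda> * (norm z)\<^sup>2"
  shows "(norm v)\<^sup>2 \<le> \<Lambda> * (v \<bullet> (matrix_inv M *v v))"
proof -
  define w where "w = matrix_inv M *v v"
  have Mw: "M *v w = v" unfolding w_def by (rule matrix_inv_mult[OF pos_def_invertible[OF M]])
  have sym: "w \<bullet> (M *v v) = v \<bullet> v"
  proof -
    have "w \<bullet> (M *v v) = (transpose M *v w) \<bullet> v" by (rule inner_transpose[symmetric])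
    also have "transpose M *v w = v" using M by (simp only: pos_def_def Mw)
    finally show ?thesis .
  qed
  let ?y = "w - (1 / \<Lambda>) *\<^sub>R v"
  have "0 \<le> ?y \<bullet> (M *v ?y)"
    using M by (cases "?y = 0") (auto simp: pos_def_def less_imp_le)
  also have "M *v ?y = v - (1 / \<Lambda>) *\<^sub>R (M *v v)"
    by (simp add: matrix_vector_mult_diff_distrib matrix_vector_mult_scaleR Mw)
  also have "?y \<bullet> (v - (1 / \<Lambda>) *\<^sub>R (M *v v))
      = w \<bullet> v - 2 / \<Lambda> * (v \<bullet> v) + (1 / \<Lambda>)\<^sup>2 * (v \<bullet> (M *v v))"
    by (simp add: inner_diff_left inner_diff_right sym power2_eq_square algebra_simps)
  also have "\<dots> \<le> w \<bullet> v - 2 / \<Lambda> * (v \<bullet> v) + (1 / \<Lambda>)\<^sup>2 * (\<Lambda> * (norm v)\<^sup>2)"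
    by (intro add_left_mono mult_left_mono \<Lambda>(2)) auto
  also have "\<dots> = w \<bullet> v - (norm v)\<^sup>2 / \<Lambda>"
  proof -
    have "v \<bullet> v = (norm v)\<^sup>2" by (simp add: power2_norm_eq_inner)
    thus ?thesis using \<Lambda>(1) by (simp add: power2_eq_square field_simps)
  qed
  finally have "(norm v)\<^sup>2 / \<Lambda> \<le> v \<bullet> w" by (simp add: inner_commute)
  thus ?thesis using \<Lambda>(1) by (simp add: w_def field_simps)
qed

context riemannian
begin

abbreviation energy :: "('m \<Rightarrow> real) \<Rightarrow> ('m \<Rightarrow> real) \<Rightarrow> real" where
  "energy u v \<equiv> (\<integral>p. grad_inner A G u v p \<partial>N)"

lemma compact_pos_bounds:
  assumes "compact K" "continuous_on K f" "\<And>x. x \<in> K \<Longrightarrow> 0 < (f x :: real)"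
  obtains a b where "0 < a" "0 < b" "\<And>x. x \<in> K \<Longrightarrow> a \<le> f x" "\<And>x. x \<in> K \<Longrightarrow> f x \<le> b"
proof (cases "K = {}")
  case True
  thus ?thesis using that[of 1 1] by simp
next
  case False
  obtain x where x: "x \<in> K" "\<forall>y\<in>K. f x \<le> f y" using continuous_attains_inf[OF assms(1) False assms(2)] by blast
  obtain y where y: "y \<in> K" "\<forall>z\<in>K. f z \<le> f y" using continuous_attains_sup[OF assms(1) False assms(2)] by blast
  show ?thesis using that[of "f x" "f y"] x y assms(3) by auto
qed

lemma chart_inv_image_iff:
  assumes c: "c \<in> A" and Q: "Q \<subseteq> cim c" and x: "x \<in> cim c"
  shows "chart_inv c x \<in> chart_inv c ` Q \<longleftrightarrow> x \<in> Q"
proof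
  assume "chart_inv c x \<in> chart_inv c ` Q"
  then obtain y where y: "y \<in> Q" "chart_inv c x = chart_inv c y" by blast
  have "y \<in> cim c" using y(1) Q by blast
  hence "y = chart_map c (chart_inv c y)" using c by simp
  also have "\<dots> = x" using c x by (simp add: y(2)[symmetric])
  finally show "x \<in> Q" using y(1) by simp
qed blast

text \<open>The functional is represented by the indicator of \<open>Q\<close>, divided by the
  density of the normalized volume in the chart.\<close>

lemma mean_value_functional:
  assumes c: "c \<in> A" and Q: "compact Q" "Q \<subseteq> cim c"
  obtains l where "l \<in> L2 N" "\<And>u. smooth_fun A u \<Longrightarrow> L2_inner N u l = integral Q (u \<circ> chart_inv c)"
proof -
  define B where "B = chart_inv c ` Q"
  have B: "compact B" unfolding B_def
    by (rule compact_continuous_image[OF continuous_on_subset[OF cont_inv[OF c] Q(2)] Q(1)])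
  have Bd: "B \<subseteq> chart_dom c" unfolding B_def using Q(2) chart_inv_dom[OF c] by blast
  have Bs: "B \<in> sets borel" using compact_imp_closed[OF B] by (rule borel_closed)
  define r where "r p = 1 / (kappa * rho c (chart_map c p))" for p
  have rho_ne: "rho c (chart_map c p) \<noteq> 0" if "p \<in> B" for p
    using rho_pos[OF c, of "chart_map c p"] that Bd by fastforce
  have "continuous_on B (\<lambda>p. rho c (chart_map c p))"
    by (rule continuous_on_compose2[OF rho_cont[OF c] continuous_on_subset[OF cont_map[OF c] Bd]]) (use Bd in auto)
  hence rc: "continuous_on B r"
    unfolding r_def using rho_ne kappa_pos by (intro continuous_intros) auto
  define l where "l p = indicator B p * r p" for p
  have lm: "l \<in> borel_measurable borel"
    using borel_measurable_continuous_on_indicator[OF Bs rc] by (simp add: l_def[abs_def])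
  obtain b where "\<forall>y\<in>r ` B. norm y \<le> b"
    using compact_imp_bounded[OF compact_continuous_image[OF rc B]] by (auto simp: bounded_iff)
  hence "\<bar>l p\<bar> \<le> max b 0" for p by (auto simp: l_def indicator_def)
  hence lL: "l \<in> L2 N" by (rule bounded_L2[OF lm])
  have "L2_inner N u l = integral Q (u \<circ> chart_inv c)" if u: "smooth_fun A u" for u
  proof -
    have um: "u \<in> borel_measurable borel" by (rule smooth_fun_measurable[OF u])
    have in_B: "chart_inv c x \<in> B \<longleftrightarrow> x \<in> Q" if "x \<in> cim c" for x
      unfolding B_def by (rule chart_inv_image_iff[OF c Q(2) that])
    have "L2_inner N u l = (\<integral>x. indicator (cim c) x * (kappa * rho c x * (u (chart_inv c x) * l (chart_inv c x))) \<partial>lborel)"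
      unfolding L2_inner_def
    proof (rule integral_N_chart(2)[OF c])
      show "(\<lambda>p. u p * l p) \<in> borel_measurable borel" using um lm by (rule borel_measurable_times)
      show "u p * l p = 0" if "p \<notin> chart_dom c" for p
      proof -
        have "p \<notin> B" using that Bd by blast
        thus ?thesis by (simp add: l_def)
      qed
    qed
    also have "\<dots> = (\<integral>x. indicator Q x * (u \<circ> chart_inv c) x \<partial>lborel)"
    proof (rule Bochner_Integration.integral_cong[OF refl])
      fix x
      show "indicator (cim c) x * (kappa * rho c x * (u (chart_inv c x) * l (chart_inv c x)))
          = indicator Q x * (u \<circ> chart_inv c) x"
      proof (cases "x \<in> Q")
        case True
        hence x: "x \<in> cim c" using Q by blast
        thus ?thesis using True in_B[OF x] rho_pos[OF c x] kappa_pos c by (simp add: l_def r_def)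
      next
        case False
        thus ?thesis using in_B[of x] by (auto simp: l_def indicator_def)
      qed
    qed
    also have "\<dots> = integral Q (u \<circ> chart_inv c)"
    proof -
      have "set_integrable lborel Q (u \<circ> chart_inv c)"
        unfolding set_integrable_def
        by (intro borel_integrable_compact Q continuous_on_subset[OF smooth_on_continuous[OF smooth_funD[OF u c]] Q(2)])
      from set_borel_integral_eq_integral(2)[OF this] show ?thesis by (simp add: set_lebesgue_integral_def)
    qed
    finally show ?thesis .
  qed
  thus ?thesis using that lL by blast
qed

text \<open>An upper bound for the metric is a lower bound for its inverse, by
  \<open>pos_def_inverse_lower\<close>; so \<open>\<langle>\<nabla>u, \<nabla>u\<rangle>\<close>
  dominates the Euclidean gradient up to the factor \<open>\<Lambda>\<close>.\<close>

lemma chart_gradient_bound: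
  assumes u: "smooth_fun A u" and c: "c \<in> A" and K: "K \<subseteq> cim c"
    and \<Lambda>: "\<Lambda> > 0" "\<And>x z. x \<in> K \<Longrightarrow> z \<bullet> (G c (chart_inv c x) *v z) \<le> \<Lambda> * (norm z)\<^sup>2"
  shows "gradient_bound K (u \<circ> chart_inv c) (\<lambda>x. \<Lambda> * pairing c u u x)"
  unfolding gradient_bound_def
proof (intro conjI exI[of _ "\<lambda>x. frechet_derivative (u \<circ> chart_inv c) (at x)"] ballI allI)
  note us = smooth_funD[OF u c]
  show "continuous_on K (\<lambda>x. \<Lambda> * pairing c u u x)"
    by (intro continuous_intros continuous_on_subset[OF smooth_on_continuous[OF smooth_pairing[OF u u c]] K])
  show D: "(u \<circ> chart_inv c has_derivative frechet_derivative (u \<circ> chart_inv c) (at x)) (at x)" if "x \<in> K" for x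
    using smooth_on_has_derivative[OF us] that K by blast
  show "continuous_on K (\<lambda>x. frechet_derivative (u \<circ> chart_inv c) (at x) w)" for w
    by (rule continuous_on_subset[OF smooth_on_continuous[OF smooth_on_derivative[OF us]] K])
  fix x w assume x: "x \<in> K"
  let ?g = "coord_differential c u x"
  have pd: "pos_def (G c (chart_inv c x))" using x K c by (intro metric_pos_def chart_inv_dom) auto
  have "frechet_derivative (u \<circ> chart_inv c) (at x) w = w \<bullet> ?g"
    unfolding coord_differential_def by (rule frechet_eq_inner_partials[OF D[OF x]])
  hence "(frechet_derivative (u \<circ> chart_inv c) (at x) w)\<^sup>2 \<le> (norm ?g)\<^sup>2 * (norm w)\<^sup>2"
    using power_mono[OF Cauchy_Schwarz_ineq2[of w ?g] abs_ge_zero, of 2]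
    by (simp add: power_mult_distrib mult.commute)
  also have "\<dots> \<le> \<Lambda> * pairing c u u x * (norm w)\<^sup>2"
    unfolding pairing_def using \<Lambda>(2)[OF x] by (intro mult_right_mono pos_def_inverse_lower[OF pd \<Lambda>(1)]) auto
  finally show "(frechet_derivative (u \<circ> chart_inv c) (at x) w)\<^sup>2 \<le> \<Lambda> * pairing c u u x * (norm w)\<^sup>2" .
qed

text \<open>On a compact box in a chart the metric and its volume density are comparable with the
  Euclidean ones, which carries \<open>box_coercive\<close> over to the manifold.\<close>

lemma chart_coercive:
  assumes c: "c \<in> A" and K: "cbox a b \<subseteq> cim c" and e: "e > 0"
  shows "\<exists>L. set L \<subseteq> L2 N \<and> (\<forall>u. smooth_fun A u \<longrightarrow>
    (\<integral>p. (u p)\<^sup>2 * indicator (chart_inv c ` cbox a b) p \<partial>N) \<le> e * energy u u + (\<Sum>l\<leftarrow>L. (L2_inner N u l)\<^sup>2))"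
proof -
  let ?K = "cbox a b"
  have cK: "compact ?K" by (rule compact_cbox)
  define B where "B = chart_inv c ` ?K"
  have B: "compact B" unfolding B_def
    by (rule compact_continuous_image[OF continuous_on_subset[OF cont_inv[OF c] K] cK])
  have Bd: "B \<subseteq> chart_dom c" unfolding B_def using K chart_inv_dom[OF c] by blast
  have Bs: "B \<in> sets borel" using compact_imp_closed[OF B] by (rule borel_closed)
  have in_B: "chart_inv c x \<in> B \<longleftrightarrow> x \<in> ?K" if "x \<in> cim c" for x
    unfolding B_def by (rule chart_inv_image_iff[OF c K that])
  have pos: "0 < rho c x" if "x \<in> ?K" for x using rho_pos[OF c] that K by blast
  obtain \<alpha> \<beta> where \<alpha>: "0 < \<alpha>" "0 < \<beta>" "\<And>x. x \<in> ?K \<Longrightarrow> \<alpha> \<le> rho c x" "\<And>x. x \<in> ?K \<Longrightarrow> rho c x \<le> \<beta>"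
    by (rule compact_pos_bounds[OF cK continuous_on_subset[OF rho_cont[OF c] K] pos]) (assumption, rule that)
  define gsum where "gsum x = (\<Sum>i\<in>UNIV. \<Sum>j\<in>UNIV. \<bar>G c (chart_inv c x) $ i $ j\<bar>)" for x
  have "continuous_on ?K gsum"
    unfolding gsum_def
    by (intro continuous_intros continuous_on_subset[OF smooth_on_continuous[OF smooth_metric[OF c]] K])
  then obtain \<Lambda>0 where "\<forall>y\<in>gsum ` ?K. norm y \<le> \<Lambda>0"
    using compact_imp_bounded[OF compact_continuous_image[OF _ cK]] by (metis bounded_iff)
  hence gsum_le: "gsum x \<le> \<Lambda>0" if "x \<in> ?K" for x using that by fastforce
  define \<Lambda> where "\<Lambda> = max \<Lambda>0 1"
  have \<Lambda>: "\<Lambda> > 0" "z \<bullet> (G c (chart_inv c x) *v z) \<le> \<Lambda> * (norm z)\<^sup>2" if "x \<in> ?K" for x z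
  proof -
    show "\<Lambda> > 0" by (simp add: \<Lambda>_def)
    have "z \<bullet> (G c (chart_inv c x) *v z) \<le> gsum x * (norm z)\<^sup>2" unfolding gsum_def by (rule matrix_form_le)
    also have "\<dots> \<le> \<Lambda> * (norm z)\<^sup>2" using gsum_le[OF that] by (intro mult_right_mono) (auto simp: \<Lambda>_def)
    finally show "z \<bullet> (G c (chart_inv c x) *v z) \<le> \<Lambda> * (norm z)\<^sup>2" .
  qed
  have \<Lambda>0: "\<Lambda> > 0" by (simp add: \<Lambda>_def)
  \<comment> \<open>With \<open>\<alpha>\<close> and \<open>\<beta>\<close> the bounds of the
    volume density and \<open>\<Lambda>\<close> a bound of the metric, this error becomes
    \<open>e\<close> when all integrals are rewritten on the manifold.\<close>
  define e' where "e' = e * \<alpha> / (\<beta> * \<Lambda>)"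
  have e': "e' > 0" using e \<alpha> \<Lambda>0 by (simp add: e'_def)
  obtain \<Q> :: "((real ^ 'n) \<times> (real ^ 'n) set) set" where \<Q>0: "finite \<Q>" "\<forall>Q\<in>\<Q>. compact (snd Q) \<and> snd Q \<subseteq> ?K"
    "\<forall>u g. gradient_bound ?K u g \<longrightarrow> integral ?K (\<lambda>x. (u x)\<^sup>2) \<le> e' * integral ?K g +
        (\<Sum>Q\<in>\<Q>. (integral (snd Q) u)\<^sup>2 / measure lborel (snd Q))"
    using box_coercive[OF e', of a b] by (elim exE conjE) (rule that)
  note \<Q> = \<Q>0(1) \<Q>0(2)[rule_format, THEN conjunct1] \<Q>0(2)[rule_format, THEN conjunct2]
  note est = \<Q>0(3)[rule_format]
  have "\<exists>l. l \<in> L2 N \<and> (\<forall>u. smooth_fun A u \<longrightarrow> L2_inner N u l = integral (snd Q) (u \<circ> chart_inv c))" if "Q \<in> \<Q>" for Q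
  proof -
    have "snd Q \<subseteq> cim c" using \<Q>(3)[OF that] K by blast
    from mean_value_functional[OF c \<Q>(2)[OF that] this] show ?thesis by metis
  qed
  then obtain l where l: "\<And>Q. Q \<in> \<Q> \<Longrightarrow> l Q \<in> L2 N"
    "\<And>Q u. Q \<in> \<Q> \<Longrightarrow> smooth_fun A u \<Longrightarrow> L2_inner N u (l Q) = integral (snd Q) (u \<circ> chart_inv c)" by metis
  \<comment> \<open>The functionals are scaled so that their squares absorb the coefficients of
    the squared mean values.\<close>
  define s where "s Q = sqrt (kappa * \<beta> / measure lborel (snd Q))" for Q :: "(real ^ 'n) \<times> (real ^ 'n) set"
  obtain qs where qs: "set qs = \<Q>" "distinct qs" using finite_distinct_list[OF \<Q>(1)] by blast
  define L where "L = map (\<lambda>Q p. s Q * l Q p) qs"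
  have "(\<integral>p. (u p)\<^sup>2 * indicator B p \<partial>N) \<le> e * energy u u + (\<Sum>l\<leftarrow>L. (L2_inner N u l)\<^sup>2)"
    if u: "smooth_fun A u" for u
  proof -
    let ?v = "u \<circ> chart_inv c"
    have um: "u \<in> borel_measurable borel" by (rule smooth_fun_measurable[OF u])
    have vc: "continuous_on ?K ?v" by (rule continuous_on_subset[OF smooth_on_continuous[OF smooth_funD[OF u c]] K])
    have pc: "continuous_on ?K (pairing c u u)"
      by (rule continuous_on_subset[OF smooth_on_continuous[OF smooth_pairing[OF u u c]] K])
    have rc: "continuous_on ?K (rho c)" by (rule continuous_on_subset[OF rho_cont[OF c] K])
    have pair0: "0 \<le> pairing c u u x" if "x \<in> ?K" for x
      unfolding pairing_def using that K c by (intro pos_def_inverse_nonneg metric_pos_def chart_inv_dom) auto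
    have chart_int: "(\<integral>p. f p * indicator B p \<partial>N) = kappa * integral ?K (\<lambda>x. rho c x * h x)"
      if f: "f \<in> borel_measurable borel" and h: "continuous_on ?K h" "\<And>x. x \<in> ?K \<Longrightarrow> f (chart_inv c x) = h x" for f h
    proof -
      have "(\<integral>p. f p * indicator B p \<partial>N)
          = (\<integral>x. indicator (cim c) x * (kappa * rho c x * (f (chart_inv c x) * indicator B (chart_inv c x))) \<partial>lborel)"
        by (rule integral_N_chart(2)[OF c]) (use f Bs Bd in \<open>auto simp: indicator_def\<close>)
      also have "\<dots> = (\<integral>x. kappa * (indicator ?K x *\<^sub>R (rho c x * h x)) \<partial>lborel)"
      proof (rule Bochner_Integration.integral_cong[OF refl])
        fix x
        show "indicator (cim c) x * (kappa * rho c x * (f (chart_inv c x) * indicator B (chart_inv c x)))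
            = kappa * (indicator ?K x *\<^sub>R (rho c x * h x))"
          using in_B[of x] K h(2)[of x] by (cases "x \<in> cim c") (auto simp: indicator_def)
      qed
      also have "\<dots> = kappa * (LINT x:?K|lborel. rho c x * h x)"
        by (simp add: set_lebesgue_integral_def)
      also have "(LINT x:?K|lborel. rho c x * h x) = integral ?K (\<lambda>x. rho c x * h x)"
      proof (rule set_borel_integral_eq_integral(2))
        show "set_integrable lborel ?K (\<lambda>x. rho c x * h x)"
          unfolding set_integrable_def by (intro borel_integrable_compact cK continuous_intros rc h)
      qed
      finally show ?thesis .
    qed
    have "(\<integral>p. (u p)\<^sup>2 * indicator B p \<partial>N) = kappa * integral ?K (\<lambda>x. rho c x * (?v x)\<^sup>2)"
      by (rule chart_int[OF borel_measurable_power[OF um] continuous_on_power[OF vc]]) simp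
    also have "\<dots> \<le> kappa * integral ?K (\<lambda>x. \<beta> * (?v x)\<^sup>2)"
      using kappa_pos \<alpha>(4)
      by (intro mult_left_mono integral_le integrable_on_continuous_compact cK continuous_intros vc rc mult_right_mono) auto
    also have "\<dots> = kappa * \<beta> * integral ?K (\<lambda>x. (?v x)\<^sup>2)" by simp
    also have "\<dots> \<le> kappa * \<beta> * (e' * integral ?K (\<lambda>x. \<Lambda> * pairing c u u x) +
        (\<Sum>Q\<in>\<Q>. (integral (snd Q) ?v)\<^sup>2 / measure lborel (snd Q)))"
      using kappa_pos \<alpha> by (intro mult_left_mono est chart_gradient_bound[OF u c K \<Lambda>0 \<Lambda>(2)]) auto
    also have "\<dots> = (e / kappa * kappa) * \<alpha> * (kappa * integral ?K (pairing c u u)) +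
        (\<Sum>Q\<in>\<Q>. kappa * \<beta> / measure lborel (snd Q) * (integral (snd Q) ?v)\<^sup>2)"
      using \<alpha> \<Lambda>0 kappa_pos by (simp add: e'_def distrib_left sum_distrib_left)
    also have "(\<Sum>Q\<in>\<Q>. kappa * \<beta> / measure lborel (snd Q) * (integral (snd Q) ?v)\<^sup>2) = (\<Sum>l\<leftarrow>L. (L2_inner N u l)\<^sup>2)"
    proof -
      have "(\<Sum>l\<leftarrow>L. (L2_inner N u l)\<^sup>2) = (\<Sum>Q\<in>\<Q>. (L2_inner N u (\<lambda>p. s Q * l Q p))\<^sup>2)"
        unfolding L_def using qs by (simp add: o_def sum_list_distinct_conv_sum_set)
      also have "\<dots> = (\<Sum>Q\<in>\<Q>. kappa * \<beta> / measure lborel (snd Q) * (integral (snd Q) ?v)\<^sup>2)"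
      proof (rule sum.cong[OF refl])
        fix Q assume Q: "Q \<in> \<Q>"
        have "(s Q)\<^sup>2 = kappa * \<beta> / measure lborel (snd Q)"
          using kappa_pos \<alpha>(2) by (simp add: s_def)
        thus "(L2_inner N u (\<lambda>p. s Q * l Q p))\<^sup>2 = kappa * \<beta> / measure lborel (snd Q) * (integral (snd Q) ?v)\<^sup>2"
          using L2.form_scale_right[OF l(1)[OF Q] smooth_fun_L2[OF u]] l(2)[OF Q u]
          by (simp add: power_mult_distrib)
      qed
      finally show ?thesis by simp
    qed
    also have "(e / kappa * kappa) * \<alpha> * (kappa * integral ?K (pairing c u u)) \<le> e * energy u u"
    proof -
      have "\<alpha> * (kappa * integral ?K (pairing c u u)) = kappa * integral ?K (\<lambda>x. \<alpha> * pairing c u u x)" by simp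
      also have "\<dots> \<le> kappa * integral ?K (\<lambda>x. rho c x * pairing c u u x)"
        using kappa_pos \<alpha>(3) pair0
        by (intro mult_left_mono integral_le integrable_on_continuous_compact cK continuous_intros pc rc mult_right_mono) auto
      also have "\<dots> = (\<integral>p. grad_inner A G u u p * indicator B p \<partial>N)"
      proof (rule chart_int[symmetric, OF _ pc])
        show "grad_inner A G u u \<in> borel_measurable borel" by (intro smooth_fun_measurable smooth_grad_inner u)
        show "grad_inner A G u u (chart_inv c x) = pairing c u u x" if "x \<in> ?K" for x
        proof -
          have "x \<in> cim c" using that K by blast
          thus ?thesis using grad_inner_chart[OF u u c chart_inv_dom[OF c]] c by simp
        qed
      qed
      also have "\<dots> \<le> energy u u"
      proof (rule integral_mono)
        have gi: "integrable N (grad_inner A G u u)" by (intro smooth_fun_integrable smooth_grad_inner u)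
        thus "integrable N (grad_inner A G u u)" .
        show "integrable N (\<lambda>p. grad_inner A G u u p * indicator B p)"
          using integrable_real_mult_indicator[OF _ gi, of B] Bs by simp
        show "grad_inner A G u u p * indicator B p \<le> grad_inner A G u u p" for p
          using grad_inner_nonneg[of u p] by (simp add: indicator_def)
      qed
      finally have "\<alpha> * (kappa * integral ?K (pairing c u u)) \<le> energy u u" .
      hence "e * (\<alpha> * (kappa * integral ?K (pairing c u u))) \<le> e * energy u u"
        using e by (intro mult_left_mono) auto
      thus ?thesis using kappa_pos by (simp add: mult.assoc)
    qed
    finally show ?thesis by simp
  qed
  moreover have "set L \<subseteq> L2 N" using qs l(1) by (auto simp: L_def)
  ultimately show ?thesis unfolding B_def by blast
qed

text \<open>Finitely many boxes in charts cover the manifold, so that the local estimates add up.\<close>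

theorem energy_coercive:
  assumes e: "e > 0"
  shows "\<exists>(k::nat) l. (\<forall>i<k. l i \<in> L2 N) \<and>
    (\<forall>u. smooth_fun A u \<longrightarrow> L2_inner N u u \<le> e * energy u u + (\<Sum>i<k. (L2_inner N u (l i))\<^sup>2))"
proof -
  have "\<exists>c a b. c \<in> A \<and> p \<in> chart_dom c \<and> chart_map c p \<in> box a b \<and> cbox a b \<subseteq> cim c" for p
  proof -
    obtain c where c: "c \<in> A" "p \<in> chart_dom c" using charts_cover by blast
    hence "chart_map c p \<in> cim c" by blast
    then obtain a b where "cbox a b \<subseteq> cim c" "chart_map c p \<in> box a b"
      using open_contains_cbox[OF open_cim[OF c(1)]] by metis
    thus ?thesis using c by blast
  qed
  then obtain c a b where c: "\<And>p. c p \<in> A" "\<And>p. p \<in> chart_dom (c p)" "\<And>p. chart_map (c p) p \<in> box (a p) (b p)"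
    "\<And>p. cbox (a p) (b p) \<subseteq> cim (c p)" by metis
  define V where "V p = chart_dom (c p) \<inter> chart_map (c p) -` box (a p) (b p)" for p
  define B where "B p = chart_inv (c p) ` cbox (a p) (b p)" for p
  have V: "open (V p)" "p \<in> V p" "V p \<subseteq> B p" for p
  proof -
    show "open (V p)" unfolding V_def by (intro open_chart_preimage c open_box)
    show "p \<in> V p" unfolding V_def using c by auto
    show "V p \<subseteq> B p"
    proof
      fix q assume q: "q \<in> V p"
      hence "chart_map (c p) q \<in> cbox (a p) (b p)" using box_subset_cbox by (auto simp: V_def)
      moreover have "q = chart_inv (c p) (chart_map (c p) q)" using q c by (simp add: V_def)
      ultimately show "q \<in> B p" unfolding B_def by blast
    qed
  qed
  have cov: "UNIV \<subseteq> (\<Union>p\<in>UNIV. V p)" using V(2) by blast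
  obtain I where I: "finite I" "UNIV \<subseteq> (\<Union>p\<in>I. V p)"
    by (rule compactE_image[OF compact_UNIV V(1) cov])
  have Bs: "B p \<in> sets borel" for p
    unfolding B_def using compact_imp_closed[OF compact_continuous_image[OF continuous_on_subset[OF cont_inv[OF c(1)] c(4)] compact_cbox]]
    by (rule borel_closed)
  \<comment> \<open>The error is distributed over the \<open>card I\<close> boxes; the summand
    \<open>1\<close> keeps the denominator positive.\<close>
  define d where "d = e / (real (card I) + 1)"
  have d: "d > 0" using e by (simp add: d_def)
  have "\<exists>L. set L \<subseteq> L2 N \<and> (\<forall>u. smooth_fun A u \<longrightarrow>
    (\<integral>q. (u q)\<^sup>2 * indicator (B p) q \<partial>N) \<le> d * energy u u + (\<Sum>l\<leftarrow>L. (L2_inner N u l)\<^sup>2))" for p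
    unfolding B_def by (rule chart_coercive[OF c(1) c(4) d])
  hence "\<exists>L. \<forall>p. set (L p) \<subseteq> L2 N \<and> (\<forall>u. smooth_fun A u \<longrightarrow>
    (\<integral>q. (u q)\<^sup>2 * indicator (B p) q \<partial>N) \<le> d * energy u u + (\<Sum>l\<leftarrow>L p. (L2_inner N u l)\<^sup>2))"
    by (intro choice allI)
  then obtain L where L: "\<And>p. set (L p) \<subseteq> L2 N" "\<And>p u. smooth_fun A u \<Longrightarrow>
    (\<integral>q. (u q)\<^sup>2 * indicator (B p) q \<partial>N) \<le> d * energy u u + (\<Sum>l\<leftarrow>L p. (L2_inner N u l)\<^sup>2)" by blast
  obtain ps where ps: "set ps = I" "distinct ps" using finite_distinct_list[OF I(1)] by blast
  define LL where "LL = concat (map L ps)"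
  have est: "L2_inner N u u \<le> e * energy u u + (\<Sum>i<length LL. (L2_inner N u (LL ! i))\<^sup>2)" if u: "smooth_fun A u" for u
  proof -
    have iu: "integrable N (\<lambda>q. (u q)\<^sup>2)" using smooth_fun_L2[OF u] by (rule L2_integrable_square)
    have iB: "integrable N (\<lambda>q. (u q)\<^sup>2 * indicator (B p) q)" for p
      using integrable_real_mult_indicator[OF _ iu, of "B p"] Bs by simp
    have E0: "0 \<le> energy u u" using grad_inner_nonneg by (intro Bochner_Integration.integral_nonneg) auto
    have "L2_inner N u u = (\<integral>q. (u q)\<^sup>2 \<partial>N)" by (simp add: L2_inner_def power2_eq_square)
    also have "\<dots> \<le> (\<integral>q. (\<Sum>p\<in>I. (u q)\<^sup>2 * indicator (B p) q) \<partial>N)"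
    proof (rule integral_mono[OF iu])
      show "integrable N (\<lambda>q. \<Sum>p\<in>I. (u q)\<^sup>2 * indicator (B p) q)" using iB by (rule Bochner_Integration.integrable_sum)
      fix q
      obtain p where p: "p \<in> I" "q \<in> B p" using I(2) V(3) by blast
      have "(u q)\<^sup>2 = (u q)\<^sup>2 * indicator (B p) q" using p by simp
      also have "\<dots> \<le> (\<Sum>p\<in>I. (u q)\<^sup>2 * indicator (B p) q)"
        using p I(1) by (intro member_le_sum) auto
      finally show "(u q)\<^sup>2 \<le> (\<Sum>p\<in>I. (u q)\<^sup>2 * indicator (B p) q)" .
    qed
    also have "\<dots> = (\<Sum>p\<in>I. \<integral>q. (u q)\<^sup>2 * indicator (B p) q \<partial>N)"
      using iB by (intro Bochner_Integration.integral_sum)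
    also have "\<dots> \<le> (\<Sum>p\<in>I. d * energy u u + (\<Sum>l\<leftarrow>L p. (L2_inner N u l)\<^sup>2))"
      by (intro sum_mono L u)
    also have "\<dots> = real (card I) * d * energy u u + (\<Sum>p\<in>I. \<Sum>l\<leftarrow>L p. (L2_inner N u l)\<^sup>2)"
      by (simp add: sum.distrib)
    also have "(\<Sum>p\<in>I. \<Sum>l\<leftarrow>L p. (L2_inner N u l)\<^sup>2) = (\<Sum>l\<leftarrow>LL. (L2_inner N u l)\<^sup>2)"
    proof -
      have "(\<Sum>l\<leftarrow>concat (map L qs). (L2_inner N u l)\<^sup>2) = (\<Sum>p\<leftarrow>qs. \<Sum>l\<leftarrow>L p. (L2_inner N u l)\<^sup>2)" for qs
        by (induction qs) simp_all
      thus ?thesis using ps by (simp add: LL_def sum_list_distinct_conv_sum_set)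
    qed
    also have "(\<Sum>l\<leftarrow>LL. (L2_inner N u l)\<^sup>2) = (\<Sum>i<length LL. (L2_inner N u (LL ! i))\<^sup>2)"
      by (simp add: sum_list_sum_nth atLeast0LessThan)
    also have "real (card I) * d * energy u u \<le> e * energy u u"
    proof (rule mult_right_mono[OF _ E0])
      show "real (card I) * d \<le> e" using e by (simp add: d_def field_simps)
    qed
    finally show ?thesis by simp
  qed
  have "LL ! i \<in> L2 N" if "i < length LL" for i
  proof -
    have "LL ! i \<in> set LL" using that by simp
    thus ?thesis using L(1) unfolding LL_def by auto
  qed
  thus ?thesis using est by (intro exI[of _ "length LL"] exI[of _ "\<lambda>i. LL ! i"]) blast
qed

end

section \<open>The spectral spaces of the Laplacian\<close>

context riemannian
begin

lemma energy_semi_inner: "semi_inner {u. smooth_fun A u} energy"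
proof
  fix f g h :: "'m \<Rightarrow> real" and a :: real
  assume f: "f \<in> {u. smooth_fun A u}"
  hence fs: "smooth_fun A f" by simp
  show "(\<lambda>x. a * f x) \<in> {u. smooth_fun A u}" using smooth_fun_scale[OF fs] by simp
  show "0 \<le> energy f f" using grad_inner_nonneg by (intro Bochner_Integration.integral_nonneg) auto
  show "energy (\<lambda>x. a * f x) h = a * energy f h" by (simp add: grad_inner_scale[OF fs])
  assume g: "g \<in> {u. smooth_fun A u}"
  hence gs: "smooth_fun A g" by simp
  show "(\<lambda>x. f x + g x) \<in> {u. smooth_fun A u}" using smooth_fun_add[OF fs gs] by simp
  show "energy f g = energy g f" by (simp add: grad_inner_sym[of f g])
  assume "h \<in> {u. smooth_fun A u}"
  hence hs: "smooth_fun A h" by simp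
  show "energy (\<lambda>x. f x + g x) h = energy f h + energy g h"
    unfolding grad_inner_add[OF fs gs]
    by (intro Bochner_Integration.integral_add smooth_fun_integrable smooth_grad_inner fs gs hs)
qed (simp add: smooth_fun_const)

text \<open>The geometry enters the abstract theory through three facts: Green's formula, the
  density of the smooth functions, and the coercivity of the energy.\<close>

lemma energy_form: "energy_form N {u. smooth_fun A u} energy (\<lambda>\<phi> p. - laplace_beltrami A G \<phi> p)"
proof (rule energy_form.intro)
  show "{u. smooth_fun A u} \<subseteq> L2 N" using smooth_fun_L2 by blast
  show "semi_inner {u. smooth_fun A u} energy" by (rule energy_semi_inner)
next
  fix \<phi> assume "\<phi> \<in> {u. smooth_fun A u}"
  hence \<phi>: "smooth_fun A \<phi>" by simp
  show "(\<lambda>p. - laplace_beltrami A G \<phi> p) \<in> L2 N"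
    using smooth_fun_L2[OF smooth_fun_scale[OF smooth_laplace_beltrami[OF \<phi>], of "-1"]] by simp
  fix u assume "u \<in> {u. smooth_fun A u}"
  thus "energy u \<phi> = L2_inner N u (\<lambda>p. - laplace_beltrami A G \<phi> p)"
    using green_formula[of u \<phi>] \<phi> by (simp add: L2_inner_def)
next
  fix f :: "'m \<Rightarrow> real" and e :: real assume "f \<in> L2 N" "e > 0"
  thus "\<exists>\<phi>\<in>{u. smooth_fun A u}. L2_norm N (\<lambda>x. f x - \<phi> x) < e" using smooth_dense by blast
next
  fix e :: real assume "e > 0"
  thus "\<exists>(k::nat) l. (\<forall>i<k. l i \<in> L2 N) \<and>
      (\<forall>u\<in>{u. smooth_fun A u}. L2_inner N u u \<le> e * energy u u + (\<Sum>i<k. (L2_inner N u (l i))\<^sup>2))"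
    using energy_coercive[of e] by simp
qed

end

sublocale riemannian \<subseteq> E: energy_form N "{u. smooth_fun A u}" energy "\<lambda>\<phi> p. - laplace_beltrami A G \<phi> p"
  by (rule energy_form)

context riemannian
begin

lemma approximates_iff:
  "E.approximates u f \<longleftrightarrow> f \<in> L2 N \<and> (\<forall>n. smooth_fun A (u n)) \<and>
     (\<lambda>n. L2_norm N (\<lambda>p. u n p - f p)) \<longlonglongrightarrow> 0 \<and>
     (\<forall>e>0. \<exists>K. \<forall>m\<ge>K. \<forall>n\<ge>K. dirichlet_energy A G (\<lambda>p. u m p - u n p) < e)"
proof -
  have "E.D.cauchy_seq u \<longleftrightarrow> (\<forall>e>0. \<exists>K. \<forall>m\<ge>K. \<forall>n\<ge>K. dirichlet_energy A G (\<lambda>p. u m p - u n p) < e)"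
    if u: "\<And>n. smooth_fun A (u n)"
    using E.D.cauchy_seqI_square[of u] E.D.cauchy_seqD_square[of u] u
    unfolding dirichlet_energy_def by (auto intro: iffI)
  thus ?thesis by (auto simp: E.approximates_def L2.converges_to_def L2_norm_eq_form_norm)
qed

lemma sobolev_H1_eq: "sobolev_H1 A G = E.form_domain"
  unfolding sobolev_H1_def E.form_domain_def approximates_iff by blast

lemma eigenspace_eq: "eigenspace A G l = E.eigensp l"
proof -
  have "L2_inner N (\<lambda>p. l * f p) \<phi> = l * L2_inner N f \<phi>" for f \<phi>
    by (simp add: L2_inner_def mult.assoc)
  moreover have "(\<lambda>p. l * f p) \<in> L2 N" if "f \<in> E.form_domain" for f
    using E.form_domain_L2[OF that] by (rule L2.scale_in)
  ultimately show ?thesis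
    unfolding eigenspace_def laplacian_graph_def sobolev_H1_eq E.eigensp_def by auto
qed

text \<open>An isometry preserves the normalized volume, the smooth functions and their gradient
  pairings. For \<open>inv T\<close> the invariance of volume and energy is read off from that
  under \<open>T\<close>.\<close>

lemma isometry_symmetry:
  assumes T: "riemannian_isometry A G T"
  shows "E.symmetry T" "E.symmetry (inv T)"
proof -
  have b: "bij T" using isometry_bij[OF T] .
  have inv: "inv T \<circ> T = id" "T \<circ> inv T = id"
    using b by (simp_all add: bij_is_inj bij_is_surj fun_eq_iff surj_f_inv_f)
  have mT: "T \<in> borel_measurable borel" and mT': "inv T \<in> borel_measurable borel"
    using isometry_cont[OF T] isometry_inv_cont[OF T] by (simp_all add: borel_measurable_continuous_onI)
  have dT: "distr N borel T = N" by (rule isometry_N[OF T])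
  have dT': "distr N borel (inv T) = N"
  proof -
    have "distr N borel (inv T) = distr (distr N borel T) borel (inv T)" by (simp add: dT)
    also have "\<dots> = distr N borel (inv T \<circ> T)"
      using mT mT' by (intro distr_distr) (simp_all cong: measurable_cong_sets)
    also have "\<dots> = N" unfolding inv(1) id_def by (rule distr_id2) simp
    finally show ?thesis .
  qed
  have trans: "(\<integral>p. f (S p) \<partial>N) = (\<integral>p. f p \<partial>N)" "integrable N (\<lambda>p. f (S p)) \<longleftrightarrow> integrable N f"
    if "S \<in> borel_measurable borel" "distr N borel S = N" "f \<in> borel_measurable borel" for S and f :: "'m \<Rightarrow> real"
  proof -
    have S: "S \<in> measurable N borel" using that(1) by (simp cong: measurable_cong_sets)
    show "(\<integral>p. f (S p) \<partial>N) = (\<integral>p. f p \<partial>N)"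
      using integral_distr[OF S, of f] that by simp
    show "integrable N (\<lambda>p. f (S p)) \<longleftrightarrow> integrable N f"
      using integrable_distr_eq[OF S, of f] that by simp
  qed
  have L2_pull: "f \<circ> S \<in> L2 N" and inner_pull: "g \<in> L2 N \<Longrightarrow> L2_inner N (f \<circ> S) (g \<circ> S) = L2_inner N f g"
    if S: "S \<in> borel_measurable borel" "distr N borel S = N" and f: "f \<in> L2 N" for S and f g :: "'m \<Rightarrow> real"
  proof -
    have fm: "f \<in> borel_measurable borel" using L2_measurable[OF f] by (simp cong: measurable_cong_sets)
    have "f \<circ> S \<in> borel_measurable borel" using S(1) fm by (rule measurable_comp)
    moreover have "integrable N (\<lambda>p. (f (S p))\<^sup>2)"
      using trans(2)[OF S, of "\<lambda>p. (f p)\<^sup>2"] fm L2_integrable_square[OF f] by simp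
    ultimately show "f \<circ> S \<in> L2 N" by (simp add: L2_def cong: measurable_cong_sets)
    assume g: "g \<in> L2 N"
    have gm: "g \<in> borel_measurable borel" using L2_measurable[OF g] by (simp cong: measurable_cong_sets)
    show "L2_inner N (f \<circ> S) (g \<circ> S) = L2_inner N f g"
      using trans(1)[OF S, of "\<lambda>p. f p * g p"] fm gm by (simp add: L2_inner_def)
  qed
  have energy_T: "energy (u \<circ> T) (v \<circ> T) = energy u v" if "smooth_fun A u" "smooth_fun A v" for u v
    unfolding grad_inner_isometry[OF T that]
    by (rule trans(1)[OF mT dT]) (intro smooth_fun_measurable smooth_grad_inner that)
  have smooth_T: "smooth_fun A (u \<circ> T)" if "smooth_fun A u" for u
    by (rule smooth_fun_pullback[OF isometry_smooth[OF T] that])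
  have smooth_T': "smooth_fun A (u \<circ> inv T)" if "smooth_fun A u" for u
    by (rule smooth_fun_pullback[OF _ that]) (use T in \<open>simp add: riemannian_isometry_def\<close>)
  have energy_T': "energy (u \<circ> inv T) (v \<circ> inv T) = energy u v" if "smooth_fun A u" "smooth_fun A v" for u v
    using energy_T[OF smooth_T'[OF that(1)] smooth_T'[OF that(2)]] by (simp add: o_assoc[symmetric] inv)
  show "E.symmetry T"
    using L2_pull[OF mT dT] inner_pull[OF mT dT] smooth_T energy_T by (simp add: E.symmetry_def)
  show "E.symmetry (inv T)"
    using L2_pull[OF mT' dT'] inner_pull[OF mT' dT'] smooth_T' energy_T' by (simp add: E.symmetry_def)
qed

end

theorem proposition2p2:
  fixes A :: "('m::{t2_space,second_countable_topology}, 'n::finite) chart set"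
    and G :: "('m, 'n) metric_tensor"
    and \<mu> :: "nat \<Rightarrow> real"
  assumes "smooth_atlas A" and "riemannian_metric A G"
    and "compact (UNIV :: 'm set)" and "connected (UNIV :: 'm set)"
    and "strict_mono \<mu>" and "\<mu> 0 = 0" and "range \<mu> = eigenvalues A G"
  shows "\<forall>s\<ge>0.
      banach_space_ae (normalized_volume A G) (vspec A G \<mu> s) (\<lambda>f. enn2real (vspec_norm A G \<mu> s f)) \<and>
      dense_in_norm (finite_spectral_sums A G \<mu>) (vspec A G \<mu> s)
        (\<lambda>f. enn2real (vspec_norm A G \<mu> s f)) \<and>
      (\<forall>f\<in>L2 (normalized_volume A G).
        ennreal (L2_norm (normalized_volume A G) f) \<le> vspec_norm A G \<mu> s f) \<and>
      (\<forall>t\<ge>s.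
        continuously_embedded
          (vspec A G \<mu> t) (\<lambda>f. enn2real (vspec_norm A G \<mu> t f))
          (vspec A G \<mu> s) (\<lambda>f. enn2real (vspec_norm A G \<mu> s f)) \<and>
        (\<forall>f\<in>L2 (normalized_volume A G). vspec_norm A G \<mu> s f \<le> vspec_norm A G \<mu> t f)) \<and>
      (\<forall>T. riemannian_isometry A G T \<longrightarrow>
        (\<forall>f\<in>L2 (normalized_volume A G).
          f \<circ> T \<in> L2 (normalized_volume A G) \<and>
          vspec_norm A G \<mu> s (f \<circ> T) = vspec_norm A G \<mu> s f))"
proof -
  interpret riemannian A G using assms(1-3) by unfold_locales
  interpret S: energy_spectrum N "{u. smooth_fun A u}" energy "\<lambda>\<phi> p. - laplace_beltrami A G \<phi> p" \<mu>
  proof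
    show "strict_mono \<mu>" by fact
    show "range \<mu> = {l. \<exists>f\<in>E.eigensp l. \<not> (AE x in N. f x = 0)}"
      using assms(7) by (simp add: eigenvalues_def eigenspace_eq)
  qed
  have norm_eq: "vspec_norm A G \<mu> s f = S.spec_norm s f" for s f
    unfolding vspec_norm_def S.spec_norm_def S.weight_def S.coeff_norm_def eigenspace_eq ..
  have nrm_eq: "(\<lambda>f. enn2real (vspec_norm A G \<mu> s f)) = S.spec_nrm s" for s
    by (simp add: norm_eq S.spec_nrm_def fun_eq_iff)
  have space_eq: "vspec A G \<mu> s = S.spec_space s" for s
    by (simp add: vspec_def S.spec_space_def norm_eq)
  have sums_eq: "finite_spectral_sums A G \<mu>
      = {f. \<exists>J e. finite J \<and> (\<forall>j\<in>J. e j \<in> E.eigensp (\<mu> j)) \<and> f = (\<lambda>p. \<Sum>j\<in>J. e j p)}"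
    unfolding finite_spectral_sums_def eigenspace_eq ..
  show ?thesis
    unfolding nrm_eq space_eq sums_eq unfolding norm_eq
  proof (intro allI impI conjI ballI)
    fix s :: real assume s: "0 \<le> s"
    show "banach_space_ae N (S.spec_space s) (S.spec_nrm s)" by (rule S.spec_space_banach[OF s])
    show "dense_in_norm {f. \<exists>J e. finite J \<and> (\<forall>j\<in>J. e j \<in> E.eigensp (\<mu> j)) \<and> f = (\<lambda>p. \<Sum>j\<in>J. e j p)}
        (S.spec_space s) (S.spec_nrm s)" by (rule S.spec_sums_dense[OF s])
    show "ennreal (L2_norm N f) \<le> S.spec_norm s f" if "f \<in> L2 N" for f
      by (rule S.L2_norm_le_spec_norm[OF that s])
    show "continuously_embedded (S.spec_space t) (S.spec_nrm t) (S.spec_space s) (S.spec_nrm s)"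
      if "s \<le> t" for t by (rule S.spec_space_embedded[OF that])
    show "S.spec_norm s f \<le> S.spec_norm t f" if "s \<le> t" for t f by (rule S.spec_norm_mono[OF that])
    fix T f assume T: "riemannian_isometry A G T" and f: "f \<in> L2 N"
    note sym = isometry_symmetry[OF T]
    show "f \<circ> T \<in> L2 N" using sym(1) f by (simp add: E.symmetry_def)
    have "inv T \<circ> T = id" "T \<circ> inv T = id"
      using isometry_bij[OF T] by (simp_all add: bij_is_inj bij_is_surj fun_eq_iff surj_f_inv_f)
    thus "S.spec_norm s (f \<circ> T) = S.spec_norm s f" by (rule S.spec_norm_symmetry[OF sym _ _ f])
  qed
qed

end
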